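(* Let $k$ be a positive integer. For a positive integer $m$ and an integer $n\ge 1$, let $r(1^{k}m^{k};n)$ denote the number of integer solutions $(x_1,\dots,x_{2k})\in\mathbb{Z}^{2k}$ of $$x_{1}^{2}+\cdots+x_{k}^{2}+m\left(x_{k+1}^{2}+\cdots+x_{2k}^{2}\right)=n.$$ (1) Let $\ell_2=\frac{k-1}{2}$ if $k$ is odd and $\ell_2=\frac{k-2}{2}$ if $k$ is even. Then there are unique rational numbers $c_{j,k,2}$ ($1\le j\le \ell_2$), depending on $j$ and $k$, such that for every positive integer $n$, $$ r(1^{k}2^{k};n)=\begin{cases} {\displaystyle-\frac{k}{B_{k,8}}\cdot\frac{2\sigma_{k-1,\chi_{-2}}^{\infty}(n)+2(-8)^{(k-1)/2}\sigma_{k-1,\chi_{-2}}^{0}(n)}{1+\delta_{k,1}}}&\text{if $k$ is odd,}\\[2ex] {\displaystyle-\frac{k}{B_{k}}\cdot\frac{(-1)^{\frac{k}{2}}\sigma_{k-1}(n)-(-1)^{\frac{k}{2}}\sigma_{k-1}\left(\frac{n}{2}\right)-2^{\frac{k}{2}}\sigma_{k-1}\left(\frac{n}{4}\right)+8^{\frac{k}{2}}\sigma_{k-1}\left(\frac{n}{8}\right)}{2^{\frac{k}{2}-1}(2^{k}-1)}}&\text{if $k$ is even} \end{cases} \;+\;\sum_{j=1}^{\ell_{2}}c_{j,k,2}\,a_{j,k,2}(n), $$ where the numbers $a_{j,k,2}(n)$ are defined by $$\sum_{n=0}^{\infty}a_{j,k,2}(n)q^{n}=\frac{(\eta_{2}\eta_{4})^{3k}}{(\eta_{1}\eta_{8})^{2k}}\left(\frac{\eta_{1}\eta_{8}}{\eta_{2}\eta_{4}}\right)^{8j}.$$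 (2) Let $\ell_4=k-2$ if $k$ is odd and $\ell_4=k-1$ if $k$ is even (an empty sum when $\ell_4\le 0$). Then there are unique rational numbers $c_{j,k,4}$ ($1\le j\le\ell_4$), depending on $j$ and $k$, such that for every positive integer $n$, $$ r(1^{k}4^{k};n)=\begin{cases} 2\sigma_{0,\chi_{-4}}^{\infty}(n)-2\sigma_{0,\chi_{-4}}^{\infty}\left(\frac{n}{2}\right)+4\sigma_{0,\chi_{-4}}^{\infty}\left(\frac{n}{4}\right)&\text{if $k=1$,}\\[1ex] -\frac{k}{B_{k,4}}\Big((-1)^{\frac{k+1}{2}}\sigma_{k-1,\chi_{-4}}^{\infty}(n)-(-1)^{\frac{k+1}{2}}\sigma_{k-1,\chi_{-4}}^{\infty}\left(\frac{n}{2}\right)+2\sigma_{k-1,\chi_{-4}}^{\infty}\left(\frac{n}{4}\right)&\\ \qquad-(-1)^{\frac{k+1}{2}}\sigma_{k-1,\chi_{-4}}^{0}(n)+2^{k-1}\sigma_{k-1,\chi_{-4}}^{0}\left(\frac{n}{2}\right)-2^{2k-1}\sigma_{k-1,\chi_{-4}}^{0}\left(\frac{n}{4}\right)\Big)&\text{if $k\ge3$ is odd,}\\[1ex] {\displaystyle-\frac{k}{B_{k}}\cdot\frac{(-1)^{\frac{k}{2}}\sigma_{k-1}(n)-(-1)^{\frac{k}{2}}\sigma_{k-1}\left(\frac{n}{2}\right)-2^{k}\sigma_{k-1}\left(\frac{n}{8}\right)+4^{k}\sigma_{k-1}\left(\frac{n}{16}\right)}{2^{k-1}(2^{k}-1)}}&\text{if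 $k$ is even} \end{cases} \;+\;\sum_{j=1}^{\ell_{4}}c_{j,k,4}\,a_{j,k,4}(n), $$ where the numbers $a_{j,k,4}(n)$ are defined by $$\sum_{n=0}^{\infty}a_{j,k,4}(n)q^{n}=\frac{(\eta_{2}\eta_{8})^{5k}}{(\eta_{1}\eta_{4}^{2}\eta_{16})^{2k}}\cdot\frac{(\eta_{1}\eta_{4}\eta_{16})^{4j}}{(\eta_{2}\eta_{8})^{6j}}.$$
   Context: Here $\tau$ is in the upper half plane, $q=e^{2\pi i\tau}$, $\eta(\tau)=q^{1/24}\prod_{j\ge1}(1-q^j)$ is the Dedekind eta function, and $\eta_m$ denotes $\eta(m\tau)$. $\chi_D(\cdot)=\left(\frac{D}{\cdot}\right)$ is the Kronecker symbol; $\delta_{\cdot,\cdot}$ is the Kronecker delta. Divisor functions: $\sigma_k(n)=\sum_{d\mid n}d^k$, $\sigma^{\infty}_{k,\chi_D}(n)=\sum_{d\mid n}\chi_D(d)d^k$, $\sigma^{0}_{k,\chi_D}(n)=\sum_{d\mid n}\chi_D(n/d)d^k$, each defined to be $0$ when $n$ is not a positive integer. $B_k$ is the $k$-th Bernoulli number. The generalized Bernoulli numbers $B_{n,8}$ and $B_{n,4}$ are defined by $$\frac{t}{e^{8t}-1}\sum_{j=1}^{8}\chi_{-2}(j)e^{jt}=\sum_{n\ge0}B_{n,8}\frac{t^n}{n!},\qquad \frac{t}{e^{4t}-1}\sum_{j=1}^{4}\chi_{-4}(j)e^{jt}=\sum_{n\ge0}B_{n,4}\frac{t^n}{n!}.$$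 *)

theory Defs
  imports
    "HOL-Analysis.Analysis"
    "HOL-Number_Theory.Number_Theory"
    "HOL-Computational_Algebra.Computational_Algebra"
begin

definition rep_count :: "nat \<Rightarrow> nat \<Rightarrow> nat \<Rightarrow> nat" where
  "rep_count k m n = card {x \<in> {1..2*k} \<rightarrow>\<^sub>E (UNIV :: int set).
     (\<Sum>i = 1..k. (x i)\<^sup>2) + int m * (\<Sum>i = k+1..2*k. (x i)\<^sup>2) = int n}"

definition kronecker_prime :: "int \<Rightarrow> nat \<Rightarrow> int" where
  "kronecker_prime a p =
     (if p = 2 then (if even a then 0 else if a mod 8 \<in> {1, 7} then 1 else -1)
      else Legendre a (int p))"

definition kronecker :: "int \<Rightarrow> int \<Rightarrow> int" where
  "kronecker a n =
     (if n = 0 then (if \<bar>a\<bar> = 1 then 1 else 0)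
      else (if a < 0 \<and> n < 0 then -1 else 1) *
           (\<Prod>p \<in> prime_factors (nat \<bar>n\<bar>). kronecker_prime a p ^ multiplicity p (nat \<bar>n\<bar>)))"

text \<open>
  The divisor functions take a rational argument, so that \<open>\<sigma>\<^sub>k(n/2)\<close> makes sense for every
  \<open>n\<close>; they vanish unless the argument is a positive integer. In \<open>divisor_sum f x\<close>, the
  function \<open>f\<close> receives the divisor \<open>d\<close> and the complementary divisor \<open>x/d\<close>.
\<close>

definition divisor_sum :: "(nat \<Rightarrow> nat \<Rightarrow> rat) \<Rightarrow> rat \<Rightarrow> rat" where
  "divisor_sum f x =
     (if x \<in> \<nat> \<and> x > 0 then (let n = nat \<lfloor>x\<rfloor> in \<Sum>d | d dvd n. f d (n div d)) else 0)"

definition divisor_sigma :: "nat \<Rightarrow> rat \<Rightarrow> rat" where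
  "divisor_sigma k = divisor_sum (\<lambda>d e. of_nat d ^ k)"

definition sigma_inf :: "nat \<Rightarrow> int \<Rightarrow> rat \<Rightarrow> rat" where
  "sigma_inf k D = divisor_sum (\<lambda>d e. of_int (kronecker D (int d)) * of_nat d ^ k)"

definition sigma_zero :: "nat \<Rightarrow> int \<Rightarrow> rat \<Rightarrow> rat" where
  "sigma_zero k D = divisor_sum (\<lambda>d e. of_int (kronecker D (int e)) * of_nat d ^ k)"

text \<open>
  The generating functions are formal power series in \<open>t\<close>. The quotient by \<open>exp (N t) - 1\<close> is
  an exact one, since that series has order 1 and \<open>t\<close> cancels.
\<close>

definition bernoulli :: "nat \<Rightarrow> rat" where
  "bernoulli n = fact n * fps_nth (fps_X / (fps_exp 1 - 1)) n"

definition gen_bernoulli :: "int \<Rightarrow> nat \<Rightarrow> nat \<Rightarrow> rat" where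
  "gen_bernoulli D N n = fact n *
     fps_nth (fps_X / (fps_exp (of_nat N) - 1) *
              (\<Sum>j = 1..N. fps_const (of_int (kronecker D (int j))) * fps_exp (of_nat j))) n"

abbreviation bernoulli8 :: "nat \<Rightarrow> rat" where
  "bernoulli8 \<equiv> gen_bernoulli (-2) 8"

abbreviation bernoulli4 :: "nat \<Rightarrow> rat" where
  "bernoulli4 \<equiv> gen_bernoulli (-4) 4"

definition nome :: "complex \<Rightarrow> complex" where
  "nome \<tau> = exp (2 * of_real pi * \<i> * \<tau>)"

text \<open>The fractional power of \<open>q\<close> means \<open>exp (2 \<pi> \<i> \<tau> / 24)\<close>; the product index is shifted to start at 0.\<close>

definition dedekind_eta :: "complex \<Rightarrow> complex" where
  "dedekind_eta \<tau> = exp (2 * of_real pi * \<i> * \<tau> / 24) * (\<Prod>j. 1 - nome \<tau> ^ Suc j)"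

definition eta_mult :: "nat \<Rightarrow> complex \<Rightarrow> complex" where
  "eta_mult m \<tau> = dedekind_eta (of_nat m * \<tau>)"

definition q_coeff :: "(complex \<Rightarrow> complex) \<Rightarrow> nat \<Rightarrow> complex" where
  "q_coeff f = (THE a. \<forall>\<tau>. Im \<tau> > 0 \<longrightarrow> (\<lambda>n. a n * nome \<tau> ^ n) sums f \<tau>)"

definition a2 :: "nat \<Rightarrow> nat \<Rightarrow> nat \<Rightarrow> complex" where
  "a2 j k = q_coeff (\<lambda>\<tau>.
     (eta_mult 2 \<tau> * eta_mult 4 \<tau>) ^ (3*k) / (eta_mult 1 \<tau> * eta_mult 8 \<tau>) ^ (2*k) *
     ((eta_mult 1 \<tau> * eta_mult 8 \<tau>) / (eta_mult 2 \<tau> * eta_mult 4 \<tau>)) ^ (8*j))"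

definition a4 :: "nat \<Rightarrow> nat \<Rightarrow> nat \<Rightarrow> complex" where
  "a4 j k = q_coeff (\<lambda>\<tau>.
     (eta_mult 2 \<tau> * eta_mult 8 \<tau>) ^ (5*k) /
       (eta_mult 1 \<tau> * (eta_mult 4 \<tau>)\<^sup>2 * eta_mult 16 \<tau>) ^ (2*k) *
     ((eta_mult 1 \<tau> * eta_mult 4 \<tau> * eta_mult 16 \<tau>) ^ (4*j) /
       (eta_mult 2 \<tau> * eta_mult 8 \<tau>) ^ (6*j)))"

definition ell2 :: "nat \<Rightarrow> nat" where
  "ell2 k = (if odd k then (k - 1) div 2 else (k - 2) div 2)"

text \<open>For \<open>k = 1\<close> truncated subtraction gives 0 instead of \<open>-1\<close>; the range \<open>{1..ell4 k}\<close> is empty either way.\<close>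

definition ell4 :: "nat \<Rightarrow> nat" where
  "ell4 k = (if odd k then k - 2 else k - 1)"

end

theory Submission
  imports Defs "HOL-Real_Asymp.Real_Asymp"
begin

text \<open>
  Put \<open>s = \<theta>(q)\<close> and \<open>t = \<theta>(q\<^sup>m)\<close>. Up to an integer power of \<open>s t\<close>, the eta quotients are powers of a quantity
  \<open>x\<close> that is affine in \<open>w + 2 / w\<close>, where \<open>w = (s / t)\<^sup>2\<close> for \<open>m = 2\<close> and \<open>w = s / t\<close> for \<open>m = 4\<close>. The Lambert series
  of the divisor functions are Taylor coefficients of Jacobi elliptic functions at special points; the
  differential equation \<open>(y')\<^sup>2 = (y\<^sup>2 - a) (y\<^sup>2 - b)\<close> turns them into polynomials in theta constants, that is, into
  \<open>(s t)\<^sup>k\<close> times Laurent polynomials in \<open>w\<close>. The divisor functions of the theorem occur in combinations that are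
  invariant under \<open>w \<mapsto> 2 / w\<close>, hence polynomials in \<open>x\<close>. As \<open>x\<close> vanishes to first order at \<open>q = 0\<close>, the
  coefficients are determined by a triangular system over the rationals. No modular forms are needed.
\<close>

text \<open>The convolution of two Lambert kernels
  \<open>2 * \<zeta> powi N / (1 - \<sigma> * P powi N)\<close> is N times a third one. As
  multiplication by N is differentiation of the moment series, this single fact yields the elliptic
  differential equation. The kernels converge only for |P| < |\<zeta>| < 1, whereas the divisor
  series that carry a constant term belong to |\<zeta>| = 1. They are reached as Abel limits, and
  the part that diverges leaves behind the closed form of a geometric series: there the Bernoulli
  numbers enter. The theta constants are identified by a doubling relation together with the product
  f(q) f(-q), which determine a power series recursively. Except for m = 2 and k odd, the number of
  coefficients in the theorem is smaller than the plain degree bound: one low-order coefficient of a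
  symmetrised polynomial must vanish, and two of them for m = 4 and k odd. Division by the Bernoulli
  numbers is justified by positivity of the relevant Taylor coefficients of tan, sec and 1 / (cos t
  - sin t).\<close>

no_notation Infinite_Set_Sum.abs_summable_on (infix "abs'_summable'_on" 50)
unbundle no vec_syntax

section \<open>Moment series of two-sided sequences\<close>

definition geometric_decay :: "(int => complex) => bool" where
 "geometric_decay c \<longleftrightarrow> (\<exists>C r. 0 < r & r < 1 & (\<forall>N. norm (c N) <= C * r ^ nat \<bar>N\<bar>))"

text \<open>The Taylor expansion at t = 0 of the sum of c(N) exp(N t). Products of such series
  correspond to convolutions of the sequences.\<close>

definition moment_series :: "(int => complex) => complex fps" where
 "moment_series c = Abs_fps (%k. (\<Sum>\<^sub>\<infinity>N. c N * of_int N ^ k) / fact k)"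

lemma summable_power_times_geometric:
 fixes r :: real
 assumes "0 <= r" "r < 1"
 shows "summable (%n. real n ^ k * r ^ n)"
proof (cases "r = 0")
 case True
 have "summable (%n. real n ^ k * 0 ^ n)"
  by (rule summable_finite[of "{0}"]) auto
 with True show ?thesis by simp
next
 case False
 hence "0 < r" using assms by simp
 have "(%n. real n ^ k * r ^ n) \<in> O(%n. ((1 + r) / 2) ^ n)"
  using \<open>0 < r\<close> assms by real_asymp
 moreover have "summable (%n. norm (((1 + r) / 2) ^ n))"
  using assms by (auto intro!: summable_geometric simp: norm_power)
 ultimately show ?thesis by (rule summable_comparison_test_bigo[rotated])
qed

lemma abs_summable_on_int:
 fixes f :: "int => complex"
 assumes "summable (%n. norm (f (int n)))" "summable (%n. norm (f (- int n)))"
 shows "f abs_summable_on UNIV"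
proof -
 have 1: "(%n. norm (f (int n))) summable_on UNIV" "(%n. norm (f (- int n))) summable_on UNIV"
  using assms by (simp_all add: summable_on_UNIV_nonneg_real_iff)
 have a: "(%x. norm (f x)) summable_on range int"
  using 1(1) by (subst summable_on_reindex) (auto simp: o_def)
 have b: "(%x. norm (f x)) summable_on range (%n. - int n)"
  using 1(2) by (subst summable_on_reindex) (auto simp: o_def inj_on_def)
 have "(UNIV :: int set) = range int \<union> range (%n. - int n)"
  by (auto simp: image_iff) (metis int_cases2)
 with summable_on_union[OF a b] show ?thesis by simp
qed

lemma geometric_decay_abs_summable:
 assumes "geometric_decay c"
 shows "(%N. c N * of_int N ^ k) abs_summable_on UNIV"
proof -
 obtain C r where r: "0 < r" "r < 1" and c: "!!N. norm (c N) <= C * r ^ nat \<bar>N\<bar>"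
  using assms unfolding geometric_decay_def by blast
 have s: "summable (%n. C * (real n ^ k * r ^ n))"
  by (intro summable_mult summable_power_times_geometric) (use r in auto)
 show ?thesis
 proof (rule abs_summable_on_int)
  show "summable (%n. norm (c (int n) * of_int (int n) ^ k))"
  proof (rule summable_comparison_test[OF _ s], intro exI allI impI)
   fix n :: nat
   show "norm (norm (c (int n) * of_int (int n) ^ k)) <= C * (real n ^ k * r ^ n)"
    using mult_right_mono[OF c[of "int n"], of "real n ^ k"]
    by (simp add: norm_mult norm_power mult_ac)
  qed
  show "summable (%n. norm (c (- int n) * of_int (- int n) ^ k))"
  proof (rule summable_comparison_test[OF _ s], intro exI allI impI)
   fix n :: nat
   show "norm (norm (c (- int n) * of_int (- int n) ^ k)) <= C * (real n ^ k * r ^ n)"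
    using mult_right_mono[OF c[of "- int n"], of "real n ^ k"]
    by (simp add: norm_mult norm_power mult_ac)
  qed
 qed
qed

lemma geometric_decay_summable:
 assumes "geometric_decay c"
 shows "(%N. c N * of_int N ^ k) summable_on UNIV"
 using geometric_decay_abs_summable[OF assms] by (rule abs_summable_summable)

lemma moment_series_deriv:
 "fps_deriv (moment_series c) = moment_series (%N. of_int N * c N)"
proof (rule fps_ext)
 fix k :: nat
 have "(\<Sum>\<^sub>\<infinity>N. c N * of_int N ^ Suc k) = (\<Sum>\<^sub>\<infinity>N. of_int N * c N * of_int N ^ k)"
  by (intro infsum_cong) simp
 then show "fps_deriv (moment_series c) $ k = moment_series (%N. of_int N * c N) $ k"
  by (simp add: moment_series_def fps_deriv_nth field_simps del: of_nat_Suc)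
qed

text \<open>Absolute summability of the family f(a) g(b) on all pairs allows the double series to be
  regrouped along the diagonals a + b = n.\<close>

lemma infsum_convolution:
 fixes f g :: "int => complex"
 assumes f: "f abs_summable_on UNIV" and g: "g abs_summable_on UNIV"
 shows "((%n. \<Sum>\<^sub>\<infinity>a. f a * g (n - a)) has_sum (infsum f UNIV * infsum g UNIV)) UNIV"
  and "(%a. f a * g (n - a)) summable_on UNIV"
proof -
 have s: "(%(a,b). f a * g b) abs_summable_on UNIV \<times> UNIV"
  by (rule Infinite_Sum.abs_summable_on_Sigma_iff[THEN iffD2])
   (use f g in \<open>auto simp: norm_mult infsum_cmult_right' abs_mult infsum_nonneg intro!: summable_on_cmult_right summable_on_cmult_left\<close>)
 have "infsum (%(a,b). f a * g b) (UNIV \<times> UNIV) = (\<Sum>\<^sub>\<infinity>a. \<Sum>\<^sub>\<infinity>b. f a * g b)"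
  using infsum_Sigma_banach[OF abs_summable_summable[OF s]] by simp
 also have "... = infsum f UNIV * infsum g UNIV"
  by (simp add: infsum_cmult_right' infsum_cmult_left')
 finally have tot: "((%(a,b). f a * g b) has_sum (infsum f UNIV * infsum g UNIV)) (UNIV \<times> UNIV)"
  using abs_summable_summable[OF s] by (metis has_sum_infsum)
 have bij: "bij_betw (%(n,a). (a, n - a)) (UNIV \<times> UNIV) (UNIV \<times> (UNIV :: int set))"
  by (rule bij_betwI[of _ _ _ "%(a,b). (a + b, a)"]) auto
 have tot': "((%(n,a). f a * g (n - a)) has_sum (infsum f UNIV * infsum g UNIV)) (UNIV \<times> UNIV)"
  using has_sum_reindex_bij_betw[OF bij, of "%(a,b). f a * g b"] tot
  by (simp add: case_prod_unfold)
 have inner: "(%a. f a * g (n - a)) summable_on UNIV" for n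
  using summable_on_SigmaD1[of "%n a. f a * g (n - a)" UNIV "%_. UNIV" n] has_sum_imp_summable[OF tot']
  by simp
 show "(%a. f a * g (n - a)) summable_on UNIV" by (rule inner)
 show "((%n. \<Sum>\<^sub>\<infinity>a. f a * g (n - a)) has_sum (infsum f UNIV * infsum g UNIV)) UNIV"
  using tot' by (rule has_sum_SigmaD) (use inner in auto)
qed

lemma has_sum_finite_sum:
 fixes f :: "'i => 'a => complex"
 assumes "finite I" "!!i. i \<in> I ==> (f i has_sum S i) A"
 shows "((%x. \<Sum>i\<in>I. f i x) has_sum (\<Sum>i\<in>I. S i)) A"
 using assms by (induction I rule: finite_induct) (auto intro!: has_sum_add)

text \<open>This is exp(a t) exp(b t) = exp((a + b) t) read coefficientwise: the binomial theorem
  for \<open>(a + b) ^ k\<close> distributes the moments over the two sequences, and the finitely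
  many double series that result are regrouped by n = a + b.\<close>

lemma moment_series_mult:
 assumes c: "geometric_decay c" and d: "geometric_decay d"
  and e: "!!n. (\<Sum>\<^sub>\<infinity>a. c a * d (n - a)) = e n"
 shows "moment_series c * moment_series d = moment_series e"
proof (rule fps_ext)
 fix k :: nat
 define cc dd where "cc i a = c a * of_int a ^ i" and "dd i a = d a * of_int a ^ i" for i and a :: int
 have sc: "cc i abs_summable_on UNIV" and sd: "dd i abs_summable_on UNIV" for i
  using geometric_decay_abs_summable[OF c] geometric_decay_abs_summable[OF d]
  by (simp_all add: cc_def dd_def)
 have binom: "(\<Sum>i\<le>k. cc i a * dd (k - i) b / (fact i * fact (k - i))) = c a * d b * of_int (a + b) ^ k / fact k" for a b
 proof -
  have "c a * d b * of_int (a + b) ^ k / fact k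
    = (\<Sum>i\<le>k. c a * d b * (of_nat (k choose i) * of_int a ^ i * of_int b ^ (k - i)) / fact k)"
   by (simp add: binomial_ring sum_distrib_left sum_divide_distrib)
  also have "... = (\<Sum>i\<le>k. cc i a * dd (k - i) b / (fact i * fact (k - i)))"
   by (intro sum.cong) (auto simp: binomial_fact cc_def dd_def field_simps)
  finally show ?thesis by simp
 qed
 have "((%n. \<Sum>i\<le>k. (\<Sum>\<^sub>\<infinity>a. cc i a * dd (k - i) (n - a)) / (fact i * fact (k - i)))
   has_sum (\<Sum>i\<le>k. (infsum (cc i) UNIV * infsum (dd (k - i)) UNIV) / (fact i * fact (k - i)))) UNIV"
  by (intro has_sum_finite_sum has_sum_divide_const infsum_convolution sc sd) auto
 also have "(%n. \<Sum>i\<le>k. (\<Sum>\<^sub>\<infinity>a. cc i a * dd (k - i) (n - a)) / (fact i * fact (k - i)))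
   = (%n. e n * of_int n ^ k / fact k)"
 proof
  fix n
  have "((%a. \<Sum>i\<le>k. cc i a * dd (k - i) (n - a) / (fact i * fact (k - i)))
    has_sum (\<Sum>i\<le>k. (\<Sum>\<^sub>\<infinity>a. cc i a * dd (k - i) (n - a)) / (fact i * fact (k - i)))) UNIV"
   by (intro has_sum_finite_sum has_sum_divide_const has_sum_infsum infsum_convolution sc sd) auto
  hence "((%a. c a * d (n - a) * (of_int n ^ k / fact k))
    has_sum (\<Sum>i\<le>k. (\<Sum>\<^sub>\<infinity>a. cc i a * dd (k - i) (n - a)) / (fact i * fact (k - i)))) UNIV"
   by (simp only: binom) simp
  moreover have "((%a. c a * d (n - a) * (of_int n ^ k / fact k)) has_sum (e n * (of_int n ^ k / fact k))) UNIV"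
   unfolding e[symmetric]
   by (intro has_sum_cmult_left has_sum_infsum infsum_convolution(2))
    (use sc[of 0] sd[of 0] in \<open>simp_all add: cc_def dd_def\<close>)
  ultimately show "(\<Sum>i\<le>k. (\<Sum>\<^sub>\<infinity>a. cc i a * dd (k - i) (n - a)) / (fact i * fact (k - i))) = e n * of_int n ^ k / fact k"
   using has_sum_unique by fastforce
 qed
 finally have "((%n. e n * of_int n ^ k / fact k) has_sum (moment_series c * moment_series d) $ k) UNIV"
  by (simp add: fps_mult_nth moment_series_def cc_def dd_def atLeast0AtMost)
 hence "(moment_series c * moment_series d) $ k = (\<Sum>\<^sub>\<infinity>n. e n * of_int n ^ k / fact k)"
  by (simp add: infsumI)
 also have "... = moment_series e $ k"
  by (simp add: moment_series_def divide_inverse infsum_cmult_left')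
 finally show "(moment_series c * moment_series d) $ k = moment_series e $ k" .
qed

section \<open>Lambert kernels and their convolution\<close>

text \<open>With nome \<open>P\<close> and \<zeta> = P^(1/2) exp(i v) these are, up to constant
  factors, the terms of the Fourier series of Jacobi's dn (\<sigma> = -1, p = 0), cn (\<sigma> = -1,
  p = 1) and sn (\<sigma> = 1, p = 1). For \<sigma> = 1, p = 0 the term N = 0 is a division by zero,
  hence 0; that kernel is used only in moments of positive order or at N \<noteq> 0.\<close>

definition ell_kernel :: "complex => int => complex => complex => int => complex" where
 "ell_kernel \<sigma> p P \<zeta> N =
   (if N mod 2 = p then 2 * \<zeta> powi N / (1 - \<sigma> * P powi N) else 0)"

text \<open>What is left of 1 / (1 - \<sigma> P^N) after subtracting 1/2 + sgn(N)/2, that is, its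
  limits 1 and 0 for N tending to plus and minus infinity. It decays in both directions and is odd
  in N.\<close>

definition sign_remainder :: "complex => int => complex => int => complex" where
 "sign_remainder \<sigma> p P N =
   (if N mod 2 = p & N ~= 0
   then of_int (sgn N) * (\<sigma> * P ^ nat \<bar>N\<bar> / (1 - \<sigma> * P ^ nat \<bar>N\<bar>)) else 0)"

lemma norm_one_minus_sign_power_ge:
 fixes P :: complex
 assumes "norm P < 1" "\<sigma> \<in> {1, -1}" "n > 0"
 shows "norm (1 - \<sigma> * P ^ n) >= 1 - norm P"
proof -
 have "norm (\<sigma> * P ^ n) <= norm P"
  using assms power_decreasing[of 1 n "norm P"] by (auto simp: norm_mult norm_power)
 thus ?thesis using norm_triangle_ineq2[of 1 "\<sigma> * P ^ n"] by simp
qed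

lemma one_minus_sign_powi_nonzero:
 fixes P :: complex
 assumes "0 < norm P" "norm P < 1" "\<sigma> \<in> {1, -1}" "N ~= 0 \<or> \<sigma> ~= 1"
 shows "1 - \<sigma> * P powi N ~= 0"
proof (cases "N = 0")
 case True
 with assms show ?thesis by auto
next
 case False
 show ?thesis
 proof
  assume "1 - \<sigma> * P powi N = 0"
  hence "\<sigma> * P powi N = 1" by simp
  hence "norm P powi N = 1" using assms(3) by (metis insertE norm_minus_cancel norm_mult norm_one norm_power_int mult_1 singletonD)
  hence "norm P powi (int (nat \<bar>N\<bar>)) = 1"
   by (cases "N >= 0") (auto simp: power_int_minus)
  hence "norm P ^ nat \<bar>N\<bar> = 1" by (simp add: power_int_def)
  moreover have "norm P ^ nat \<bar>N\<bar> < 1"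
   using assms False by (intro power_less_one_iff[THEN iffD2]) auto
  ultimately show False by simp
 qed
qed

lemma geometric_decayI:
 assumes "0 <= r" "r < 1" "!!n. norm (c (int n)) <= C * r ^ n" "!!n. n > 0 ==> norm (c (- int n)) <= C * r ^ n"
 shows "geometric_decay c"
proof -
 have C: "C >= 0" using assms(3)[of 0] norm_ge_zero[of "c 0"] by (simp; linarith)
 \<comment> \<open>A rate that is strictly positive even for r = 0, as the definition of geometric
   decay demands.\<close>
 define s where "s = (1 + r) / 2"
 have s: "0 < s" "s < 1" "r <= s" using assms by (auto simp: s_def)
 have "norm (c N) <= C * s ^ nat \<bar>N\<bar>" for N
 proof -
  have "norm (c N) <= C * r ^ nat \<bar>N\<bar>"
   using assms(3)[of "nat \<bar>N\<bar>"] assms(4)[of "nat \<bar>N\<bar>"] by (cases "N >= 0") auto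
  also have "... <= C * s ^ nat \<bar>N\<bar>"
   using C s assms by (intro mult_left_mono power_mono) auto
  finally show ?thesis .
 qed
 thus ?thesis unfolding geometric_decay_def using s by blast
qed

lemma geometric_decay_sign_remainder:
 assumes "norm P < 1" "\<sigma> \<in> {1, -1}"
 shows "geometric_decay (sign_remainder \<sigma> p P)"
proof (rule geometric_decayI)
 have b: "norm (sign_remainder \<sigma> p P N) <= 1 / (1 - norm P) * norm P ^ nat \<bar>N\<bar>" for N
 proof (cases "N mod 2 = p & N ~= 0")
  case True
  have "norm (sign_remainder \<sigma> p P N) = norm P ^ nat \<bar>N\<bar> / norm (1 - \<sigma> * P ^ nat \<bar>N\<bar>)"
   using True assms by (auto simp: sign_remainder_def norm_mult norm_divide norm_power sgn_if)
  also have "... <= norm P ^ nat \<bar>N\<bar> / (1 - norm P)"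
   using True assms norm_one_minus_sign_power_ge[OF assms, of "nat \<bar>N\<bar>"]
   by (intro divide_left_mono mult_pos_pos) (auto simp del: zero_less_norm_iff)
  finally show ?thesis by simp
 qed (use assms in \<open>auto simp: sign_remainder_def\<close>)
 show "norm (sign_remainder \<sigma> p P (int n)) <= 1 / (1 - norm P) * norm P ^ n" for n using b[of "int n"] by simp
 show "norm (sign_remainder \<sigma> p P (- int n)) <= 1 / (1 - norm P) * norm P ^ n" for n using b[of "- int n"] by simp
qed (use assms in auto)

lemma has_sum_odd_int:
 fixes f :: "int => complex"
 assumes "f summable_on UNIV" "!!N. f (- N) = - f N"
 shows "(f has_sum 0) UNIV"
proof -
 have "infsum f UNIV = infsum (%N. f (- N)) UNIV"
  by (rule infsum_reindex_bij_witness[of _ uminus uminus]) auto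
 also have "... = - infsum f UNIV" by (simp add: assms(2) infsum_uminus)
 finally have "infsum f UNIV = 0" by simp
 thus ?thesis using assms(1) has_sum_infsum by metis
qed

lemma has_sum_sign_remainder:
 assumes "norm P < 1" "\<sigma> \<in> {1, -1}"
 shows "(sign_remainder \<sigma> p P has_sum 0) UNIV"
proof (rule has_sum_odd_int)
 show "sign_remainder \<sigma> p P summable_on UNIV"
  using geometric_decay_summable[OF geometric_decay_sign_remainder[OF assms], of p 0] by simp
 have "(- N) mod 2 = p \<longleftrightarrow> N mod 2 = p" for N :: int by presburger
 thus "sign_remainder \<sigma> p P (- N) = - sign_remainder \<sigma> p P N" for N
  by (simp add: sign_remainder_def sgn_minus)
qed

text \<open>For n > 0 the summand is 1 strictly between 0 and n, 1/2 at the two ends and 0 outside,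
  so a single parity class contributes n/2 whichever class it is. Passing from n to n + 2 changes
  only the terms at n, n + 1 and n + 2, which gives the induction in both directions.\<close>

lemma has_sum_sign_convolution:
 fixes n p :: int
 assumes p: "p \<in> {0, 1}"
 shows "((%a. if a mod 2 = p then (of_int (sgn a) + of_int (sgn (n - a))) / 2 else 0)
      has_sum (of_int n / 2 :: complex)) UNIV"
proof -
 define h where "h n a = (if a mod 2 = p then (of_int (sgn a) + of_int (sgn (n - a))) / 2 else 0 :: complex)" for n a
 define P where "P n \<longleftrightarrow> (h n has_sum (of_int n / 2)) UNIV" for n
 have step: "((%a. h (n + 2) a - h n a) has_sum 1) UNIV" for n
 proof (rule has_sum_finite_neutralI[of "{n, n+1, n+2}"])
  fix a assume "a \<in> UNIV - {n, n + 1, n + 2}"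
  thus "h (n + 2) a - h n a = 0" by (auto simp: h_def sgn_if)
 next
  have "(n mod 2 = p & (n+1) mod 2 ~= p & (n+2) mod 2 = p) \<or> (n mod 2 ~= p & (n+1) mod 2 = p & (n+2) mod 2 ~= p)"
   using p by auto presburger+
  thus "1 = (\<Sum>a\<in>{n, n+1, n+2}. h (n + 2) a - h n a)"
   by (auto simp: h_def sgn_if)
 qed auto
 have up: "P n ==> P (n + 2)" for n
  unfolding P_def using has_sum_add[OF _ step, of "h n" "of_int n / 2" n] by (simp add: field_simps)
 have down: "P (n + 2) ==> P n" for n
  unfolding P_def using has_sum_add[OF _ has_sum_uminusI[OF step], of "h (n+2)" "of_int (n+2) / 2" n] by (simp add: field_simps)
 have z: "P 0"
  unfolding P_def by (rule has_sum_finite_neutralI[of "{}"]) (auto simp: h_def sgn_minus)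
 have o: "P 1"
  unfolding P_def
 proof (rule has_sum_finite_neutralI[of "{0, 1}"])
  show "of_int 1 / 2 = (\<Sum>a\<in>{0, 1}. h 1 a)" using p by (auto simp: h_def)
 qed (auto simp: h_def sgn_if)
 have "P (2 * m + e)" if "e \<in> {0, 1}" for m e
 proof (induction m rule: int_induct[where k = 0])
  case base show ?case using that z o by auto
 next
  case (step1 i) thus ?case using up[of "2 * i + e"] by (simp add: algebra_simps)
 next
  case (step2 i) thus ?case using down[of "2 * (i - 1) + e"] by (simp add: algebra_simps)
 qed
 note * = this
 have "n mod 2 = 0 \<or> n mod 2 = 1" by presburger
 hence "P n" using *[of "n mod 2" "n div 2"] by simp
 thus ?thesis unfolding P_def h_def .
qed

lemma ell_kernel_denominator_split:
 fixes P :: complex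
 assumes "0 < norm P" "norm P < 1" "\<sigma> \<in> {1, -1}" "N mod 2 = p" "N ~= 0 \<or> \<sigma> ~= 1"
 shows "1 / (1 - \<sigma> * P powi N) = 1/2 + of_int (sgn N) / 2 + sign_remainder \<sigma> p P N"
proof (cases "N = 0")
 case True
 with assms have "\<sigma> = -1" by auto
 thus ?thesis by (simp add: True sign_remainder_def)
next
 case False
 define x where "x = P ^ nat \<bar>N\<bar>"
 have x: "1 - \<sigma> * x ~= 0"
  using one_minus_sign_powi_nonzero[OF assms(1-3), of "int (nat \<bar>N\<bar>)"] False by (simp add: x_def power_int_def)
 have x0: "x ~= 0" using assms by (auto simp: x_def)
 have s: "\<sigma> * \<sigma> = 1" using assms by auto
 show ?thesis
 proof (cases "N > 0")
  case True
  hence "P powi N = x" "P ^ nat N = x" by (simp_all add: x_def power_int_def)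
  thus ?thesis using x True assms by (simp add: sign_remainder_def field_simps)
 next
  case neg: False
  hence pn: "P powi N = 1 / x" using False by (simp add: x_def power_int_def field_simps)
  define D where "D = 1 - \<sigma> * x"
  have "- \<sigma> * D = x - \<sigma>" using assms(3) by (auto simp: D_def)
  hence "1 - \<sigma> * P powi N = - \<sigma> * D / x" using x0 by (simp add: pn diff_divide_distrib)
  moreover have "1 / (- \<sigma> * D / x) = - (\<sigma> * x / D)"
   using assms(3) by auto
  ultimately have "1 / (1 - \<sigma> * P powi N) = - (\<sigma> * x / (1 - \<sigma> * x))"
   by (simp add: D_def)
  moreover have "P ^ nat (- N) = x" using neg by (simp add: x_def)
  ultimately show ?thesis using neg False assms by (simp add: sign_remainder_def)
 qed
qed

text \<open>With A = 1 - \<sigma> P^a and B = 1 - \<sigma>' P^(n-a) one has A + B - A B = 1 -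
  \<sigma> \<sigma>' P^n, so 1/(A B) is 1/A + 1/B - 1 divided by a quantity independent of a. On
  summation over a the decaying remainders of 1/A and 1/B are odd and vanish, and the signs
  contribute n/2. The last assumption keeps the denominator on the right away from 0 at n = 0. The
  factor n is the one that later acts as a derivative.\<close>

lemma ell_kernel_convolution:
 assumes P: "0 < norm P" "norm P < 1" and z: "\<zeta> ~= 0"
  and s: "\<sigma> \<in> {1, -1}" "\<sigma>' \<in> {1, -1}" and p: "p \<in> {0, 1}" "p' \<in> {0, 1}"
  and v: "\<sigma> = 1 --> p = 1" "\<sigma>' = 1 --> p' = 1"
  and n: "n ~= 0 \<or> \<sigma> * \<sigma>' ~= 1 \<or> p ~= p'"
 shows "(\<Sum>\<^sub>\<infinity>a. ell_kernel \<sigma> p P \<zeta> a * ell_kernel \<sigma>' p' P \<zeta> (n - a))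
      = of_int n * ell_kernel (\<sigma> * \<sigma>') ((p + p') mod 2) P \<zeta> n"
proof (cases "n mod 2 = (p + p') mod 2")
 case False
 have "ell_kernel \<sigma> p P \<zeta> a * ell_kernel \<sigma>' p' P \<zeta> (n - a) = 0" for a
  using False by (auto simp: ell_kernel_def) presburger
 hence "(\<Sum>\<^sub>\<infinity>a. ell_kernel \<sigma> p P \<zeta> a * ell_kernel \<sigma>' p' P \<zeta> (n - a)) = 0" by (simp only: infsum_0_simp)
 thus ?thesis using False by (simp add: ell_kernel_def)
next
 case True
 have par: "(n - a) mod 2 = p' \<longleftrightarrow> a mod 2 = p" for a
  using True p by auto presburger+
 have den: "1 - \<sigma> * \<sigma>' * P powi n ~= 0"
 proof (rule one_minus_sign_powi_nonzero[OF P])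
  show "n ~= 0 \<or> \<sigma> * \<sigma>' ~= 1" using n True p by auto
 qed (use s in auto)
 define K where "K = 4 * \<zeta> powi n / (1 - \<sigma> * \<sigma>' * P powi n)"
 have ab: "((%a. sign_remainder \<sigma>' p' P (n - a)) has_sum 0) UNIV"
  using has_sum_sign_remainder[OF P(2) s(2), of p']
  by (subst has_sum_reindex_bij_witness[of _ "%a. n - a" "%a. n - a" _ "sign_remainder \<sigma>' p' P"]) auto
 have "((%a. K * (sign_remainder \<sigma> p P a + sign_remainder \<sigma>' p' P (n - a)
      + (if a mod 2 = p then (of_int (sgn a) + of_int (sgn (n - a))) / 2 else 0)))
     has_sum (K * (0 + 0 + of_int n / 2))) UNIV"
  by (intro has_sum_cmult_right has_sum_add has_sum_sign_remainder ab has_sum_sign_convolution P s p)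
 also have "(%a. K * (sign_remainder \<sigma> p P a + sign_remainder \<sigma>' p' P (n - a)
      + (if a mod 2 = p then (of_int (sgn a) + of_int (sgn (n - a))) / 2 else 0)))
   = (%a. ell_kernel \<sigma> p P \<zeta> a * ell_kernel \<sigma>' p' P \<zeta> (n - a))"
 proof
  fix a
  show "K * (sign_remainder \<sigma> p P a + sign_remainder \<sigma>' p' P (n - a)
      + (if a mod 2 = p then (of_int (sgn a) + of_int (sgn (n - a))) / 2 else 0))
    = ell_kernel \<sigma> p P \<zeta> a * ell_kernel \<sigma>' p' P \<zeta> (n - a)"
  proof (cases "a mod 2 = p")
   case False
   thus ?thesis by (simp add: ell_kernel_def sign_remainder_def par)
  next
   case a: True
   hence b: "(n - a) mod 2 = p'" using par by simp
   define A B where "A = 1 - \<sigma> * P powi a" and "B = 1 - \<sigma>' * P powi (n - a)"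
   have A: "A ~= 0" unfolding A_def using a v p s by (intro one_minus_sign_powi_nonzero[OF P]) auto
   have B: "B ~= 0" unfolding B_def using b v p s by (intro one_minus_sign_powi_nonzero[OF P]) auto
   have PP: "P powi a * P powi (n - a) = P powi n" and zz: "\<zeta> powi a * \<zeta> powi (n - a) = \<zeta> powi n"
    using P z by (simp_all flip: power_int_add)
   have gen: "(1 - s * x) + (1 - s' * y) - (1 - s * x) * (1 - s' * y) = 1 - s * s' * (x * y)" for s s' x y :: complex
    by (simp add: algebra_simps)
   have AB: "A + B - A * B = 1 - \<sigma> * \<sigma>' * P powi n"
    using gen[of \<sigma> "P powi a" \<sigma>' "P powi (n - a)"] by (simp only: A_def B_def PP)
   have e1: "sign_remainder \<sigma> p P a = 1 / A - 1/2 - of_int (sgn a) / 2"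
   proof -
    have "a ~= 0 \<or> \<sigma> ~= 1" using a v(1) by auto
    thus ?thesis using ell_kernel_denominator_split[OF P s(1) a] by (simp add: A_def)
   qed
   have e2: "sign_remainder \<sigma>' p' P (n - a) = 1 / B - 1/2 - of_int (sgn (n - a)) / 2"
   proof -
    have "n - a ~= 0 \<or> \<sigma>' ~= 1" using b v(2) by auto
    thus ?thesis using ell_kernel_denominator_split[OF P s(2) b] by (simp add: B_def)
   qed
   have "K * (sign_remainder \<sigma> p P a + sign_remainder \<sigma>' p' P (n - a)
      + (if a mod 2 = p then (of_int (sgn a) + of_int (sgn (n - a))) / 2 else 0))
     = K * (1 / A + 1 / B - 1)"
    using a by (simp add: e1 e2 field_simps)
   also have "1 / A + 1 / B - 1 = (1 - \<sigma> * \<sigma>' * P powi n) / (A * B)"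
    unfolding AB[symmetric] using A B by (simp add: field_simps)
   also have "K * ((1 - \<sigma> * \<sigma>' * P powi n) / (A * B)) = 4 * \<zeta> powi n / (A * B)"
    using den by (simp add: K_def)
   also have "... = ell_kernel \<sigma> p P \<zeta> a * ell_kernel \<sigma>' p' P \<zeta> (n - a)"
    using a b by (simp add: ell_kernel_def A_def B_def zz[symmetric])
   finally show ?thesis .
  qed
 qed
 finally have "(\<Sum>\<^sub>\<infinity>a. ell_kernel \<sigma> p P \<zeta> a * ell_kernel \<sigma>' p' P \<zeta> (n - a)) = K * (0 + 0 + of_int n / 2)"
  by (rule infsumI)
 also have "... = of_int n * ell_kernel (\<sigma> * \<sigma>') ((p + p') mod 2) P \<zeta> n"
 proof -
  have "4 * x / d * (0 + 0 + m / 2) = m * (2 * x / d)" for x d m :: complex by simp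
  thus ?thesis using True by (simp only: ell_kernel_def K_def) simp
 qed
 finally show ?thesis .
qed

text \<open>To the right the kernel decays like |\<zeta>|^N. To the left the denominator grows like
  |P|^N, which leaves |P / \<zeta>|^|N|; this is where the annulus |P| < |\<zeta>| < 1 comes
  from.\<close>

lemma geometric_decay_ell_kernel:
 assumes P: "0 < norm P" "norm P < norm \<zeta>" "norm \<zeta> < 1" and s: "\<sigma> \<in> {1, -1}"
 shows "geometric_decay (ell_kernel \<sigma> p P \<zeta>)"
proof (rule geometric_decayI)
 define r where "r = max (norm \<zeta>) (norm P / norm \<zeta>)"
 have P1: "norm P < 1" using P by linarith
 have z0: "norm \<zeta> > 0" using P by linarith
 show "0 <= r" "r < 1" using P z0 by (auto simp: r_def le_max_iff_disj)
 show "norm (ell_kernel \<sigma> p P \<zeta> (int n)) <= 2 / (1 - norm P) * r ^ n" for n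
 proof (cases "n = 0")
  case True
  have "norm (ell_kernel \<sigma> p P \<zeta> 0) <= 1" using s by (auto simp: ell_kernel_def)
  moreover have "2 / (1 - norm P) >= 1" using P P1 by (simp add: field_simps)
  ultimately show ?thesis using True by simp
 next
  case False
  have "norm (ell_kernel \<sigma> p P \<zeta> (int n)) <= 2 * norm \<zeta> ^ n / norm (1 - \<sigma> * P ^ n)"
   by (auto simp: ell_kernel_def norm_mult norm_divide norm_power)
  also have "... <= 2 * norm \<zeta> ^ n / (1 - norm P)"
   using norm_one_minus_sign_power_ge[OF P1 s, of n] False P1
   by (intro divide_left_mono mult_pos_pos) auto
  also have "... <= 2 * r ^ n / (1 - norm P)"
   using P1 by (intro divide_right_mono mult_left_mono power_mono) (auto simp: r_def)
  finally show ?thesis by simp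
 qed
 show "norm (ell_kernel \<sigma> p P \<zeta> (- int n)) <= 2 / (1 - norm P) * r ^ n" if "n > 0" for n
 proof -
  have nz: "P ^ n ~= 0" "\<zeta> ^ n ~= 0" using P z0 by auto
  have "1 - \<sigma> * P powi (- int n) = - \<sigma> * (1 - \<sigma> * P ^ n) / P ^ n"
   using nz s by (auto simp: power_int_minus field_simps)
  hence "norm (1 - \<sigma> * P powi (- int n)) = norm (1 - \<sigma> * P ^ n) / norm P ^ n"
   using s by (auto simp: norm_mult norm_divide norm_power)
  hence "norm (2 * \<zeta> powi (- int n) / (1 - \<sigma> * P powi (- int n)))
    = norm (2 * \<zeta> powi (- int n)) / (norm (1 - \<sigma> * P ^ n) / norm P ^ n)"
   by (simp only: norm_divide)
  also have "... = 2 * (norm P / norm \<zeta>) ^ n / norm (1 - \<sigma> * P ^ n)"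
   by (simp add: norm_mult norm_power power_int_minus norm_inverse power_divide divide_inverse power_mult_distrib flip: power_inverse)
  finally have "norm (ell_kernel \<sigma> p P \<zeta> (- int n)) <= 2 * (norm P / norm \<zeta>) ^ n / norm (1 - \<sigma> * P ^ n)"
   by (simp add: ell_kernel_def)
  also have "... <= 2 * (norm P / norm \<zeta>) ^ n / (1 - norm P)"
   using norm_one_minus_sign_power_ge[OF P1 s, of n] that P1
   by (intro divide_left_mono mult_pos_pos) auto
  also have "... <= 2 * r ^ n / (1 - norm P)"
   using P1 by (intro divide_right_mono mult_left_mono power_mono) (auto simp: r_def)
  finally show ?thesis by simp
 qed
qed

section \<open>Jacobi elliptic functions as moment series\<close>

definition dn_series :: "complex => complex => complex fps" where
 "dn_series P \<zeta> = moment_series (ell_kernel (-1) 0 P \<zeta>)"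

definition cn_series :: "complex => complex => complex fps" where
 "cn_series P \<zeta> = moment_series (ell_kernel (-1) 1 P \<zeta>)"

definition sn_series :: "complex => complex => complex fps" where
 "sn_series P \<zeta> = moment_series (ell_kernel 1 1 P \<zeta>)"

text \<open>For q = exp(-y) the summand is 1 / cosh(n y). The sum is the value of dn at the half
  period and turns out to be \<open>theta q\<close> squared.\<close>

definition sech_sum :: "complex => complex" where
 "sech_sum q = (\<Sum>\<^sub>\<infinity>n::int. 2 * q powi n / (1 + q powi (2 * n)))"

text \<open>Differentiation multiplies the coefficients by N, and the convolution of any two of the
  three kernels is N times the third.\<close>

lemma elliptic_series_deriv:
 assumes "0 < norm P" "norm P < norm \<zeta>" "norm \<zeta> < 1"
 shows "fps_deriv (dn_series P \<zeta>) = sn_series P \<zeta> * cn_series P \<zeta>"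
  and "fps_deriv (sn_series P \<zeta>) = dn_series P \<zeta> * cn_series P \<zeta>"
  and "fps_deriv (cn_series P \<zeta>) = sn_series P \<zeta> * dn_series P \<zeta>"
proof -
 have P1: "norm P < 1" and z: "\<zeta> ~= 0" using assms by auto
 note k = ell_kernel_convolution[OF assms(1) P1 z]
 note g = geometric_decay_ell_kernel[OF assms]
 show "fps_deriv (dn_series P \<zeta>) = sn_series P \<zeta> * cn_series P \<zeta>"
  unfolding dn_series_def sn_series_def cn_series_def moment_series_deriv
  by (intro moment_series_mult[symmetric] g) (use k[of 1 "-1" 1 1] in auto)
 show "fps_deriv (sn_series P \<zeta>) = dn_series P \<zeta> * cn_series P \<zeta>"
  unfolding dn_series_def sn_series_def cn_series_def moment_series_deriv
  by (intro moment_series_mult[symmetric] g) (use k[of "-1" "-1" 0 1] in auto)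
 show "fps_deriv (cn_series P \<zeta>) = sn_series P \<zeta> * dn_series P \<zeta>"
  unfolding dn_series_def sn_series_def cn_series_def moment_series_deriv
  by (intro moment_series_mult[symmetric] g) (use k[of 1 "-1" 1 0] in auto)
qed

lemma moment_series_nth_0: "moment_series c $ 0 = infsum c UNIV"
 by (simp add: moment_series_def)

text \<open>A square is the sum over n of the self-convolution, and the two self-convolutions differ
  only at n = 0.\<close>

lemma square_difference_convolution:
 assumes c: "geometric_decay c" and d: "geometric_decay d"
  and e: "!!n. n ~= 0 ==> (\<Sum>\<^sub>\<infinity>a. c a * c (n - a)) = (\<Sum>\<^sub>\<infinity>a. d a * d (n - a))"
 shows "(infsum c UNIV)\<^sup>2 - (infsum d UNIV)\<^sup>2 = (\<Sum>\<^sub>\<infinity>a. c a * c (- a)) - (\<Sum>\<^sub>\<infinity>a. d a * d (- a))"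
proof -
 have sc: "c abs_summable_on UNIV" and sd: "d abs_summable_on UNIV"
  using geometric_decay_abs_summable[OF c, of 0] geometric_decay_abs_summable[OF d, of 0] by simp_all
 have "((%n. (\<Sum>\<^sub>\<infinity>a. c a * c (n - a)) + - (\<Sum>\<^sub>\<infinity>a. d a * d (n - a)))
   has_sum (infsum c UNIV * infsum c UNIV + - (infsum d UNIV * infsum d UNIV))) UNIV"
  by (intro has_sum_add has_sum_uminusI infsum_convolution sc sd)
 moreover have "((%n. (\<Sum>\<^sub>\<infinity>a. c a * c (n - a)) + - (\<Sum>\<^sub>\<infinity>a. d a * d (n - a)))
   has_sum ((\<Sum>\<^sub>\<infinity>a. c a * c (- a)) - (\<Sum>\<^sub>\<infinity>a. d a * d (- a)))) UNIV"
  by (rule has_sum_finite_neutralI[of "{0}"]) (auto simp: e)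
 ultimately show ?thesis
  using has_sum_unique by (fastforce simp: power2_eq_square)
qed

lemma infsum_even:
 fixes f :: "int => complex"
 shows "(\<Sum>\<^sub>\<infinity>N. if N mod 2 = 0 then f (N div 2) else 0) = infsum f UNIV"
proof -
 have "(\<Sum>\<^sub>\<infinity>N. if N mod 2 = 0 then f (N div 2) else 0) = (\<Sum>\<^sub>\<infinity>N\<in>{N. N mod 2 = 0}. f (N div 2))"
  by (rule infsum_cong_neutral) auto
 also have "... = infsum f UNIV"
  by (rule infsum_reindex_bij_witness[of _ "%n. 2 * n" "%N. N div 2"]) auto
 finally show ?thesis .
qed

lemma sech_sum_eq_dn:
 fixes r :: complex
 shows "dn_series (r\<^sup>2) r $ 0 = sech_sum (r\<^sup>2)"
  and "dn_series (r\<^sup>2) (\<i> * r) $ 0 = sech_sum (- r\<^sup>2)"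
proof -
 have "dn_series (r\<^sup>2) r $ 0
   = (\<Sum>\<^sub>\<infinity>N. if N mod 2 = 0 then 2 * (r\<^sup>2) powi (N div 2) / (1 + (r\<^sup>2) powi (2 * (N div 2))) else 0)"
  unfolding dn_series_def moment_series_nth_0
  by (rule infsum_cong) (auto simp: ell_kernel_def power_int_mult elim!: evenE)
 thus "dn_series (r\<^sup>2) r $ 0 = sech_sum (r\<^sup>2)"
  unfolding infsum_even[of "%n. 2 * (r\<^sup>2) powi n / (1 + (r\<^sup>2) powi (2 * n))"] sech_sum_def .
 have "dn_series (r\<^sup>2) (\<i> * r) $ 0
   = (\<Sum>\<^sub>\<infinity>N. if N mod 2 = 0 then 2 * (- r\<^sup>2) powi (N div 2) / (1 + (- r\<^sup>2) powi (2 * (N div 2))) else 0)"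
  unfolding dn_series_def moment_series_nth_0
  by (rule infsum_cong) (auto simp: ell_kernel_def power_int_mult power_mult_distrib elim!: evenE)
 thus "dn_series (r\<^sup>2) (\<i> * r) $ 0 = sech_sum (- r\<^sup>2)"
  unfolding infsum_even[of "%n. 2 * (- r\<^sup>2) powi n / (1 + (- r\<^sup>2) powi (2 * n))"] sech_sum_def .
qed

text \<open>At \<zeta>^2 = P the kernel is 2 x / (1 - x^2) with x = r^N, which is odd in N: this is
  the zero of sn.\<close>

lemma sn_series_center:
 assumes "0 < norm r" "norm r < 1"
 shows "sn_series (r\<^sup>2) r $ 0 = 0"
proof -
 have "norm (r\<^sup>2) < norm r" using assms by (simp add: norm_mult power2_eq_square)
 hence "geometric_decay (ell_kernel 1 1 (r\<^sup>2) r)"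
  using assms by (intro geometric_decay_ell_kernel) auto
 hence s: "ell_kernel 1 1 (r\<^sup>2) r summable_on UNIV"
  using geometric_decay_summable[of _ 0] by simp
 have "(ell_kernel 1 1 (r\<^sup>2) r has_sum 0) UNIV"
 proof (rule has_sum_odd_int[OF s])
  fix N :: int
  define x where "x = r powi N"
  have x: "x ~= 0" "r\<^sup>2 powi N = x\<^sup>2" using assms by (auto simp: x_def power_int_power power_int_power' mult.commute)
  have "(1 / x) / (1 - 1 / x\<^sup>2) = - (x / (1 - x\<^sup>2))"
   using x by (cases "x\<^sup>2 = 1") (auto simp: field_simps power2_eq_square)
  moreover have "(- N) mod 2 = 1 \<longleftrightarrow> N mod 2 = 1" by presburger
  ultimately show "ell_kernel 1 1 (r\<^sup>2) r (- N) = - ell_kernel 1 1 (r\<^sup>2) r N"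
   using x by (simp add: ell_kernel_def power_int_minus x_def[symmetric] divide_inverse) 
 qed
 thus ?thesis by (simp add: sn_series_def moment_series_nth_0 infsumI)
qed

text \<open>At \<zeta>^2 = -P and odd N one has P^N = -x^2 with x = \<zeta>^N, so the kernel of cn
  takes the same odd form 2 x / (1 - x^2) as that of sn at its own zero.\<close>

lemma cn_series_center:
 assumes "0 < norm r" "norm r < 1"
 shows "cn_series (r\<^sup>2) (\<i> * r) $ 0 = 0"
proof -
 have "norm (r\<^sup>2) < norm r" using assms by (simp add: norm_mult power2_eq_square)
 hence "geometric_decay (ell_kernel (-1) 1 (r\<^sup>2) (\<i> * r))"
  using assms by (intro geometric_decay_ell_kernel) (auto simp: norm_mult)
 hence s: "ell_kernel (-1) 1 (r\<^sup>2) (\<i> * r) summable_on UNIV"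
  using geometric_decay_summable[of _ 0] by simp
 have "(ell_kernel (-1) 1 (r\<^sup>2) (\<i> * r) has_sum 0) UNIV"
 proof (rule has_sum_odd_int[OF s])
  fix N :: int
  show "ell_kernel (-1) 1 (r\<^sup>2) (\<i> * r) (- N) = - ell_kernel (-1) 1 (r\<^sup>2) (\<i> * r) N"
  proof (cases "N mod 2 = 1")
   case True
   hence N: "(- N) mod 2 = 1" by presburger
   have "odd N" using True by presburger
   define x where "x = (\<i> * r) powi N"
   have x: "x ~= 0" using assms by (auto simp: x_def)
   have "x\<^sup>2 = ((\<i> * r)\<^sup>2) powi N" by (simp add: x_def power_int_power power_int_power' mult.commute)
   also have "(\<i> * r)\<^sup>2 = - (r\<^sup>2)" by (simp add: power_mult_distrib)
   also have "(- (r\<^sup>2)) powi N = - (r\<^sup>2 powi N)" using \<open>odd N\<close> by (simp add: power_int_minus_left)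
   finally have y: "r\<^sup>2 powi N = - x\<^sup>2" by simp
   have "(1 / x) / (1 - 1 / x\<^sup>2) = - (x / (1 - x\<^sup>2))"
    using x by (cases "x\<^sup>2 = 1") (auto simp: field_simps power2_eq_square)
   thus ?thesis
    using x y True N by (simp add: ell_kernel_def power_int_minus x_def[symmetric] divide_inverse)
  next
   case False
   hence "(- N) mod 2 ~= 1" by presburger
   thus ?thesis using False by (simp add: ell_kernel_def)
  qed
 qed
 thus ?thesis by (simp add: cn_series_def moment_series_nth_0 infsumI)
qed

lemma ell_kernel_reflect_independent:
 assumes "\<zeta> ~= 0"
 shows "ell_kernel \<sigma> p P \<zeta> a * ell_kernel \<sigma> p P \<zeta> (- a)
    = ell_kernel \<sigma> p P 1 a * ell_kernel \<sigma> p P 1 (- a)"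
 using assms by (auto simp: ell_kernel_def power_int_minus)

text \<open>The self-convolutions of the three kernels agree at every n \<noteq> 0, being n times
  the same even kernel. Only the term n = 0 is left, and there the powers of \<zeta> cancel, so
  nothing depends on the point.\<close>

lemma elliptic_constants_aux:
 assumes "0 < norm P" "norm P < norm \<zeta>" "norm \<zeta> < 1" "norm P < norm \<xi>" "norm \<xi> < 1"
 shows "(dn_series P \<zeta> $ 0)\<^sup>2 - (sn_series P \<zeta> $ 0)\<^sup>2 = (dn_series P \<xi> $ 0)\<^sup>2 - (sn_series P \<xi> $ 0)\<^sup>2"
  and "(dn_series P \<zeta> $ 0)\<^sup>2 - (cn_series P \<zeta> $ 0)\<^sup>2 = (dn_series P \<xi> $ 0)\<^sup>2 - (cn_series P \<xi> $ 0)\<^sup>2"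
proof -
 have P1: "norm P < 1" using assms by linarith
 have A: "(infsum (ell_kernel (-1) 0 P x) UNIV)\<^sup>2 - (infsum (ell_kernel \<sigma> 1 P x) UNIV)\<^sup>2
   = (\<Sum>\<^sub>\<infinity>a. ell_kernel (-1) 0 P 1 a * ell_kernel (-1) 0 P 1 (- a))
   - (\<Sum>\<^sub>\<infinity>a. ell_kernel \<sigma> 1 P 1 a * ell_kernel \<sigma> 1 P 1 (- a))"
  if "\<sigma> \<in> {1, -1}" "norm P < norm x" "norm x < 1" for \<sigma> x
 proof -
  have x: "x ~= 0" using that assms by auto
  have "(infsum (ell_kernel (-1) 0 P x) UNIV)\<^sup>2 - (infsum (ell_kernel \<sigma> 1 P x) UNIV)\<^sup>2
   = (\<Sum>\<^sub>\<infinity>a. ell_kernel (-1) 0 P x a * ell_kernel (-1) 0 P x (- a))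
   - (\<Sum>\<^sub>\<infinity>a. ell_kernel \<sigma> 1 P x a * ell_kernel \<sigma> 1 P x (- a))"
  proof (intro square_difference_convolution geometric_decay_ell_kernel)
   fix n :: int assume n: "n ~= 0"
   show "(\<Sum>\<^sub>\<infinity>a. ell_kernel (-1) 0 P x a * ell_kernel (-1) 0 P x (n - a))
     = (\<Sum>\<^sub>\<infinity>a. ell_kernel \<sigma> 1 P x a * ell_kernel \<sigma> 1 P x (n - a))"
    using ell_kernel_convolution[OF assms(1) P1 x, of "-1" "-1" 0 0 n]
     ell_kernel_convolution[OF assms(1) P1 x, of \<sigma> \<sigma> 1 1 n] n that by auto
  qed (use assms that in auto)
  thus ?thesis by (simp only: ell_kernel_reflect_independent[OF x])
 qed
 show "(dn_series P \<zeta> $ 0)\<^sup>2 - (sn_series P \<zeta> $ 0)\<^sup>2 = (dn_series P \<xi> $ 0)\<^sup>2 - (sn_series P \<xi> $ 0)\<^sup>2"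
  using A[of 1 \<zeta>] A[of 1 \<xi>] assms by (simp add: dn_series_def sn_series_def moment_series_nth_0)
 show "(dn_series P \<zeta> $ 0)\<^sup>2 - (cn_series P \<zeta> $ 0)\<^sup>2 = (dn_series P \<xi> $ 0)\<^sup>2 - (cn_series P \<xi> $ 0)\<^sup>2"
  using A[of "-1" \<zeta>] A[of "-1" \<xi>] assms by (simp add: dn_series_def cn_series_def moment_series_nth_0)
qed

text \<open>The constants may be evaluated at any point of the annulus. With r^2 = P the convenient
  ones are \<zeta> = r, where sn vanishes, and \<zeta> = i r, where cn vanishes; there dn equals
  \<open>sech_sum P\<close> and \<open>sech_sum (- P)\<close>.\<close>

lemma elliptic_constants_0:
 assumes "0 < norm P" "norm P < norm \<zeta>" "norm \<zeta> < 1"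
 shows "(dn_series P \<zeta> $ 0)\<^sup>2 - (sn_series P \<zeta> $ 0)\<^sup>2 = (sech_sum P)\<^sup>2"
  and "(dn_series P \<zeta> $ 0)\<^sup>2 - (cn_series P \<zeta> $ 0)\<^sup>2 = (sech_sum (- P))\<^sup>2"
proof -
 define r where "r = csqrt P"
 have r: "r\<^sup>2 = P" by (simp add: r_def)
 have nr: "(norm r)\<^sup>2 = norm P" using r by (metis norm_power)
 have r0: "0 < norm r" using assms r by auto
 have "(norm r)\<^sup>2 < 1\<^sup>2" unfolding nr using assms by simp
 hence r1: "norm r < 1" by (rule power2_less_imp_less) simp
 have rP: "norm P < norm r" unfolding nr[symmetric] using r0 r1 by (simp add: power2_eq_square)
 show "(dn_series P \<zeta> $ 0)\<^sup>2 - (sn_series P \<zeta> $ 0)\<^sup>2 = (sech_sum P)\<^sup>2"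
  using elliptic_constants_aux(1)[OF assms rP r1] sech_sum_eq_dn(1)[of r] sn_series_center[OF r0 r1]
  by (simp add: r)
 show "(dn_series P \<zeta> $ 0)\<^sup>2 - (cn_series P \<zeta> $ 0)\<^sup>2 = (sech_sum (- P))\<^sup>2"
  using elliptic_constants_aux(2)[OF assms, of "\<i> * r"] sech_sum_eq_dn(2)[of r] cn_series_center[OF r0 r1] rP r1
  by (simp add: r norm_mult)
qed

lemma fps_deriv_eq_0_imp_const:
 fixes f :: "complex fps"
 assumes "fps_deriv f = 0"
 shows "f = fps_const (f $ 0)"
 using assms by (simp add: fps_deriv_eq_0_iff)

lemma elliptic_constants:
 assumes "0 < norm P" "norm P < norm \<zeta>" "norm \<zeta> < 1"
 shows "(dn_series P \<zeta>)\<^sup>2 - (sn_series P \<zeta>)\<^sup>2 = fps_const ((sech_sum P)\<^sup>2)"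
  and "(dn_series P \<zeta>)\<^sup>2 - (cn_series P \<zeta>)\<^sup>2 = fps_const ((sech_sum (- P))\<^sup>2)"
proof -
 have "fps_deriv ((dn_series P \<zeta>)\<^sup>2 - (sn_series P \<zeta>)\<^sup>2) = 0" "fps_deriv ((dn_series P \<zeta>)\<^sup>2 - (cn_series P \<zeta>)\<^sup>2) = 0"
  by (simp_all add: power2_eq_square elliptic_series_deriv[OF assms] algebra_simps)
 from this[THEN fps_deriv_eq_0_imp_const] elliptic_constants_0[OF assms]
 show "(dn_series P \<zeta>)\<^sup>2 - (sn_series P \<zeta>)\<^sup>2 = fps_const ((sech_sum P)\<^sup>2)"
  and "(dn_series P \<zeta>)\<^sup>2 - (cn_series P \<zeta>)\<^sup>2 = fps_const ((sech_sum (- P))\<^sup>2)"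
  by (simp_all add: power2_eq_square)
qed

text \<open>If (y')^2 = (y^2 - a)(y^2 - b), then (y^n)'' = n(n+1) y^(n+2) - n^2 (a + b) y^n + n(n-1)
  a b y^(n-2). Iterating this gives the derivative of order 2j of y^n at 0, up to the factor y(0)^(n
  mod 2), with \<open>h\<close>, \<open>s\<close>, \<open>p\<close> in the roles of y(0)^2, a + b
  and a b. The recursion lives over any commutative ring because it is also run on polynomials. For
  n < 2 the truncated index n - 2 is multiplied by 0.\<close>

primrec even_deriv :: "'a::comm_ring_1 => 'a => 'a => nat => nat => 'a" where
 "even_deriv h s p 0 = (%n. h ^ (n div 2))"
| "even_deriv h s p (Suc j) = (%n. of_nat (n * (n + 1)) * even_deriv h s p j (n + 2)
   - of_nat (n * n) * s * even_deriv h s p j n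
   + of_nat (n * (n - 1)) * p * even_deriv h s p j (n - 2))"

lemma fps_second_deriv_nth:
 fixes f :: "complex fps"
 shows "fact (2 * Suc j) * f $ (2 * Suc j) = fact (2 * j) * fps_deriv (fps_deriv f) $ (2 * j)"
 by (simp add: fps_deriv_nth algebra_simps)

lemma fps_deriv_power_Suc:
 "fps_deriv (y ^ Suc m :: complex fps) = of_nat (Suc m) * (y ^ m * fps_deriv y)"
 by (induction m) (simp_all add: algebra_simps)

lemma even_deriv_power:
 fixes y :: "complex fps"
 assumes y1: "(fps_deriv y)\<^sup>2 = (y\<^sup>2 - fps_const a) * (y\<^sup>2 - fps_const b)"
  and y2: "fps_deriv (fps_deriv y) = y * (2 * y\<^sup>2 - fps_const (a + b))"
 shows "fact (2 * j) * (y ^ n) $ (2 * j)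
     = (y $ 0) ^ (n mod 2) * even_deriv ((y $ 0)\<^sup>2) (a + b) (a * b) j n"
proof (induction j arbitrary: n)
 case 0
 have "(y $ 0) ^ n = (y $ 0) ^ (n mod 2) * ((y $ 0)\<^sup>2) ^ (n div 2)"
  by (simp flip: power_mult power_add)
 thus ?case by (simp add: fps_power_zeroth)
next
 case (Suc j)
 have yy: "fps_deriv (fps_deriv (y ^ n)) = of_nat (n * (n + 1)) * y ^ (n + 2)
   - of_nat (n * n) * fps_const (a + b) * y ^ n + of_nat (n * (n - 1)) * fps_const (a * b) * y ^ (n - 2)"
 proof (cases "n >= 2")
  case True
  then obtain m where n: "n = m + 2" by (metis add.commute le_Suc_ex)
  have "fps_deriv (fps_deriv (y ^ n)) = of_nat n * (of_nat (n - 1) * y ^ m * (fps_deriv y)\<^sup>2 + y ^ (m + 1) * fps_deriv (fps_deriv y))"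
  proof -
   have e: "y ^ n = y ^ Suc (Suc m)" by (simp add: n)
   have D: "fps_deriv (fps_deriv (y ^ n)) = of_nat n * (of_nat (n - 1) * y ^ m * fps_deriv y * fps_deriv y + y ^ Suc m * fps_deriv (fps_deriv y))"
    unfolding e fps_deriv_power_Suc by (simp add: fps_deriv_power_Suc n algebra_simps del: power_Suc)
   show ?thesis unfolding D by (simp add: power2_eq_square mult.assoc)
  qed
  also have "... = of_nat (n * (n + 1)) * y ^ (n + 2)
   - of_nat (n * n) * fps_const (a + b) * y ^ n + of_nat (n * (n - 1)) * fps_const (a * b) * y ^ (n - 2)"
   unfolding y1 y2 by (simp add: n power2_eq_square power_add algebra_simps flip: fps_const_add fps_const_mult)
  finally show ?thesis .
 next
  case False
  hence "n = 0 \<or> n = 1" by auto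
  thus ?thesis
  proof
   assume "n = 1"
   thus ?thesis by (simp add: y2 power2_eq_square power3_eq_cube algebra_simps numeral_3_eq_3)
  qed simp
 qed
 have yy': "fps_deriv (fps_deriv (y ^ n)) = fps_const (of_nat (n * (n + 1))) * y ^ (n + 2)
   - fps_const (of_nat (n * n) * (a + b)) * y ^ n + fps_const (of_nat (n * (n - 1)) * (a * b)) * y ^ (n - 2)"
  unfolding yy by (simp only: fps_const_mult[symmetric] fps_of_nat)
 have m1: "(n + 2) mod 2 = n mod 2" by simp
 \<comment> \<open>For n = 1 the truncated n - 2 has the wrong parity, but its coefficient
   vanishes.\<close>
 have m2: "of_nat (n * (n - 1)) * (c ^ ((n - 2) mod 2)) = of_nat (n * (n - 1)) * (c ^ (n mod 2))" for c :: complex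
 proof (cases "n >= 2")
  case True
  thus ?thesis by (simp add: le_mod_geq)
 next
  case False
  hence "n = 0 \<or> n = 1" by auto
  thus ?thesis by auto
 qed
 have "fact (2 * Suc j) * (y ^ n) $ (2 * Suc j) = fact (2 * j) * fps_deriv (fps_deriv (y ^ n)) $ (2 * j)"
  by (rule fps_second_deriv_nth)
 also have "... = of_nat (n * (n + 1)) * (fact (2 * j) * (y ^ (n + 2)) $ (2 * j))
   - of_nat (n * n) * (a + b) * (fact (2 * j) * (y ^ n) $ (2 * j))
   + of_nat (n * (n - 1)) * (a * b) * (fact (2 * j) * (y ^ (n - 2)) $ (2 * j))"
  unfolding yy' fps_add_nth fps_sub_nth fps_mult_left_const_nth by (simp add: algebra_simps del: of_nat_mult of_nat_add)
 also have "... = (y $ 0) ^ (n mod 2) * even_deriv ((y $ 0)\<^sup>2) (a + b) (a * b) (Suc j) n"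
 proof -
  have t: "K * q * (u * e) = v * (K * q * e)" if "K * u = K * v" for K q u v e :: complex
  proof -
   have "K * q * (u * e) = (K * u) * (q * e)" by (simp only: mult_ac)
   also have "... = v * (K * q * e)" unfolding that by (simp only: mult_ac)
   finally show ?thesis .
  qed
  show ?thesis
   unfolding Suc.IH m1 t[OF m2] by (simp add: algebra_simps del: of_nat_mult of_nat_add)
 qed
 finally show ?case .
qed

lemma elliptic_moment_dn:
 assumes "0 < norm P" "norm P < norm \<zeta>" "norm \<zeta> < 1"
 defines "a \<equiv> (sech_sum P)\<^sup>2" and "b \<equiv> (sech_sum (- P))\<^sup>2"
 shows "fact (2 * j) * ((dn_series P \<zeta>) ^ n) $ (2 * j)
  = (dn_series P \<zeta> $ 0) ^ (n mod 2) * even_deriv ((dn_series P \<zeta> $ 0)\<^sup>2) (a + b) (a * b) j n"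
proof (rule even_deriv_power)
 note d = elliptic_series_deriv[OF assms(1-3)]
 have s: "(sn_series P \<zeta>)\<^sup>2 = (dn_series P \<zeta>)\<^sup>2 - fps_const a" and c: "(cn_series P \<zeta>)\<^sup>2 = (dn_series P \<zeta>)\<^sup>2 - fps_const b"
  using elliptic_constants[OF assms(1-3)] by (simp_all add: a_def b_def algebra_simps)
 show "(fps_deriv (dn_series P \<zeta>))\<^sup>2 = ((dn_series P \<zeta>)\<^sup>2 - fps_const a) * ((dn_series P \<zeta>)\<^sup>2 - fps_const b)"
  by (simp only: d power_mult_distrib s c)
 have "fps_deriv (fps_deriv (dn_series P \<zeta>)) = dn_series P \<zeta> * ((cn_series P \<zeta>)\<^sup>2 + (sn_series P \<zeta>)\<^sup>2)"
  by (simp add: d power2_eq_square algebra_simps)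
 thus "fps_deriv (fps_deriv (dn_series P \<zeta>)) = dn_series P \<zeta> * (2 * (dn_series P \<zeta>)\<^sup>2 - fps_const (a + b))"
  by (simp add: s c algebra_simps flip: fps_const_add)
qed

text \<open>From dn^2 = sn^2 + a and cn^2 = sn^2 + a - b, the equation for sn is that of
  \<open>even_deriv_power\<close> with the parameters -a and b - a. Their sum is b - 2a and their
  product a (a - b).\<close>

lemma elliptic_moment_sn:
 assumes "0 < norm P" "norm P < norm \<zeta>" "norm \<zeta> < 1"
 defines "a \<equiv> (sech_sum P)\<^sup>2" and "b \<equiv> (sech_sum (- P))\<^sup>2"
 shows "fact (2 * j) * ((sn_series P \<zeta>) ^ n) $ (2 * j)
  = (sn_series P \<zeta> $ 0) ^ (n mod 2) * even_deriv ((sn_series P \<zeta> $ 0)\<^sup>2) (b - 2 * a) (a * (a - b)) j n"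
proof -
 note d = elliptic_series_deriv[OF assms(1-3)]
 define A B where "A = fps_const a" and "B = fps_const b"
 have n: "fps_const (- a) = - A" "fps_const (b - a) = B - A" "fps_const (b - 2 * a) = B - 2 * A"
  by (simp_all add: A_def B_def numeral_fps_const)
 have AB: "(dn_series P \<zeta>)\<^sup>2 - (sn_series P \<zeta>)\<^sup>2 = A" "(dn_series P \<zeta>)\<^sup>2 - (cn_series P \<zeta>)\<^sup>2 = B"
  using elliptic_constants[OF assms(1-3)] by (simp_all add: A_def B_def a_def b_def)
 have s: "(dn_series P \<zeta>)\<^sup>2 = (sn_series P \<zeta>)\<^sup>2 - fps_const (- a)"
  using AB(1) unfolding n by (simp add: algebra_simps)
 have c: "(cn_series P \<zeta>)\<^sup>2 = (sn_series P \<zeta>)\<^sup>2 - fps_const (b - a)"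
  using AB unfolding n by (simp add: algebra_simps)
 have e: "- a + (b - a) = b - 2 * a" "- a * (b - a) = a * (a - b)" by (simp_all add: algebra_simps)
 have 1: "(fps_deriv (sn_series P \<zeta>))\<^sup>2 = ((sn_series P \<zeta>)\<^sup>2 - fps_const (- a)) * ((sn_series P \<zeta>)\<^sup>2 - fps_const (b - a))"
  by (simp only: d power_mult_distrib s c)
 have "fps_deriv (fps_deriv (sn_series P \<zeta>)) = sn_series P \<zeta> * ((cn_series P \<zeta>)\<^sup>2 + (dn_series P \<zeta>)\<^sup>2)"
  by (simp add: d power2_eq_square algebra_simps)
 hence 2: "fps_deriv (fps_deriv (sn_series P \<zeta>)) = sn_series P \<zeta> * (2 * (sn_series P \<zeta>)\<^sup>2 - fps_const (- a + (b - a)))"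
  unfolding s c e n by (simp add: algebra_simps)
 show ?thesis using even_deriv_power[OF 1 2, of j n] unfolding e .
qed

lemma moment_dn:
 "fact k * dn_series P \<zeta> $ k = (\<Sum>\<^sub>\<infinity>N. ell_kernel (-1) 0 P \<zeta> N * of_int N ^ k)"
 by (simp add: dn_series_def moment_series_def)

lemma moment_sn:
 "fact k * sn_series P \<zeta> $ k = (\<Sum>\<^sub>\<infinity>N. ell_kernel 1 1 P \<zeta> N * of_int N ^ k)"
 by (simp add: sn_series_def moment_series_def)

text \<open>The convolution square of the dn kernel at N is N times the kernel with \<sigma> = 1 and
  p = 0. This is available for N \<noteq> 0 only; the term N = 0 disappears because k is
  positive.\<close>

lemma moment_dn_square:
 assumes "0 < norm P" "norm P < norm \<zeta>" "norm \<zeta> < 1" "k > 0"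
 shows "fact k * (dn_series P \<zeta>)\<^sup>2 $ k = (\<Sum>\<^sub>\<infinity>N. ell_kernel 1 0 P \<zeta> N * of_int N ^ Suc k)"
proof -
 have P1: "norm P < 1" and z: "\<zeta> ~= 0" using assms by auto
 define e where "e = (%n. \<Sum>\<^sub>\<infinity>a. ell_kernel (-1) 0 P \<zeta> a * ell_kernel (-1) 0 P \<zeta> (n - a))"
 have "(dn_series P \<zeta>)\<^sup>2 = moment_series e"
  unfolding dn_series_def power2_eq_square e_def
  by (intro moment_series_mult geometric_decay_ell_kernel assms) auto
 hence "fact k * (dn_series P \<zeta>)\<^sup>2 $ k = (\<Sum>\<^sub>\<infinity>N. e N * of_int N ^ k)"
  by (simp add: moment_series_def)
 also have "... = (\<Sum>\<^sub>\<infinity>N. ell_kernel 1 0 P \<zeta> N * of_int N ^ Suc k)"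
 proof (rule infsum_cong)
  fix N :: int
  show "e N * of_int N ^ k = ell_kernel 1 0 P \<zeta> N * of_int N ^ Suc k"
   using ell_kernel_convolution[OF assms(1) P1 z, of "-1" "-1" 0 0 N] \<open>k > 0\<close>
   by (cases "N = 0") (auto simp: e_def)
 qed
 finally show ?thesis .
qed

text \<open>sn^2 and dn^2 differ by a constant, which does not affect moments of positive
  order.\<close>

lemma moment_sn_square:
 assumes "0 < norm P" "norm P < norm \<zeta>" "norm \<zeta> < 1" "k > 0"
 shows "fact k * (sn_series P \<zeta>)\<^sup>2 $ k = (\<Sum>\<^sub>\<infinity>N. ell_kernel 1 0 P \<zeta> N * of_int N ^ Suc k)"
proof -
 have "(sn_series P \<zeta>)\<^sup>2 = (dn_series P \<zeta>)\<^sup>2 - fps_const ((sech_sum P)\<^sup>2)"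
  using elliptic_constants(1)[OF assms(1-3)] by (simp add: algebra_simps)
 hence "(sn_series P \<zeta>)\<^sup>2 $ k = (dn_series P \<zeta>)\<^sup>2 $ k" using \<open>k > 0\<close> by simp
 thus ?thesis using moment_dn_square[OF assms] by simp
qed

section \<open>Abel limits of moments on the unit circle\<close>

lemma infsum_int_eq_suminf:
 fixes f :: "int => complex"
 assumes "f abs_summable_on UNIV"
 shows "(%n. f (int n) + (if n = 0 then 0 else f (- int n))) sums infsum f UNIV"
proof -
 have s: "f summable_on UNIV" using assms by (rule abs_summable_summable)
 have 1: "f summable_on range int" "f summable_on range (%n. - int (Suc n))"
  using s by (rule summable_on_subset_banach; simp)+
 have a: "((%n. f (int n)) has_sum infsum f (range int)) UNIV"
  using has_sum_infsum[OF 1(1)] by (subst (asm) has_sum_reindex) (auto simp: o_def)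
 have b: "((%n. f (- int (Suc n))) has_sum infsum f (range (%n. - int (Suc n)))) UNIV"
  using has_sum_infsum[OF 1(2)] by (subst (asm) has_sum_reindex) (auto simp: o_def inj_on_def)
 have U: "(UNIV :: int set) = range int \<union> range (%n. - int (Suc n))"
 proof (intro equalityI subsetI)
  fix N :: int
  show "N \<in> range int \<union> range (%n. - int (Suc n))" by (cases N rule: int_cases) blast+
 qed auto
 have i: "infsum f UNIV = infsum f (range int) + infsum f (range (%n. - int (Suc n)))"
  by (subst U, rule infsum_Un_disjoint[OF 1]) auto
 have "(%n. if n = 0 then 0 else f (- int n)) sums infsum f (range (%n. - int (Suc n)))"
  using has_sum_imp_sums[OF b] sums_Suc_iff[of "%n. if n = 0 then 0 else f (- int n)"] by (simp del: of_nat_Suc)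
 from sums_add[OF has_sum_imp_sums[OF a] this] show ?thesis unfolding i .
qed

text \<open>Folding the terms N and -N together reduces the claim to Tannery's theorem for ordinary
  series, with the bound doubled.\<close>

lemma tendsto_infsum_int:
 fixes f :: "'a => int => complex"
 assumes lim: "!!N. ((%x. f x N) \<longlongrightarrow> g N) F"
  and bd: "eventually (%x. \<forall>N. norm (f x N) <= M (nat \<bar>N\<bar>)) F"
  and M: "summable M" and F: "F ~= bot"
 shows "((%x. infsum (f x) UNIV) \<longlongrightarrow> infsum g UNIV) F"
proof -
 have s: "h abs_summable_on UNIV" if "\<forall>N. norm (h N) <= M (nat \<bar>N\<bar>)" for h :: "int => complex"
 proof (rule abs_summable_on_int)
  have "norm (h (int n)) <= M n" "norm (h (- int n)) <= M n" for n
   using that[rule_format, of "int n"] that[rule_format, of "- int n"] by simp_all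
  thus "summable (%n. norm (h (int n)))" "summable (%n. norm (h (- int n)))"
   by (auto intro!: summable_comparison_test[OF _ M])
 qed
 have gM: "norm (g N) <= M (nat \<bar>N\<bar>)" for N
  using tendsto_norm[OF lim[of N]] by (rule tendsto_upperbound) (use bd F in \<open>auto elim: eventually_mono\<close>)
 have M0: "0 <= M n" for n using order.trans[OF norm_ge_zero gM[of "int n"]] by simp
 define a where "a k x = f x (int k) + (if k = 0 then 0 else f x (- int k))" for k x
 define b where "b k = g (int k) + (if k = 0 then 0 else g (- int k))" for k
 have "((%x. suminf (%k. a k x)) \<longlongrightarrow> suminf b) F"
 proof (rule tannerys_theorem[THEN conjunct2, THEN conjunct2])
  show "((%x. a k x) \<longlongrightarrow> b k) F" for k unfolding a_def b_def by (cases "k = 0") (auto intro!: tendsto_intros lim)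
  have "eventually (%x. \<forall>k. norm (a k x) <= 2 * M k) F"
   using bd
  proof eventually_elim
   case (elim x)
   show ?case
   proof
    fix k
    have "norm (a k x) <= norm (f x (int k)) + norm (f x (- int k))"
     unfolding a_def by (cases "k = 0") (auto intro: norm_triangle_ineq)
    also have "... <= M k + M k"
     using elim[rule_format, of "int k"] elim[rule_format, of "- int k"] by simp
    finally show "norm (a k x) <= 2 * M k" by simp
   qed
  qed
  hence "eventually (%(k, x). True & (\<forall>k. norm (a k x) <= 2 * M k)) (at_top \<times>\<^sub>F F)"
   using eventually_prodI[of "%_. True" at_top] by (simp add: case_prod_unfold)
  thus "eventually (%(k, x). norm (a k x) <= 2 * M k) (at_top \<times>\<^sub>F F)"
   by (rule eventually_mono) auto
  show "summable (%k. 2 * M k)" using M by (rule summable_mult)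
 qed (rule F)
 moreover have "suminf b = infsum g UNIV"
  unfolding b_def by (rule sums_unique[symmetric], rule infsum_int_eq_suminf, rule s) (use gM in auto)
 moreover have "eventually (%x. suminf (%k. a k x) = infsum (f x) UNIV) F"
  using bd
 proof eventually_elim
  case (elim x)
  show ?case unfolding a_def by (rule sums_unique[symmetric], rule infsum_int_eq_suminf, rule s) (use elim in auto)
 qed
 ultimately show ?thesis using tendsto_cong by fastforce
qed

text \<open>Since \<open>D0 $ 0\<close> is non-zero, the coefficients of a quotient obey a recursion
  that divides by the constant term only, and limits pass through it one coefficient at a
  time.\<close>

lemma tendsto_fps_quotient:
 fixes C D N :: "'a => complex fps" and C0 D0 N0 :: "complex fps"
 assumes eq: "eventually (%x. D x * C x = N x) F" and eq0: "D0 * C0 = N0"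
  and D: "!!k. ((%x. D x $ k) \<longlongrightarrow> D0 $ k) F" and N: "!!k. ((%x. N x $ k) \<longlongrightarrow> N0 $ k) F"
  and nz: "D0 $ 0 ~= 0"
 shows "((%x. C x $ k) \<longlongrightarrow> C0 $ k) F"
proof (induction k rule: less_induct)
 case (less k)
 have rec: "G $ k = (R $ k - (\<Sum>i<k. G $ i * E $ (k - i))) / E $ 0" if "E * G = R" "E $ 0 ~= 0" for E G R :: "complex fps"
 proof -
  have "R $ k = (G * E) $ k" using that by (simp add: mult.commute)
  also have "... = (\<Sum>i\<le>k. G $ i * E $ (k - i))" by (simp add: fps_mult_nth atLeast0AtMost)
  also have "... = (\<Sum>i<k. G $ i * E $ (k - i)) + G $ k * E $ 0"
   by (simp add: lessThan_Suc_atMost[symmetric])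
  finally show ?thesis using that(2) by (simp add: field_simps)
 qed
 have nzev: "eventually (%x. D x $ 0 ~= 0) F" using tendsto_imp_eventually_ne[OF D nz] .
 have "((%x. (N x $ k - (\<Sum>i<k. C x $ i * D x $ (k - i))) / D x $ 0) \<longlongrightarrow>
     (N0 $ k - (\<Sum>i<k. C0 $ i * D0 $ (k - i))) / D0 $ 0) F"
  by (intro tendsto_intros D N less.IH nz) auto
 moreover have "eventually (%x. (N x $ k - (\<Sum>i<k. C x $ i * D x $ (k - i))) / D x $ 0 = C x $ k) F"
  using eq nzev by eventually_elim (use rec in metis)
 ultimately show ?case unfolding rec[OF eq0 nz] using tendsto_cong by fastforce
qed

text \<open>The part of the kernel that stems from 1/2 + sgn(N)/2 in the expansion of 1 / (1 -
  \<sigma> P^N). It is the part that no longer decays once |\<zeta>| = 1.\<close>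

definition half_geometric :: "int => complex => int => complex" where
 "half_geometric p \<zeta> N = (if N mod 2 = p then \<zeta> powi N * (1 + of_int (sgn N)) else 0)"

text \<open>Numerator in the closed form of the geometric series of
  \<open>half_geometric p \<zeta> N\<close> exp(N t); the denominator is 1 - \<zeta>^2 exp(2
  t).\<close>

definition half_geometric_numerator :: "int => complex => complex fps" where
 "half_geometric_numerator p \<zeta> =
   (if p = 1 then fps_const (2 * \<zeta>) * fps_exp 1 else 1 + fps_const (\<zeta>\<^sup>2) * fps_exp 2)"

lemma geometric_decay_single: "geometric_decay (%N. if N = m then z else 0)"
proof -
 have "\<forall>N. norm (if N = m then z else 0) <= norm z * 2 ^ nat \<bar>m\<bar> * (1/2) ^ nat \<bar>N\<bar>"
  by (auto simp: power_divide)
 moreover have "(0::real) < 1/2" "(1/2::real) < 1" by auto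
 ultimately show ?thesis unfolding geometric_decay_def by blast
qed

lemma geometric_decay_add:
 assumes "geometric_decay c" "geometric_decay d"
 shows "geometric_decay (%N. c N + d N)"
proof -
 obtain C r where r: "0 < r" "r < 1" "!!N. norm (c N) <= C * r ^ nat \<bar>N\<bar>"
  using assms(1) unfolding geometric_decay_def by blast
 obtain D s where s: "0 < s" "s < 1" "!!N. norm (d N) <= D * s ^ nat \<bar>N\<bar>"
  using assms(2) unfolding geometric_decay_def by blast
 have C: "C >= 0" using r(3)[of 0] norm_ge_zero[of "c 0"] by (simp; linarith)
 have D: "D >= 0" using s(3)[of 0] norm_ge_zero[of "d 0"] by (simp; linarith)
 have "norm (c N + d N) <= (C + D) * max r s ^ nat \<bar>N\<bar>" for N
 proof -
  have "norm (c N + d N) <= C * r ^ nat \<bar>N\<bar> + D * s ^ nat \<bar>N\<bar>"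
   using norm_triangle_ineq[of "c N" "d N"] r(3)[of N] s(3)[of N] by linarith
  also have "... <= C * max r s ^ nat \<bar>N\<bar> + D * max r s ^ nat \<bar>N\<bar>"
   using r s C D by (intro add_mono mult_left_mono power_mono) auto
  finally show ?thesis by (simp add: algebra_simps)
 qed
 moreover have "0 < max r s" "max r s < 1" using r s by auto
 ultimately show ?thesis unfolding geometric_decay_def by blast
qed

lemma infsum_single:
 fixes f :: "int => complex"
 assumes "!!N. N ~= m ==> f N = 0"
 shows "infsum f UNIV = f m"
proof -
 have "infsum f UNIV = infsum f {m}" by (rule infsum_cong_neutral) (use assms in auto)
 thus ?thesis by simp
qed

lemma moment_series_single:
 "moment_series (%N. if N = m then z else 0) = fps_const z * fps_exp (of_int m)"
 by (rule fps_ext) (simp add: moment_series_def infsum_single[of m])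

lemma moment_series_add:
 assumes "geometric_decay c" "geometric_decay d"
 shows "moment_series (%N. c N + d N) = moment_series c + moment_series d"
 by (rule fps_ext)
   (simp add: moment_series_def ring_distribs infsum_add geometric_decay_summable assms add_divide_distrib)

lemma geometric_decay_half_geometric:
 assumes "norm \<zeta> < 1"
 shows "geometric_decay (half_geometric p \<zeta>)"
proof (rule geometric_decayI)
 show "norm (half_geometric p \<zeta> (int n)) <= 2 * norm \<zeta> ^ n" for n
  by (auto simp: half_geometric_def norm_mult norm_power sgn_if)
 show "norm (half_geometric p \<zeta> (- int n)) <= 2 * norm \<zeta> ^ n" if "n > 0" for n
  using that by (auto simp: half_geometric_def)
qed (use assms in auto)

text \<open>The sequence satisfies c(N) = \<zeta>^2 c(N - 2) except at N = 0, 1, 2, so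
  multiplication by 1 - \<zeta>^2 exp(2 t) leaves finitely many terms. The resulting equation keeps
  its meaning for |\<zeta>| = 1, where the series diverges.\<close>

lemma half_geometric_equation:
 assumes z: "norm \<zeta> < 1" "\<zeta> ~= 0" and p: "p \<in> {0, 1}"
 shows "(1 - fps_const (\<zeta>\<^sup>2) * fps_exp 2) * moment_series (half_geometric p \<zeta>) = half_geometric_numerator p \<zeta>"
proof -
 let ?c = "half_geometric p \<zeta>"
 let ?s = "%N::int. if N = 2 then \<zeta>\<^sup>2 else 0"
 note g = geometric_decay_half_geometric[OF z(1), of p]
 have "moment_series ?s * moment_series ?c = moment_series (%n. \<zeta>\<^sup>2 * ?c (n - 2))"
  by (rule moment_series_mult[OF geometric_decay_single g]) (subst infsum_single[of 2], auto)
 hence 1: "fps_const (\<zeta>\<^sup>2) * fps_exp 2 * moment_series ?c = moment_series (%n. \<zeta>\<^sup>2 * ?c (n - 2))"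
  by (simp add: moment_series_single)
 have zz: "\<zeta>\<^sup>2 * \<zeta> powi (N - 2) = \<zeta> powi N" for N
  using z(2) by (simp add: power_int_diff)
 have "?c = (%N. \<zeta>\<^sup>2 * ?c (N - 2) + ((if N = 1 then of_int p * (2 * \<zeta>) else 0)
   + ((if N = 0 then 1 - of_int p else 0) + (if N = 2 then (1 - of_int p) * \<zeta>\<^sup>2 else 0))))"
 proof
  fix N :: int
  have m: "(N - 2) mod 2 = N mod 2" by simp
  have r: "\<zeta>\<^sup>2 * (\<zeta> powi (N - 2) * x) = \<zeta> powi N * x" for x using zz[of N] by (simp flip: mult.assoc)
  consider "N < 0" | "N = 0" | "N = 1" | "N = 2" | "N > 2" by linarith
  thus "?c N = \<zeta>\<^sup>2 * ?c (N - 2) + ((if N = 1 then of_int p * (2 * \<zeta>) else 0)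
   + ((if N = 0 then 1 - of_int p else 0) + (if N = 2 then (1 - of_int p) * \<zeta>\<^sup>2 else 0)))"
   using p by cases (auto simp: half_geometric_def m r)
 qed
 hence "moment_series ?c = moment_series (%N. \<zeta>\<^sup>2 * ?c (N - 2) + ((if N = 1 then of_int p * (2 * \<zeta>) else 0)
   + ((if N = 0 then 1 - of_int p else 0) + (if N = 2 then (1 - of_int p) * \<zeta>\<^sup>2 else 0))))"
  by (rule arg_cong)
 also have "... = moment_series (%N. \<zeta>\<^sup>2 * ?c (N - 2)) + half_geometric_numerator p \<zeta>"
 proof -
  obtain C r where r: "0 < r" "r < 1" "!!N. norm (?c N) <= C * r ^ nat \<bar>N\<bar>"
   using g unfolding geometric_decay_def by blast
  have C: "C >= 0" using r(3)[of 0] norm_ge_zero[of "?c 0"] by (simp; linarith)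
  have "geometric_decay (%N. \<zeta>\<^sup>2 * ?c (N - 2))"
   unfolding geometric_decay_def
  proof (intro exI conjI allI)
   fix N :: int
   have "norm (\<zeta>\<^sup>2 * ?c (N - 2)) <= norm (\<zeta>\<^sup>2) * (C * r ^ nat \<bar>N - 2\<bar>)"
    unfolding norm_mult by (intro mult_left_mono r) auto
   moreover have "r ^ nat \<bar>N - 2\<bar> <= r ^ nat \<bar>N\<bar> / r ^ 2"
   proof -
    have "r ^ nat \<bar>N - 2\<bar> = r ^ (nat \<bar>N - 2\<bar> + 2) / r ^ 2" using r by (simp add: power_add power2_eq_square)
    also have "... <= r ^ nat \<bar>N\<bar> / r ^ 2"
     using r by (intro divide_right_mono power_decreasing) auto
    finally show ?thesis .
   qed
   ultimately show "norm (\<zeta>\<^sup>2 * ?c (N - 2)) <= (norm (\<zeta>\<^sup>2) * C / r ^ 2) * r ^ nat \<bar>N\<bar>"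
    using mult_left_mono[of "r ^ nat \<bar>N - 2\<bar>" "r ^ nat \<bar>N\<bar> / r ^ 2" "norm (\<zeta>\<^sup>2) * C"] C
    by (simp add: mult_ac)
  qed (use r in auto)
  moreover have gd: "geometric_decay (%N::int. (if N = 0 then 1 - of_int p else 0) + (if N = 2 then (1 - of_int p) * \<zeta>\<^sup>2 else 0 :: complex))"
   and gd': "geometric_decay (%N::int. (if N = 1 then of_int p * (2 * \<zeta>) else 0) + ((if N = 0 then 1 - of_int p else 0) + (if N = 2 then (1 - of_int p) * \<zeta>\<^sup>2 else 0 :: complex)))"
   by (rule geometric_decay_add[OF geometric_decay_single geometric_decay_single]
        geometric_decay_add[OF geometric_decay_single geometric_decay_add[OF geometric_decay_single geometric_decay_single]])+
  ultimately show ?thesis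
   using p by (auto simp: moment_series_add geometric_decay_single gd gd' moment_series_single half_geometric_numerator_def)
 qed
 finally show ?thesis unfolding 1[symmetric] by (simp add: algebra_simps)
qed

text \<open>The value assigned to the moment of order k on the unit circle. The diverging
  half-geometric part is replaced by a coefficient of \<open>C\<close>, which in all uses solves the
  functional equation of that part; the remaining sum converges because of the decay of
  \<open>sign_remainder\<close>.\<close>

definition boundary_moment :: "complex => int => complex => complex => complex fps => nat => complex" where
 "boundary_moment \<sigma> p P \<zeta> C k = fact k * C $ k
   + (\<Sum>\<^sub>\<infinity>N. 2 * \<zeta> powi N * sign_remainder \<sigma> p P N * of_int N ^ k)"

lemma norm_sign_remainder_le:
 assumes "norm P < 1" "\<sigma> \<in> {1, -1}"
 shows "norm (sign_remainder \<sigma> p P N) <= 1 / (1 - norm P) * norm P ^ nat \<bar>N\<bar>"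
proof (cases "N mod 2 = p & N ~= 0")
 case True
 have "norm (sign_remainder \<sigma> p P N) = norm P ^ nat \<bar>N\<bar> / norm (1 - \<sigma> * P ^ nat \<bar>N\<bar>)"
  using True assms by (auto simp: sign_remainder_def norm_mult norm_divide norm_power sgn_if)
 also have "... <= norm P ^ nat \<bar>N\<bar> / (1 - norm P)"
  using True assms norm_one_minus_sign_power_ge[OF assms, of "nat \<bar>N\<bar>"]
  by (intro divide_left_mono mult_pos_pos) (auto simp del: zero_less_norm_iff)
 finally show ?thesis by simp
qed (use assms in \<open>auto simp: sign_remainder_def\<close>)

lemma norm_powi_le:
 fixes \<zeta> :: complex
 assumes "0 < norm \<zeta>" "norm \<zeta> <= 1"
 shows "norm (\<zeta> powi N) <= (1 / norm \<zeta>) ^ nat \<bar>N\<bar>"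
proof (cases "N >= 0")
 case True
 have "norm \<zeta> ^ nat N <= 1" using assms by (simp add: power_le_one)
 also have "1 <= (1 / norm \<zeta>) ^ nat N" using assms by (simp add: one_le_power)
 finally show ?thesis using True by (simp add: norm_power power_int_def)
next
 case False
 thus ?thesis by (simp add: norm_power norm_inverse power_int_def power_divide divide_inverse)
qed

text \<open>Inside the annulus a moment is the half-geometric moment plus a sum over
  \<open>sign_remainder\<close>. The first converges through its functional equation, which
  determines the limit because \<zeta>^2 \<noteq> 1; the second converges by domination. For
  \<sigma> = 1 and p = 0 the kernel has only a default value at N = 0, and there k > 0 removes that
  term.\<close>

lemma boundary_moment_limit:
 assumes P: "0 < norm P" "norm P < 1" and z: "norm \<zeta> = 1" "\<zeta>\<^sup>2 ~= 1"
  and s: "\<sigma> \<in> {1, -1}" "p \<in> {0, 1}" "k > 0 \<or> (\<sigma> = 1 --> p = 1)"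
  and C: "(1 - fps_const (\<zeta>\<^sup>2) * fps_exp 2) * C = half_geometric_numerator p \<zeta>"
 shows "((%x. \<Sum>\<^sub>\<infinity>N. ell_kernel \<sigma> p P (of_real x * \<zeta>) N * of_int N ^ k)
      \<longlongrightarrow> boundary_moment \<sigma> p P \<zeta> C k) (at_left 1)"
proof -
 \<comment> \<open>Points with modulus between s and 1 are considered. As s > |P|, the tail for
   negative N is at most of size (|P| / s)^|N|, uniformly in x.\<close>
 define s where "s = (1 + norm P) / 2"
 have s: "norm P < s" "s < 1" "0 < s" using P by (auto simp: s_def add_pos_nonneg)
 have ev: "eventually (%x::real. s < x & x < 1) (at_left 1)"
  using eventually_at_left_real[of s 1] s by (auto elim: eventually_mono)
 have lim1: "((%x. of_real x * \<zeta>) \<longlongrightarrow> \<zeta>) (at_left (1::real))"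
  by (rule tendsto_eq_intros refl | simp)+
 have "((%x. moment_series (half_geometric p (of_real x * \<zeta>)) $ k) \<longlongrightarrow> C $ k) (at_left (1::real))"
 proof (rule tendsto_fps_quotient[OF _ C])
  show "\<forall>\<^sub>F x in at_left (1::real). (1 - fps_const ((of_real x * \<zeta>)\<^sup>2) * fps_exp 2)
    * moment_series (half_geometric p (of_real x * \<zeta>)) = half_geometric_numerator p (of_real x * \<zeta>)"
   using ev
  proof eventually_elim
   case (elim x)
   hence "0 < x" using s(3) by linarith
   hence "norm (of_real x * \<zeta>) < 1" "of_real x * \<zeta> ~= 0" using elim z(1) by (auto simp: norm_mult)
   thus ?case using assms(6) by (intro half_geometric_equation)
  qed
  show "((%x. (1 - fps_const ((of_real x * \<zeta>)\<^sup>2) * fps_exp 2) $ k) \<longlongrightarrow> (1 - fps_const (\<zeta>\<^sup>2) * fps_exp 2) $ k) (at_left (1::real))" for k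
   unfolding fps_sub_nth fps_mult_left_const_nth by (intro tendsto_intros lim1)
  show "((%x. half_geometric_numerator p (of_real x * \<zeta>) $ k) \<longlongrightarrow> half_geometric_numerator p \<zeta> $ k) (at_left (1::real))" for k
  proof (cases "p = 1")
   case True
   show ?thesis unfolding half_geometric_numerator_def if_P[OF True] fps_mult_left_const_nth
    by (intro tendsto_intros lim1)
  next
   case False
   show ?thesis unfolding half_geometric_numerator_def if_not_P[OF False] fps_add_nth fps_mult_left_const_nth
    by (intro tendsto_intros lim1)
  qed
  show "(1 - fps_const (\<zeta>\<^sup>2) * fps_exp 2) $ 0 ~= 0" using z by simp
 qed
 hence L1: "((%x. fact k * moment_series (half_geometric p (of_real x * \<zeta>)) $ k) \<longlongrightarrow> fact k * C $ k) (at_left (1::real))"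
  by (intro tendsto_intros)
 define K where "K = 2 * (1 / (1 - norm P))"
 have K: "K >= 0" using P by (simp add: K_def)
 have bound: "norm (2 * (of_real x * \<zeta>) powi N * sign_remainder \<sigma> p P N * of_int N ^ k)
   <= K * (real (nat \<bar>N\<bar>) ^ k * (norm P / s) ^ nat \<bar>N\<bar>)" if x: "s < x" "x < 1" for x N
 proof -
  have "norm ((of_real x * \<zeta>) powi N) <= (1 / norm (of_real x * \<zeta>)) ^ nat \<bar>N\<bar>"
   by (rule norm_powi_le) (use x s z in \<open>auto simp: norm_mult\<close>)
  also have "... <= (1 / s) ^ nat \<bar>N\<bar>"
   using x s z by (intro power_mono) (auto simp: norm_mult field_simps)
  finally have 1: "norm ((of_real x * \<zeta>) powi N) <= (1 / s) ^ nat \<bar>N\<bar>" .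
  have "norm (2 * (of_real x * \<zeta>) powi N * sign_remainder \<sigma> p P N * of_int N ^ k)
    = 2 * norm ((of_real x * \<zeta>) powi N) * norm (sign_remainder \<sigma> p P N) * real (nat \<bar>N\<bar>) ^ k"
   by (simp add: norm_mult norm_power)
  also have "... <= 2 * (1 / s) ^ nat \<bar>N\<bar> * (1 / (1 - norm P) * norm P ^ nat \<bar>N\<bar>) * real (nat \<bar>N\<bar>) ^ k"
   using norm_sign_remainder_le[OF P(2) assms(5), of p N] 1 s
   by (intro mult_right_mono mult_mono) auto
  also have "... = K * (real (nat \<bar>N\<bar>) ^ k * (norm P / s) ^ nat \<bar>N\<bar>)"
   by (simp add: K_def power_divide mult_ac)
  finally show ?thesis .
 qed
 have "((%x. \<Sum>\<^sub>\<infinity>N. 2 * (of_real x * \<zeta>) powi N * sign_remainder \<sigma> p P N * of_int N ^ k)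
   \<longlongrightarrow> (\<Sum>\<^sub>\<infinity>N. 2 * \<zeta> powi N * sign_remainder \<sigma> p P N * of_int N ^ k)) (at_left (1::real))"
 proof (rule tendsto_infsum_int[where M = "%n. K * (real n ^ k * (norm P / s) ^ n)"])
  show "((%x. 2 * (of_real x * \<zeta>) powi N * sign_remainder \<sigma> p P N * of_int N ^ k)
   \<longlongrightarrow> 2 * \<zeta> powi N * sign_remainder \<sigma> p P N * of_int N ^ k) (at_left (1::real))" for N
   by (intro tendsto_intros lim1) (use z in auto)
  show "\<forall>\<^sub>F x in at_left (1::real). \<forall>N. norm (2 * (of_real x * \<zeta>) powi N * sign_remainder \<sigma> p P N * of_int N ^ k)
    <= K * (real (nat \<bar>N\<bar>) ^ k * (norm P / s) ^ nat \<bar>N\<bar>)"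
   using ev by eventually_elim (use bound in blast)
  show "summable (%n. K * (real n ^ k * (norm P / s) ^ n))"
   by (intro summable_mult summable_power_times_geometric) (use s in auto)
 qed simp
 with L1 have "((%x. fact k * moment_series (half_geometric p (of_real x * \<zeta>)) $ k
    + (\<Sum>\<^sub>\<infinity>N. 2 * (of_real x * \<zeta>) powi N * sign_remainder \<sigma> p P N * of_int N ^ k))
   \<longlongrightarrow> boundary_moment \<sigma> p P \<zeta> C k) (at_left (1::real))"
  unfolding boundary_moment_def by (rule tendsto_add)
 moreover have "\<forall>\<^sub>F x in at_left (1::real). fact k * moment_series (half_geometric p (of_real x * \<zeta>)) $ k
    + (\<Sum>\<^sub>\<infinity>N. 2 * (of_real x * \<zeta>) powi N * sign_remainder \<sigma> p P N * of_int N ^ k)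
   = (\<Sum>\<^sub>\<infinity>N. ell_kernel \<sigma> p P (of_real x * \<zeta>) N * of_int N ^ k)"
  using ev
 proof eventually_elim
  case (elim x)
  let ?z = "of_real x * \<zeta>"
  have nz: "norm ?z < 1" using elim s z by (simp add: norm_mult)
  have M: "summable (%n. K * (real n ^ k * (norm P / s) ^ n))"
   by (intro summable_mult summable_power_times_geometric) (use s in auto)
  have "(%N. 2 * ?z powi N * sign_remainder \<sigma> p P N * of_int N ^ k) abs_summable_on UNIV"
  proof (rule abs_summable_on_int)
   have "norm (2 * ?z powi (int n) * sign_remainder \<sigma> p P (int n) * of_int (int n) ^ k) <= K * (real n ^ k * (norm P / s) ^ n)"
    "norm (2 * ?z powi (- int n) * sign_remainder \<sigma> p P (- int n) * of_int (- int n) ^ k) <= K * (real n ^ k * (norm P / s) ^ n)" for n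
    using bound[of x "int n"] bound[of x "- int n"] elim by simp_all
   thus "summable (%n. norm (2 * ?z powi (int n) * sign_remainder \<sigma> p P (int n) * of_int (int n) ^ k))"
    "summable (%n. norm (2 * ?z powi (- int n) * sign_remainder \<sigma> p P (- int n) * of_int (- int n) ^ k))"
    by (auto intro!: summable_comparison_test[OF _ M] simp del: of_int_minus of_int_of_nat_eq)
  qed
  hence s2: "(%N. 2 * ?z powi N * sign_remainder \<sigma> p P N * of_int N ^ k) summable_on UNIV"
   by (rule abs_summable_summable)
  have s1: "(%N. half_geometric p ?z N * of_int N ^ k) summable_on UNIV"
   by (intro geometric_decay_summable geometric_decay_half_geometric nz)
  have "fact k * moment_series (half_geometric p ?z) $ k = (\<Sum>\<^sub>\<infinity>N. half_geometric p ?z N * of_int N ^ k)"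
   by (simp add: moment_series_def)
  hence "fact k * moment_series (half_geometric p ?z) $ k + (\<Sum>\<^sub>\<infinity>N. 2 * ?z powi N * sign_remainder \<sigma> p P N * of_int N ^ k)
    = (\<Sum>\<^sub>\<infinity>N. half_geometric p ?z N * of_int N ^ k + 2 * ?z powi N * sign_remainder \<sigma> p P N * of_int N ^ k)"
   using infsum_add[OF s1 s2] by simp
  also have "... = (\<Sum>\<^sub>\<infinity>N. ell_kernel \<sigma> p P ?z N * of_int N ^ k)"
  proof (rule infsum_cong)
   fix N :: int
   show "half_geometric p ?z N * of_int N ^ k + 2 * ?z powi N * sign_remainder \<sigma> p P N * of_int N ^ k
     = ell_kernel \<sigma> p P ?z N * of_int N ^ k"
   proof (cases "N mod 2 = p")
    case False
    thus ?thesis by (simp add: half_geometric_def ell_kernel_def sign_remainder_def)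
   next
    case True
    show ?thesis
    proof (cases "N ~= 0 \<or> \<sigma> ~= 1")
     case nz: True
     have "ell_kernel \<sigma> p P ?z N = 2 * ?z powi N * (1 / (1 - \<sigma> * P powi N))"
      using True by (simp add: ell_kernel_def)
     also have "... = half_geometric p ?z N + 2 * ?z powi N * sign_remainder \<sigma> p P N"
      unfolding ell_kernel_denominator_split[OF P assms(5) True nz]
      using True by (simp add: half_geometric_def algebra_simps)
     finally show ?thesis by (simp add: algebra_simps)
    next
     case False
     hence "k > 0" "N = 0" using True assms(7) by auto
     thus ?thesis by (simp add: zero_power)
    qed
   qed
  qed
  finally show ?case .
 qed
 ultimately show ?thesis using tendsto_cong by fastforce
qed

lemma tendsto_even_deriv:
 fixes h :: "'a => complex"
 assumes "(h \<longlongrightarrow> h0) F"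
 shows "((%x. even_deriv (h x) s p j n) \<longlongrightarrow> even_deriv h0 s p j n) F"
 by (induction j arbitrary: n) (auto intro!: tendsto_intros assms)

text \<open>Inside the annulus the identity is \<open>elliptic_moment_sn\<close>; both sides have
  limits as the point moves radially to \<zeta>, the right one because \<open>even_deriv\<close> is
  polynomial in its first argument.\<close>

lemma boundary_moment_sn:
 assumes P: "0 < norm P" "norm P < 1" and z: "norm \<zeta> = 1" "\<zeta>\<^sup>2 ~= 1"
  and C: "(1 - fps_const (\<zeta>\<^sup>2) * fps_exp 2) * C = half_geometric_numerator 1 \<zeta>"
 defines "a \<equiv> (sech_sum P)\<^sup>2" and "b \<equiv> (sech_sum (- P))\<^sup>2" and "y \<equiv> boundary_moment 1 1 P \<zeta> C 0"
 shows "boundary_moment 1 1 P \<zeta> C (2 * j) = y * even_deriv (y\<^sup>2) (b - 2 * a) (a * (a - b)) j 1"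
proof -
 have l: "((%x. fact k * sn_series P (of_real x * \<zeta>) $ k) \<longlongrightarrow> boundary_moment 1 1 P \<zeta> C k) (at_left (1::real))" for k
  unfolding moment_sn by (rule boundary_moment_limit[OF P z _ _ _ C]) auto
 have y: "((%x. sn_series P (of_real x * \<zeta>) $ 0) \<longlongrightarrow> y) (at_left (1::real))"
  using l[of 0] by (simp add: y_def)
 have "((%x. sn_series P (of_real x * \<zeta>) $ 0 * even_deriv ((sn_series P (of_real x * \<zeta>) $ 0)\<^sup>2) (b - 2 * a) (a * (a - b)) j 1)
   \<longlongrightarrow> y * even_deriv (y\<^sup>2) (b - 2 * a) (a * (a - b)) j 1) (at_left (1::real))"
  by (intro tendsto_intros tendsto_even_deriv y)
 moreover have "\<forall>\<^sub>F x in at_left (1::real). sn_series P (of_real x * \<zeta>) $ 0 * even_deriv ((sn_series P (of_real x * \<zeta>) $ 0)\<^sup>2) (b - 2 * a) (a * (a - b)) j 1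
   = fact (2 * j) * sn_series P (of_real x * \<zeta>) $ (2 * j)"
  using eventually_at_left_real[OF P(2)]
 proof eventually_elim
  case (elim x)
  thus ?case using elliptic_moment_sn[of P "of_real x * \<zeta>" j 1] P z by (simp add: a_def b_def norm_mult)
 qed
 ultimately have "((%x. fact (2 * j) * sn_series P (of_real x * \<zeta>) $ (2 * j))
   \<longlongrightarrow> y * even_deriv (y\<^sup>2) (b - 2 * a) (a * (a - b)) j 1) (at_left (1::real))"
  using tendsto_cong by fastforce
 with l[of "2 * j"] show ?thesis by (rule tendsto_unique[rotated]) simp
qed

text \<open>The radial limit of the identity for dn^2. Its moment of order 2j is a moment of order
  2j + 1 of the kernel with \<sigma> = 1, p = 0, hence the odd order on the left.\<close>

lemma boundary_moment_dn_square:
 assumes P: "0 < norm P" "norm P < 1" and z: "norm \<zeta> = 1" "\<zeta>\<^sup>2 ~= 1" and j: "j > 0"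
  and C: "(1 - fps_const (\<zeta>\<^sup>2) * fps_exp 2) * C = half_geometric_numerator 0 \<zeta>"
 defines "a \<equiv> (sech_sum P)\<^sup>2" and "b \<equiv> (sech_sum (- P))\<^sup>2" and "y \<equiv> boundary_moment (-1) 0 P \<zeta> C 0"
 shows "boundary_moment 1 0 P \<zeta> C (2 * j + 1) = even_deriv (y\<^sup>2) (a + b) (a * b) j 2"
proof -
 have y: "((%x. dn_series P (of_real x * \<zeta>) $ 0) \<longlongrightarrow> y) (at_left (1::real))"
  using boundary_moment_limit[OF P z, of "-1" 0 0 C] C by (simp add: y_def moment_dn[of 0, simplified])
 have l: "((%x. \<Sum>\<^sub>\<infinity>N. ell_kernel 1 0 P (of_real x * \<zeta>) N * of_int N ^ (2 * j + 1))
    \<longlongrightarrow> boundary_moment 1 0 P \<zeta> C (2 * j + 1)) (at_left (1::real))"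
  by (rule boundary_moment_limit[OF P z _ _ _ C]) auto
 have "((%x. even_deriv ((dn_series P (of_real x * \<zeta>) $ 0)\<^sup>2) (a + b) (a * b) j 2)
   \<longlongrightarrow> even_deriv (y\<^sup>2) (a + b) (a * b) j 2) (at_left (1::real))"
  by (intro tendsto_intros tendsto_even_deriv y)
 moreover have "\<forall>\<^sub>F x in at_left (1::real). even_deriv ((dn_series P (of_real x * \<zeta>) $ 0)\<^sup>2) (a + b) (a * b) j 2
   = (\<Sum>\<^sub>\<infinity>N. ell_kernel 1 0 P (of_real x * \<zeta>) N * of_int N ^ (2 * j + 1))"
  using eventually_at_left_real[OF P(2)]
 proof eventually_elim
  case (elim x)
  thus ?case using elliptic_moment_dn[of P "of_real x * \<zeta>" j 2] moment_dn_square[of P "of_real x * \<zeta>" "2 * j"] P z j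
   by (simp add: a_def b_def norm_mult)
 qed
 ultimately have "((%x. \<Sum>\<^sub>\<infinity>N. ell_kernel 1 0 P (of_real x * \<zeta>) N * of_int N ^ (2 * j + 1))
   \<longlongrightarrow> even_deriv (y\<^sup>2) (a + b) (a * b) j 2) (at_left (1::real))"
  using tendsto_cong by fastforce
 with l show ?thesis by (rule tendsto_unique[rotated]) simp
qed

section \<open>Power series on the unit disc\<close>

lemma fps_conv_radius_ge_1I:
 fixes f :: "complex fps"
 assumes "!!q. norm q < 1 ==> summable (%n. f $ n * q ^ n)"
 shows "fps_conv_radius f >= 1"
 unfolding fps_conv_radius_def
 by (rule conv_radius_geI_ex') (use assms in auto)

lemma sums_eval_fps_disc:
 fixes f :: "complex fps"
 assumes "fps_conv_radius f >= 1" "norm q < 1"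
 shows "(%n. f $ n * q ^ n) sums eval_fps f q"
proof (rule sums_eval_fps)
 have "ereal (norm q) < 1" using assms(2) by simp
 thus "ereal (norm q) < fps_conv_radius f" using assms(1) by (rule less_le_trans)
qed

text \<open>Equality on the punctured disc is enough, as both sums are continuous at 0. The q-series
  identities below are only available for q \<noteq> 0, where negative powers of q make
  sense.\<close>

lemma eval_fps_unique_disc:
 fixes f g :: "complex fps"
 assumes f: "fps_conv_radius f >= 1" and g: "fps_conv_radius g >= 1"
  and eq: "!!q. 0 < norm q ==> norm q < 1 ==> eval_fps f q = eval_fps g q"
 shows "f = g"
proof (rule eval_fps_eqD)
 show "fps_conv_radius f > 0" "fps_conv_radius g > 0"
  using f g by (auto intro: less_le_trans[of 0 "1::ereal"])
 have c: "isCont (eval_fps h) 0" if "fps_conv_radius h >= 1" for h :: "complex fps"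
  using that by (intro continuous_eval_fps) (auto intro: less_le_trans[of 0 "1::ereal"] simp flip: zero_ereal_def)
 have ev: "\<forall>\<^sub>F q in at 0. eval_fps f q = eval_fps g q"
  unfolding eventually_at by (rule exI[of _ 1]) (use eq in auto)
 have "eval_fps f 0 = eval_fps g 0"
 proof (rule tendsto_unique)
  show "(eval_fps f \<longlongrightarrow> eval_fps f 0) (at 0)" using c[OF f] by (simp add: isCont_def)
  have "(eval_fps g \<longlongrightarrow> eval_fps g 0) (at 0)" using c[OF g] by (simp add: isCont_def)
  thus "(eval_fps f \<longlongrightarrow> eval_fps g 0) (at 0)" using ev by (simp add: tendsto_cong)
 qed simp
 thus "\<forall>\<^sub>F q in nhds 0. eval_fps f q = eval_fps g q"
  using ev by (simp add: eventually_at_filter) (auto elim: eventually_mono)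
qed

text \<open>Turns an absolutely convergent family of monomials, indexed by integers or by pairs of
  divisors, into a power series by collecting equal exponents. It serves both theta series and
  Lambert series.\<close>

lemma power_series_of_fibers:
 fixes c :: "'a => complex" and e :: "'a => nat"
 assumes s: "!!q. norm q < 1 ==> (%x. c x * q ^ e x) abs_summable_on A"
  and fin: "!!n. finite {x \<in> A. e x = n}"
 defines "f \<equiv> Abs_fps (%n. \<Sum>x | x \<in> A & e x = n. c x)"
 shows "fps_conv_radius f >= 1"
  and "norm q < 1 ==> eval_fps f q = (\<Sum>\<^sub>\<infinity>x\<in>A. c x * q ^ e x)"
proof -
 have sums: "(%n. f $ n * q ^ n) sums (\<Sum>\<^sub>\<infinity>x\<in>A. c x * q ^ e x)" if q: "norm q < 1" for q
 proof -
  have h: "((%x. c x * q ^ e x) has_sum (\<Sum>\<^sub>\<infinity>x\<in>A. c x * q ^ e x)) A"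
   using abs_summable_summable[OF s[OF q]] by (rule has_sum_infsum)
  have "((%(n, x). c x * q ^ e x) has_sum (\<Sum>\<^sub>\<infinity>x\<in>A. c x * q ^ e x)) (SIGMA n:UNIV. {x \<in> A. e x = n})"
   using h by (subst has_sum_reindex_bij_witness[of _ "%x. (e x, x)" snd A "%x. c x * q ^ e x"]) auto
  hence "((%n. \<Sum>x | x \<in> A & e x = n. c x * q ^ e x) has_sum (\<Sum>\<^sub>\<infinity>x\<in>A. c x * q ^ e x)) UNIV"
   by (rule has_sum_SigmaD) (rule has_sum_finiteI, use fin in \<open>auto intro: sum.cong\<close>)
  also have "(%n. \<Sum>x | x \<in> A & e x = n. c x * q ^ e x) = (%n. f $ n * q ^ n)"
   by (auto simp: f_def sum_distrib_right intro!: sum.cong)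
  finally show ?thesis by (rule has_sum_imp_sums)
 qed
 show r: "fps_conv_radius f >= 1"
  using sums by (intro fps_conv_radius_ge_1I) (auto simp: summable_def)
 show "eval_fps f q = (\<Sum>\<^sub>\<infinity>x\<in>A. c x * q ^ e x)" if "norm q < 1"
  using sums[OF that] sums_eval_fps_disc[OF r that] by (rule sums_unique2[rotated])
qed

definition fps_dilate :: "nat => complex fps => complex fps" where
 "fps_dilate m f = Abs_fps (%n. if m dvd n then f $ (n div m) else 0)"

lemma fps_dilate_eval:
 assumes f: "fps_conv_radius f >= 1" and m: "m > 0"
 shows "fps_conv_radius (fps_dilate m f) >= 1"
  and "norm q < 1 ==> eval_fps (fps_dilate m f) q = eval_fps f (q ^ m)"
proof -
 have s: "(%n. fps_dilate m f $ n * q ^ n) sums eval_fps f (q ^ m)" if q: "norm q < 1" for q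
 proof -
  have "norm (q ^ m) < 1" using q m by (simp add: norm_power power_less_one_iff)
  hence "(%n. f $ n * (q ^ m) ^ n) sums eval_fps f (q ^ m)" by (rule sums_eval_fps_disc[OF f])
  moreover have "f $ n * (q ^ m) ^ n = fps_dilate m f $ (m * n) * q ^ (m * n)" for n
   using m by (simp add: fps_dilate_def power_mult)
  ultimately have "(%n. fps_dilate m f $ (m * n) * q ^ (m * n)) sums eval_fps f (q ^ m)" by simp
  thus ?thesis
   by (subst (asm) sums_mono_reindex[of "%n. m * n"]) (use m in \<open>auto simp: strict_mono_def fps_dilate_def elim!: dvdE\<close>)
 qed
 show r: "fps_conv_radius (fps_dilate m f) >= 1"
  using s by (intro fps_conv_radius_ge_1I) (auto simp: summable_def)
 show "eval_fps (fps_dilate m f) q = eval_fps f (q ^ m)" if "norm q < 1"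
  using s[OF that] sums_eval_fps_disc[OF r that] by (rule sums_unique2[rotated])
qed

definition fps_reflect :: "complex fps => complex fps" where
 "fps_reflect f = Abs_fps (%n. (-1) ^ n * f $ n)"

lemma fps_reflect_eval:
 assumes f: "fps_conv_radius f >= 1"
 shows "fps_conv_radius (fps_reflect f) >= 1"
  and "norm q < 1 ==> eval_fps (fps_reflect f) q = eval_fps f (- q)"
proof -
 have s: "(%n. fps_reflect f $ n * q ^ n) sums eval_fps f (- q)" if q: "norm q < 1" for q
  using sums_eval_fps_disc[OF f, of "- q"] q by (simp add: fps_reflect_def power_minus[of q] mult_ac)
 show r: "fps_conv_radius (fps_reflect f) >= 1"
  using s by (intro fps_conv_radius_ge_1I) (auto simp: summable_def)
 show "eval_fps (fps_reflect f) q = eval_fps f (- q)" if "norm q < 1"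
  using s[OF that] sums_eval_fps_disc[OF r that] by (rule sums_unique2[rotated])
qed

lemma fps_mult_disc:
 fixes f g :: "complex fps"
 assumes f: "fps_conv_radius f >= 1" and g: "fps_conv_radius g >= 1"
 shows "fps_conv_radius (f * g) >= 1"
  and "norm q < 1 ==> eval_fps (f * g) q = eval_fps f q * eval_fps g q"
proof -
 show "fps_conv_radius (f * g) >= 1"
  using fps_conv_radius_mult[of f g] f g by (meson min.bounded_iff order.trans)
 show "eval_fps (f * g) q = eval_fps f q * eval_fps g q" if "norm q < 1"
  using that f g by (intro eval_fps_mult) (auto intro: less_le_trans[of _ "1::ereal"])
qed

lemma fps_add_disc:
 fixes f g :: "complex fps"
 assumes f: "fps_conv_radius f >= 1" and g: "fps_conv_radius g >= 1"
 shows "fps_conv_radius (f + g) >= 1"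
  and "norm q < 1 ==> eval_fps (f + g) q = eval_fps f q + eval_fps g q"
proof -
 show "fps_conv_radius (f + g) >= 1"
  using fps_conv_radius_add[of f g] f g by (meson min.bounded_iff order.trans)
 show "eval_fps (f + g) q = eval_fps f q + eval_fps g q" if "norm q < 1"
  using that f g by (intro eval_fps_add) (auto intro: less_le_trans[of _ "1::ereal"])
qed

text \<open>The doubling relation says that coefficients 2n and n of a series f agree, which settles
  even indices. For odd n = 2m - 1 the coefficient of q^(n+1) in f(q) f(-q) is 2 f_0 f_m - 2 f_1 f_n
  plus products of coefficients with smaller indices. As f_1 \<noteq> 0, it determines f_n.\<close>

lemma doubling_unique:
 fixes A B :: "complex fps"
 assumes rad: "fps_conv_radius A >= 1" "fps_conv_radius B >= 1"
  and A2: "!!q. 0 < norm q ==> norm q < 1 ==> eval_fps A q + eval_fps A (- q) = 2 * eval_fps A (q\<^sup>2)"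
  and B2: "!!q. 0 < norm q ==> norm q < 1 ==> eval_fps B q + eval_fps B (- q) = 2 * eval_fps B (q\<^sup>2)"
  and AB: "A * fps_reflect A = R" "B * fps_reflect B = S"
  and init: "A $ 0 = 1" "B $ 0 = 1" "A $ 1 = B $ 1" "A $ 1 ~= 0"
  and RS: "!!n. n >= 2 ==> (!!m. m < n ==> A $ m = B $ m) ==> R $ (n + 1) = S $ (n + 1)"
 shows "A = B"
proof -
 have dbl: "f $ (2 * n) = f $ n"
  if r: "fps_conv_radius f >= 1" and f: "!!q. 0 < norm q ==> norm q < 1 ==> eval_fps f q + eval_fps f (- q) = 2 * eval_fps f (q\<^sup>2)"
  for f :: "complex fps" and n
 proof -
  note r1 = fps_reflect_eval[OF r] and r2 = fps_dilate_eval[OF r pos2]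
  have "f + fps_reflect f = fps_dilate 2 f + fps_dilate 2 f"
  proof (rule eval_fps_unique_disc)
   show "eval_fps (f + fps_reflect f) q = eval_fps (fps_dilate 2 f + fps_dilate 2 f) q" if "0 < norm q" "norm q < 1" for q
    using f[OF that] fps_add_disc(2)[OF r r1(1) that(2)] fps_add_disc(2)[OF r2(1) r2(1) that(2)] that r1(2) r2(2)
    by simp
  qed (rule fps_add_disc(1)[OF r r1(1)] fps_add_disc(1)[OF r2(1) r2(1)])+
  hence "(f + fps_reflect f) $ (2 * n) = (fps_dilate 2 f + fps_dilate 2 f) $ (2 * n)" by simp
  thus ?thesis by (simp add: fps_reflect_def fps_dilate_def)
 qed
 have "A $ n = B $ n" for n
 proof (induction n rule: less_induct)
  case (less n)
  consider "n = 0" | "n = 1" | "n > 1" "even n" | "n >= 3" "odd n"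
   by (cases "n = 0"; cases "n = 1"; cases "even n") (auto elim!: oddE)
  thus ?case
  proof cases
   case 3
   then obtain m where m: "n = 2 * m" "m < n" by (auto elim!: evenE)
   thus ?thesis using less.IH[of m] dbl[OF rad(1) A2] dbl[OF rad(2) B2] by simp
  next
   case 4
   define m where "m = (n + 1) div 2"
   have m: "n + 1 = 2 * m" "m < n" using 4 by (auto simp: m_def)
   have split: "(f * fps_reflect f) $ (n + 1) = 2 * f $ 0 * f $ m - 2 * f $ 1 * f $ n + (\<Sum>i=2..n-1. f $ i * ((-1) ^ (n + 1 - i) * f $ (n + 1 - i)))"
    if "f $ (2 * m) = f $ m" for f :: "complex fps"
   proof -
    have "{0..n+1} = insert 0 (insert 1 (insert n (insert (n + 1) {2..n-1})))" using 4 by auto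
    hence S: "(\<Sum>i=0..n+1. g i) = g 0 + g 1 + g n + g (n + 1) + (\<Sum>i=2..n-1. g i)" for g :: "nat => complex"
     using 4 by simp
    define h where "h i = f $ i * ((-1) ^ (n + 1 - i) * f $ (n + 1 - i))" for i
    have "(f * fps_reflect f) $ (n + 1) = (\<Sum>i=0..n+1. h i)"
     by (simp only: fps_mult_nth fps_reflect_def h_def fps_nth_Abs_fps)
    also have "... = h 0 + h 1 + h n + h (n + 1) + (\<Sum>i=2..n-1. h i)" by (rule S)
    also have "h 0 = f $ 0 * f $ m" using 4 that by (simp add: h_def m(1)[symmetric] flip: m(1) that)
    also have "h (n + 1) = f $ 0 * f $ m" using that by (simp add: h_def flip: m(1) that)
    also have "h 1 = - (f $ 1 * f $ n)" using 4 by (simp add: h_def)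
    also have "h n = - (f $ 1 * f $ n)" using 4 by (simp add: h_def)
    finally show ?thesis by (simp add: h_def)
   qed
   have "(\<Sum>i=2..n-1. A $ i * ((-1) ^ (n + 1 - i) * A $ (n + 1 - i))) = (\<Sum>i=2..n-1. B $ i * ((-1) ^ (n + 1 - i) * B $ (n + 1 - i)))"
    using less.IH by (intro sum.cong) auto
   moreover have "(A * fps_reflect A) $ (n + 1) = (B * fps_reflect B) $ (n + 1)"
    unfolding AB using RS[of n] less.IH 4 by auto
   ultimately have "A $ 1 * A $ n = A $ 1 * B $ n"
    using split[OF dbl[OF rad(1) A2]] split[OF dbl[OF rad(2) B2]] init less.IH[OF m(2)] by simp
   thus ?thesis using init by simp
  qed (use init in auto)
 qed
 thus ?thesis by (rule fps_ext)
qed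

section \<open>Theta series and sech sums\<close>

definition theta_fps :: "complex fps" where
 "theta_fps = Abs_fps (%n. \<Sum>x::int | x \<in> UNIV & nat (x\<^sup>2) = n. 1)"

definition theta :: "complex => complex" where
 "theta q = (\<Sum>\<^sub>\<infinity>x::int. q ^ nat (x\<^sup>2))"

lemma nat_abs_le_nat_square: "nat \<bar>x\<bar> <= nat (x\<^sup>2)"
 by (simp add: abs_le_square_iff[symmetric] nat_mono power2_eq_square)
   (metis abs_ge_zero abs_mult_self_eq mult_cancel_left1 mult_le_cancel_left1 nat_mono not_less zero_less_abs_iff int_one_le_iff_zero_less)

lemma theta_decay:
 fixes q :: complex
 assumes "norm q < 1"
 shows "geometric_decay (%x. q ^ nat (x\<^sup>2))"
proof (rule geometric_decayI)
 have b: "norm (q ^ nat (x\<^sup>2)) <= norm q ^ nat \<bar>x\<bar>" for x :: int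
  using assms nat_abs_le_nat_square[of x] by (auto simp: norm_power intro!: power_decreasing)
 show "norm (q ^ nat ((int n)\<^sup>2)) <= 1 * norm q ^ n" for n using b[of "int n"] by simp
 show "norm (q ^ nat ((- int n)\<^sup>2)) <= 1 * norm q ^ n" for n using b[of "- int n"] by simp
qed (use assms in auto)

lemma theta_abs_summable:
 fixes q :: complex
 shows "norm q < 1 ==> (%x::int. q ^ nat (x\<^sup>2)) abs_summable_on UNIV"
 using geometric_decay_abs_summable[OF theta_decay, of q 0] by simp

lemma theta_fps_eval:
 shows "fps_conv_radius theta_fps >= 1" and "norm q < 1 ==> eval_fps theta_fps q = theta q"
proof -
 have fin: "finite {x::int. x \<in> UNIV & nat (x\<^sup>2) = n}" for n
 proof (rule finite_subset)
  show "{x::int. x \<in> UNIV & nat (x\<^sup>2) = n} \<subseteq> {- int n..int n}"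
  proof
   fix x :: int assume "x \<in> {x::int. x \<in> UNIV & nat (x\<^sup>2) = n}"
   hence "nat \<bar>x\<bar> <= n" using nat_abs_le_nat_square[of x] by simp
   thus "x \<in> {- int n..int n}" by auto
  qed
 qed simp
 have s: "(%x::int. 1 * q ^ nat (x\<^sup>2)) abs_summable_on UNIV" if "norm q < 1" for q :: complex
  using theta_abs_summable[OF that] by simp
 show "fps_conv_radius theta_fps >= 1"
  unfolding theta_fps_def by (rule power_series_of_fibers(1)[OF s fin])
 show "eval_fps theta_fps q = theta q" if "norm q < 1"
  unfolding theta_fps_def theta_def using power_series_of_fibers(2)[OF s fin that] by simp
qed

text \<open>Odd x cancel, and x = 2y gives q^(4 y^2).\<close>

lemma theta_quadruple:
 assumes "norm q < 1"
 shows "theta q + theta (- q) = 2 * theta (q ^ 4)"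
proof -
 have s: "(%x::int. q ^ nat (x\<^sup>2)) summable_on UNIV" "(%x::int. (- q) ^ nat (x\<^sup>2)) summable_on UNIV"
  using theta_abs_summable[of q] theta_abs_summable[of "- q"] assms abs_summable_summable by auto
 have "theta q + theta (- q) = (\<Sum>\<^sub>\<infinity>x::int. q ^ nat (x\<^sup>2) + (- q) ^ nat (x\<^sup>2))"
  unfolding theta_def by (rule infsum_add[symmetric, OF s])
 also have "... = (\<Sum>\<^sub>\<infinity>x::int. if x mod 2 = 0 then 2 * (q ^ 4) ^ nat ((x div 2)\<^sup>2) else 0)"
 proof (rule infsum_cong)
  fix x :: int
  show "q ^ nat (x\<^sup>2) + (- q) ^ nat (x\<^sup>2) = (if x mod 2 = 0 then 2 * (q ^ 4) ^ nat ((x div 2)\<^sup>2) else 0)"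
  proof (cases "even x")
   case True
   then obtain y where y: "x = 2 * y" by (elim evenE)
   have "nat (x\<^sup>2) = 4 * nat (y\<^sup>2)" by (simp add: y power_mult_distrib nat_mult_distrib)
   thus ?thesis by (simp add: y power_mult)
  next
   case False
   hence "odd (nat (x\<^sup>2))" by (simp add: even_nat_iff)
   thus ?thesis using False by (simp add: odd_iff_mod_2_eq_one)
  qed
 qed
 also have "... = 2 * theta (q ^ 4)"
  unfolding infsum_even[of "%y. 2 * (q ^ 4) ^ nat (y\<^sup>2)"] theta_def by (rule infsum_cmult_right')
 finally show ?thesis .
qed

lemma infsum_product_int:
 fixes f g :: "int => complex"
 assumes f: "f abs_summable_on UNIV" and g: "g abs_summable_on UNIV"
 shows "((%(a,b). f a * g b) has_sum (infsum f UNIV * infsum g UNIV)) UNIV"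
proof -
 have s: "(%(a,b). f a * g b) abs_summable_on UNIV \<times> UNIV"
  by (rule Infinite_Sum.abs_summable_on_Sigma_iff[THEN iffD2])
   (use f g in \<open>auto simp: norm_mult infsum_cmult_right' abs_mult infsum_nonneg intro!: summable_on_cmult_right summable_on_cmult_left\<close>)
 have "infsum (%(a,b). f a * g b) (UNIV \<times> UNIV) = (\<Sum>\<^sub>\<infinity>a. \<Sum>\<^sub>\<infinity>b. f a * g b)"
  using infsum_Sigma_banach[OF abs_summable_summable[OF s]] by simp
 also have "... = infsum f UNIV * infsum g UNIV"
  by (simp add: infsum_cmult_right' infsum_cmult_left')
 finally show ?thesis
  using abs_summable_summable[OF s] by (metis UNIV_Times_UNIV has_sum_infsum)
qed

lemma has_sum_same_parity:
 fixes f :: "int \<times> int => complex"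
 shows "(f has_sum S) {(x, y). even (x + y)} \<longleftrightarrow> ((%(a, b). f (a + b, a - b)) has_sum S) UNIV"
proof (rule has_sum_reindex_bij_witness[of _ "%(a, b). (a + b, a - b)" "%(x, y). ((x + y) div 2, (x - y) div 2)"])
 have e: "(x + y) div 2 + (x - y) div 2 = x" "(x + y) div 2 - (x - y) div 2 = y" if "even (x + y)" for x y :: int
  using that by presburger+
 fix z :: "int \<times> int" assume "z \<in> {(x, y). even (x + y)}"
 then obtain x y where z: "z = (x, y)" "even (x + y)" by auto
 show "(case (case z of (x, y) => ((x + y) div 2, (x - y) div 2)) of (a, b) => (a + b, a - b)) = z"
  unfolding z(1) prod.case e[OF z(2)] by simp
 show "(case (case z of (x, y) => ((x + y) div 2, (x - y) div 2)) of (a, b) => f (a + b, a - b)) = f z"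
  unfolding z(1) prod.case e[OF z(2)] by simp
qed auto

lemma nat_square_sum: "nat ((a + b)\<^sup>2) + nat ((a - b)\<^sup>2) = 2 * nat (a\<^sup>2) + 2 * nat (b\<^sup>2)" for a b :: int
proof -
 have "int (nat ((a + b)\<^sup>2) + nat ((a - b)\<^sup>2)) = int (2 * nat (a\<^sup>2) + 2 * nat (b\<^sup>2))"
 proof -
  have e: "int (nat (z\<^sup>2)) = z\<^sup>2" for z :: int by simp
  show ?thesis
   by (simp only: of_nat_add of_nat_mult e of_nat_numeral) (simp add: power2_eq_square algebra_simps)
 qed
 thus ?thesis by (simp only: of_nat_eq_iff)
qed

lemma minus_power_nat_square: "(- q) ^ nat (x\<^sup>2) = (if even x then q ^ nat (x\<^sup>2) else - (q ^ nat (x\<^sup>2)))" for q :: complex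
 by (simp add: even_nat_iff)

text \<open>Pairs (x, y) with x + y odd cancel. On the others x = a + b, y = a - b gives x^2 + y^2 =
  2 a^2 + 2 b^2.\<close>

lemma theta_square_sum:
 assumes q: "norm q < 1"
 shows "(theta q)\<^sup>2 + (theta (- q))\<^sup>2 = 2 * (theta (q\<^sup>2))\<^sup>2"
proof -
 have q2: "norm (q\<^sup>2) < 1" using q by (simp add: norm_power power_less_one_iff)
 have p: "((%(x, y). p ^ nat (x\<^sup>2) * p ^ nat (y\<^sup>2)) has_sum (theta p)\<^sup>2) UNIV" if "norm p < 1" for p :: complex
  using infsum_product_int[OF theta_abs_summable[OF that] theta_abs_summable[OF that]]
  by (simp add: theta_def power2_eq_square)
 have "((%z. (case z of (x, y) => q ^ nat (x\<^sup>2) * q ^ nat (y\<^sup>2)) + (case z of (x, y) => (- q) ^ nat (x\<^sup>2) * (- q) ^ nat (y\<^sup>2)))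
   has_sum ((theta q)\<^sup>2 + (theta (- q))\<^sup>2)) UNIV"
  by (intro has_sum_add p) (use q in auto)
 hence "((%(x, y). 2 * (q ^ nat (x\<^sup>2) * q ^ nat (y\<^sup>2))) has_sum ((theta q)\<^sup>2 + (theta (- q))\<^sup>2)) {(x, y). even (x + y)}"
  by (subst has_sum_cong_neutral) (auto simp: minus_power_nat_square split: if_splits)
 hence "((%(a, b). 2 * ((q\<^sup>2) ^ nat (a\<^sup>2) * (q\<^sup>2) ^ nat (b\<^sup>2))) has_sum ((theta q)\<^sup>2 + (theta (- q))\<^sup>2)) UNIV"
  unfolding has_sum_same_parity
  by (simp add: power_add[symmetric] nat_square_sum power_mult[symmetric] case_prod_unfold)
 moreover have "((%(a, b). 2 * ((q\<^sup>2) ^ nat (a\<^sup>2) * (q\<^sup>2) ^ nat (b\<^sup>2))) has_sum (2 * (theta (q\<^sup>2))\<^sup>2)) UNIV"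
  using has_sum_cmult_right[OF p[OF q2], of 2] by (simp add: case_prod_unfold)
 ultimately show ?thesis by (rule has_sum_unique)
qed

text \<open>Exchanging x and y changes the sign of the terms with x + y odd, so these cancel. On the
  others x = a + b, y = a - b, and the sign of the second factor depends on the parity of a + b,
  which splits into one sign for a and one for b.\<close>

lemma theta_reflect_product:
 assumes q: "norm q < 1"
 shows "theta q * theta (- q) = (theta (- q\<^sup>2))\<^sup>2"
proof -
 have q2: "norm (- q\<^sup>2) < 1" using q by (simp add: norm_power power_less_one_iff)
 define f where "f = (%(x::int, y::int). q ^ nat (x\<^sup>2) * (- q) ^ nat (y\<^sup>2))"
 have f: "(f has_sum (theta q * theta (- q))) UNIV"
  using infsum_product_int[OF theta_abs_summable[OF q] theta_abs_summable[of "- q"]] q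
  by (simp add: theta_def f_def)
 have sub: "f summable_on A" for A
  using has_sum_imp_summable[OF f] by (rule summable_on_subset_banach) simp
 let ?E = "{(x::int, y). even (x + y)}" and ?O = "{(x::int, y). odd (x + y)}"
 have "infsum f ?O = infsum (%z. - f z) ?O"
  by (rule infsum_reindex_bij_witness[of _ "%(x, y). (y, x)" "%(x, y). (y, x)"])
    (auto simp: f_def minus_power_nat_square split: if_splits)
 hence O: "infsum f ?O = 0" by (simp add: infsum_uminus)
 have "theta q * theta (- q) = infsum f (?E \<union> ?O)"
 proof -
  have "?E \<union> ?O = UNIV" by auto
  thus ?thesis using infsumI[OF f] by (simp only:)
 qed
 also have "... = infsum f ?E" using O by (subst infsum_Un_disjoint) (auto intro: sub)
 finally have "(f has_sum (theta q * theta (- q))) ?E" using sub by simp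
 hence "((%(a, b). f (a + b, a - b)) has_sum (theta q * theta (- q))) UNIV"
  unfolding has_sum_same_parity .
 also have "(%(a, b). f (a + b, a - b)) = (%(a, b). (- q\<^sup>2) ^ nat (a\<^sup>2) * (- q\<^sup>2) ^ nat (b\<^sup>2))"
 proof -
  have "q ^ nat ((a + b)\<^sup>2) * q ^ nat ((a - b)\<^sup>2) = (q\<^sup>2) ^ nat (a\<^sup>2) * (q\<^sup>2) ^ nat (b\<^sup>2)" for a b :: int
   by (simp add: power_add[symmetric] nat_square_sum power_mult[symmetric])
  thus ?thesis by (auto simp: f_def minus_power_nat_square fun_eq_iff)
 qed
 finally have "((%(a, b). (- q\<^sup>2) ^ nat (a\<^sup>2) * (- q\<^sup>2) ^ nat (b\<^sup>2)) has_sum (theta q * theta (- q))) UNIV" .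
 moreover have "((%(a, b). (- q\<^sup>2) ^ nat (a\<^sup>2) * (- q\<^sup>2) ^ nat (b\<^sup>2)) has_sum (theta (- q\<^sup>2))\<^sup>2) UNIV"
  using infsum_product_int[OF theta_abs_summable[OF q2] theta_abs_summable[OF q2]]
  by (simp add: theta_def power2_eq_square)
 ultimately show ?thesis by (rule has_sum_unique)
qed

text \<open>The counterpart of \<open>sech_sum\<close> for the form x^2 + 2 y^2. The terms n and -n
  together give 2 (q^n + q^(3n)) / (1 + q^(4n)), whose expansion carries the character modulo
  8.\<close>

definition sech_sum_fine :: "complex => complex" where
 "sech_sum_fine q = (\<Sum>\<^sub>\<infinity>n::int. 2 * q powi (3 * n) / (1 + q powi (4 * n)))"

text \<open>Even indices make up the dn kernel, odd ones the cn kernel, and replacing \<zeta> by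
  -\<zeta> changes the sign of the odd ones only.\<close>

lemma dn_cn_split:
 assumes "0 < norm P" "norm P < norm \<zeta>" "norm \<zeta> < 1"
 shows "(\<Sum>\<^sub>\<infinity>N::int. 2 * \<zeta> powi N / (1 + P powi N)) = dn_series P \<zeta> $ 0 + cn_series P \<zeta> $ 0"
  and "(\<Sum>\<^sub>\<infinity>N::int. 2 * (- \<zeta>) powi N / (1 + P powi N)) = dn_series P \<zeta> $ 0 - cn_series P \<zeta> $ 0"
  and "(%N::int. 2 * \<zeta> powi N / (1 + P powi N)) summable_on UNIV"
proof -
 have d: "ell_kernel (-1) p P \<zeta> summable_on UNIV" for p
  using geometric_decay_summable[OF geometric_decay_ell_kernel[OF assms], of "-1" p 0] by simp
 have e: "(%N. 2 * \<zeta> powi N / (1 + P powi N)) = (%N. ell_kernel (-1) 0 P \<zeta> N + ell_kernel (-1) 1 P \<zeta> N)"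
  by (auto simp: ell_kernel_def)
 show "(%N::int. 2 * \<zeta> powi N / (1 + P powi N)) summable_on UNIV"
  unfolding e by (intro summable_on_add d)
 show "(\<Sum>\<^sub>\<infinity>N::int. 2 * \<zeta> powi N / (1 + P powi N)) = dn_series P \<zeta> $ 0 + cn_series P \<zeta> $ 0"
  unfolding e dn_series_def cn_series_def moment_series_nth_0 by (rule infsum_add[OF d d])
 have "(\<Sum>\<^sub>\<infinity>N::int. 2 * (- \<zeta>) powi N / (1 + P powi N)) = (\<Sum>\<^sub>\<infinity>N. ell_kernel (-1) 0 P \<zeta> N + - ell_kernel (-1) 1 P \<zeta> N)"
  by (rule infsum_cong) (auto simp: ell_kernel_def power_int_minus_left even_iff_mod_2_eq_zero)
 also have "... = dn_series P \<zeta> $ 0 - cn_series P \<zeta> $ 0"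
  unfolding dn_series_def cn_series_def moment_series_nth_0
  using infsum_add[OF d, of "%N. - ell_kernel (-1) 1 P \<zeta> N" 0] d[of 1] by (simp add: infsum_uminus summable_on_uminus)
 finally show "(\<Sum>\<^sub>\<infinity>N::int. 2 * (- \<zeta>) powi N / (1 + P powi N)) = dn_series P \<zeta> $ 0 - cn_series P \<zeta> $ 0" .
qed

lemma norm_power_between:
 fixes q :: complex
 assumes "0 < norm q" "norm q < 1" "m < n"
 shows "norm (q ^ n) < norm (q ^ m)" "n > 0 ==> norm (q ^ n) < 1" "0 < norm (q ^ n)"
 using assms by (auto simp: norm_power power_strict_decreasing power_less_one_iff)

text \<open>The sums at q and -q are dn + cn and dn - cn for nome q^2 and \<zeta> = q, and dn^2 -
  cn^2 is a known constant. This is the relation that \<open>theta_reflect_product\<close> gives for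
  the square of theta.\<close>

lemma sech_sum_reflect_product:
 fixes q :: complex
 assumes q: "0 < norm q" "norm q < 1"
 shows "sech_sum q * sech_sum (- q) = (sech_sum (- q\<^sup>2))\<^sup>2"
proof -
 have n: "0 < norm (q\<^sup>2)" "norm (q\<^sup>2) < norm q"
  using norm_power_between[OF q, of 1 2] by simp_all
 have e: "q powi (2 * N) = (q\<^sup>2) powi N" "(- q) powi (2 * N) = (q\<^sup>2) powi N" for N
  by (simp_all add: power_int_mult)
 have "sech_sum q = dn_series (q\<^sup>2) q $ 0 + cn_series (q\<^sup>2) q $ 0"
  "sech_sum (- q) = dn_series (q\<^sup>2) q $ 0 - cn_series (q\<^sup>2) q $ 0"
  unfolding sech_sum_def e by (rule dn_cn_split[OF n q(2)])+
 note sd = this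
 show ?thesis
  unfolding sd elliptic_constants_0(2)[OF n q(2), symmetric] by (simp add: power2_eq_square algebra_simps)
qed

text \<open>Again a product (dn + cn)(dn - cn), now for nome q^4 and \<zeta> = q^3.\<close>

lemma sech_sum_fine_reflect_product:
 fixes q :: complex
 assumes q: "0 < norm q" "norm q < 1"
 shows "sech_sum_fine q * sech_sum_fine (- q) = (sech_sum (- (q ^ 4)))\<^sup>2"
proof -
 have n: "0 < norm (q ^ 4)" "norm (q ^ 4) < norm (q ^ 3)" "norm (q ^ 3) < 1"
  using norm_power_between[OF q, of 3 4] norm_power_between[OF q, of 0 3] by simp_all
 have e: "q powi (4 * N) = (q ^ 4) powi N" "(- q) powi (4 * N) = (q ^ 4) powi N"
  "q powi (3 * N) = (q ^ 3) powi N" "(- q) powi (3 * N) = (- (q ^ 3)) powi N" for N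
  by (simp_all add: power_int_mult)
 have "sech_sum_fine q = dn_series (q ^ 4) (q ^ 3) $ 0 + cn_series (q ^ 4) (q ^ 3) $ 0"
  "sech_sum_fine (- q) = dn_series (q ^ 4) (q ^ 3) $ 0 - cn_series (q ^ 4) (q ^ 3) $ 0"
  unfolding sech_sum_fine_def e by (rule dn_cn_split[OF n])+
 note sd = this
 show ?thesis
  unfolding sd elliptic_constants_0(2)[OF n, symmetric] by (simp add: power2_eq_square algebra_simps)
qed

lemma sech_sum_summable:
 fixes q :: complex
 assumes q: "0 < norm q" "norm q < 1"
 shows "(%n::int. 2 * q powi n / (1 + q powi (2 * n))) summable_on UNIV"
proof -
 have n: "0 < norm (q\<^sup>2)" "norm (q\<^sup>2) < norm q"
  using norm_power_between[OF q, of 1 2] by simp_all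
 show ?thesis using dn_cn_split(3)[OF n q(2)] by (simp add: power_int_mult)
qed

lemma sech_sum_fine_summable:
 fixes q :: complex
 assumes q: "0 < norm q" "norm q < 1"
 shows "(%n::int. 2 * q powi (3 * n) / (1 + q powi (4 * n))) summable_on UNIV"
proof -
 have n: "0 < norm (q ^ 4)" "norm (q ^ 4) < norm (q ^ 3)" "norm (q ^ 3) < 1"
  using norm_power_between[OF q, of 3 4] norm_power_between[OF q, of 0 3] by simp_all
 show ?thesis using dn_cn_split(3)[OF n] by (simp add: power_int_mult)
qed

text \<open>Replacing q by -q leaves the denominators alone and changes the sign of the terms with
  odd n, so only even n survive.\<close>

lemma sech_sum_doubling:
 fixes q :: complex
 assumes q: "0 < norm q" "norm q < 1"
 shows "sech_sum q + sech_sum (- q) = 2 * sech_sum (q\<^sup>2)"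
  and "sech_sum_fine q + sech_sum_fine (- q) = 2 * sech_sum_fine (q\<^sup>2)"
proof -
 have "sech_sum q + sech_sum (- q)
   = (\<Sum>\<^sub>\<infinity>n::int. 2 * q powi n / (1 + q powi (2 * n)) + 2 * (- q) powi n / (1 + (- q) powi (2 * n)))"
  unfolding sech_sum_def using q by (intro infsum_add[symmetric] sech_sum_summable) auto
 also have "... = (\<Sum>\<^sub>\<infinity>n::int. if n mod 2 = 0 then 2 * (2 * (q\<^sup>2) powi (n div 2) / (1 + (q\<^sup>2) powi (2 * (n div 2)))) else 0)"
  by (rule infsum_cong) (auto simp: power_int_minus_left power_int_mult elim!: evenE)
 also have "... = 2 * sech_sum (q\<^sup>2)"
  unfolding infsum_even[of "%n. 2 * (2 * (q\<^sup>2) powi n / (1 + (q\<^sup>2) powi (2 * n)))"] sech_sum_def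
  by (rule infsum_cmult_right')
 finally show "sech_sum q + sech_sum (- q) = 2 * sech_sum (q\<^sup>2)" .
 have "sech_sum_fine q + sech_sum_fine (- q)
   = (\<Sum>\<^sub>\<infinity>n::int. 2 * q powi (3 * n) / (1 + q powi (4 * n)) + 2 * (- q) powi (3 * n) / (1 + (- q) powi (4 * n)))"
  unfolding sech_sum_fine_def using q by (intro infsum_add[symmetric] sech_sum_fine_summable) auto
 also have "... = (\<Sum>\<^sub>\<infinity>n::int. if n mod 2 = 0 then 2 * (2 * (q\<^sup>2) powi (3 * (n div 2)) / (1 + (q\<^sup>2) powi (4 * (n div 2)))) else 0)"
  by (rule infsum_cong) (auto simp: power_int_minus_left power_int_mult elim!: evenE)
 also have "... = 2 * sech_sum_fine (q\<^sup>2)"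
  unfolding infsum_even[of "%n. 2 * (2 * (q\<^sup>2) powi (3 * n) / (1 + (q\<^sup>2) powi (4 * n)))"] sech_sum_fine_def
  by (rule infsum_cmult_right')
 finally show "sech_sum_fine q + sech_sum_fine (- q) = 2 * sech_sum_fine (q\<^sup>2)" .
qed

section \<open>Lambert series and the two binary forms\<close>

text \<open>The divisor sums of u(d) v(n/d), written over pairs with product n so that
  \<open>power_series_of_fibers\<close> applies.\<close>

definition lambert_fps :: "(nat => complex) => (nat => complex) => complex fps" where
 "lambert_fps u v = Abs_fps (%n. \<Sum>z | z \<in> {1..} \<times> {1..} & fst z * snd z = n. u (fst z) * v (snd z))"

definition polynomially_bounded :: "(nat => complex) => bool" where
 "polynomially_bounded u \<longleftrightarrow> (\<exists>C k. \<forall>n. norm (u n) <= C * real n ^ k + C)"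

lemma lambert_fps_nth:
 assumes "n > 0"
 shows "lambert_fps u v $ n = (\<Sum>d | d dvd n. u d * v (n div d))"
 unfolding lambert_fps_def fps_nth_Abs_fps
 by (rule sum.reindex_bij_witness[of _ "%d. (d, n div d)" fst])
   (use assms in \<open>auto elim!: dvdE intro: Suc_leI\<close>)

lemma lambert_fps_nth_0: "lambert_fps u v $ 0 = 0"
 unfolding lambert_fps_def by (auto intro!: sum.neutral)

lemma polynomially_bounded_const: "polynomially_bounded (%_. c)"
 unfolding polynomially_bounded_def by (rule exI[of _ "norm c"], rule exI[of _ 1]) auto

lemma polynomially_bounded_power_times:
 assumes "!!n. norm (v n) <= 1"
 shows "polynomially_bounded (%n. v n * of_nat n ^ k)"
 unfolding polynomially_bounded_def
proof (rule exI[of _ 1], rule exI[of _ k], rule allI)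
 fix n
 have "norm (v n * of_nat n ^ k) <= 1 * real n ^ k"
  unfolding norm_mult norm_power norm_of_nat using assms by (intro mult_right_mono) auto
 thus "norm (v n * of_nat n ^ k) <= 1 * real n ^ k + 1" by simp
qed

lemma polynomially_bounded_power: "polynomially_bounded (%n. of_nat n ^ k)"
 using polynomially_bounded_power_times[of "%_. 1" k] by simp

lemma polynomially_bounded_summable:
 assumes "polynomially_bounded u" "0 <= r" "r < 1"
 shows "(%n. norm (u n) * r ^ n) summable_on UNIV"
proof -
 obtain C k where C: "!!n. norm (u n) <= C * real n ^ k + C"
  using assms unfolding polynomially_bounded_def by blast
 have "summable (%n. C * (real n ^ k * r ^ n) + C * (real n ^ 0 * r ^ n))"
  by (intro summable_add summable_mult summable_power_times_geometric assms)
 hence "summable (%n. norm (u n) * r ^ n)"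
  by (rule summable_comparison_test[rotated])
    (use mult_right_mono[OF C zero_le_power[OF assms(2)]] assms in \<open>auto simp: algebra_simps\<close>)
 thus ?thesis using assms by (simp add: summable_on_UNIV_nonneg_real_iff)
qed

lemma nat_mult_ge_half_sum: "d >= 1 ==> m >= 1 ==> d + m <= 2 * (d * m)" for d m :: nat
 by (cases d; cases m) auto

text \<open>With r = sqrt |q| the bound |q|^(d m) = r^(2 d m) \<le> r^(d + m) separates the two
  variables.\<close>

lemma lambert_abs_summable:
 assumes u: "polynomially_bounded u" and v: "polynomially_bounded v" and q: "norm q < 1"
 shows "(%z. u (fst z) * v (snd z) * q ^ (fst z * snd z)) abs_summable_on {1..} \<times> {1..}"
proof -
 define r where "r = sqrt (norm q)"
 have r: "0 <= r" "r < 1" "norm q = r\<^sup>2" using q by (auto simp: r_def)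
 have s: "(%(d, m). (norm (u d) * r ^ d) * (norm (v m) * r ^ m)) abs_summable_on {1..} \<times> {1..}"
  by (rule Infinite_Sum.abs_summable_on_Sigma_iff[THEN iffD2])
   (use polynomially_bounded_summable[OF u r(1,2)] polynomially_bounded_summable[OF v r(1,2)] r in
    \<open>auto simp: norm_mult infsum_cmult_right' abs_mult infsum_nonneg intro!: summable_on_cmult_right summable_on_cmult_left
      elim: summable_on_subset_banach\<close>)
 show ?thesis
 proof (rule Infinite_Sum.abs_summable_on_comparison_test[OF s])
  fix z assume z: "z \<in> {1::nat..} \<times> {1::nat..}"
  obtain d m where dm: "z = (d, m)" by (cases z)
  have "norm q ^ (d * m) = r ^ (2 * (d * m))" by (simp add: r(3) power_mult)
  also have "... <= r ^ (d + m)"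
   using nat_mult_ge_half_sum[of d m] z r by (intro power_decreasing) (auto simp: dm)
  finally have "norm (u d) * norm (v m) * norm q ^ (d * m) <= norm (u d) * norm (v m) * r ^ (d + m)"
   by (intro mult_left_mono) auto
  thus "norm (u (fst z) * v (snd z) * q ^ (fst z * snd z)) <= norm (case z of (d, m) => (norm (u d) * r ^ d) * (norm (v m) * r ^ m))"
   using r by (simp add: dm norm_mult norm_power power_add mult_ac)
 qed
qed

lemma lambert_fps_eval:
 assumes u: "polynomially_bounded u" and v: "polynomially_bounded v"
 shows "fps_conv_radius (lambert_fps u v) >= 1"
  and "norm q < 1 ==> ((%d. u d * (\<Sum>\<^sub>\<infinity>m\<in>{1..}. v m * (q ^ d) ^ m)) has_sum eval_fps (lambert_fps u v) q) {1..}"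
proof -
 have fin: "finite {z \<in> {1..} \<times> {1..}. fst z * snd z = n}" for n :: nat
 proof (rule finite_subset)
  show "{z \<in> {1..} \<times> {1..}. fst z * snd z = n} \<subseteq> {..n} \<times> {..n}" by auto
 qed simp
 show "fps_conv_radius (lambert_fps u v) >= 1"
  unfolding lambert_fps_def
  by (rule power_series_of_fibers(1)[where c = "%z. u (fst z) * v (snd z)" and e = "%z. fst z * snd z", OF lambert_abs_summable[OF u v] fin])
 assume q: "norm q < 1"
 have ev: "eval_fps (lambert_fps u v) q = (\<Sum>\<^sub>\<infinity>z\<in>{1..} \<times> {1..}. u (fst z) * v (snd z) * q ^ (fst z * snd z))"
  unfolding lambert_fps_def
  by (rule power_series_of_fibers(2)[where c = "%z. u (fst z) * v (snd z)" and e = "%z. fst z * snd z", OF lambert_abs_summable[OF u v] fin q])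
 have s: "(%z. u (fst z) * v (snd z) * q ^ (fst z * snd z)) summable_on {1..} \<times> {1..}"
  using lambert_abs_summable[OF u v q] by (rule abs_summable_summable)
 show "((%d. u d * (\<Sum>\<^sub>\<infinity>m\<in>{1..}. v m * (q ^ d) ^ m)) has_sum eval_fps (lambert_fps u v) q) {1..}"
 proof (rule has_sum_SigmaD[where B = "%_. {1..}" and f = "%z. u (fst z) * v (snd z) * q ^ (fst z * snd z)"])
  show "((%z. u (fst z) * v (snd z) * q ^ (fst z * snd z)) has_sum eval_fps (lambert_fps u v) q) ({1..} \<times> {1..})"
   unfolding ev by (rule has_sum_infsum[OF s])
  fix d :: nat assume d: "d \<in> {1..}"
  have "(%m. u d * v m * q ^ (d * m)) summable_on {1..}"
   using summable_on_SigmaD1[of "%d m. u d * v m * q ^ (d * m)" "{1..}" "%_. {1..}" d] s d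
   by (simp add: case_prod_unfold)
  hence "((%m. u d * v m * q ^ (d * m)) has_sum (\<Sum>\<^sub>\<infinity>m\<in>{1..}. u d * v m * q ^ (d * m))) {1..}" by simp
  also have "(\<Sum>\<^sub>\<infinity>m\<in>{1..}. u d * v m * q ^ (d * m)) = u d * (\<Sum>\<^sub>\<infinity>m\<in>{1..}. v m * (q ^ d) ^ m)"
   by (simp add: mult.assoc infsum_cmult_right' power_mult)
  finally show "((%m. u (fst (d, m)) * v (snd (d, m)) * q ^ (fst (d, m) * snd (d, m))) has_sum u d * (\<Sum>\<^sub>\<infinity>m\<in>{1..}. v m * (q ^ d) ^ m)) {1..}"
   by simp
 qed
qed

text \<open>Shifting the index by one period multiplies the sum by x^M and drops its first M
  terms.\<close>

lemma infsum_periodic_geometric: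
 fixes x :: complex
 assumes x: "norm x < 1" and v: "!!n. norm (v n) <= 1" "!!n. v (n + M) = v n" and M: "M > 0"
 shows "(\<Sum>\<^sub>\<infinity>m\<in>{1..}. v m * x ^ m) = (\<Sum>i=1..M. v i * x ^ i) / (1 - x ^ M)"
proof -
 define g where "g n = v (Suc n) * x ^ Suc n" for n
 have "summable (%n. norm x ^ Suc n)"
  using x by (simp add: summable_geometric)
 hence s: "summable (%n. norm (g n))"
  by (rule summable_comparison_test[rotated])
    (use v(1) in \<open>auto simp: g_def norm_mult norm_power intro!: mult_left_le_one_le\<close>)
 have "(\<Sum>\<^sub>\<infinity>m\<in>{1..}. v m * x ^ m) = (\<Sum>\<^sub>\<infinity>n. g n)"
  by (rule infsum_reindex_bij_witness[of _ Suc "%m. m - 1"]) (auto simp: g_def)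
 also have "... = suminf g"
  using norm_summable_imp_has_sum[OF s summable_sums[OF summable_norm_cancel[OF s]]] by (rule infsumI)
 finally have 1: "(\<Sum>\<^sub>\<infinity>m\<in>{1..}. v m * x ^ m) = suminf g" .
 have "v (Suc (n + M)) = v (Suc n)" for n using v(2)[of "Suc n"] by simp
 hence "g (n + M) = x ^ M * g n" for n by (simp add: g_def power_add)
 hence "(\<Sum>n. g (n + M)) = x ^ M * suminf g"
  using suminf_mult[OF summable_norm_cancel[OF s]] by simp
 moreover have "suminf g = (\<Sum>n. g (n + M)) + (\<Sum>i<M. g i)"
  by (rule suminf_split_initial_segment[OF summable_norm_cancel[OF s]])
 moreover have "(\<Sum>i<M. g i) = (\<Sum>i=1..M. v i * x ^ i)"
  by (rule sum.reindex_bij_witness[of _ "%i. i - 1" Suc]) (auto simp: g_def)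
 ultimately have "(1 - x ^ M) * suminf g = (\<Sum>i=1..M. v i * x ^ i)" by (simp add: algebra_simps)
 moreover have "x ^ M ~= 1"
 proof
  assume "x ^ M = 1"
  hence "norm x ^ M = 1" by (metis norm_one norm_power)
  thus False using x M power_less_one_iff[of "norm x" M] by simp
 qed
 ultimately show ?thesis unfolding 1 by (simp add: field_simps)
qed

text \<open>The complex-valued characters for discriminants -4 and (\<open>chi8\<close>) -2,
  described by residues; \<open>kronecker_eq_chi\<close> connects them with the Kronecker
  symbol.\<close>

definition chi4 :: "nat => complex" where
 "chi4 n = (if n mod 4 = 1 then 1 else if n mod 4 = 3 then -1 else 0)"

definition chi8 :: "nat => complex" where
 "chi8 n = (if n mod 8 \<in> {1, 3} then 1 else if n mod 8 \<in> {5, 7} then -1 else 0)"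

lemma norm_chi_le: "norm (chi4 n) <= 1" "norm (chi8 n) <= 1"
 by (auto simp: chi4_def chi8_def)

lemma one_pm_power_nonzero:
 fixes x :: complex
 assumes "norm x < 1" "n > 0"
 shows "1 + x ^ n ~= 0" "1 - x ^ n ~= 0"
 using norm_one_minus_sign_power_ge[OF assms(1) _ assms(2), of "-1"]
    norm_one_minus_sign_power_ge[OF assms(1) _ assms(2), of 1] assms by auto

lemma infsum_geometric_1:
 fixes x :: complex
 assumes "norm x < 1"
 shows "(\<Sum>\<^sub>\<infinity>m\<in>{1::nat..}. 1 * x ^ m) = x / (1 - x)"
 using infsum_periodic_geometric[OF assms, of "%_. 1" 1] by simp

lemma infsum_chi4:
 assumes "norm x < 1"
 shows "(\<Sum>\<^sub>\<infinity>m\<in>{1..}. chi4 m * x ^ m) = x / (1 + x\<^sup>2)"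
proof -
 have "(\<Sum>\<^sub>\<infinity>m\<in>{1..}. chi4 m * x ^ m) = (\<Sum>i=1..4. chi4 i * x ^ i) / (1 - x ^ 4)"
  by (rule infsum_periodic_geometric[OF assms norm_chi_le(1)]) (auto simp: chi4_def)
 also have "(\<Sum>i=1..4. chi4 i * x ^ i) = x * (1 - x\<^sup>2)"
 proof -
  have "{1..4::nat} = {1, 2, 3, 4}" by auto
  hence "(\<Sum>i=1..4. chi4 i * x ^ i) = x - x ^ 3" by (simp add: chi4_def)
  also have "... = x * (1 - x\<^sup>2)" by (simp add: algebra_simps eval_nat_numeral)
  finally show ?thesis .
 qed
 also have "1 - x ^ 4 = (1 + x\<^sup>2) * (1 - x\<^sup>2)" by (simp add: algebra_simps eval_nat_numeral)
 finally show ?thesis using one_pm_power_nonzero[OF assms, of 2] by simp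
qed

lemma infsum_chi8:
 assumes "norm x < 1"
 shows "(\<Sum>\<^sub>\<infinity>m\<in>{1..}. chi8 m * x ^ m) = (x + x ^ 3) / (1 + x ^ 4)"
proof -
 have "(\<Sum>\<^sub>\<infinity>m\<in>{1..}. chi8 m * x ^ m) = (\<Sum>i=1..8. chi8 i * x ^ i) / (1 - x ^ 8)"
  by (rule infsum_periodic_geometric[OF assms norm_chi_le(2)]) (auto simp: chi8_def)
 also have "(\<Sum>i=1..8. chi8 i * x ^ i) = (x + x ^ 3) * (1 - x ^ 4)"
 proof -
  have "{1..8::nat} = {1, 2, 3, 4, 5, 6, 7, 8}" by auto
  hence "(\<Sum>i=1..8. chi8 i * x ^ i) = x + x ^ 3 - x ^ 5 - x ^ 7" by (simp add: chi8_def)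
  also have "... = (x + x ^ 3) * (1 - x ^ 4)" by (simp add: algebra_simps eval_nat_numeral)
  finally show ?thesis .
 qed
 also have "1 - x ^ 8 = (1 + x ^ 4) * (1 - x ^ 4)" by (simp add: algebra_simps eval_nat_numeral)
 finally show ?thesis using one_pm_power_nonzero[OF assms, of 4] by simp
qed

lemma norm_power_less_1: "norm q < 1 ==> n > 0 ==> norm (q ^ n :: complex) < 1"
 by (simp add: norm_power power_less_one_iff)

lemma lambert_has_sum:
 assumes u: "polynomially_bounded u" and q: "norm q < 1"
 shows "((%n. u n * (q ^ n / (1 - q ^ n))) has_sum eval_fps (lambert_fps u (%_. 1)) q) {1..}"
  and "((%n. u n * (q ^ n / (1 + (q ^ n)\<^sup>2))) has_sum eval_fps (lambert_fps u chi4) q) {1..}"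
  and "((%n. u n * ((q ^ n + (q ^ n) ^ 3) / (1 + (q ^ n) ^ 4))) has_sum eval_fps (lambert_fps u chi8) q) {1..}"
proof -
 have b: "polynomially_bounded chi4" "polynomially_bounded chi8"
  using polynomially_bounded_power_times[of chi4 0] polynomially_bounded_power_times[of chi8 0] norm_chi_le by auto
 have n: "norm (q ^ n) < 1" if "n \<in> {1..}" for n using q that by (intro norm_power_less_1) auto
 show "((%n. u n * (q ^ n / (1 - q ^ n))) has_sum eval_fps (lambert_fps u (%_. 1)) q) {1..}"
  using lambert_fps_eval(2)[OF u polynomially_bounded_const q, of 1] infsum_geometric_1[OF n]
  by (subst (asm) has_sum_cong) auto
 show "((%n. u n * (q ^ n / (1 + (q ^ n)\<^sup>2))) has_sum eval_fps (lambert_fps u chi4) q) {1..}"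
  using lambert_fps_eval(2)[OF u b(1) q] infsum_chi4[OF n]
  by (subst (asm) has_sum_cong) auto
 show "((%n. u n * ((q ^ n + (q ^ n) ^ 3) / (1 + (q ^ n) ^ 4))) has_sum eval_fps (lambert_fps u chi8) q) {1..}"
  using lambert_fps_eval(2)[OF u b(2) q] infsum_chi8[OF n]
  by (subst (asm) has_sum_cong) auto
qed

lemma infsum_int_positive:
 fixes f :: "int => complex"
 assumes s: "f summable_on UNIV" and S: "((%n. f (int n) + f (- int n)) has_sum S) {1..}"
 shows "infsum f UNIV = f 0 + S"
proof -
 have s1: "f summable_on A" for A using s by (rule summable_on_subset_banach) simp
 have p: "((%n. f (int n)) has_sum infsum f {0<..}) {1..}"
  using has_sum_infsum[OF s1[of "{0<..}"]]
  by (subst has_sum_reindex_bij_witness[of _ nat int "{0<..}" f]) auto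
 have m: "((%n. f (- int n)) has_sum infsum f {..<0}) {1..}"
  using has_sum_infsum[OF s1[of "{..<0}"]]
  by (subst has_sum_reindex_bij_witness[of _ "%N. nat (- N)" "%n. - int n" "{..<0}" f]) auto
 have "infsum f UNIV = infsum f ({0} \<union> ({0<..} \<union> {..<0}))" by (rule arg_cong[of _ _ "infsum f"]) auto
 also have "... = f 0 + (infsum f {0<..} + infsum f {..<0})"
 proof -
  have "infsum f ({0} \<union> ({0<..} \<union> {..<0})) = infsum f {0} + infsum f ({0<..} \<union> {..<0})"
   by (rule infsum_Un_disjoint) (auto intro: s1)
  also have "infsum f ({0<..} \<union> {..<0}) = infsum f {0<..} + infsum f {..<0}"
   by (rule infsum_Un_disjoint) (auto intro: s1)
  finally show ?thesis by simp
 qed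
 also have "infsum f {0<..} + infsum f {..<0} = S"
  using has_sum_unique[OF has_sum_add[OF p m] S] .
 finally show ?thesis .
qed

lemma sech_sum_lambert:
 assumes q: "0 < norm q" "norm q < 1"
 shows "sech_sum q = 1 + 4 * eval_fps (lambert_fps (%_. 1) chi4) q"
  and "sech_sum_fine q = 1 + 2 * eval_fps (lambert_fps (%_. 1) chi8) q"
proof -
 have nz: "q ^ n ~= 0" for n using q by auto
 have c: "polynomially_bounded (%_. 1)" by (rule polynomially_bounded_const)
 show "sech_sum q = 1 + 4 * eval_fps (lambert_fps (%_. 1) chi4) q"
  unfolding sech_sum_def
 proof (subst infsum_int_positive[OF sech_sum_summable[OF q]])
  show "((%n. 2 * q powi int n / (1 + q powi (2 * int n)) + 2 * q powi - int n / (1 + q powi (2 * - int n)))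
    has_sum 4 * eval_fps (lambert_fps (%_. 1) chi4) q) {1..}"
  proof (subst has_sum_cong)
   show "((%n. 4 * (1 * (q ^ n / (1 + (q ^ n)\<^sup>2)))) has_sum 4 * eval_fps (lambert_fps (%_. 1) chi4) q) {1..}"
    by (intro has_sum_cmult_right lambert_has_sum(2)[OF c q(2)])
   fix n :: nat assume "n \<in> {1..}"
   define x where "x = q ^ n"
   have x: "x ~= 0" "1 + x\<^sup>2 ~= 0" using nz[of n] one_pm_power_nonzero(1)[of x 2] norm_power_less_1[OF q(2), of n] \<open>n \<in> {1..}\<close> by (auto simp: x_def)
   have e: "q powi int n = x" "q powi (2 * int n) = x\<^sup>2" "q powi - int n = 1 / x" "q powi (2 * - int n) = 1 / x\<^sup>2"
    by (simp_all add: x_def power_int_minus divide_inverse power_int_mult power_mult_distrib power_inverse power_mult[symmetric] mult.commute)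
   show "2 * q powi int n / (1 + q powi (2 * int n)) + 2 * q powi - int n / (1 + q powi (2 * - int n)) = 4 * (1 * (q ^ n / (1 + (q ^ n)\<^sup>2)))"
    unfolding e x_def[symmetric] using x by (simp add: divide_simps power2_eq_square) (simp add: algebra_simps)
  qed
 qed auto
 show "sech_sum_fine q = 1 + 2 * eval_fps (lambert_fps (%_. 1) chi8) q"
  unfolding sech_sum_fine_def
 proof (subst infsum_int_positive[OF sech_sum_fine_summable[OF q]])
  show "((%n. 2 * q powi (3 * int n) / (1 + q powi (4 * int n)) + 2 * q powi (3 * - int n) / (1 + q powi (4 * - int n)))
    has_sum 2 * eval_fps (lambert_fps (%_. 1) chi8) q) {1..}"
  proof (subst has_sum_cong)
   show "((%n. 2 * (1 * ((q ^ n + (q ^ n) ^ 3) / (1 + (q ^ n) ^ 4)))) has_sum 2 * eval_fps (lambert_fps (%_. 1) chi8) q) {1..}"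
    by (intro has_sum_cmult_right lambert_has_sum(3)[OF c q(2)])
   fix n :: nat assume "n \<in> {1..}"
   define x where "x = q ^ n"
   have x: "x ~= 0" "1 + x ^ 4 ~= 0" using nz[of n] one_pm_power_nonzero(1)[of x 4] norm_power_less_1[OF q(2), of n] \<open>n \<in> {1..}\<close> by (auto simp: x_def)
   have e: "q powi (3 * int n) = x ^ 3" "q powi (4 * int n) = x ^ 4" "q powi (3 * - int n) = 1 / x ^ 3" "q powi (4 * - int n) = 1 / x ^ 4"
    by (simp_all add: x_def power_int_minus divide_inverse power_int_mult power_mult_distrib power_inverse power_mult[symmetric] mult.commute)
   have "(1 / x ^ 3) / (1 + 1 / x ^ 4) = x / (1 + x ^ 4)"
   proof -
    have "1 + 1 / x ^ 4 = (1 + x ^ 4) / x ^ 4" using x by (simp add: field_simps)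
    moreover have "(1 / x ^ 3) / (d / x ^ 4) = x / d" for d
     using x(1) by (simp add: eval_nat_numeral)
    ultimately show ?thesis by (simp only:)
   qed
   note * = this
   have "2 * (1 / x ^ 3) / (1 + 1 / x ^ 4) = 2 * (x / (1 + x ^ 4))"
    unfolding *[symmetric] by simp
   thus "2 * q powi (3 * int n) / (1 + q powi (4 * int n)) + 2 * q powi (3 * - int n) / (1 + q powi (4 * - int n)) = 2 * (1 * ((q ^ n + (q ^ n) ^ 3) / (1 + (q ^ n) ^ 4)))"
    unfolding e x_def[symmetric] by (simp add: add_divide_distrib)
  qed
 qed auto
qed

lemma theta_fps_nth_01: "theta_fps $ 0 = 1" "theta_fps $ 1 = 2"
proof -
 have "{x::int. x \<in> UNIV & nat (x\<^sup>2) = 0} = {0}" by auto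
 thus "theta_fps $ 0 = 1" by (simp add: theta_fps_def)
 have "x = 1 \<or> x = -1" if "nat (x\<^sup>2) = 1" for x :: int
 proof -
  have "x\<^sup>2 = 1" using that by (simp add: nat_eq_iff)
  thus ?thesis by (simp add: power2_eq_1_iff)
 qed
 hence "{x::int. x \<in> UNIV & nat (x\<^sup>2) = 1} = {1, -1}" by auto
 thus "theta_fps $ 1 = 2" by (simp add: theta_fps_def)
qed

lemma lambert_1_nth_1: "lambert_fps u v $ 1 = u 1 * v 1"
 using lambert_fps_nth[of 1 u v] by simp

lemma eval_one_plus_multiple:
 fixes f :: "complex fps"
 assumes "fps_conv_radius f >= 1"
 shows "fps_conv_radius (1 + fps_const c * f) >= 1"
  and "norm q < 1 ==> eval_fps (1 + fps_const c * f) q = 1 + c * eval_fps f q"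
proof -
 note m = fps_mult_disc[of "fps_const c", OF _ assms]
 show "fps_conv_radius (1 + fps_const c * f) >= 1" using fps_add_disc(1)[of 1, OF _ m(1)] by simp
 show "eval_fps (1 + fps_const c * f) q = 1 + c * eval_fps f q" if "norm q < 1"
  using fps_add_disc(2)[of 1, OF _ m(1) that] m(2)[OF _ that] by simp
qed

lemma fps_power_eval:
 fixes f :: "complex fps"
 assumes "fps_conv_radius f >= 1"
 shows "fps_conv_radius (f ^ n) >= 1" and "norm q < 1 ==> eval_fps (f ^ n) q = eval_fps f q ^ n"
proof -
 show 1: "fps_conv_radius (f ^ n) >= 1" for n
  by (induction n) (auto intro: fps_mult_disc(1) assms)
 show "eval_fps (f ^ n) q = eval_fps f q ^ n" if "norm q < 1"
  by (induction n) (auto simp: fps_mult_disc(2)[OF assms 1 that])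
qed

text \<open>Jacobi's two-square theorem. Both sides satisfy f(q) + f(-q) = 2 f(q^2) and f(q) f(-q) =
  f(-q^2)^2, and both begin with 1 + 4q, so \<open>doubling_unique\<close> identifies them.\<close>

theorem sech_sum_eq_theta_square:
 assumes q: "0 < norm q" "norm q < 1"
 shows "sech_sum q = (theta q)\<^sup>2"
proof -
 define A B where "A = 1 + fps_const 4 * lambert_fps (%_. 1) chi4" and "B = theta_fps ^ 2"
 have l: "fps_conv_radius (lambert_fps (%_. 1) chi4) >= 1"
  by (intro lambert_fps_eval polynomially_bounded_const) (use polynomially_bounded_power_times[of chi4 0] norm_chi_le in auto)
 have A: "fps_conv_radius A >= 1" "!!q. 0 < norm q ==> norm q < 1 ==> eval_fps A q = sech_sum q"
  unfolding A_def using eval_one_plus_multiple[OF l, where c = 4] sech_sum_lambert(1) by auto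
 have B: "fps_conv_radius B >= 1" "!!q. norm q < 1 ==> eval_fps B q = (theta q)\<^sup>2"
  unfolding B_def using fps_power_eval[OF theta_fps_eval(1), where n = 2] theta_fps_eval(2) by auto
 have R: "f * fps_reflect f = (fps_dilate 2 (fps_reflect f))\<^sup>2"
  if f: "fps_conv_radius f >= 1" and e: "!!q. 0 < norm q ==> norm q < 1 ==> eval_fps f q * eval_fps f (- q) = (eval_fps f (- q\<^sup>2))\<^sup>2" for f
 proof (rule eval_fps_unique_disc)
  note r = fps_reflect_eval[OF f]
  note d = fps_dilate_eval[OF r(1) pos2]
  note p = fps_power_eval[OF d(1), where n = 2]
  note m = fps_mult_disc[OF f r(1)]
  show "fps_conv_radius (f * fps_reflect f) >= 1" "fps_conv_radius ((fps_dilate 2 (fps_reflect f))\<^sup>2) >= 1"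
   by (rule m p)+
  fix q :: complex assume q: "0 < norm q" "norm q < 1"
  show "eval_fps (f * fps_reflect f) q = eval_fps ((fps_dilate 2 (fps_reflect f))\<^sup>2) q"
   using e[OF q] q norm_power_less_1[OF q(2), of 2] by (simp add: m(2) p(2) d(2) r(2))
 qed
 have "A = B"
 proof (rule doubling_unique[OF A(1) B(1)])
  fix q :: complex assume q: "0 < norm q" "norm q < 1"
  have q2: "0 < norm (q\<^sup>2)" "norm (q\<^sup>2) < 1" using norm_power_less_1[OF q(2), of 2] q by auto
  show "eval_fps A q + eval_fps A (- q) = 2 * eval_fps A (q\<^sup>2)"
   using sech_sum_doubling(1)[OF q] A(2) q q2 by simp
  show "eval_fps B q + eval_fps B (- q) = 2 * eval_fps B (q\<^sup>2)"
   using theta_square_sum[OF q(2)] B(2) q q2 by simp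
 next
  show "A * fps_reflect A = (fps_dilate 2 (fps_reflect A))\<^sup>2"
  proof (rule R[OF A(1)])
   fix q :: complex assume q: "0 < norm q" "norm q < 1"
   have q2: "0 < norm (- q\<^sup>2)" "norm (- q\<^sup>2) < 1" using norm_power_less_1[OF q(2), of 2] q by auto
   show "eval_fps A q * eval_fps A (- q) = (eval_fps A (- q\<^sup>2))\<^sup>2"
    using sech_sum_reflect_product[OF q] A(2)[OF q] A(2)[of "- q"] A(2)[OF q2] q by simp
  qed
  show "B * fps_reflect B = (fps_dilate 2 (fps_reflect B))\<^sup>2"
  proof (rule R[OF B(1)])
   fix q :: complex assume q: "0 < norm q" "norm q < 1"
   have q2: "norm (- q\<^sup>2) < 1" using norm_power_less_1[OF q(2), of 2] by auto
   show "eval_fps B q * eval_fps B (- q) = (eval_fps B (- q\<^sup>2))\<^sup>2"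
    using theta_reflect_product[OF q(2)] B(2)[of q] B(2)[of "- q"] B(2)[OF q2] q
    by (simp flip: power_mult_distrib)
  qed
  show "A $ 0 = 1" by (simp add: A_def lambert_fps_nth_0)
  show "B $ 0 = 1" by (simp add: B_def fps_power_zeroth theta_fps_nth_01)
  have a1: "A $ 1 = 4" using lambert_1_nth_1[of "%_. 1" chi4] by (simp add: A_def chi4_def)
  have b1: "B $ 1 = 4" using theta_fps_nth_01 by (simp add: B_def power2_eq_square fps_mult_nth)
  show "A $ 1 = B $ 1" "A $ 1 ~= 0" using a1 b1 by simp_all
  fix n :: nat assume n: "n >= 2" and eq: "!!m. m < n ==> A $ m = B $ m"
  \<comment> \<open>The coefficient of q^(n+1) in f(-q^2)^2 involves only coefficients of f with
    index at most (n + 1)/2, which is less than n.\<close>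
  have "fps_dilate 2 (fps_reflect A) $ i = fps_dilate 2 (fps_reflect B) $ i" if "i <= n + 1" for i
   using that n eq[of "i div 2"] by (auto simp: fps_dilate_def fps_reflect_def)
  thus "(fps_dilate 2 (fps_reflect A))\<^sup>2 $ (n + 1) = (fps_dilate 2 (fps_reflect B))\<^sup>2 $ (n + 1)"
   by (simp add: power2_eq_square fps_mult_nth)
 qed
 thus ?thesis using A(2)[OF q] B(2)[OF q(2)] by simp
qed

text \<open>The corresponding theorem for x^2 + 2 y^2. Here f(q) f(-q) is the fourth power of theta
  at -q^4 for both functions, the sech side by means of the two-square theorem; so the two products
  agree outright and the recursion needs no further input.\<close>

theorem sech_sum_fine_eq_theta_product:
 assumes q: "0 < norm q" "norm q < 1"
 shows "sech_sum_fine q = theta q * theta (q\<^sup>2)"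
proof -
 define A B where "A = 1 + fps_const 2 * lambert_fps (%_. 1) chi8" and "B = theta_fps * fps_dilate 2 theta_fps"
 have l: "fps_conv_radius (lambert_fps (%_. 1) chi8) >= 1"
  by (intro lambert_fps_eval polynomially_bounded_const) (use polynomially_bounded_power_times[of chi8 0] norm_chi_le in auto)
 have A: "fps_conv_radius A >= 1" "!!q. 0 < norm q ==> norm q < 1 ==> eval_fps A q = sech_sum_fine q"
  unfolding A_def using eval_one_plus_multiple[OF l, where c = 2] sech_sum_lambert(2) by auto
 note d = fps_dilate_eval[OF theta_fps_eval(1) pos2]
 have B: "fps_conv_radius B >= 1" "!!q. norm q < 1 ==> eval_fps B q = theta q * theta (q\<^sup>2)"
  unfolding B_def using fps_mult_disc[OF theta_fps_eval(1) d(1)] d(2) theta_fps_eval(2) norm_power_less_1[of _ 2] by auto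
 have "A = B"
 proof (rule doubling_unique[OF A(1) B(1)])
  fix q :: complex assume q: "0 < norm q" "norm q < 1"
  have q2: "0 < norm (q\<^sup>2)" "norm (q\<^sup>2) < 1" using norm_power_less_1[OF q(2), of 2] q by auto
  show "eval_fps A q + eval_fps A (- q) = 2 * eval_fps A (q\<^sup>2)"
   using sech_sum_doubling(2)[OF q] A(2) q q2 by simp
  have "theta q * theta (q\<^sup>2) + theta (- q) * theta (q\<^sup>2) = 2 * (theta (q\<^sup>2) * theta (q ^ 4))"
   unfolding distrib_right[symmetric] theta_quadruple[OF q(2)] by simp
  thus "eval_fps B q + eval_fps B (- q) = 2 * eval_fps B (q\<^sup>2)"
   using B(2) q q2 by (simp flip: power_mult)
 next
  note r = fps_reflect_eval[OF A(1)] fps_reflect_eval[OF B(1)]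
  show "A * fps_reflect A = B * fps_reflect B"
  proof (rule eval_fps_unique_disc)
   show "fps_conv_radius (A * fps_reflect A) >= 1" "fps_conv_radius (B * fps_reflect B) >= 1"
    by (rule fps_mult_disc A B r)+
   fix q :: complex assume q: "0 < norm q" "norm q < 1"
   have q2: "norm (q\<^sup>2) < 1" using norm_power_less_1[OF q(2), of 2] by auto
   have q4: "0 < norm (- (q ^ 4))" "norm (- (q ^ 4)) < 1" using norm_power_less_1[OF q(2), of 4] q by auto
   have "theta (q\<^sup>2) * theta (- q\<^sup>2) = (theta (- (q ^ 4)))\<^sup>2"
    using theta_reflect_product[OF q2] by (simp flip: power_mult)
   hence "(theta q * theta (q\<^sup>2)) * (theta (- q) * theta (q\<^sup>2)) = ((theta (- (q ^ 4)))\<^sup>2)\<^sup>2"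
    using theta_reflect_product[OF q(2)] by (simp add: power2_eq_square algebra_simps) (metis mult.assoc mult.commute)
   thus "eval_fps (A * fps_reflect A) q = eval_fps (B * fps_reflect B) q"
    using sech_sum_fine_reflect_product[OF q] sech_sum_eq_theta_square[OF q4] q A(2)[OF q] A(2)[of "- q"] B(2)[of q] B(2)[of "- q"]
    by (simp add: fps_mult_disc(2)[OF A(1) r(1)] fps_mult_disc(2)[OF B(1) r(3)] r(2) r(4))
  qed
  show "B * fps_reflect B = B * fps_reflect B" by (rule refl)
  show "A $ 0 = 1" by (simp add: A_def lambert_fps_nth_0)
  show "B $ 0 = 1" by (simp add: B_def fps_dilate_def theta_fps_nth_01)
  have a1: "A $ 1 = 2" using lambert_1_nth_1[of "%_. 1" chi8] by (simp add: A_def chi8_def)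
  have b1: "B $ 1 = 2" using theta_fps_nth_01 by (simp add: B_def fps_mult_nth fps_dilate_def)
  show "A $ 1 = B $ 1" "A $ 1 ~= 0" using a1 b1 by simp_all
 qed simp
 thus ?thesis using A(2)[OF q] B(2)[OF q(2)] by simp
qed

section \<open>Divisor series as moments at special points\<close>

definition sigma_fps :: "nat => complex fps" where
 "sigma_fps k = lambert_fps (%n. of_nat n ^ k) (%_. 1)"

definition chi_inf_fps :: "(nat => complex) => nat => complex fps" where
 "chi_inf_fps \<chi> k = lambert_fps (%n. \<chi> n * of_nat n ^ k) (%_. 1)"

definition chi_zero_fps :: "(nat => complex) => nat => complex fps" where
 "chi_zero_fps \<chi> k = lambert_fps (%n. of_nat n ^ k) \<chi>"

lemma infsum_even_positive:
 fixes g :: "int => complex"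
 assumes g: "g summable_on UNIV" and z: "!!N. odd N ==> g N = 0"
  and S: "((%n. g (2 * int n) + g (- (2 * int n))) has_sum S) {1..}"
 shows "infsum g UNIV = g 0 + S"
proof -
 have e: "infsum g UNIV = (\<Sum>\<^sub>\<infinity>N. if N mod 2 = 0 then g (2 * (N div 2)) else 0)"
  by (rule infsum_cong) (auto simp: z odd_iff_mod_2_eq_one)
 have s: "(%n. g (2 * n)) summable_on UNIV"
 proof -
  have "g summable_on range (%n. 2 * n)" using g by (rule summable_on_subset_banach) simp
  thus ?thesis by (subst (asm) summable_on_reindex) (auto simp: o_def inj_on_def)
 qed
 show ?thesis
  unfolding e infsum_even[of "%n. g (2 * n)"]
  using infsum_int_positive[OF s, of S] S by simp
qed

text \<open>For negative index P^n / (1 - \<sigma> P^n) appears with the opposite sign, so the terms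
  n and -n share one denominator and combine to a Lambert summand.\<close>

lemma ell_kernel_pair:
 assumes P: "0 < norm P" "norm P < 1" and z: "\<zeta> ~= 0" and s: "\<sigma> \<in> {1, -1}" and n: "n > 0" "int n mod 2 = p"
 shows "ell_kernel \<sigma> p P \<zeta> (int n) * of_int (int n) ^ k + ell_kernel \<sigma> p P \<zeta> (- int n) * of_int (- int n) ^ k
  = of_nat n ^ k * (2 * (\<zeta> ^ n - \<sigma> * (-1) ^ k * (P / \<zeta>) ^ n) / (1 - \<sigma> * P ^ n))"
proof -
 have p: "(- int n) mod 2 = p" using n by presburger
 define X Y where "X = \<zeta> ^ n" and "Y = P ^ n"
 have nz: "X ~= 0" "Y ~= 0" using z P by (auto simp: X_def Y_def)
 have d: "1 - \<sigma> * Y ~= 0"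
  using norm_one_minus_sign_power_ge[OF P(2) s n(1)] P(2) by (auto simp: Y_def simp del: right_minus_eq)
 have 1: "ell_kernel \<sigma> p P \<zeta> (int n) = 2 * X / (1 - \<sigma> * Y)"
  using n by (simp add: ell_kernel_def X_def Y_def)
 have "1 - \<sigma> * (1 / Y) = - \<sigma> * (1 - \<sigma> * Y) / Y" using nz s by (auto simp: field_simps)
 moreover have "2 * (1 / X) / (- \<sigma> * D / Y) = - \<sigma> * (2 * (Y / X) / D)" if "D ~= 0" for D
  using nz that s by auto
 ultimately have "2 * (1 / X) / (1 - \<sigma> * (1 / Y)) = - \<sigma> * (2 * (Y / X) / (1 - \<sigma> * Y))"
  using d by simp
 hence 2: "ell_kernel \<sigma> p P \<zeta> (- int n) = - \<sigma> * (2 * (Y / X) / (1 - \<sigma> * Y))"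
  using p by (simp add: ell_kernel_def X_def Y_def power_int_minus divide_inverse)
 have 3: "of_int (- int n) ^ k = (-1) ^ k * of_nat n ^ k" for k :: nat
  by (simp add: power_minus[of "of_nat n"])
 have "2 * X / D * m + (- \<sigma> * (2 * (Y / X) / D)) * (e * m) = m * (2 * (X - \<sigma> * e * (Y / X)) / D)" for D m e
  by (simp add: diff_divide_distrib algebra_simps)
 thus ?thesis unfolding 1 2 3 power_divide X_def[symmetric] Y_def[symmetric] by simp
qed

text \<open>Only the indices N = 2n contribute, whence the factor 2^k and the squares of \<zeta> and
  P; for k > 0 there is no contribution from N = 0.\<close>

lemma elliptic_moment_even:
 assumes z: "0 < norm P" "norm P < norm \<zeta>" "norm \<zeta> < 1" and s: "\<sigma> \<in> {1, -1}" and k: "k > 0"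
  and S: "((%n. of_nat n ^ k * (2 * ((\<zeta>\<^sup>2) ^ n - \<sigma> * (-1) ^ k * ((P / \<zeta>)\<^sup>2) ^ n) / (1 - \<sigma> * (P\<^sup>2) ^ n))) has_sum S) {1..}"
 shows "(\<Sum>\<^sub>\<infinity>N. ell_kernel \<sigma> 0 P \<zeta> N * of_int N ^ k) = 2 ^ k * S"
proof -
 have P1: "norm P < 1" and z0: "\<zeta> ~= 0" using z by auto
 have "infsum (%N. ell_kernel \<sigma> 0 P \<zeta> N * of_int N ^ k) UNIV = ell_kernel \<sigma> 0 P \<zeta> 0 * of_int 0 ^ k + 2 ^ k * S"
 proof (rule infsum_even_positive)
  show "(%N. ell_kernel \<sigma> 0 P \<zeta> N * of_int N ^ k) summable_on UNIV"
   by (rule geometric_decay_summable[OF geometric_decay_ell_kernel[OF z s]])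
  show "ell_kernel \<sigma> 0 P \<zeta> N * of_int N ^ k = 0" if "odd N" for N
   using that by (simp add: ell_kernel_def odd_iff_mod_2_eq_one)
  have "((%n. 2 ^ k * (of_nat n ^ k * (2 * ((\<zeta>\<^sup>2) ^ n - \<sigma> * (-1) ^ k * ((P / \<zeta>)\<^sup>2) ^ n) / (1 - \<sigma> * (P\<^sup>2) ^ n)))) has_sum 2 ^ k * S) {1..}"
   using S by (rule has_sum_cmult_right)
  thus "((%n. ell_kernel \<sigma> 0 P \<zeta> (2 * int n) * of_int (2 * int n) ^ k
    + ell_kernel \<sigma> 0 P \<zeta> (- (2 * int n)) * of_int (- (2 * int n)) ^ k) has_sum 2 ^ k * S) {1..}"
  proof (subst has_sum_cong)
   fix n :: nat assume n: "n \<in> {1..}"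
   have "2 * n > 0" "int (2 * n) mod 2 = 0" using n by auto
   from ell_kernel_pair[OF z(1) P1 z0 s this, of k]
   show "ell_kernel \<sigma> 0 P \<zeta> (2 * int n) * of_int (2 * int n) ^ k
    + ell_kernel \<sigma> 0 P \<zeta> (- (2 * int n)) * of_int (- (2 * int n)) ^ k
    = 2 ^ k * (of_nat n ^ k * (2 * ((\<zeta>\<^sup>2) ^ n - \<sigma> * (-1) ^ k * ((P / \<zeta>)\<^sup>2) ^ n) / (1 - \<sigma> * (P\<^sup>2) ^ n)))"
    by (simp add: power_mult power_mult_distrib)
  qed
 qed
 thus ?thesis using k by (simp add: zero_power)
qed

lemma elliptic_moment_odd:
 assumes z: "0 < norm P" "norm P < norm \<zeta>" "norm \<zeta> < 1" and s: "\<sigma> \<in> {1, -1}"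
  and S: "((%n. if odd n then of_nat n ^ k * (2 * (\<zeta> ^ n - \<sigma> * (-1) ^ k * (P / \<zeta>) ^ n) / (1 - \<sigma> * P ^ n)) else 0) has_sum S) {1..}"
 shows "(\<Sum>\<^sub>\<infinity>N. ell_kernel \<sigma> 1 P \<zeta> N * of_int N ^ k) = S"
proof -
 have P1: "norm P < 1" and z0: "\<zeta> ~= 0" using z by auto
 have "infsum (%N. ell_kernel \<sigma> 1 P \<zeta> N * of_int N ^ k) UNIV = ell_kernel \<sigma> 1 P \<zeta> 0 * of_int 0 ^ k + S"
 proof (rule infsum_int_positive)
  show "(%N. ell_kernel \<sigma> 1 P \<zeta> N * of_int N ^ k) summable_on UNIV"
   by (rule geometric_decay_summable[OF geometric_decay_ell_kernel[OF z s]])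
  from S show "((%n. ell_kernel \<sigma> 1 P \<zeta> (int n) * of_int (int n) ^ k
    + ell_kernel \<sigma> 1 P \<zeta> (- int n) * of_int (- int n) ^ k) has_sum S) {1..}"
  proof (subst has_sum_cong)
   fix n :: nat assume n: "n \<in> {1..}"
   show "ell_kernel \<sigma> 1 P \<zeta> (int n) * of_int (int n) ^ k
    + ell_kernel \<sigma> 1 P \<zeta> (- int n) * of_int (- int n) ^ k
    = (if odd n then of_nat n ^ k * (2 * (\<zeta> ^ n - \<sigma> * (-1) ^ k * (P / \<zeta>) ^ n) / (1 - \<sigma> * P ^ n)) else 0)"
   proof (cases "odd n")
    case True
    hence "int n mod 2 = 1" "n > 0" using n by (auto simp flip: odd_iff_mod_2_eq_one)
    thus ?thesis using ell_kernel_pair[OF z(1) P1 z0 s, of n 1 k] True by simp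
   next
    case False
    hence "int n mod 2 ~= 1" "(- int n) mod 2 ~= 1" by (auto simp flip: odd_iff_mod_2_eq_one)
    thus ?thesis using False by (simp add: ell_kernel_def)
   qed
  qed
 qed
 thus ?thesis by (simp add: ell_kernel_def)
qed

lemma boundary_moment_eq:
 assumes P: "norm P < 1" and z: "norm \<zeta> = 1" and s: "\<sigma> \<in> {1, -1}"
  and S: "((%n. if int n mod 2 = p then of_nat n ^ k * (2 * (\<sigma> * P ^ n / (1 - \<sigma> * P ^ n)) * (\<zeta> ^ n - (-1) ^ k * (1 / \<zeta>) ^ n)) else 0) has_sum S) {1..}"
 shows "boundary_moment \<sigma> p P \<zeta> C k = fact k * C $ k + S"
proof -
 have z0: "\<zeta> ~= 0" using z by auto
 have "infsum (%N. 2 * \<zeta> powi N * sign_remainder \<sigma> p P N * of_int N ^ k) UNIV = 2 * \<zeta> powi 0 * sign_remainder \<sigma> p P 0 * of_int 0 ^ k + S"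
 proof (rule infsum_int_positive)
  have "geometric_decay (%N. 2 * \<zeta> powi N * sign_remainder \<sigma> p P N)"
  proof (rule geometric_decayI)
   have b: "norm (2 * \<zeta> powi N * sign_remainder \<sigma> p P N) <= 2 / (1 - norm P) * norm P ^ nat \<bar>N\<bar>" for N
    using norm_sign_remainder_le[OF P s, of p N] z by (simp add: norm_mult norm_power_int)
   show "norm (2 * \<zeta> powi int n * sign_remainder \<sigma> p P (int n)) <= 2 / (1 - norm P) * norm P ^ n" for n using b[of "int n"] by simp
   show "norm (2 * \<zeta> powi (- int n) * sign_remainder \<sigma> p P (- int n)) <= 2 / (1 - norm P) * norm P ^ n" for n using b[of "- int n"] by simp
  qed (use P in auto)
  thus "(%N. 2 * \<zeta> powi N * sign_remainder \<sigma> p P N * of_int N ^ k) summable_on UNIV"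
   by (rule geometric_decay_summable)
  from S show "((%n. 2 * \<zeta> powi int n * sign_remainder \<sigma> p P (int n) * of_int (int n) ^ k
    + 2 * \<zeta> powi (- int n) * sign_remainder \<sigma> p P (- int n) * of_int (- int n) ^ k) has_sum S) {1..}"
  proof (subst has_sum_cong)
   fix n :: nat assume n: "n \<in> {1..}"
   have p: "(- int n) mod 2 = p \<longleftrightarrow> int n mod 2 = p" by presburger
   have 3: "of_int (- int n) ^ k = (-1) ^ k * of_nat n ^ k" for k :: nat
    by (simp add: power_minus[of "of_nat n"])
   show "2 * \<zeta> powi int n * sign_remainder \<sigma> p P (int n) * of_int (int n) ^ k
    + 2 * \<zeta> powi (- int n) * sign_remainder \<sigma> p P (- int n) * of_int (- int n) ^ k
    = (if int n mod 2 = p then of_nat n ^ k * (2 * (\<sigma> * P ^ n / (1 - \<sigma> * P ^ n)) * (\<zeta> ^ n - (-1) ^ k * (1 / \<zeta>) ^ n)) else 0)"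
   proof (cases "int n mod 2 = p")
    case True
    define R Z W where "R = \<sigma> * P ^ n / (1 - \<sigma> * P ^ n)" and "Z = \<zeta> ^ n" and "W = (1 / \<zeta>) ^ n"
    have e: "sign_remainder \<sigma> p P (int n) = R" "sign_remainder \<sigma> p P (- int n) = - R"
     "\<zeta> powi int n = Z" "\<zeta> powi (- int n) = W"
     using n True by (simp_all add: sign_remainder_def p R_def Z_def W_def power_int_minus power_inverse divide_inverse)
    have "2 * Z * R * m + 2 * W * (- R) * (e * m) = m * (2 * R * (Z - e * W))" for e m
     by (simp add: algebra_simps)
    thus ?thesis unfolding 3 e R_def[symmetric] Z_def[symmetric] W_def[symmetric] using True by simp
   next
    case False
    thus ?thesis by (simp add: sign_remainder_def p)
   qed
  qed
 qed
 thus ?thesis by (simp add: boundary_moment_def sign_remainder_def)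
qed

lemma csqrt_nome:
 fixes q :: complex
 assumes q: "0 < norm q" "norm q < 1"
 obtains r where "r\<^sup>2 = q" "0 < norm r" "norm r < 1" "norm q < norm r"
proof -
 define r where "r = csqrt q"
 have r: "r\<^sup>2 = q" by (simp add: r_def)
 have nr: "(norm r)\<^sup>2 = norm q" using r by (metis norm_power)
 have r0: "0 < norm r" using q r by auto
 have "(norm r)\<^sup>2 < 1\<^sup>2" unfolding nr using q by simp
 hence r1: "norm r < 1" by (rule power2_less_imp_less) simp
 have "norm q < norm r" unfolding nr[symmetric] using r0 r1 by (simp add: power2_eq_square)
 thus ?thesis using that r r0 r1 by blast
qed

lemma power_power_commute: "(x ^ a) ^ b = (x ^ b) ^ a" for x :: complex
 by (simp flip: power_mult add: mult.commute)

text \<open>For nome q^2 and \<zeta> = q^(3/2) one has \<zeta>^2 = q^3 and (P / \<zeta>)^2 = q. The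
  moments of dn then carry (q^n + q^(3n)) / (1 + q^(4n)), the generating function of the character
  modulo 8, and dn itself is \<open>sech_sum_fine q\<close>.\<close>

lemma zero8_moment:
 assumes q: "0 < norm q" "norm q < 1" and j: "j > 0"
 defines "y \<equiv> theta q * theta (q\<^sup>2)" and "a \<equiv> theta (q\<^sup>2) ^ 4" and "b \<equiv> theta (- q\<^sup>2) ^ 4"
 shows "2 * 4 ^ j * eval_fps (chi_zero_fps chi8 (2 * j)) q = y * even_deriv (y\<^sup>2) (a + b) (a * b) j 1"
proof -
 obtain r where r: "r\<^sup>2 = q" "0 < norm r" "norm r < 1" using csqrt_nome[OF q] by blast
 have P: "0 < norm (q\<^sup>2)" "norm (q\<^sup>2) < norm (r ^ 3)" "norm (r ^ 3) < 1" "norm (q\<^sup>2) < 1"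
  using norm_power_between[OF r(2,3), of 3 4] norm_power_between[OF r(2,3), of 0 3] norm_power_less_1[OF q(2), of 2] q
  by (simp_all flip: r(1) power_mult)
 have zz: "(r ^ 3)\<^sup>2 = q ^ 3" by (simp flip: r(1) power_mult)
 have pp: "((q\<^sup>2)\<^sup>2) = q ^ 4" by (simp flip: power_mult)
 have pz: "(q\<^sup>2 / r ^ 3)\<^sup>2 = q"
  unfolding power_divide zz pp using q by (simp add: eval_nat_numeral)
 have dn0: "dn_series (q\<^sup>2) (r ^ 3) $ 0 = y"
 proof -
  have "dn_series (q\<^sup>2) (r ^ 3) $ 0
    = (\<Sum>\<^sub>\<infinity>N. if N mod 2 = 0 then 2 * q powi (3 * (N div 2)) / (1 + q powi (4 * (N div 2))) else 0)"
   unfolding dn_series_def moment_series_nth_0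
  proof (rule infsum_cong)
   fix N :: int
   show "ell_kernel (- 1) 0 (q\<^sup>2) (r ^ 3) N = (if N mod 2 = 0 then 2 * q powi (3 * (N div 2)) / (1 + q powi (4 * (N div 2))) else 0)"
   proof (cases "even N")
    case True
    then obtain m where m: "N = 2 * m" by (elim evenE)
    have "(r ^ 3) powi (2 * m) = q powi (3 * m)" by (simp only: power_int_mult power_int_numeral zz)
    moreover have "(q\<^sup>2) powi (2 * m) = q powi (4 * m)" by (simp only: power_int_mult power_int_numeral pp)
    ultimately show ?thesis by (simp add: ell_kernel_def m)
   qed (simp add: ell_kernel_def odd_iff_mod_2_eq_one)
  qed
  also have "... = sech_sum_fine q"
   unfolding infsum_even[of "%n. 2 * q powi (3 * n) / (1 + q powi (4 * n))"] sech_sum_fine_def ..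
  finally show ?thesis by (simp add: sech_sum_fine_eq_theta_product[OF q] y_def)
 qed
 have ss: "(sech_sum (q\<^sup>2))\<^sup>2 = a" "(sech_sum (- q\<^sup>2))\<^sup>2 = b"
  using sech_sum_eq_theta_square[of "q\<^sup>2"] sech_sum_eq_theta_square[of "- q\<^sup>2"] P
  by (simp_all add: a_def b_def)
 have "((%n. of_nat n ^ (2 * j) * (2 * (((r ^ 3)\<^sup>2) ^ n - (-1) * (-1) ^ (2 * j) * ((q\<^sup>2 / r ^ 3)\<^sup>2) ^ n) / (1 - (-1) * ((q\<^sup>2)\<^sup>2) ^ n)))
   has_sum 2 * eval_fps (chi_zero_fps chi8 (2 * j)) q) {1..}"
 proof (subst has_sum_cong)
  show "((%n. 2 * (of_nat n ^ (2 * j) * ((q ^ n + (q ^ n) ^ 3) / (1 + (q ^ n) ^ 4)))) has_sum 2 * eval_fps (chi_zero_fps chi8 (2 * j)) q) {1..}"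
   unfolding chi_zero_fps_def by (intro has_sum_cmult_right lambert_has_sum(3) polynomially_bounded_power q)
  fix n :: nat
  have m: "(-1) ^ (2 * j) = (1 :: complex)" by simp
  show "of_nat n ^ (2 * j) * (2 * (((r ^ 3)\<^sup>2) ^ n - (-1) * (-1) ^ (2 * j) * ((q\<^sup>2 / r ^ 3)\<^sup>2) ^ n) / (1 - (-1) * ((q\<^sup>2)\<^sup>2) ^ n))
    = 2 * (of_nat n ^ (2 * j) * ((q ^ n + (q ^ n) ^ 3) / (1 + (q ^ n) ^ 4)))"
   unfolding zz pz pp m power_power_commute[of q 3 n] power_power_commute[of q 4 n] by (simp add: add.commute)
 qed
 from elliptic_moment_even[OF P(1-3) _ _ this] j
 have "(\<Sum>\<^sub>\<infinity>N. ell_kernel (-1) 0 (q\<^sup>2) (r ^ 3) N * of_int N ^ (2 * j)) = 4 ^ j * (2 * eval_fps (chi_zero_fps chi8 (2 * j)) q)"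
  by (simp add: power_mult)
 thus ?thesis
  using elliptic_moment_dn[OF P(1-3), of j 1] moment_dn[of "2 * j" "q\<^sup>2" "r ^ 3"] by (simp add: dn0 ss mult_ac)
qed

lemma sech_sum_square:
 assumes "0 < norm q" "norm q < 1"
 shows "(sech_sum q)\<^sup>2 = theta q ^ 4" "(sech_sum (- q))\<^sup>2 = theta (- q) ^ 4"
 using sech_sum_eq_theta_square[of q] sech_sum_eq_theta_square[of "- q"] assms by simp_all

lemma lambert_odd_has_sum:
 assumes u: "polynomially_bounded u" and q: "norm q < 1"
 shows "((%n. u n * (q ^ n / (1 - (q ^ n)\<^sup>2))) has_sum
  (eval_fps (lambert_fps u (%_. 1)) q + - eval_fps (lambert_fps u (%_. 1)) (q\<^sup>2))) {1..}"
proof (subst has_sum_cong)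
 have q2: "norm (q\<^sup>2) < 1" using norm_power_less_1[OF q, of 2] by simp
 show "((%n. u n * (q ^ n / (1 - q ^ n)) + - (u n * ((q\<^sup>2) ^ n / (1 - (q\<^sup>2) ^ n)))) has_sum
  (eval_fps (lambert_fps u (%_. 1)) q + - eval_fps (lambert_fps u (%_. 1)) (q\<^sup>2))) {1..}"
  by (intro has_sum_add has_sum_uminusI lambert_has_sum(1) u q q2)
 fix n :: nat assume n: "n \<in> {1..}"
 define x where "x = q ^ n"
 have "norm x < 1" using norm_power_less_1[OF q, of n] n by (simp add: x_def)
 hence nz: "1 - x ~= 0" "1 + x ~= 0" using one_pm_power_nonzero[of x 1] by auto
 have f: "1 - x\<^sup>2 = (1 - x) * (1 + x)" by (simp add: power2_eq_square algebra_simps)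
 have "x / (1 - x\<^sup>2) = x / (1 - x) - x\<^sup>2 / (1 - x\<^sup>2)"
  unfolding f using nz by (simp add: divide_simps) (simp add: power2_eq_square algebra_simps)
 thus "u n * (q ^ n / (1 - (q ^ n)\<^sup>2)) = u n * (q ^ n / (1 - q ^ n)) + - (u n * ((q\<^sup>2) ^ n / (1 - (q\<^sup>2) ^ n)))"
  unfolding power_power_commute[of q 2 n] x_def[symmetric] by (simp add: right_diff_distrib)
qed

lemma has_sum_even_nat:
 fixes f :: "nat => complex"
 assumes "((%m. f (2 * m)) has_sum S) {1..}"
 shows "((%n. if even n then f n else 0) has_sum S) {1..}"
proof -
 have "(f has_sum S) {n. n >= 1 & even n}"
  using assms by (subst has_sum_reindex_bij_witness[of _ "%m. 2 * m" "%n. n div 2" "{1..}" "%m. f (2 * m)"]) auto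
 thus ?thesis by (rule has_sum_cong_neutral[THEN iffD1, rotated -1]) auto
qed

lemma has_sum_alternating:
 fixes f :: "nat => complex"
 assumes "(f has_sum S) {1..}" "((%m. f (2 * m)) has_sum T) {1..}"
 shows "((%n. (-1) ^ n * f n) has_sum (2 * T + - S)) {1..}"
proof (subst has_sum_cong)
 show "((%n. 2 * (if even n then f n else 0) + - f n) has_sum (2 * T + - S)) {1..}"
  by (intro has_sum_add has_sum_cmult_right has_sum_uminusI has_sum_even_nat assms)
qed auto

lemma lambert_fps_commute: "lambert_fps u v = lambert_fps v u"
 unfolding lambert_fps_def
 by (rule fps_ext, simp, rule sum.reindex_bij_witness[of _ prod.swap prod.swap]) (auto simp: mult.commute)

text \<open>The moments of sn^2 at the point \<zeta>^2 = q where sn vanishes, whence the initial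
  value 0 of the recursion. The summand q^n / (1 - q^(2n)) yields the difference of the divisor
  series at q and q^2.\<close>

lemma sigma_moment:
 assumes q: "0 < norm q" "norm q < 1" and j: "j > 0"
 defines "a \<equiv> theta q ^ 4" and "b \<equiv> theta (- q) ^ 4"
 shows "2 ^ (2 * j + 3) * (eval_fps (sigma_fps (2 * j + 1)) q - eval_fps (sigma_fps (2 * j + 1)) (q\<^sup>2))
  = even_deriv 0 (b - 2 * a) (a * (a - b)) j 2"
proof -
 obtain r where r: "r\<^sup>2 = q" "0 < norm r" "norm r < 1" "norm q < norm r" using csqrt_nome[OF q] by blast
 have pz: "(q / r)\<^sup>2 = q" using r q by (simp add: power_divide power2_eq_square)
 have sn0: "sn_series q r $ 0 = 0" using sn_series_center[OF r(2,3)] r(1) by simp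
 have m: "(-1) ^ (2 * j + 1) = (-1 :: complex)" by simp
 have "((%n. of_nat n ^ (2 * j + 1) * (2 * ((r\<^sup>2) ^ n - 1 * (-1) ^ (2 * j + 1) * ((q / r)\<^sup>2) ^ n) / (1 - 1 * (q\<^sup>2) ^ n)))
   has_sum 4 * (eval_fps (sigma_fps (2 * j + 1)) q + - eval_fps (sigma_fps (2 * j + 1)) (q\<^sup>2))) {1..}"
 proof (subst has_sum_cong)
  show "((%n. 4 * (of_nat n ^ (2 * j + 1) * (q ^ n / (1 - (q ^ n)\<^sup>2)))) has_sum
    4 * (eval_fps (sigma_fps (2 * j + 1)) q + - eval_fps (sigma_fps (2 * j + 1)) (q\<^sup>2))) {1..}"
   unfolding sigma_fps_def by (intro has_sum_cmult_right lambert_odd_has_sum polynomially_bounded_power q)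
  show "of_nat n ^ (2 * j + 1) * (2 * ((r\<^sup>2) ^ n - 1 * (-1) ^ (2 * j + 1) * ((q / r)\<^sup>2) ^ n) / (1 - 1 * (q\<^sup>2) ^ n))
    = 4 * (of_nat n ^ (2 * j + 1) * (q ^ n / (1 - (q ^ n)\<^sup>2)))" for n
   unfolding pz m r(1) power_power_commute[of q 2 n] by simp
 qed
 from elliptic_moment_even[OF q(1) r(4) r(3) _ _ this]
 have "(\<Sum>\<^sub>\<infinity>N. ell_kernel 1 0 q r N * of_int N ^ (2 * j + 1))
   = 2 ^ (2 * j + 1) * (4 * (eval_fps (sigma_fps (2 * j + 1)) q + - eval_fps (sigma_fps (2 * j + 1)) (q\<^sup>2)))"
  by simp
 note M = this
 let ?A = "eval_fps (sigma_fps (2 * j + 1)) q" and ?B = "eval_fps (sigma_fps (2 * j + 1)) (q\<^sup>2)"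
 have "2 ^ (2 * j + 3) * (?A - ?B) = 2 ^ (2 * j + 1) * (4 * (?A + - ?B))" by (simp add: power_add)
 also have "... = fact (2 * j) * (sn_series q r)\<^sup>2 $ (2 * j)"
  using M moment_sn_square[OF q(1) r(4) r(3), of "2 * j"] j by simp
 also have "... = even_deriv 0 (b - 2 * a) (a * (a - b)) j 2"
  using elliptic_moment_sn[OF q(1) r(4) r(3), of j 2] by (simp add: sn0 sech_sum_square[OF q] a_def b_def)
 finally show ?thesis .
qed

lemma i_power_odd: "odd n ==> \<i> ^ n = \<i> * chi4 n" for n :: nat
proof -
 assume "odd n"
 then obtain m where m: "n = 2 * m + 1" by (elim oddE)
 have "\<i> ^ n = \<i> * (-1) ^ m" by (simp add: m power_mult)
 also have "(-1) ^ m = chi4 n"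
 proof (cases "even m")
  case True
  then obtain l where "m = 2 * l" by (elim evenE)
  thus ?thesis by (simp add: m chi4_def)
 next
  case False
  then obtain l where l: "m = 2 * l + 1" by (elim oddE)
  have "n mod 4 = 3" unfolding m l by presburger
  thus ?thesis using False by (simp add: chi4_def)
 qed
 finally show ?thesis .
qed

lemma chi4_even: "even n ==> chi4 n = 0"
 unfolding chi4_def by (auto; presburger)

text \<open>The moments of dn^2 at the boundary point \<zeta> = i, where dn vanishes. For N = 2n the
  sign i^N = (-1)^n is resolved into series in P^2 and P^4, and the equation for \<open>C\<close>
  makes it -tanh t, the source of the constant term.\<close>

lemma sigma_boundary_moment:
 assumes P: "0 < norm P" "norm P < 1" and j: "j > 0" and C: "(1 + fps_exp 2) * C = 1 - fps_exp 2"
 defines "a \<equiv> theta P ^ 4" and "b \<equiv> theta (- P) ^ 4"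
 shows "fact (2 * j + 1) * C $ (2 * j + 1)
   + 2 ^ (2 * j + 3) * (2 ^ (2 * j + 2) * eval_fps (sigma_fps (2 * j + 1)) (P ^ 4) - eval_fps (sigma_fps (2 * j + 1)) (P\<^sup>2))
  = even_deriv 0 (a + b) (a * b) j 2"
proof -
 have P2: "norm (P\<^sup>2) < 1" and P4: "norm (P ^ 4) < 1" using norm_power_less_1[OF P(2)] by auto
 have z: "norm \<i> = 1" "\<i>\<^sup>2 ~= 1" by auto
 have C': "(1 - fps_const (\<i>\<^sup>2) * fps_exp 2) * C = half_geometric_numerator 0 \<i>"
  using C by (simp add: half_geometric_numerator_def flip: fps_const_neg)
 have C0: "C $ 0 = 0"
  using arg_cong[OF C, of "%f. f $ 0"] by simp
 have m: "(-1) ^ (2 * j + 1) = (-1 :: complex)" by simp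
 let ?f = "%n. of_nat n ^ (2 * j + 1) * ((P\<^sup>2) ^ n / (1 - (P\<^sup>2) ^ n))"
 have alt: "((%n. (-1) ^ n * ?f n) has_sum (2 * (2 ^ (2 * j + 1) * eval_fps (sigma_fps (2 * j + 1)) (P ^ 4)) + - eval_fps (sigma_fps (2 * j + 1)) (P\<^sup>2))) {1..}"
 proof (rule has_sum_alternating)
  show "(?f has_sum eval_fps (sigma_fps (2 * j + 1)) (P\<^sup>2)) {1..}"
   unfolding sigma_fps_def by (intro lambert_has_sum(1) polynomially_bounded_power P2)
  show "((%n. ?f (2 * n)) has_sum 2 ^ (2 * j + 1) * eval_fps (sigma_fps (2 * j + 1)) (P ^ 4)) {1..}"
  proof (subst has_sum_cong)
   show "((%n. 2 ^ (2 * j + 1) * (of_nat n ^ (2 * j + 1) * ((P ^ 4) ^ n / (1 - (P ^ 4) ^ n)))) has_sum 2 ^ (2 * j + 1) * eval_fps (sigma_fps (2 * j + 1)) (P ^ 4)) {1..}"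
    unfolding sigma_fps_def by (intro has_sum_cmult_right lambert_has_sum(1) polynomially_bounded_power P4)
   have e: "(P\<^sup>2) ^ (2 * n) = (P ^ 4) ^ n" for n by (simp flip: power_mult)
   show "?f (2 * n) = 2 ^ (2 * j + 1) * (of_nat n ^ (2 * j + 1) * ((P ^ 4) ^ n / (1 - (P ^ 4) ^ n)))" for n
    unfolding e by (simp only: of_nat_mult of_nat_numeral power_mult_distrib mult.assoc)
  qed
 qed
 have "((%n. if even n then of_nat n ^ (2 * j + 1) * (2 * (1 * P ^ n / (1 - 1 * P ^ n)) * (\<i> ^ n - (-1) ^ (2 * j + 1) * (1 / \<i>) ^ n)) else 0)
   has_sum 2 ^ (2 * j + 3) * (2 * (2 ^ (2 * j + 1) * eval_fps (sigma_fps (2 * j + 1)) (P ^ 4)) + - eval_fps (sigma_fps (2 * j + 1)) (P\<^sup>2))) {1..}"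
 proof (rule has_sum_even_nat, subst has_sum_cong)
  show "((%n. 2 ^ (2 * j + 3) * ((-1) ^ n * ?f n)) has_sum 2 ^ (2 * j + 3) * (2 * (2 ^ (2 * j + 1) * eval_fps (sigma_fps (2 * j + 1)) (P ^ 4)) + - eval_fps (sigma_fps (2 * j + 1)) (P\<^sup>2))) {1..}"
   by (rule has_sum_cmult_right[OF alt])
  fix n :: nat
  have e: "\<i> ^ (2 * n) = (-1) ^ n" "(1 / \<i>) ^ (2 * n) = (-1) ^ n" "P ^ (2 * n) = (P\<^sup>2) ^ n"
   by (simp_all add: power_mult)
  have t: "(2::complex) ^ (2 * j + 3) = 2 ^ (2 * j + 1) * 4" by (simp add: power_add)
  show "of_nat (2 * n) ^ (2 * j + 1) * (2 * (1 * P ^ (2 * n) / (1 - 1 * P ^ (2 * n))) * (\<i> ^ (2 * n) - (-1) ^ (2 * j + 1) * (1 / \<i>) ^ (2 * n)))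
    = 2 ^ (2 * j + 3) * ((-1) ^ n * ?f n)"
   unfolding e m t of_nat_mult of_nat_numeral power_mult_distrib by (simp add: mult_ac)
 qed
 hence "((%n. if int n mod 2 = 0 then of_nat n ^ (2 * j + 1) * (2 * (1 * P ^ n / (1 - 1 * P ^ n)) * (\<i> ^ n - (-1) ^ (2 * j + 1) * (1 / \<i>) ^ n)) else 0)
   has_sum 2 ^ (2 * j + 3) * (2 * (2 ^ (2 * j + 1) * eval_fps (sigma_fps (2 * j + 1)) (P ^ 4)) + - eval_fps (sigma_fps (2 * j + 1)) (P\<^sup>2))) {1..}"
  by (rule has_sum_cong[THEN iffD1, rotated]) (auto simp flip: even_iff_mod_2_eq_zero)
 from boundary_moment_eq[OF P(2) z(1) _ this, of C]
 have 1: "boundary_moment 1 0 P \<i> C (2 * j + 1) = fact (2 * j + 1) * C $ (2 * j + 1)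
   + 2 ^ (2 * j + 3) * (2 * (2 ^ (2 * j + 1) * eval_fps (sigma_fps (2 * j + 1)) (P ^ 4)) + - eval_fps (sigma_fps (2 * j + 1)) (P\<^sup>2))"
  by simp
 have "((%n. if int n mod 2 = 0 then of_nat n ^ 0 * (2 * (-1 * P ^ n / (1 - -1 * P ^ n)) * (\<i> ^ n - (-1) ^ 0 * (1 / \<i>) ^ n)) else 0) has_sum 0) {1..}"
 proof (subst has_sum_cong)
  show "((%_. 0) has_sum (0::complex)) {1::nat..}" by simp
  have "\<i> ^ n - (1 / \<i>) ^ n = 0" if "even n" for n :: nat using that by (elim evenE) (simp add: power_mult)
  thus "(if int n mod 2 = 0 then of_nat n ^ 0 * (2 * (-1 * P ^ n / (1 - -1 * P ^ n)) * (\<i> ^ n - (-1) ^ 0 * (1 / \<i>) ^ n)) else 0) = 0" for n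
   by (simp flip: even_iff_mod_2_eq_zero)
 qed
 from boundary_moment_eq[OF P(2) z(1) _ this, of C] C0
 have 2: "boundary_moment (-1) 0 P \<i> C 0 = 0" by simp
 have K: "2 ^ (2 * j + 2) * A - B = 2 * (2 ^ (2 * j + 1) * A) + - B" for A B :: complex by simp
 show ?thesis
  using boundary_moment_dn_square[OF P z j C'] unfolding 1 2 K sech_sum_square[OF P] a_def b_def
  by simp
qed

text \<open>The central point \<zeta>^2 = P = q, at which dn is the square of \<open>theta q\<close>
  and the summand q^n / (1 + q^(2n)) generates the character modulo 4.\<close>

lemma zero4_moment:
 assumes q: "0 < norm q" "norm q < 1" and j: "j > 0"
 defines "y \<equiv> (theta q)\<^sup>2" and "a \<equiv> theta q ^ 4" and "b \<equiv> theta (- q) ^ 4"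
 shows "4 ^ (j + 1) * eval_fps (chi_zero_fps chi4 (2 * j)) q = y * even_deriv (y\<^sup>2) (a + b) (a * b) j 1"
proof -
 obtain r where r: "r\<^sup>2 = q" "0 < norm r" "norm r < 1" "norm q < norm r" using csqrt_nome[OF q] by blast
 have pz: "(q / r)\<^sup>2 = q" using r q by (simp add: power_divide power2_eq_square)
 have dn0: "dn_series q r $ 0 = y"
  using sech_sum_eq_dn(1)[of r] sech_sum_eq_theta_square[OF q] by (simp add: r(1) y_def)
 have m: "(-1) ^ (2 * j) = (1 :: complex)" by simp
 have "((%n. of_nat n ^ (2 * j) * (2 * ((r\<^sup>2) ^ n - (-1) * (-1) ^ (2 * j) * ((q / r)\<^sup>2) ^ n) / (1 - (-1) * (q\<^sup>2) ^ n)))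
   has_sum 4 * eval_fps (chi_zero_fps chi4 (2 * j)) q) {1..}"
 proof (subst has_sum_cong)
  show "((%n. 4 * (of_nat n ^ (2 * j) * (q ^ n / (1 + (q ^ n)\<^sup>2)))) has_sum 4 * eval_fps (chi_zero_fps chi4 (2 * j)) q) {1..}"
   unfolding chi_zero_fps_def by (intro has_sum_cmult_right lambert_has_sum(2) polynomially_bounded_power q)
  show "of_nat n ^ (2 * j) * (2 * ((r\<^sup>2) ^ n - (-1) * (-1) ^ (2 * j) * ((q / r)\<^sup>2) ^ n) / (1 - (-1) * (q\<^sup>2) ^ n))
    = 4 * (of_nat n ^ (2 * j) * (q ^ n / (1 + (q ^ n)\<^sup>2)))" for n
   unfolding pz m r(1) power_power_commute[of q 2 n] by simp
 qed
 from elliptic_moment_even[OF q(1) r(4) r(3) _ _ this] j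
 have "(\<Sum>\<^sub>\<infinity>N. ell_kernel (-1) 0 q r N * of_int N ^ (2 * j)) = 4 ^ j * (4 * eval_fps (chi_zero_fps chi4 (2 * j)) q)"
  by (simp add: power_mult)
 thus ?thesis
  using elliptic_moment_dn[OF q(1) r(4) r(3), of j 1] moment_dn[of "2 * j" q r]
  by (simp add: dn0 sech_sum_square[OF q] a_def b_def mult_ac)
qed

text \<open>For nome q^2 and \<zeta> = i q both \<zeta>^2 and (P / \<zeta>)^2 equal -q^2. The signs
  (-1)^n that this produces are resolved into series in q^2 and q^4; dn is the square of theta at
  -q^2.\<close>

lemma zero4_alternating_moment:
 assumes q: "0 < norm q" "norm q < 1" and j: "j > 0"
 defines "y \<equiv> (theta (- q\<^sup>2))\<^sup>2" and "a \<equiv> theta (q\<^sup>2) ^ 4" and "b \<equiv> theta (- q\<^sup>2) ^ 4"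
 shows "4 ^ (j + 1) * (2 * 4 ^ j * eval_fps (chi_zero_fps chi4 (2 * j)) (q ^ 4) - eval_fps (chi_zero_fps chi4 (2 * j)) (q\<^sup>2))
   = y * even_deriv (y\<^sup>2) (a + b) (a * b) j 1"
proof -
 have n: "0 < norm (q\<^sup>2)" "norm (q\<^sup>2) < norm (\<i> * q)" "norm (\<i> * q) < 1" "norm (q\<^sup>2) < 1" "norm (q ^ 4) < 1"
  using norm_power_between[OF q, of 1 2] q norm_power_less_1[OF q(2)] by (simp_all add: norm_mult)
 have zz: "(\<i> * q)\<^sup>2 = - (q\<^sup>2)" by (simp add: power_mult_distrib)
 have pz: "(q\<^sup>2 / (\<i> * q))\<^sup>2 = - (q\<^sup>2)" unfolding power_divide zz using q by (simp add: power2_eq_square)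
 have dn0: "dn_series (q\<^sup>2) (\<i> * q) $ 0 = y"
  using sech_sum_eq_dn(2)[of q] sech_sum_eq_theta_square[of "- q\<^sup>2"] n by (simp add: y_def)
 have m: "(-1) ^ (2 * j) = (1 :: complex)" by simp
 let ?f = "%n. of_nat n ^ (2 * j) * ((q\<^sup>2) ^ n / (1 + ((q\<^sup>2) ^ n)\<^sup>2))"
 have alt: "((%n. (-1) ^ n * ?f n) has_sum (2 * (4 ^ j * eval_fps (chi_zero_fps chi4 (2 * j)) (q ^ 4)) + - eval_fps (chi_zero_fps chi4 (2 * j)) (q\<^sup>2))) {1..}"
 proof (rule has_sum_alternating)
  show "(?f has_sum eval_fps (chi_zero_fps chi4 (2 * j)) (q\<^sup>2)) {1..}"
   unfolding chi_zero_fps_def by (intro lambert_has_sum(2) polynomially_bounded_power n)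
  show "((%n. ?f (2 * n)) has_sum 4 ^ j * eval_fps (chi_zero_fps chi4 (2 * j)) (q ^ 4)) {1..}"
  proof (subst has_sum_cong)
   show "((%n. 4 ^ j * (of_nat n ^ (2 * j) * ((q ^ 4) ^ n / (1 + ((q ^ 4) ^ n)\<^sup>2)))) has_sum 4 ^ j * eval_fps (chi_zero_fps chi4 (2 * j)) (q ^ 4)) {1..}"
    unfolding chi_zero_fps_def by (intro has_sum_cmult_right lambert_has_sum(2) polynomially_bounded_power n)
   have e: "(q\<^sup>2) ^ (2 * n) = (q ^ 4) ^ n" for n by (simp flip: power_mult)
   have f: "(2::complex) ^ (2 * j) = 4 ^ j" by (simp add: power_mult)
   show "?f (2 * n) = 4 ^ j * (of_nat n ^ (2 * j) * ((q ^ 4) ^ n / (1 + ((q ^ 4) ^ n)\<^sup>2)))" for n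
    unfolding e by (simp only: of_nat_mult of_nat_numeral power_mult_distrib mult.assoc f)
  qed
 qed
 have "((%n. of_nat n ^ (2 * j) * (2 * (((\<i> * q)\<^sup>2) ^ n - (-1) * (-1) ^ (2 * j) * ((q\<^sup>2 / (\<i> * q))\<^sup>2) ^ n) / (1 - (-1) * ((q\<^sup>2)\<^sup>2) ^ n)))
   has_sum 4 * (2 * (4 ^ j * eval_fps (chi_zero_fps chi4 (2 * j)) (q ^ 4)) + - eval_fps (chi_zero_fps chi4 (2 * j)) (q\<^sup>2))) {1..}"
 proof (subst has_sum_cong)
  show "((%n. 4 * ((-1) ^ n * ?f n)) has_sum 4 * (2 * (4 ^ j * eval_fps (chi_zero_fps chi4 (2 * j)) (q ^ 4)) + - eval_fps (chi_zero_fps chi4 (2 * j)) (q\<^sup>2))) {1..}"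
   by (rule has_sum_cmult_right[OF alt])
  show "of_nat n ^ (2 * j) * (2 * (((\<i> * q)\<^sup>2) ^ n - (-1) * (-1) ^ (2 * j) * ((q\<^sup>2 / (\<i> * q))\<^sup>2) ^ n) / (1 - (-1) * ((q\<^sup>2)\<^sup>2) ^ n))
    = 4 * ((-1) ^ n * ?f n)" for n
   unfolding pz zz m power_power_commute[of "q\<^sup>2" 2 n] power_minus[of "q\<^sup>2"] by simp
 qed
 from elliptic_moment_even[OF n(1-3) _ _ this] j
 have "(\<Sum>\<^sub>\<infinity>N. ell_kernel (-1) 0 (q\<^sup>2) (\<i> * q) N * of_int N ^ (2 * j))
   = 4 ^ j * (4 * (2 * (4 ^ j * eval_fps (chi_zero_fps chi4 (2 * j)) (q ^ 4)) + - eval_fps (chi_zero_fps chi4 (2 * j)) (q\<^sup>2)))"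
  by (simp add: power_mult)
 thus ?thesis
  using elliptic_moment_dn[OF n(1-3), of j 1] moment_dn[of "2 * j" "q\<^sup>2" "\<i> * q"]
  by (simp add: dn0 sech_sum_square[OF n(1,4)] a_def b_def mult_ac)
qed

lemma theta_square_lambert:
 assumes "0 < norm q" "norm q < 1"
 shows "(theta q)\<^sup>2 = 1 + 4 * eval_fps (chi_inf_fps chi4 0) q"
 using sech_sum_lambert(1)[OF assms] sech_sum_eq_theta_square[OF assms]
 by (simp add: chi_inf_fps_def lambert_fps_commute[of "%_. 1"])

lemma theta_product_lambert:
 assumes "0 < norm q" "norm q < 1"
 shows "theta q * theta (q\<^sup>2) = 1 + 2 * eval_fps (chi_inf_fps chi8 0) q"
 using sech_sum_lambert(2)[OF assms] sech_sum_fine_eq_theta_product[OF assms]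
 by (simp add: chi_inf_fps_def lambert_fps_commute[of "%_. 1"])

text \<open>The point \<zeta> = i q once more, now with the odd indices of sn: for odd n, i^n = i
  \<open>chi4 n\<close> converts the signs into the character. The value \<open>y\<close> of sn is
  the moment of order 0, a difference of two two-square series.\<close>

lemma inf4_moment:
 assumes q: "0 < norm q" "norm q < 1"
 defines "y \<equiv> \<i> * ((theta q)\<^sup>2 - (theta (q\<^sup>2))\<^sup>2)" and "a \<equiv> theta (q\<^sup>2) ^ 4" and "b \<equiv> theta (- q\<^sup>2) ^ 4"
 shows "4 * \<i> * (eval_fps (chi_inf_fps chi4 (2 * j)) q - eval_fps (chi_inf_fps chi4 (2 * j)) (q\<^sup>2))
   = y * even_deriv (y\<^sup>2) (b - 2 * a) (a * (a - b)) j 1"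
proof -
 have n: "0 < norm (q\<^sup>2)" "norm (q\<^sup>2) < norm (\<i> * q)" "norm (\<i> * q) < 1" "norm (q\<^sup>2) < 1" "norm (q ^ 4) < 1"
  using norm_power_between[OF q, of 1 2] q norm_power_less_1[OF q(2)] by (simp_all add: norm_mult)
 have pz: "q\<^sup>2 / (\<i> * q) = - (\<i> * q)" using q by (simp add: power2_eq_square field_simps)
 have M: "(\<Sum>\<^sub>\<infinity>N. ell_kernel 1 1 (q\<^sup>2) (\<i> * q) N * of_int N ^ (2 * j))
   = 4 * \<i> * (eval_fps (chi_inf_fps chi4 (2 * j)) q + - eval_fps (chi_inf_fps chi4 (2 * j)) (q\<^sup>2))" for j
 proof (rule elliptic_moment_odd[OF n(1-3)], simp, subst has_sum_cong)
  show "((%n. 4 * \<i> * (chi4 n * of_nat n ^ (2 * j) * (q ^ n / (1 - (q ^ n)\<^sup>2)))) has_sum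
    4 * \<i> * (eval_fps (chi_inf_fps chi4 (2 * j)) q + - eval_fps (chi_inf_fps chi4 (2 * j)) (q\<^sup>2))) {1..}"
   unfolding chi_inf_fps_def
   by (intro has_sum_cmult_right lambert_odd_has_sum polynomially_bounded_power_times norm_chi_le q)
  fix n :: nat
  have m: "(-1) ^ (2 * j) = (1 :: complex)" by simp
  show "(if odd n then of_nat n ^ (2 * j) * (2 * ((\<i> * q) ^ n - 1 * (-1) ^ (2 * j) * (q\<^sup>2 / (\<i> * q)) ^ n) / (1 - 1 * (q\<^sup>2) ^ n)) else 0)
    = 4 * \<i> * (chi4 n * of_nat n ^ (2 * j) * (q ^ n / (1 - (q ^ n)\<^sup>2)))"
  proof (cases "odd n")
   case True
   thus ?thesis unfolding pz m power_power_commute[of q 2 n] by (simp add: power_mult_distrib i_power_odd)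
  qed (simp add: chi4_even)
 qed
 have sn0: "sn_series (q\<^sup>2) (\<i> * q) $ 0 = y"
  using M[of 0] moment_sn[of 0 "q\<^sup>2" "\<i> * q"] theta_square_lambert[OF q] theta_square_lambert[OF n(1,4)]
  by (simp add: y_def algebra_simps)
 show ?thesis
  using M[of j] elliptic_moment_sn[OF n(1-3), of j 1] moment_sn[of "2 * j" "q\<^sup>2" "\<i> * q"]
  by (simp add: sn0 sech_sum_square[OF n(1,4)] a_def b_def)
qed

text \<open>The boundary point \<zeta> = i with odd indices. Here C = i / cosh t, and its constant
  term i completes the moment of order 0 to i times the two-square series.\<close>

lemma inf4_boundary_moment:
 assumes P: "0 < norm P" "norm P < 1" and C: "(1 + fps_exp 2) * C = fps_const (2 * \<i>) * fps_exp 1"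
 defines "y \<equiv> \<i> * (theta P)\<^sup>2" and "a \<equiv> theta P ^ 4" and "b \<equiv> theta (- P) ^ 4"
 shows "fact (2 * j) * C $ (2 * j) + 4 * \<i> * eval_fps (chi_inf_fps chi4 (2 * j)) P
   = y * even_deriv (y\<^sup>2) (b - 2 * a) (a * (a - b)) j 1"
proof -
 have z: "norm \<i> = 1" "\<i>\<^sup>2 ~= 1" by auto
 have C': "(1 - fps_const (\<i>\<^sup>2) * fps_exp 2) * C = half_geometric_numerator 1 \<i>"
  using C by (simp add: half_geometric_numerator_def flip: fps_const_neg)
 have C0: "C $ 0 = \<i>"
  using arg_cong[OF C, of "%f. f $ 0"] by simp
 have M: "boundary_moment 1 1 P \<i> C (2 * j) = fact (2 * j) * C $ (2 * j) + 4 * \<i> * eval_fps (chi_inf_fps chi4 (2 * j)) P" for j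
 proof (rule boundary_moment_eq[OF P(2) z(1)], simp, subst has_sum_cong)
  show "((%n. 4 * \<i> * (chi4 n * of_nat n ^ (2 * j) * (P ^ n / (1 - P ^ n)))) has_sum
    4 * \<i> * eval_fps (chi_inf_fps chi4 (2 * j)) P) {1..}"
   unfolding chi_inf_fps_def
   by (intro has_sum_cmult_right lambert_has_sum(1) polynomially_bounded_power_times norm_chi_le P)
  fix n :: nat
  have m: "(-1) ^ (2 * j) = (1 :: complex)" by simp
  have i: "1 / \<i> = - \<i>" by simp
  show "(if int n mod 2 = 1 then of_nat n ^ (2 * j) * (2 * (1 * P ^ n / (1 - 1 * P ^ n)) * (\<i> ^ n - (-1) ^ (2 * j) * (1 / \<i>) ^ n)) else 0)
    = 4 * \<i> * (chi4 n * of_nat n ^ (2 * j) * (P ^ n / (1 - P ^ n)))"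
  proof (cases "odd n")
   case True
   thus ?thesis unfolding m i by (simp add: i_power_odd flip: odd_iff_mod_2_eq_one)
  qed (simp add: chi4_even flip: odd_iff_mod_2_eq_one)
 qed
 have y: "boundary_moment 1 1 P \<i> C 0 = y"
  using M[of 0] theta_square_lambert[OF P] C0 by (simp add: y_def algebra_simps)
 show ?thesis
  using boundary_moment_sn[OF P z C', of j] unfolding y M
  by (simp add: sech_sum_square[OF P] a_def b_def)
qed

text \<open>As \<zeta> has order dividing 8, only n mod 8 matters, and the four odd residues are
  compared using 1 / \<zeta> = -i \<zeta>.\<close>

lemma eighth_root_power_odd:
 fixes \<zeta> :: complex
 assumes z: "\<zeta>\<^sup>2 = \<i>" and n: "odd n"
 shows "\<zeta> ^ n - (1 / \<zeta>) ^ n = (\<zeta> - 1 / \<zeta>) * chi8 n"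
proof -
 define w where "w = 1 / \<zeta>"
 have w: "w\<^sup>2 = - \<i>" by (simp add: w_def power_divide z)
 have z0: "\<zeta> ~= 0" using z by auto
 have zw: "\<zeta> * w = 1" using z0 by (simp add: w_def)
 have w2: "w = - \<i> * \<zeta>"
 proof -
  have "w = w\<^sup>2 * \<zeta>" using zw by (simp add: power2_eq_square mult.commute)
  thus ?thesis by (simp add: w)
 qed
 have z8: "\<zeta> ^ 8 = 1" "w ^ 8 = 1"
 proof -
  have e: "x ^ 8 = ((x\<^sup>2)\<^sup>2)\<^sup>2" for x :: complex by (simp flip: power_mult)
  show "\<zeta> ^ 8 = 1" "w ^ 8 = 1" unfolding e z w by simp_all
 qed
 have e: "x ^ n = x ^ (n mod 8)" if "x ^ 8 = 1" for x :: complex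
 proof -
  have "x ^ n = x ^ (8 * (n div 8) + n mod 8)" by simp
  also have "... = x ^ (n mod 8)" unfolding power_add power_mult that by simp
  finally show ?thesis .
 qed
 have p: "x ^ 3 = x\<^sup>2 * x" "x ^ 5 = (x\<^sup>2)\<^sup>2 * x" "x ^ 7 = x\<^sup>2 * (x\<^sup>2)\<^sup>2 * x" for x :: complex
  by (simp_all add: eval_nat_numeral mult_ac)
 have "n mod 8 = 1 \<or> n mod 8 = 3 \<or> n mod 8 = 5 \<or> n mod 8 = 7" using n by presburger
 then consider "n mod 8 = 1" | "n mod 8 = 3" | "n mod 8 = 5" | "n mod 8 = 7" by blast
 hence "\<zeta> ^ n - w ^ n = (\<zeta> - w) * chi8 n"
 proof cases
  case 2
  show ?thesis unfolding e[OF z8(1)] e[OF z8(2)] 2 p z w using 2 by (simp add: chi8_def w2 algebra_simps)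
 next
  case 3
  show ?thesis unfolding e[OF z8(1)] e[OF z8(2)] 3 p z w using 3 by (simp add: chi8_def algebra_simps)
 next
  case 4
  show ?thesis unfolding e[OF z8(1)] e[OF z8(2)] 4 p z w using 4 by (simp add: chi8_def w2 algebra_simps)
 qed (simp add: e[OF z8(1)] e[OF z8(2)] chi8_def)
 thus ?thesis by (simp add: w_def)
qed

lemma chi8_even: "even n ==> chi8 n = 0"
 unfolding chi8_def by (auto; presburger)

text \<open>The moments of sn at an eighth root of unity, where the odd-index signs are d times the
  character modulo 8 and the value of sn is d times the theta product.\<close>

lemma inf8_boundary_moment:
 assumes q: "0 < norm q" "norm q < 1" and z: "\<zeta>\<^sup>2 = \<i>" "norm \<zeta> = 1"
  and C: "(1 - fps_const \<i> * fps_exp 2) * C = fps_const (2 * \<zeta>) * fps_exp 1"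
 defines "d \<equiv> \<zeta> - 1 / \<zeta>"
 defines "y \<equiv> d * (theta q * theta (q\<^sup>2))" and "a \<equiv> theta q ^ 4" and "b \<equiv> theta (- q) ^ 4"
 shows "fact (2 * j) * C $ (2 * j) + 2 * d * eval_fps (chi_inf_fps chi8 (2 * j)) q
   = y * even_deriv (y\<^sup>2) (b - 2 * a) (a * (a - b)) j 1"
proof -
 have z1: "\<zeta>\<^sup>2 ~= 1" using z by (simp add: complex_eq_iff)
 have C': "(1 - fps_const (\<zeta>\<^sup>2) * fps_exp 2) * C = half_geometric_numerator 1 \<zeta>"
  using C by (simp add: half_geometric_numerator_def z)
 have C0: "C $ 0 = d"
 proof -
  have i: "1 - \<i> ~= 0" by (simp add: complex_eq_iff)
  have z0: "\<zeta> ~= 0" using z by auto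
  have "(1 - \<i>) * C $ 0 = 2 * \<zeta>"
   using arg_cong[OF C, of "%f. f $ 0"] by simp
  moreover have "(1 - \<i>) * d = 2 * \<zeta>"
  proof -
   have "1 / \<zeta> = - \<i> * \<zeta>" using z z0 by (simp add: field_simps power2_eq_square)
   thus ?thesis by (simp add: d_def algebra_simps)
  qed
  ultimately show ?thesis using i by (metis mult_left_cancel)
 qed
 have M: "boundary_moment 1 1 q \<zeta> C (2 * j) = fact (2 * j) * C $ (2 * j) + 2 * d * eval_fps (chi_inf_fps chi8 (2 * j)) q" for j
 proof (rule boundary_moment_eq[OF q(2) z(2)], simp, subst has_sum_cong)
  show "((%n. 2 * d * (chi8 n * of_nat n ^ (2 * j) * (q ^ n / (1 - q ^ n)))) has_sum
    2 * d * eval_fps (chi_inf_fps chi8 (2 * j)) q) {1..}"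
   unfolding chi_inf_fps_def
   by (intro has_sum_cmult_right lambert_has_sum(1) polynomially_bounded_power_times norm_chi_le q)
  fix n :: nat
  have m: "(-1) ^ (2 * j) = (1 :: complex)" by simp
  show "(if int n mod 2 = 1 then of_nat n ^ (2 * j) * (2 * (1 * q ^ n / (1 - 1 * q ^ n)) * (\<zeta> ^ n - (-1) ^ (2 * j) * (1 / \<zeta>) ^ n)) else 0)
    = 2 * d * (chi8 n * of_nat n ^ (2 * j) * (q ^ n / (1 - q ^ n)))"
  proof (cases "odd n")
   case True
   have "int n mod 2 = 1" using True by presburger
   thus ?thesis unfolding m mult_1 eighth_root_power_odd[OF z(1) True] by (simp add: d_def)
  next
   case False
   hence "int n mod 2 ~= 1" by presburger
   thus ?thesis using False by (simp add: chi8_even)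
  qed
 qed
 have y: "boundary_moment 1 1 q \<zeta> C 0 = y"
  using M[of 0] theta_product_lambert[OF q] C0 by (simp add: y_def algebra_simps)
 show ?thesis
  using boundary_moment_sn[OF q z(2) z1 C', of j] unfolding y M
  by (simp add: sech_sum_square[OF q] a_def b_def)
qed

section \<open>Symmetrisation under w to 2 / w\<close>

text \<open>Homogeneity: \<open>h\<close> and \<open>s\<close> have weight 1, \<open>p\<close> has
  weight 2, and every term of the recursion has weight n div 2 + j.\<close>

lemma even_deriv_scale:
 "even_deriv (c * h) (c * s) (c ^ 2 * p) j n = c ^ (n div 2 + j) * even_deriv h s p j n"
proof (induction j arbitrary: n)
 case 0
 show ?case by (simp add: power_mult_distrib)
next
 case (Suc j)
 have 1: "c ^ ((n + 2) div 2 + j) = c ^ (n div 2 + Suc j)" by simp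
 have 2: "c * c ^ (n div 2 + j) = c ^ (n div 2 + Suc j)" by simp
 have 3: "of_nat (n * (n - 1)) * (c ^ 2 * c ^ ((n - 2) div 2 + j)) = of_nat (n * (n - 1)) * c ^ (n div 2 + Suc j)"
 proof (cases "n >= 2")
  case True
  then obtain m where m: "n = m + 2" by (metis add.commute le_Suc_ex)
  show ?thesis by (simp add: m power2_eq_square mult.assoc del: of_nat_mult of_nat_add)
 next
  case False
  hence "n = 0 \<or> n = 1" by auto
  thus ?thesis by auto
 qed
 have a: "of_nat (n * n) * (c * s) * (c ^ (n div 2 + j) * e) = c ^ (n div 2 + Suc j) * (of_nat (n * n) * s * e)" for e
  unfolding 2[symmetric] by (simp only: mult_ac)
 have b: "of_nat (n * (n - 1)) * (c ^ 2 * p) * (c ^ ((n - 2) div 2 + j) * e) = c ^ (n div 2 + Suc j) * (of_nat (n * (n - 1)) * p * e)" for e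
 proof -
  have "of_nat (n * (n - 1)) * (c ^ 2 * p) * (c ^ ((n - 2) div 2 + j) * e)
    = (of_nat (n * (n - 1)) * (c ^ 2 * c ^ ((n - 2) div 2 + j))) * (p * e)" by (simp only: mult_ac)
  also have "... = c ^ (n div 2 + Suc j) * (of_nat (n * (n - 1)) * p * e)" unfolding 3 by (simp only: mult_ac)
  finally show ?thesis .
 qed
 show ?case
  unfolding even_deriv.simps Suc.IH a b 1
  by (simp add: algebra_simps del: of_nat_mult of_nat_add power_Suc)
qed

lemma poly_even_deriv:
 "poly (even_deriv h s p j n) x = even_deriv (poly h x) (poly s x) (poly p x) j n"
 by (induction j arbitrary: n) (simp_all del: of_nat_mult of_nat_add)

lemma degree_even_deriv:
 fixes h s p :: "complex poly"
 assumes "degree h <= d" "degree s <= d" "degree p <= 2 * d"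
 shows "degree (even_deriv h s p j n) <= d * (n div 2 + j)"
proof (induction j arbitrary: n)
 case 0
 have "degree (h ^ (n div 2)) <= degree h * (n div 2)" by (rule degree_power_le)
 also have "... <= d * (n div 2)" using assms by simp
 finally show ?case by simp
next
 case (Suc j)
 have m: "degree (f * g) <= a + b" if "degree f <= a" "degree g <= b" for f g :: "complex poly" and a b
  using degree_mult_le[of f g] that by linarith
 have o: "degree (of_nat k :: complex poly) <= 0" for k by simp
 have 1: "degree (of_nat (n * (n + 1)) * even_deriv h s p j (n + 2)) <= d * (n div 2 + Suc j)"
  using m[OF o Suc.IH[of "n + 2"], of "n * (n + 1)"] by simp
 have 2: "degree (of_nat (n * n) * s * even_deriv h s p j n) <= d * (n div 2 + Suc j)"
  using m[OF m[OF o assms(2)] Suc.IH[of n], of "n * n"] by (simp add: algebra_simps)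
 have 3: "degree (of_nat (n * (n - 1)) * p * even_deriv h s p j (n - 2)) <= d * (n div 2 + Suc j)"
 proof (cases "n >= 2")
  case True
  then obtain m' where m': "n = m' + 2" by (metis add.commute le_Suc_ex)
  show ?thesis
   using m[OF m[OF o assms(3)] Suc.IH[of "n - 2"], of "n * (n - 1)"] by (simp add: m' algebra_simps)
 next
  case False
  hence "n = 0 \<or> n = 1" by auto
  thus ?thesis by auto
 qed
 show ?case unfolding even_deriv.simps using 1 2 3 by (intro degree_add_le degree_diff_le)
qed

text \<open>With u = 2 / w, so that w u = 2, the recursion is w^(f+2) + u^(f+2) = (w + u)(w^(f+1) +
  u^(f+1)) - w u (w^f + u^f).\<close>

lemma power_sum_reciprocal_poly:
 "\<exists>P :: complex poly. degree P <= e & (\<forall>w. w ~= 0 --> w ^ e + (2 / w) ^ e = poly P (w + 2 / w))"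
proof (induction e rule: less_induct)
 case (less e)
 consider "e = 0" | "e = 1" | f where "e = f + 2" by (metis One_nat_def add_2_eq_Suc' not0_implies_Suc)
 thus ?case
 proof cases
  case 1 thus ?thesis by (intro exI[of _ "[:2:]"]) auto
 next
  case 2 thus ?thesis by (intro exI[of _ "[:0, 1:]"]) auto
 next
  case (3 f)
  obtain P :: "complex poly" where P: "degree P <= f" "!!w. w ~= 0 ==> w ^ f + (2 / w) ^ f = poly P (w + 2 / w)"
   using less.IH[of f] 3 by auto
  obtain R :: "complex poly" where R: "degree R <= f + 1" "!!w. w ~= 0 ==> w ^ (f + 1) + (2 / w) ^ (f + 1) = poly R (w + 2 / w)"
   using less.IH[of "f + 1"] 3 by auto
  have "degree (pCons 0 R - Polynomial.smult 2 P) <= e"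
   using P(1) R(1) 3 by (intro degree_diff_le) (auto intro: order.trans[OF degree_pCons_le])
  moreover have "w ^ e + (2 / w) ^ e = poly (pCons 0 R - Polynomial.smult 2 P) (w + 2 / w)" if w: "w ~= 0" for w :: complex
  proof -
   define u where "u = 2 / w"
   have wu: "w * u = 2" using w by (simp add: u_def)
   have P': "w ^ f + u ^ f = poly P (w + u)" and R': "w ^ (f + 1) + u ^ (f + 1) = poly R (w + u)"
    using P(2)[OF w] R(2)[OF w] by (simp_all add: u_def)
   have "w ^ (f + 2) + u ^ (f + 2) = (w + u) * (w ^ (f + 1) + u ^ (f + 1)) - (w * u) * (w ^ f + u ^ f)"
    by (simp add: algebra_simps)
   hence "w ^ (f + 2) + u ^ (f + 2) = (w + u) * poly R (w + u) - 2 * poly P (w + u)"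
    unfolding P' R' wu .
   thus ?thesis by (simp add: 3 u_def[symmetric])
  qed
  ultimately show ?thesis by blast
 qed
qed

lemma poly_altdef_le:
 fixes p :: "complex poly"
 assumes "degree p <= n"
 shows "poly p x = (\<Sum>i\<le>n. poly.coeff p i * x ^ i)"
 unfolding poly_altdef by (rule sum.mono_neutral_left) (use assms in \<open>auto simp: coeff_eq_0\<close>)

text \<open>The monomial w^(i - M) and its image under w to 2 / w add up to a multiple of a power
  sum of exponent |i - M|, and the degree bound on h keeps that exponent at most M.\<close>

lemma symmetric_laurent_poly:
 fixes h :: "complex poly"
 assumes "degree h <= 2 * M"
 shows "\<exists>P. degree P <= M & (\<forall>w. w ~= 0 --> poly h w / w ^ M + poly h (2 / w) / (2 / w) ^ M = poly P (w + 2 / w))"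
proof -
 obtain C :: "nat => complex poly" where C: "!!e. degree (C e) <= e"
  "!!e w. w ~= 0 ==> w ^ e + (2 / w) ^ e = poly (C e) (w + 2 / w)"
  using power_sum_reciprocal_poly by metis
 define g where "g i = (if i >= M then Polynomial.smult (poly.coeff h i) (C (i - M)) else Polynomial.smult (poly.coeff h i / 2 ^ (M - i)) (C (M - i)))" for i
 have g: "poly.coeff h i * w ^ i / w ^ M + poly.coeff h i * (2 / w) ^ i / (2 / w) ^ M = poly (g i) (w + 2 / w)" if w: "w ~= 0" for i w
 proof (cases "i >= M")
  case True
  then obtain e where e: "i = M + e" using le_Suc_ex by blast
  have "poly.coeff h i * w ^ i / w ^ M + poly.coeff h i * (2 / w) ^ i / (2 / w) ^ M = poly.coeff h i * (w ^ e + (2 / w) ^ e)"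
   using w by (simp add: e power_add algebra_simps)
  thus ?thesis using True C(2)[OF w, of e] by (simp add: g_def e)
 next
  case False
  then obtain e where e: "M = i + e" using nat_le_linear le_Suc_ex by blast
  have "poly.coeff h i * w ^ i / w ^ M + poly.coeff h i * (2 / w) ^ i / (2 / w) ^ M = poly.coeff h i / 2 ^ e * (w ^ e + (2 / w) ^ e)"
   using w by (simp add: e power_add power_divide field_simps)
  thus ?thesis using False C(2)[OF w, of e] by (simp add: g_def e)
 qed
 define P where "P = (\<Sum>i\<le>2 * M. g i)"
 have "degree P <= M"
  unfolding P_def
 proof (rule degree_sum_le)
  fix i assume i: "i \<in> {..2 * M}"
  have "degree (Polynomial.smult c (C e)) <= M" if "e <= M" for c e
   using degree_smult_le[of c "C e"] C(1)[of e] that by linarith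
  thus "degree (g i) <= M" using i by (auto simp: g_def)
 qed simp
 moreover have "poly h w / w ^ M + poly h (2 / w) / (2 / w) ^ M = poly P (w + 2 / w)" if "w ~= 0" for w
 proof -
  have "poly h x = (\<Sum>i\<le>2 * M. poly.coeff h i * x ^ i)" for x
   using assms by (rule poly_altdef_le)
  thus ?thesis
   by (simp add: P_def poly_sum sum_divide_distrib g[OF that, symmetric] sum.distrib)
 qed
 ultimately show ?thesis by blast
qed

text \<open>w^M P(w + 2 / w) is a polynomial whose constant term is 2^M times the coefficient of
  degree M of P. If it vanishes, the degree drops.\<close>

lemma reduce_degree:
 fixes P Q :: "complex poly"
 assumes P: "degree P <= M" "M >= 1" and Q: "!!w. w ~= 0 ==> poly Q w = w ^ M * poly P (w + 2 / w)" and "poly.coeff Q 0 = 0"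
 shows "degree P <= M - 1"
proof -
 define R where "R = (\<Sum>i\<le>M. Polynomial.smult (poly.coeff P i) ([:2, 0, 1:] ^ i * [:0, 1:] ^ (M - i)))"
 have R: "poly R w = poly Q w" if w: "w ~= 0" for w
 proof -
  have "poly P (w + 2 / w) = (\<Sum>i\<le>M. poly.coeff P i * (w + 2 / w) ^ i)" using P(1) by (rule poly_altdef_le)
  hence "poly Q w = (\<Sum>i\<le>M. poly.coeff P i * (w ^ M * (w + 2 / w) ^ i))"
   using Q[OF w] by (simp add: sum_distrib_left mult_ac)
  also have "... = (\<Sum>i\<le>M. poly.coeff P i * ((2 + w * w) ^ i * w ^ (M - i)))"
  proof (rule sum.cong)
   fix i assume "i \<in> {..M}"
   hence "w ^ M = w ^ i * w ^ (M - i)" by (simp flip: power_add)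
   moreover have "w ^ i * (w + 2 / w) ^ i = (2 + w * w) ^ i"
    using w by (simp add: algebra_simps flip: power_mult_distrib)
   ultimately show "poly.coeff P i * (w ^ M * (w + 2 / w) ^ i) = poly.coeff P i * ((2 + w * w) ^ i * w ^ (M - i))"
    by (simp add: mult_ac)
  qed simp
  also have "... = poly R w" by (simp add: R_def poly_sum poly_power)
  finally show ?thesis by simp
 qed
 have "R = Q"
 proof (rule ccontr)
  assume "R ~= Q"
  hence "finite {w. poly (R - Q) w = 0}" by (intro poly_roots_finite) simp
  moreover have "UNIV - {0} \<subseteq> {w. poly (R - Q) w = 0}" using R by auto
  ultimately have "finite (UNIV - {0::complex})" using finite_subset by blast
  thus False by (simp add: infinite_UNIV_char_0)
 qed
 hence "poly R 0 = 0" using assms(4) by (simp add: poly_0_coeff_0)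
 moreover have "poly R 0 = (\<Sum>i\<le>M. if i = M then poly.coeff P M * 2 ^ M else 0)"
  unfolding R_def poly_sum by (intro sum.cong) (auto simp: poly_power zero_power)
 ultimately have "poly.coeff P M = 0" by simp
 hence "degree P ~= M" using P(2) by (metis leading_coeff_0_iff degree_0 not_one_le_zero)
 thus ?thesis using P(1) by linarith
qed

text \<open>Scaling by v clears the denominators: v^j times the first summand is a polynomial of
  degree at most 2j, and the second summand is the first one at 2 / v. The degree j is already the
  number of eta quotients wanted for m = 2 and k = 2j + 1.\<close>

lemma laurent_case_2_odd:
 "\<exists>P :: complex poly. degree P <= j & (\<forall>v. v ~= 0 -->
   even_deriv 1 (1 / v + 2 - v) ((2 - v) / v) j 1 + even_deriv 1 (v / 2 + 2 - 2 / v) (v - 1) j 1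
   = poly P (v + 2 / v))"
proof -
 define h where "h = even_deriv [:0, 1:] [:1, 2, -1:] [:0, 2, -1 :: complex:] j 1"
 have h: "even_deriv 1 (1 / v + 2 - v) ((2 - v) / v) j 1 = poly h v / v ^ j" if v: "v ~= 0" for v
 proof -
  have e: "poly [:0, 1:] v = v * 1" "poly [:1, 2, -1:] v = v * (1 / v + 2 - v)"
   "poly [:0, 2, -1:] v = v ^ 2 * ((2 - v) / v)"
   using v by (simp_all add: field_simps power2_eq_square)
  have "poly h v = even_deriv (v * 1) (v * (1 / v + 2 - v)) (v ^ 2 * ((2 - v) / v)) j 1"
   unfolding h_def poly_even_deriv e ..
  thus ?thesis unfolding even_deriv_scale using v by simp
 qed
 have "degree h <= 2 * (1 div 2 + j)" unfolding h_def by (rule degree_even_deriv) auto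
 hence "degree h <= 2 * j" by simp
 from symmetric_laurent_poly[OF this] obtain P where P: "degree P <= j"
  "!!w. w ~= 0 ==> poly h w / w ^ j + poly h (2 / w) / (2 / w) ^ j = poly P (w + 2 / w)" by blast
 have "even_deriv 1 (1 / v + 2 - v) ((2 - v) / v) j 1 + even_deriv 1 (v / 2 + 2 - 2 / v) (v - 1) j 1
   = poly P (v + 2 / v)" if v: "v ~= 0" for v
 proof -
  have e: "1 / (2 / v) + 2 - 2 / v = v / 2 + 2 - 2 / v" "(2 - 2 / v) / (2 / v) = v - 1" using v by (simp_all add: field_simps)
  have "2 / v ~= 0" using v by simp
  from h[OF this] P(2)[OF v] h[OF v] show ?thesis unfolding e by simp
 qed
 thus ?thesis using P(1) by blast
qed

lemma even_deriv_0_0: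
 assumes "n >= 2"
 shows "even_deriv 0 s 0 j n = (0 :: 'a :: comm_ring_1)"
 using assms by (induction j arbitrary: n) (simp_all add: zero_power)

text \<open>\<open>S\<close> and \<open>T\<close> are Laurent polynomials in the roles of the sum
  and the product; clearing w^d and w^(2d) gives the degree d(j + 1) after symmetrisation. Both
  cleared products have constant term 0. With initial value 0 the recursion for y^2 therefore
  vanishes at w = 0, and \<open>reduce_degree\<close> saves one degree.\<close>

lemma laurent_even_generic:
 fixes s1 p1 s2 p2 :: "complex poly" and S T :: "complex => complex"
 assumes j: "j >= 1" and d: "d > 0" and deg: "degree s1 <= 2 * d" "degree p1 <= 4 * d"
  and c: "poly.coeff p1 0 = 0" "poly.coeff p2 0 = 0"
  and 1: "!!w. w ~= 0 ==> poly s1 w = w ^ d * S w" "!!w. w ~= 0 ==> poly p1 w = w ^ (2 * d) * T w"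
  and 2: "!!w. w ~= 0 ==> poly s2 w = w ^ d * S (2 / w)" "!!w. w ~= 0 ==> poly p2 w = w ^ (2 * d) * T (2 / w)"
 shows "\<exists>P. degree P <= d * (j + 1) - 1 & (\<forall>w. w ~= 0 -->
   even_deriv 0 (S w) (T w) j 2 + even_deriv 0 (S (2 / w)) (T (2 / w)) j 2 = poly P (w + 2 / w))"
proof -
 define h1 h2 where "h1 = even_deriv 0 s1 p1 j 2" and "h2 = even_deriv 0 s2 p2 j 2"
 have h: "poly (even_deriv 0 s p j 2) w = w ^ (d * (j + 1)) * even_deriv 0 X Y j 2"
  if "poly s w = w ^ d * X" "poly p w = w ^ (2 * d) * Y" for s p :: "complex poly" and w X Y
 proof -
  have "w ^ (2 * d) = (w ^ d) ^ 2" by (simp add: power_mult mult.commute[of 2])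
  hence "poly (even_deriv 0 s p j 2) w = even_deriv (w ^ d * 0) (w ^ d * X) ((w ^ d) ^ 2 * Y) j 2"
   unfolding poly_even_deriv using that by simp
  also have "... = w ^ (d * (j + 1)) * even_deriv 0 X Y j 2"
   unfolding even_deriv_scale unfolding power_mult[symmetric] by simp
  finally show ?thesis .
 qed
 have h1: "poly h1 w / w ^ (d * (j + 1)) = even_deriv 0 (S w) (T w) j 2" if "w ~= 0" for w
  using h[OF 1(1)[OF that] 1(2)[OF that]] that by (simp add: h1_def)
 have h2: "poly h2 w = w ^ (d * (j + 1)) * even_deriv 0 (S (2 / w)) (T (2 / w)) j 2" if "w ~= 0" for w
  using h[OF 2(1)[OF that] 2(2)[OF that]] by (simp add: h2_def)
 have "degree h1 <= (2 * d) * (2 div 2 + j)" unfolding h1_def using deg by (intro degree_even_deriv) auto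
 hence "degree h1 <= 2 * (d * (j + 1))" by (simp add: algebra_simps)
 from symmetric_laurent_poly[OF this] obtain P where P: "degree P <= d * (j + 1)"
  "!!w. w ~= 0 ==> poly h1 w / w ^ (d * (j + 1)) + poly h1 (2 / w) / (2 / w) ^ (d * (j + 1)) = poly P (w + 2 / w)" by blast
 have *: "even_deriv 0 (S w) (T w) j 2 + even_deriv 0 (S (2 / w)) (T (2 / w)) j 2 = poly P (w + 2 / w)" if "w ~= 0" for w
  using P(2)[OF that] h1[OF that] h1[of "2 / w"] that by simp
 have "degree P <= d * (j + 1) - 1"
 proof (rule reduce_degree[OF P(1)])
  show "1 <= d * (j + 1)" using d by simp
  show "poly (h1 + h2) w = w ^ (d * (j + 1)) * poly P (w + 2 / w)" if w: "w ~= 0" for w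
   unfolding *[OF w, symmetric] using h1[OF w] h2[OF w] w by (simp add: field_simps)
  have "poly h1 0 = 0" "poly h2 0 = 0"
   unfolding h1_def h2_def poly_even_deriv using c by (simp_all add: poly_0_coeff_0 even_deriv_0_0)
  thus "poly.coeff (h1 + h2) 0 = 0" by (simp add: poly_0_coeff_0)
 qed
 thus ?thesis using * by blast
qed

text \<open>The case d = 1. For S v = 4/v - 4 - v and T v = 4v - 4 the coefficient lists are, in
  order, v S(v), v^2 T(v), v^2 T(2/v) and v S(2/v).\<close>

lemma laurent_case_2_even:
 assumes "j >= 1"
 shows "\<exists>P :: complex poly. degree P <= j & (\<forall>v. v ~= 0 -->
   even_deriv 0 (4 / v - 4 - v) (4 * v - 4) j 2 + even_deriv 0 (4 / (2 / v) - 4 - 2 / v) (4 * (2 / v) - 4) j 2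
   = poly P (v + 2 / v))"
 using laurent_even_generic[OF assms, of 1 "[:4, -4, -1:]" "[:0, 0, -4, 4:]" "[:0, 8, -4:]"
  "%v. 4 / v - 4 - v" "%v. 4 * v - 4" "[:-2, -4, 2:]"]
 by (simp add: field_simps power2_eq_square)

text \<open>The case d = 2; the coefficient lists are, in order, w^2 S(w), w^4 T(w), w^4 T(2/w) and
  w^2 S(2/w).\<close>

lemma laurent_case_4_even:
 assumes "j >= 1"
 shows "\<exists>P :: complex poly. degree P <= 2 * (j + 1) - 1 & (\<forall>w. w ~= 0 -->
   even_deriv 0 ((2 - w) ^ 4 / w\<^sup>2 - 2 * w\<^sup>2) (w ^ 4 - (2 - w) ^ 4) j 2
   + even_deriv 0 ((2 - 2 / w) ^ 4 / (2 / w)\<^sup>2 - 2 * (2 / w)\<^sup>2) ((2 / w) ^ 4 - (2 - 2 / w) ^ 4) j 2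
   = poly P (w + 2 / w))"
proof (rule laurent_even_generic[OF assms, of 2 "[:16, -32, 24, -8, -1:]" "[:0, 0, 0, 0, -16, 32, -24, 8:]" "[:0, 64, -96, 64, -16:]"
  "%w. (2 - w) ^ 4 / w\<^sup>2 - 2 * w\<^sup>2" "%w. w ^ 4 - (2 - w) ^ 4" "[:-4, -16, 24, -16, 4:]"])
 fix w :: complex assume w: "w ~= 0"
 show "poly [:16, -32, 24, -8, -1:] w = w\<^sup>2 * ((2 - w) ^ 4 / w\<^sup>2 - 2 * w\<^sup>2)"
  using w by (simp add: right_diff_distrib) (simp add: eval_nat_numeral algebra_simps)
 show "poly [:0, 0, 0, 0, -16, 32, -24, 8:] w = w ^ (2 * 2) * (w ^ 4 - (2 - w) ^ 4)"
  by (simp add: eval_nat_numeral algebra_simps)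
 show "poly [:-4, -16, 24, -16, 4:] w = w\<^sup>2 * ((2 - 2 / w) ^ 4 / (2 / w)\<^sup>2 - 2 * (2 / w)\<^sup>2)"
  using w by (simp add: field_simps eval_nat_numeral)
 show "poly [:0, 64, -96, 64, -16:] w = w ^ (2 * 2) * ((2 / w) ^ 4 - (2 - 2 / w) ^ 4)"
  using w by (simp add: field_simps eval_nat_numeral)
qed auto

lemma coeff_mult_1: "poly.coeff (p * q) 1 = poly.coeff p 0 * poly.coeff q 1 + poly.coeff p 1 * poly.coeff q 0" for p q :: "complex poly"
 by (simp add: coeff_mult)

lemma coeff_even_deriv_Suc:
 fixes h s p :: "complex poly"
 shows "poly.coeff (even_deriv h s p (Suc j) n) 0
   = of_nat (n * (n + 1)) * poly.coeff (even_deriv h s p j (n + 2)) 0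
    - of_nat (n * n) * poly.coeff s 0 * poly.coeff (even_deriv h s p j n) 0
    + of_nat (n * (n - 1)) * poly.coeff p 0 * poly.coeff (even_deriv h s p j (n - 2)) 0"
  and "poly.coeff (even_deriv h s p (Suc j) n) 1
   = of_nat (n * (n + 1)) * poly.coeff (even_deriv h s p j (n + 2)) 1
    - of_nat (n * n) * (poly.coeff s 0 * poly.coeff (even_deriv h s p j n) 1 + poly.coeff s 1 * poly.coeff (even_deriv h s p j n) 0)
    + of_nat (n * (n - 1)) * (poly.coeff p 0 * poly.coeff (even_deriv h s p j (n - 2)) 1 + poly.coeff p 1 * poly.coeff (even_deriv h s p j (n - 2)) 0)"
 by (simp_all add: coeff_mult_1 coeff_mult_0 of_nat_poly mult.assoc del: of_nat_mult of_nat_add flip: One_nat_def)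

text \<open>Modulo w^2, with h = 1, s = 2 - 4w and p = 1 - 4w, the quantity (y')^2 = h^2 - s h + p
  vanishes and y'' = y (2h - s) = 4 w y. So y is constant at w = 0, and the linear coefficients
  follow a linear recursion solved by n(n+1)(n+2) - 2 n^3 + n(n-1)(n-2) = 4n.\<close>

lemma low_coeffs_unit:
 fixes s p :: "complex poly"
 assumes s: "poly.coeff s 0 = 2" "poly.coeff s 1 = -4" and p: "poly.coeff p 0 = 1" "poly.coeff p 1 = -4"
 shows "poly.coeff (even_deriv 1 s p (Suc j) n) 0 = 0"
  and "poly.coeff (even_deriv 1 s p (Suc j) n) 1 = of_nat n * 4 ^ Suc j"
proof (induction j arbitrary: n)
 case 0
 have c: "poly.coeff (even_deriv 1 s p 0 m) 0 = 1" "poly.coeff (even_deriv 1 s p 0 m) 1 = 0" for m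
  by simp_all
 have n: "(of_nat (n * (n - 1)) :: complex) = of_nat n * of_nat n - of_nat n"
  by (cases n) (simp_all add: algebra_simps)
 {
  case 1 show ?case unfolding coeff_even_deriv_Suc c s p n by (simp add: algebra_simps)
 next
  case 2 show ?case unfolding coeff_even_deriv_Suc c s p n by (simp add: algebra_simps)
 }
next
 case (Suc j)
 {
  case 1 show ?case by (subst coeff_even_deriv_Suc) (simp add: Suc.IH del: even_deriv.simps)
 next
  case 2
  have n: "of_nat (n * (n - 1)) * (of_nat (n - 2) :: complex) = of_nat n * (of_nat n - 1) * (of_nat n - 2)"
  proof (cases "n >= 2")
   case True
   then obtain m where "n = m + 2" by (metis add.commute le_Suc_ex)
   thus ?thesis by (simp add: algebra_simps)
  next
   case False
   hence "n = 0 \<or> n = 1" by auto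
   thus ?thesis by auto
  qed
  have "poly.coeff (even_deriv 1 s p (Suc (Suc j)) n) 1
    = (of_nat (n * (n + 1)) * of_nat (n + 2) - 2 * (of_nat (n * n) * of_nat n) + of_nat (n * (n - 1)) * of_nat (n - 2)) * 4 ^ Suc j"
   by (subst coeff_even_deriv_Suc, unfold Suc.IH s p)
     (simp add: algebra_simps del: of_nat_mult of_nat_add power_Suc)
  also have "of_nat (n * (n + 1)) * of_nat (n + 2) - 2 * (of_nat (n * n) * of_nat n) + of_nat (n * (n - 1)) * of_nat (n - 2) = (of_nat n * 4 :: complex)"
   unfolding n by (simp add: algebra_simps)
  finally show ?case by simp
 }
qed

lemma coeff_power_low:
 fixes h :: "complex poly"
 assumes "poly.coeff h 0 = 1" "poly.coeff h 1 = -2"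
 shows "poly.coeff (h ^ d) 0 = 1" "poly.coeff (h ^ d) 1 = - 2 * of_nat d"
proof -
 show 0: "poly.coeff (h ^ d) 0 = 1" for d
  by (induction d) (simp_all add: coeff_mult_0 assms)
 show "poly.coeff (h ^ d) 1 = - 2 * of_nat d"
 proof (induction d)
  case (Suc d)
  show ?case
   unfolding power_Suc coeff_mult_1 Suc.IH assms 0 by (simp add: algebra_simps)
 qed (simp add: one_pCons)
qed

text \<open>Modulo w^2, with h = 1 - 2w, both h^2 - s h + p and 2h - s vanish. Thus y is constant up
  to first order in w, and so are all its powers.\<close>

lemma low_coeffs_vanish:
 fixes h s p :: "complex poly"
 assumes h: "poly.coeff h 0 = 1" "poly.coeff h 1 = -2"
  and s: "poly.coeff s 0 = 2" "poly.coeff s 1 = -4" and p: "poly.coeff p 0 = 1" "poly.coeff p 1 = -4"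
  and n: "odd n"
 shows "poly.coeff (even_deriv h s p (Suc j) n) 0 = 0 & poly.coeff (even_deriv h s p (Suc j) n) 1 = 0"
 using n
proof (induction j arbitrary: n)
 case 0
 then obtain m where m: "n = 2 * m + 1" by (elim oddE)
 have c: "poly.coeff (even_deriv h s p 0 k) 0 = 1" "poly.coeff (even_deriv h s p 0 k) 1 = - 2 * of_nat (k div 2)" for k
  using coeff_power_low[OF h] by simp_all
 have d: "(n + 2) div 2 = m + 1" "n div 2 = m" "(n - 2) div 2 = m - 1" using m by auto
 have 1: "(of_nat (n * (n - 1)) :: complex) = of_nat n * of_nat n - of_nat n"
  by (simp add: m algebra_simps)
 have 2: "of_nat (n * (n - 1)) * (of_nat (m - 1) :: complex) = of_nat n * (of_nat n - 1) * (of_nat m - 1)"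
  by (cases m) (simp_all add: m algebra_simps)
 have 3: "(of_nat n :: complex) = 2 * of_nat m + 1" by (simp add: m)
 have "poly.coeff (even_deriv h s p (Suc 0) n) 0 = 0"
  unfolding coeff_even_deriv_Suc c s p 1 by (simp add: algebra_simps)
 moreover have "poly.coeff (even_deriv h s p (Suc 0) n) 1 = 0"
 proof -
  have "poly.coeff (even_deriv h s p (Suc 0) n) 1
   = of_nat (n * (n + 1)) * (- 2 * of_nat (m + 1)) - of_nat (n * n) * (2 * (- 2 * of_nat m) + (- 4))
    + (- 2 * (of_nat (n * (n - 1)) * of_nat (m - 1)) + (- 4) * of_nat (n * (n - 1)))"
   unfolding coeff_even_deriv_Suc c s p d by (simp add: algebra_simps del: of_nat_mult of_nat_add)
  also have "... = 0" unfolding 2 unfolding 1 unfolding of_nat_mult of_nat_add 3 by (simp add: algebra_simps)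
  finally show ?thesis .
 qed
 ultimately show ?case ..
next
 case (Suc j)
 have "odd (n + 2)" "n = 1 \<or> odd (n - 2)" using Suc.prems by (auto elim!: oddE)
 with Suc.IH[of "n + 2"] Suc.IH[of n] Suc.IH[of "n - 2"] Suc.prems
 have "poly.coeff (even_deriv h s p (Suc j) (n + 2)) 0 = 0" "poly.coeff (even_deriv h s p (Suc j) (n + 2)) 1 = 0"
  "poly.coeff (even_deriv h s p (Suc j) n) 0 = 0" "poly.coeff (even_deriv h s p (Suc j) n) 1 = 0"
  "of_nat (n * (n - 1)) = (0 :: complex) \<or> poly.coeff (even_deriv h s p (Suc j) (n - 2)) 0 = 0 & poly.coeff (even_deriv h s p (Suc j) (n - 2)) 1 = 0"
  by auto
 note * = this
 have "poly.coeff (even_deriv h s p (Suc (Suc j)) n) 0 = 0"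
  by (subst coeff_even_deriv_Suc(1), unfold *(1-4)) (use *(5) in auto)
 moreover have "poly.coeff (even_deriv h s p (Suc (Suc j)) n) 1 = 0"
  by (subst coeff_even_deriv_Suc(2), unfold *(1-4)) (use *(5) in \<open>auto simp del: One_nat_def\<close>)
 ultimately show ?case ..
qed

text \<open>At w = 0 the data h = 0, s = 4, p = 0 describe the linearised equation y'' = -4y, and
  odd powers other than y itself vanish.\<close>

lemma low_coeff_power:
 fixes h s p :: "complex poly"
 assumes h: "poly.coeff h 0 = 0" and s: "poly.coeff s 0 = 4" and p: "poly.coeff p 0 = 0" and n: "odd n"
 shows "poly.coeff (even_deriv h s p j n) 0 = (if n = 1 then (-4) ^ j else 0)"
 using n
proof (induction j arbitrary: n)
 case 0
 then obtain m where m: "n = 2 * m + 1" by (elim oddE)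
 have "poly.coeff (h ^ m) 0 = 0 ^ m" using h by (induction m) (simp_all add: coeff_mult_0)
 thus ?case by (simp add: m zero_power)
next
 case (Suc j)
 have "odd (n + 2)" "odd n" using Suc.prems by auto
 thus ?case
  using Suc.IH[of "n + 2"] Suc.IH[of n]
  by (subst coeff_even_deriv_Suc) (auto simp: s p simp del: even_deriv.simps)
qed

text \<open>After multiplication by w^K with K = 2j + 1 the four summands become the polynomials
  \<open>a1\<close>, \<open>a2\<close>, \<open>b1\<close>, \<open>b2\<close>, which alone give only
  the degree K. Two degrees have to be saved. The low coefficients of \<open>a1\<close> and
  \<open>b2\<close> and all constant terms vanish; the linear coefficients are 2 * 16^j for
  \<open>a2\<close> and 2 (-4)^j for \<open>b1\<close>. The weight (-1/4)^j is the one for which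
  they cancel, so that \<open>reduce_degree\<close> applies twice.\<close>

lemma laurent_case_4_odd:
 assumes j: "j >= 1"
 shows "\<exists>P :: complex poly. degree P <= 2 * j - 1 & (\<forall>w. w ~= 0 -->
   (-1/4) ^ j * (w * even_deriv (w\<^sup>2) (w\<^sup>2 + (2 - w) ^ 4 / w\<^sup>2) ((2 - w) ^ 4) j 1
    + (2 / w) * even_deriv ((2 / w)\<^sup>2) ((2 / w)\<^sup>2 + (2 - 2 / w) ^ 4 / (2 / w)\<^sup>2) ((2 - 2 / w) ^ 4) j 1)
   - ((2 - w) * even_deriv ((2 - w)\<^sup>2) ((w - 2 + 2 / w)\<^sup>2 + (2 - w)\<^sup>2) (((w - 2 + 2 / w) * (2 - w))\<^sup>2) j 1
    + (2 - 2 / w) * even_deriv ((2 - 2 / w)\<^sup>2) ((2 / w - 2 + 2 / (2 / w))\<^sup>2 + (2 - 2 / w)\<^sup>2) (((2 / w - 2 + 2 / (2 / w)) * (2 - 2 / w))\<^sup>2) j 1)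
   = poly P (w + 2 / w))"
proof -
 define A :: "complex => complex" where "A w = w * even_deriv (w\<^sup>2) (w\<^sup>2 + (2 - w) ^ 4 / w\<^sup>2) ((2 - w) ^ 4) j 1" for w
 define B :: "complex => complex" where
  "B w = (2 - w) * even_deriv ((2 - w)\<^sup>2) ((w - 2 + 2 / w)\<^sup>2 + (2 - w)\<^sup>2) (((w - 2 + 2 / w) * (2 - w))\<^sup>2) j 1" for w
 define K where "K = 2 * j + 1"
 define a1 b1 a2 b2 :: "complex poly" where
  "a1 = [:0, 0, 1:] * even_deriv [:0, 0, 0, 0, 1:] [:16, -32, 24, -8, 2:] [:0, 0, 0, 0, 16, -32, 24, -8, 1:] j 1" and
  "b1 = [:0, 2, -1:] * even_deriv [:0, 0, 4, -4, 1:] [:4, -8, 12, -8, 2:] ([:0, 4, -6, 4, -1:] * [:0, 4, -6, 4, -1:]) j 1" and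
  "a2 = [:2:] * ([:4 ^ j:] * even_deriv 1 [:2, -4, 6, -4, 1:] [:1, -4, 6, -4, 1:] j 1)" and
  "b2 = [:-2, 2:] * ([:4 ^ j:] * even_deriv [:1, -2, 1:] [:2, -4, 3, -1, 1/4:] ([:-1, 2, -3/2, 1/2:] * [:-1, 2, -3/2, 1/2:]) j 1)"
 have gen: "f * even_deriv h s p j 1 * w ^ K = (w * f) * even_deriv (w ^ 2 * h) (w ^ 2 * s) ((w ^ 2) ^ 2 * p) j 1"
  for f h s p w :: complex
  unfolding even_deriv_scale K_def by (simp add: power_mult[symmetric])
 have gen4: "even_deriv (4 * h) (4 * s) (4 ^ 2 * p) j 1 = 4 ^ j * even_deriv h s p j 1" for h s p :: complex
  unfolding even_deriv_scale by simp
 have a1: "poly a1 w = A w * w ^ K" if w: "w ~= 0" for w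
 proof -
  have e: "poly [:0, 0, 1:] w = w * w" "poly [:0, 0, 0, 0, 1:] w = w ^ 2 * w\<^sup>2"
   "poly [:16, -32, 24, -8, 2:] w = w ^ 2 * (w\<^sup>2 + (2 - w) ^ 4 / w\<^sup>2)"
   "poly [:0, 0, 0, 0, 16, -32, 24, -8, 1:] w = (w ^ 2) ^ 2 * ((2 - w) ^ 4)"
   using w by (simp_all add: distrib_left) (simp_all add: eval_nat_numeral algebra_simps)
  show ?thesis unfolding A_def gen a1_def poly_mult poly_even_deriv e ..
 qed
 have b1: "poly b1 w = B w * w ^ K" if w: "w ~= 0" for w
 proof -
  have u: "w * (w - 2 + 2 / w) = w\<^sup>2 - 2 * w + 2" using w by (simp add: field_simps power2_eq_square)
  have u2: "w ^ 2 * (w - 2 + 2 / w)\<^sup>2 = (w\<^sup>2 - 2 * w + 2)\<^sup>2" unfolding u[symmetric] by (simp add: power_mult_distrib)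
  have e: "poly [:0, 2, -1:] w = w * (2 - w)" "poly [:0, 0, 4, -4, 1:] w = w ^ 2 * (2 - w)\<^sup>2"
   by (simp_all add: eval_nat_numeral algebra_simps)
  have e3: "poly [:4, -8, 12, -8, 2:] w = w ^ 2 * ((w - 2 + 2 / w)\<^sup>2 + (2 - w)\<^sup>2)"
   unfolding distrib_left u2 by (simp add: eval_nat_numeral algebra_simps)
  have g: "poly [:0, 4, -6, 4, -1:] w = (w\<^sup>2 - 2 * w + 2) * (w * (2 - w))"
   by (simp add: eval_nat_numeral algebra_simps)
  have e4: "poly [:0, 4, -6, 4, -1:] w * poly [:0, 4, -6, 4, -1:] w = (w ^ 2) ^ 2 * (((w - 2 + 2 / w) * (2 - w))\<^sup>2)"
   unfolding g u[symmetric] by (simp add: power2_eq_square mult_ac)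
  show ?thesis unfolding B_def gen b1_def poly_mult poly_even_deriv e e3 e4 ..
 qed
 have a2: "poly a2 w = A (2 / w) * w ^ K" if w: "w ~= 0" for w
 proof -
  have v: "w * (2 - 2 / w) = 2 * (w - 1)" using w by (simp add: field_simps)
  have e1: "w * (2 / w) = 2" "w ^ 2 * (2 / w)\<^sup>2 = 4 * 1" using w by (simp_all add: power_divide)
  have v4: "w ^ 4 * (2 - 2 / w) ^ 4 = 16 * (w - 1) ^ 4"
   unfolding power_mult_distrib[symmetric] v by (simp only: power_mult_distrib) simp
  have e2: "w ^ 2 * ((2 / w)\<^sup>2 + (2 - 2 / w) ^ 4 / (2 / w)\<^sup>2) = 4 * (1 + (w - 1) ^ 4)"
  proof -
   have "w ^ 2 * ((2 - 2 / w) ^ 4 / (2 / w)\<^sup>2) = (w ^ 4 * (2 - 2 / w) ^ 4) / 4"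
    using w by (simp add: power_divide eval_nat_numeral)
   thus ?thesis unfolding distrib_left e1 v4 by simp
  qed
  have e3: "(w ^ 2) ^ 2 * (2 - 2 / w) ^ 4 = 4 ^ 2 * (w - 1) ^ 4"
   using v4 by (simp flip: power_mult)
  have A: "A (2 / w) * w ^ K = 2 * (4 ^ j * even_deriv 1 (1 + (w - 1) ^ 4) ((w - 1) ^ 4) j 1)"
   unfolding A_def gen e1 e2 e3 gen4 ..
  have E: "poly [:2, -4, 6, -4, 1:] w = 1 + (w - 1) ^ 4" "poly [:1, -4, 6, -4, 1:] w = (w - 1) ^ 4"
   by (simp_all add: eval_nat_numeral algebra_simps)
  show ?thesis by (simp only: A a2_def poly_mult poly_even_deriv E poly_1) simp
 qed
 have b2: "poly b2 w = B (2 / w) * w ^ K" if w: "w ~= 0" for w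
 proof -
  have v: "w * (2 - 2 / w) = 2 * (w - 1)" using w by (simp add: field_simps)
  have v2: "w ^ 2 * (2 - 2 / w)\<^sup>2 = 4 * (w - 1)\<^sup>2"
   unfolding power_mult_distrib[symmetric] v by (simp only: power_mult_distrib) simp
  have u: "w * (2 / w - 2 + 2 / (2 / w)) = w\<^sup>2 - 2 * w + 2" using w by (simp add: field_simps power2_eq_square)
  have u2: "w ^ 2 * (2 / w - 2 + 2 / (2 / w))\<^sup>2 = (w\<^sup>2 - 2 * w + 2)\<^sup>2" unfolding u[symmetric] by (simp add: power_mult_distrib)
  have e2: "w ^ 2 * ((2 / w - 2 + 2 / (2 / w))\<^sup>2 + (2 - 2 / w)\<^sup>2) = 4 * poly [:2, -4, 3, -1, 1/4:] w"
   unfolding distrib_left u2 v2 by (simp add: eval_nat_numeral algebra_simps)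
  have g: "(w\<^sup>2 - 2 * w + 2) * (2 * (w - 1)) = 4 * poly [:-1, 2, -3/2, 1/2:] w"
   by (simp add: eval_nat_numeral algebra_simps)
  have "(w ^ 2) ^ 2 * ((2 / w - 2 + 2 / (2 / w)) * (2 - 2 / w))\<^sup>2 = ((w * (2 / w - 2 + 2 / (2 / w))) * (w * (2 - 2 / w)))\<^sup>2"
   by (simp add: power2_eq_square mult_ac)
  also have "... = 4 ^ 2 * (poly [:-1, 2, -3/2, 1/2:] w * poly [:-1, 2, -3/2, 1/2:] w)"
   unfolding u v g by (simp only: power2_eq_square mult_ac)
  finally have e3: "(w ^ 2) ^ 2 * ((2 / w - 2 + 2 / (2 / w)) * (2 - 2 / w))\<^sup>2 = ..." .
  have e1: "4 * (w - 1)\<^sup>2 = 4 * poly [:1, -2, 1:] w" by (simp add: power2_eq_square algebra_simps)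
  show ?thesis
   unfolding B_def gen v v2 e2 e3 e1 gen4 unfolding b2_def poly_mult poly_even_deriv by (simp add: algebra_simps)
 qed
 define h where "h = Polynomial.smult ((-1/4) ^ j) a1 - b1"
 define h2 where "h2 = Polynomial.smult ((-1/4) ^ j) a2 - b2"
 have m: "degree (f * g) <= a + b" if "degree f <= a" "degree g <= b" for f g :: "complex poly" and a b
  using degree_mult_le[of f g] that by linarith
 have da: "degree a1 <= 2 * K"
 proof -
  have "degree a1 <= 2 + 4 * (1 div 2 + j)" unfolding a1_def by (intro m degree_even_deriv) auto
  thus ?thesis by (simp add: K_def)
 qed
 have db: "degree b1 <= 2 * K"
 proof -
  have "degree ([:0, 4, -6, 4, -1:] * [:0, 4, -6, 4, -1 :: complex:]) <= 4 + 4" by (intro m) auto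
  hence "degree b1 <= 2 + 4 * (1 div 2 + j)" unfolding b1_def by (intro m degree_even_deriv) auto
  thus ?thesis by (simp add: K_def)
 qed
 have "degree h <= 2 * K"
  unfolding h_def using da db by (intro degree_diff_le order.trans[OF degree_smult_le])
 from symmetric_laurent_poly[OF this] obtain P where P: "degree P <= K"
  "!!w. w ~= 0 ==> poly h w / w ^ K + poly h (2 / w) / (2 / w) ^ K = poly P (w + 2 / w)" by blast
 have h: "poly h w / w ^ K = (-1/4) ^ j * A w - B w" if "w ~= 0" for w
  using a1[OF that] b1[OF that] that by (simp add: h_def diff_divide_distrib)
 have h2: "poly h2 w = ((-1/4) ^ j * A (2 / w) - B (2 / w)) * w ^ K" if "w ~= 0" for w
  using a2[OF that] b2[OF that] that by (simp add: h2_def algebra_simps)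
 have *: "((-1/4) ^ j * A w - B w) + ((-1/4) ^ j * A (2 / w) - B (2 / w)) = poly P (w + 2 / w)" if w: "w ~= 0" for w
 proof -
  have "2 / w ~= 0" using w by simp
  thus ?thesis using P(2)[OF w] h[OF w] h[of "2 / w"] by simp
 qed
 obtain i where i: "j = Suc i" using j by (cases j) auto
 have l1: "poly.coeff (even_deriv 1 [:2, -4, 6, -4, 1:] [:1, -4, 6, -4, 1 :: complex:] j 1) 0 = 0"
  "poly.coeff (even_deriv 1 [:2, -4, 6, -4, 1:] [:1, -4, 6, -4, 1 :: complex:] j 1) 1 = 4 ^ j"
  unfolding i by (subst low_coeffs_unit; simp)+
 have l2: "poly.coeff (even_deriv [:1, -2, 1:] [:2, -4, 3, -1, 1/4:] ([:-1, 2, -3/2, 1/2:] * [:-1, 2, -3/2, 1/2 :: complex:]) j 1) 0 = 0"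
   "poly.coeff (even_deriv [:1, -2, 1:] [:2, -4, 3, -1, 1/4:] ([:-1, 2, -3/2, 1/2:] * [:-1, 2, -3/2, 1/2 :: complex:]) j 1) 1 = 0"
  unfolding i using low_coeffs_vanish[of "[:1, -2, 1:]" "[:2, -4, 3, -1, 1/4:]" "[:-1, 2, -3/2, 1/2:] * [:-1, 2, -3/2, 1/2:]" 1 i]
  by (simp_all add: coeff_mult_0)
 have l3: "poly.coeff (even_deriv [:0, 0, 4, -4, 1:] [:4, -8, 12, -8, 2:] ([:0, 4, -6, 4, -1:] * [:0, 4, -6, 4, -1 :: complex:]) j 1) 0 = (-4) ^ j"
  by (subst low_coeff_power) (simp_all add: coeff_mult_0)
 define Q where "Q = h + h2"
 have Q: "poly Q w = w ^ K * poly P (w + 2 / w)" if w: "w ~= 0" for w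
 proof -
  have hw: "poly h w = ((-1/4) ^ j * A w - B w) * w ^ K"
   using h[OF w] w by (simp add: divide_eq_eq)
  show ?thesis
   unfolding *[OF w, symmetric] Q_def poly_add hw h2[OF w] by (simp only: ring_distribs mult_ac)
 qed
 have q: "(-1/4) ^ j * (2 * (4 ^ j * 4 ^ j)) = (2 * (-4) ^ j :: complex)"
  by (simp flip: power_mult_distrib)
 have Q0: "poly.coeff Q 0 = 0" and Q1: "poly.coeff Q 1 = 0"
  unfolding Q_def h_def h2_def a1_def b1_def a2_def b2_def coeff_add coeff_diff coeff_smult coeff_mult_0 coeff_mult_1 l1 l2 l3
  using q by (simp_all add: mult_ac)
 have K: "1 <= K" "1 <= K - 1" using j by (auto simp: K_def)
 have P1: "degree P <= K - 1" by (rule reduce_degree[OF P(1) K(1) Q Q0])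
 \<comment> \<open>Q is divisible by w, so the argument is repeated for Q / w with the exponent K -
   1; its constant term is the linear coefficient of Q.\<close>
 obtain R where R: "Q = pCons 0 R" using Q0 by (metis coeff_pCons_0 pCons_cases)
 have "degree P <= K - 1 - 1"
 proof (rule reduce_degree[OF P1 K(2)])
  show "poly R w = w ^ (K - 1) * poly P (w + 2 / w)" if w: "w ~= 0" for w
  proof -
   have "w * poly R w = w * (w ^ (K - 1) * poly P (w + 2 / w))"
    using Q[OF w] K(1) by (simp add: R K_def)
   thus ?thesis using w by simp
  qed
  show "poly.coeff R 0 = 0" using Q1 by (simp add: R)
 qed
 hence "degree P <= 2 * j - 1" by (simp add: K_def)
 moreover have "(-1/4) ^ j * (A w + A (2 / w)) - (B w + B (2 / w)) = poly P (w + 2 / w)" if "w ~= 0" for w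
  using *[OF that] by (simp add: algebra_simps)
 ultimately show ?thesis unfolding A_def B_def by blast
qed

section \<open>Euler products and the Jacobi triple product\<close>

definition euler_product :: "complex => complex" where
 "euler_product q = (\<Prod>n. 1 - q ^ Suc n)"

lemma has_prod_one_plus:
 fixes f :: "nat => complex"
 assumes "summable (%n. norm (f n))" "!!n. 1 + f n ~= 0"
 shows "(%n. \<Prod>i<n. 1 + f i) \<longlonglongrightarrow> (\<Prod>n. 1 + f n)" "(\<Prod>n. 1 + f n) ~= 0"
proof -
 have "abs_convergent_prod (%n. 1 + f n)"
  using assms(1) by (intro summable_imp_abs_convergent_prod) simp
 hence c: "convergent_prod (%n. 1 + f n)" by (rule abs_convergent_prod_imp_convergent_prod)
 have "(%n. \<Prod>i\<le>n. 1 + f i) \<longlonglongrightarrow> (\<Prod>n. 1 + f n)" using convergent_prod_LIMSEQ[OF c] .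
 hence "(%n. \<Prod>i<Suc n. 1 + f i) \<longlonglongrightarrow> (\<Prod>n. 1 + f n)" by (simp add: lessThan_Suc_atMost)
 thus "(%n. \<Prod>i<n. 1 + f i) \<longlonglongrightarrow> (\<Prod>n. 1 + f n)" by (rule LIMSEQ_imp_Suc)
 show "(\<Prod>n. 1 + f n) ~= 0" using prodinf_nonzero[OF c] assms(2) by auto
qed

lemma summable_norm_power_mult_add:
 fixes q :: complex
 assumes "norm q < 1" "a > 0"
 shows "summable (%n. norm (c * q ^ (a * n + b)))"
proof -
 have "norm q ^ a < 1" using assms by (simp add: power_less_one_iff)
 hence "summable (%n. (norm c * norm q ^ b) * (norm q ^ a) ^ n)"
  by (intro summable_mult summable_geometric) simp
 moreover have "norm (c * q ^ (a * n + b)) = (norm c * norm q ^ b) * (norm q ^ a) ^ n" for n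
  by (simp only: norm_mult norm_power power_add power_mult mult_ac)
 ultimately show ?thesis by simp
qed

lemma power_product_nonzero:
 fixes q :: complex
 assumes "norm q < 1" "m > 0"
 shows "1 + q ^ m ~= 0" "1 - q ^ m ~= 0" "1 + - (q ^ m) ~= 0"
 using one_pm_power_nonzero[OF assms] by auto

lemma euler_product_limit:
 assumes q: "norm q < 1"
 shows "(%n. \<Prod>i<n. 1 - q ^ Suc i) \<longlonglongrightarrow> euler_product q" "euler_product q ~= 0"
proof -
 have "summable (%i. norm (- (q ^ Suc i)))" using summable_norm_power_mult_add[OF q, of 1 "-1" 1] by simp
 moreover have "1 + - (q ^ Suc i) ~= 0" for i using power_product_nonzero(3)[OF q, of "Suc i"] by simp
 ultimately show "(%n. \<Prod>i<n. 1 - q ^ Suc i) \<longlonglongrightarrow> euler_product q" "euler_product q ~= 0"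
  using has_prod_one_plus[of "%i. - (q ^ Suc i)"] by (simp_all add: euler_product_def del: power_Suc)
qed

definition odd_product :: "complex => complex" where
 "odd_product q = (\<Prod>n. 1 - q ^ (2 * n + 1))"

lemma odd_product_limit:
 assumes q: "norm q < 1"
 shows "(%n. \<Prod>i<n. 1 - q ^ (2 * i + 1)) \<longlonglongrightarrow> odd_product q" "odd_product q ~= 0"
proof -
 have "summable (%i. norm (- (q ^ (2 * i + 1))))" using summable_norm_power_mult_add[OF q, of 2 "-1" 1] by simp
 moreover have "1 + - (q ^ (2 * i + 1)) ~= 0" for i using power_product_nonzero(3)[OF q, of "2 * i + 1"] by simp
 ultimately show "(%n. \<Prod>i<n. 1 - q ^ (2 * i + 1)) \<longlonglongrightarrow> odd_product q" "odd_product q ~= 0"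
  using has_prod_one_plus[of "%i. - (q ^ (2 * i + 1))"] by (simp_all add: odd_product_def del: power_Suc power_add)
qed

text \<open>The partial product of length 2n separates into odd and even exponents.\<close>

lemma euler_product_split:
 assumes q: "norm q < 1"
 shows "odd_product q * euler_product (q\<^sup>2) = euler_product q"
proof (rule LIMSEQ_unique)
 have q2: "norm (q\<^sup>2) < 1" using norm_power_less_1[OF q, of 2] by simp
 show "(%n. (\<Prod>i<n. 1 - q ^ (2 * i + 1)) * (\<Prod>i<n. 1 - (q\<^sup>2) ^ Suc i)) \<longlonglongrightarrow> odd_product q * euler_product (q\<^sup>2)"
  by (intro tendsto_mult odd_product_limit euler_product_limit q q2)
 have "(\<Prod>i<n. 1 - q ^ (2 * i + 1)) * (\<Prod>i<n. 1 - (q\<^sup>2) ^ Suc i) = (\<Prod>i<2 * n. 1 - q ^ Suc i)" for n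
  by (induction n) (simp_all add: power_mult[symmetric] mult_ac flip: power_Suc)
 moreover have "(%n. \<Prod>i<2 * n. 1 - q ^ Suc i) \<longlonglongrightarrow> euler_product q"
  using LIMSEQ_subseq_LIMSEQ[OF euler_product_limit(1)[OF q], of "%n. 2 * n"] by (simp add: strict_mono_def o_def)
 ultimately show "(%n. (\<Prod>i<n. 1 - q ^ (2 * i + 1)) * (\<Prod>i<n. 1 - (q\<^sup>2) ^ Suc i)) \<longlonglongrightarrow> euler_product q" by simp
qed

lemma odd_product_reflect:
 assumes q: "norm q < 1"
 shows "odd_product (- q) * odd_product q = odd_product (q\<^sup>2)"
proof (rule LIMSEQ_unique)
 have q2: "norm (q\<^sup>2) < 1" "norm (- q) < 1" using q norm_power_less_1[OF q, of 2] by auto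
 show "(%n. (\<Prod>i<n. 1 - (- q) ^ (2 * i + 1)) * (\<Prod>i<n. 1 - q ^ (2 * i + 1))) \<longlonglongrightarrow> odd_product (- q) * odd_product q"
  by (intro tendsto_mult odd_product_limit q q2)
 have e: "(1 - (- q) ^ (2 * i + 1)) * (1 - q ^ (2 * i + 1)) = 1 - (q\<^sup>2) ^ (2 * i + 1)" for i
 proof -
  have "(- q) ^ (2 * i + 1) = - (q ^ (2 * i + 1))" by simp
  moreover have "(q\<^sup>2) ^ (2 * i + 1) = (q ^ (2 * i + 1))\<^sup>2" by (rule power_power_commute)
  ultimately show ?thesis by (simp only:) (simp add: power2_eq_square algebra_simps)
 qed
 have "(\<Prod>i<n. 1 - (- q) ^ (2 * i + 1)) * (\<Prod>i<n. 1 - q ^ (2 * i + 1)) = (\<Prod>i<n. 1 - (q\<^sup>2) ^ (2 * i + 1))" for n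
  unfolding prod.distrib[symmetric] e ..
 thus "(%n. (\<Prod>i<n. 1 - (- q) ^ (2 * i + 1)) * (\<Prod>i<n. 1 - q ^ (2 * i + 1))) \<longlonglongrightarrow> odd_product (q\<^sup>2)"
  using odd_product_limit(1)[OF q2(1)] by simp
qed

context
 fixes q :: complex
 assumes q: "0 < norm q" "norm q < 1"
begin

text \<open>The reciprocal of the q-Pochhammer symbol of length m in base q^2, with the usual value
  0 for negative m; this convention makes the recursion below hold for every integer m.\<close>

definition inverse_factor :: "int => complex" where
 "inverse_factor m = (if m < 0 then 0 else 1 / (\<Prod>i<nat m. 1 - (q\<^sup>2) ^ Suc i))"

text \<open>q^(k^2) times the Gaussian binomial coefficient of 2n over n + k in base q^2, divided by
  the q-Pochhammer symbol of length 2n. Without that normalisation the coefficient would not have a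
  limit factor by factor.\<close>

definition jacobi_coefficient :: "nat => int => complex" where
 "jacobi_coefficient n k = q powi (k\<^sup>2) * inverse_factor (int n - k) * inverse_factor (int n + k)"

lemma square_nome: "norm (q\<^sup>2) < 1"
 using norm_power_less_1[OF q(2), of 2] by simp

lemma inverse_factor_rec: "inverse_factor (m - 1) = (1 - (q\<^sup>2) powi m) * inverse_factor m"
proof -
 consider "m < 0" | "m = 0" | "m > 0" by linarith
 thus ?thesis
 proof cases
  case 3
  then obtain l where l: "m = int (Suc l)" by (metis gr0_implies_Suc zero_less_imp_eq_int)
  have "m - 1 = int l" using l by simp
  hence "inverse_factor (m - 1) = 1 / (\<Prod>i<l. 1 - (q\<^sup>2) ^ Suc i)"
   by (simp add: inverse_factor_def del: power_Suc)
  moreover have "inverse_factor m = 1 / ((\<Prod>i<l. 1 - (q\<^sup>2) ^ Suc i) * (1 - (q\<^sup>2) ^ Suc l))"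
   by (simp add: l inverse_factor_def del: power_Suc of_nat_Suc)
  moreover have "1 - (q\<^sup>2) ^ Suc l ~= 0" using power_product_nonzero(2)[OF square_nome, of "Suc l"] by simp
  moreover have "(q\<^sup>2) powi m = (q\<^sup>2) ^ Suc l" by (simp only: l power_int_of_nat)
  ultimately show ?thesis by (simp del: power_Suc)
 qed (auto simp: inverse_factor_def)
qed

text \<open>Written in a = q^(2(n+1-k)), b = q^(2(n+1+k)) and c = q^(-2), all coefficients share the
  factor q^(k^2) \<open>G\<close>, and the claim becomes a polynomial identity in a, b and
  c.\<close>

lemma jacobi_coefficient_rec:
 "(1 - (q\<^sup>2) ^ (2 * n + 1)) * (1 - (q\<^sup>2) ^ (2 * n + 2)) * jacobi_coefficient (Suc n) k
  = (1 + (q\<^sup>2) ^ (2 * n + 1)) * jacobi_coefficient n k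
   + q ^ (2 * n + 1) * (jacobi_coefficient n (k - 1) + jacobi_coefficient n (k + 1))"
proof -
 have q0: "q ~= 0" using q by auto
 define c where "c = 1 / q\<^sup>2"
 define a b G where "a = (q\<^sup>2) powi (int n + 1 - k)" and "b = (q\<^sup>2) powi (int n + 1 + k)"
  and "G = inverse_factor (int n + 1 - k) * inverse_factor (int n + 1 + k)"
 have ab: "a * b = (q\<^sup>2) ^ (2 * n + 2)"
 proof -
  have "(q\<^sup>2) powi (int n + 1 - k + (int n + 1 + k)) = a * b"
   unfolding a_def b_def by (rule power_int_add) (use q0 in auto)
  moreover have "int n + 1 - k + (int n + 1 + k) = int (2 * n + 2)" by simp
  ultimately have "a * b = (q\<^sup>2) powi (int (2 * n + 2))" by (simp only:)
  thus ?thesis by (simp only: power_int_of_nat)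
 qed
 have abc: "a * b * c = (q\<^sup>2) ^ (2 * n + 1)" unfolding ab c_def using q0 by (simp add: power_add power2_eq_square)
 have bc: "(q\<^sup>2) powi (int n + k) = b * c" "(q\<^sup>2) powi (int n - k) = a * c"
 proof -
  have e: "int n + 1 + k = int n + k + 1" "int n + 1 - k = int n - k + 1" by simp_all
  have "b = (q\<^sup>2) powi (int n + k) * q\<^sup>2" "a = (q\<^sup>2) powi (int n - k) * q\<^sup>2"
   unfolding a_def b_def e by (rule power_int_add_1; use q0 in simp)+
  thus "(q\<^sup>2) powi (int n + k) = b * c" "(q\<^sup>2) powi (int n - k) = a * c" using q0 by (simp_all add: c_def)
 qed
 have r: "inverse_factor (int n - k) = (1 - a) * inverse_factor (int n + 1 - k)"
  "inverse_factor (int n + k) = (1 - b) * inverse_factor (int n + 1 + k)"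
  "inverse_factor (int n + k - 1) = (1 - b * c) * ((1 - b) * inverse_factor (int n + 1 + k))"
  "inverse_factor (int n - k - 1) = (1 - a * c) * ((1 - a) * inverse_factor (int n + 1 - k))"
 proof -
  have e: "int n - k = int n + 1 - k - 1" "int n + k = int n + 1 + k - 1" by simp_all
  show r1: "inverse_factor (int n - k) = (1 - a) * inverse_factor (int n + 1 - k)"
   unfolding a_def e(1) by (rule inverse_factor_rec)
  show r2: "inverse_factor (int n + k) = (1 - b) * inverse_factor (int n + 1 + k)"
   unfolding b_def e(2) by (rule inverse_factor_rec)
  show "inverse_factor (int n + k - 1) = (1 - b * c) * ((1 - b) * inverse_factor (int n + 1 + k))"
   unfolding inverse_factor_rec[of "int n + k"] bc r2 ..
  show "inverse_factor (int n - k - 1) = (1 - a * c) * ((1 - a) * inverse_factor (int n + 1 - k))"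
   unfolding inverse_factor_rec[of "int n - k"] bc r1 ..
 qed
 have s: "q ^ (2 * n + 1) * q powi ((k - 1)\<^sup>2) = q powi (k\<^sup>2) * a" "q ^ (2 * n + 1) * q powi ((k + 1)\<^sup>2) = q powi (k\<^sup>2) * b"
 proof -
  have e: "(q\<^sup>2) powi m = q powi (2 * m)" for m by (simp add: power_int_mult)
  have "q ^ (2 * n + 1) = q powi (2 * int n + 1)" by (simp add: power_int_def nat_add_distrib nat_mult_distrib)
  thus "q ^ (2 * n + 1) * q powi ((k - 1)\<^sup>2) = q powi (k\<^sup>2) * a" "q ^ (2 * n + 1) * q powi ((k + 1)\<^sup>2) = q powi (k\<^sup>2) * b"
   unfolding a_def b_def e using q0
   by (simp_all add: power2_eq_square algebra_simps flip: power_int_add)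
 qed
 have f: "jacobi_coefficient (Suc n) k = q powi (k\<^sup>2) * G"
  "jacobi_coefficient n k = q powi (k\<^sup>2) * ((1 - a) * (1 - b) * G)"
  "q ^ (2 * n + 1) * jacobi_coefficient n (k - 1) = q powi (k\<^sup>2) * (a * (1 - b) * (1 - b * c) * G)"
  "q ^ (2 * n + 1) * jacobi_coefficient n (k + 1) = q powi (k\<^sup>2) * (b * (1 - a) * (1 - a * c) * G)"
 proof -
  show "jacobi_coefficient (Suc n) k = q powi (k\<^sup>2) * G"
   unfolding jacobi_coefficient_def G_def by (simp add: algebra_simps)
  show "jacobi_coefficient n k = q powi (k\<^sup>2) * ((1 - a) * (1 - b) * G)"
   unfolding jacobi_coefficient_def G_def r by (simp only: mult_ac)
  have "int n - (k - 1) = int n + 1 - k" "int n + (k - 1) = int n + k - 1" by simp_all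
  hence "q ^ (2 * n + 1) * jacobi_coefficient n (k - 1) = (q ^ (2 * n + 1) * q powi ((k - 1)\<^sup>2)) * (inverse_factor (int n + 1 - k) * inverse_factor (int n + k - 1))"
   unfolding jacobi_coefficient_def by (simp only: mult_ac)
  thus "q ^ (2 * n + 1) * jacobi_coefficient n (k - 1) = q powi (k\<^sup>2) * (a * (1 - b) * (1 - b * c) * G)"
   unfolding s r G_def by (simp only: mult_ac)
  have "int n - (k + 1) = int n - k - 1" "int n + (k + 1) = int n + 1 + k" by simp_all
  hence "q ^ (2 * n + 1) * jacobi_coefficient n (k + 1) = (q ^ (2 * n + 1) * q powi ((k + 1)\<^sup>2)) * (inverse_factor (int n - k - 1) * inverse_factor (int n + 1 + k))"
   unfolding jacobi_coefficient_def by (simp only: mult_ac)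
  thus "q ^ (2 * n + 1) * jacobi_coefficient n (k + 1) = q powi (k\<^sup>2) * (b * (1 - a) * (1 - a * c) * G)"
   unfolding s r G_def by (simp only: mult_ac)
 qed
 have id: "(1 - a * b * c) * (1 - a * b) * (x * g) = (1 + a * b * c) * (x * ((1 - a) * (1 - b) * g))
   + (x * (a * (1 - b) * (1 - b * c) * g) + x * (b * (1 - a) * (1 - a * c) * g))" for x g
  by (simp add: algebra_simps)
 show ?thesis unfolding distrib_left f abc[symmetric] ab[symmetric] by (rule id)
qed

lemma jacobi_coefficient_support: "\<bar>k\<bar> > int n ==> jacobi_coefficient n k = 0"
 by (auto simp: jacobi_coefficient_def inverse_factor_def)

lemma jacobi_summable: "(%k. z powi k * jacobi_coefficient n (k + d)) summable_on UNIV"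
proof (rule finite_nonzero_values_imp_summable_on)
 have "{k \<in> UNIV. z powi k * jacobi_coefficient n (k + d) ~= 0} \<subseteq> {- int n - d..int n - d}"
 proof
  fix k assume "k \<in> {k \<in> UNIV. z powi k * jacobi_coefficient n (k + d) ~= 0}"
  hence "~ \<bar>k + d\<bar> > int n" using jacobi_coefficient_support[of n "k + d"] by auto
  thus "k \<in> {- int n - d..int n - d}" by auto
 qed
 thus "finite {k \<in> UNIV. z powi k * jacobi_coefficient n (k + d) ~= 0}" by (rule finite_subset) simp
qed

text \<open>Multiplying by the two factors with i = n replaces the coefficient at k by a combination
  of those at k - 1, k and k + 1; this is \<open>jacobi_coefficient_rec\<close>, the shifts in k
  being absorbed by powers of z.\<close>

lemma finite_jacobi_triple_product:
 assumes z: "z ~= 0"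
 shows "(\<Prod>i<n. (1 + z * q ^ (2 * i + 1)) * (1 + q ^ (2 * i + 1) / z))
   = (\<Prod>i<2 * n. 1 - (q\<^sup>2) ^ Suc i) * (\<Sum>\<^sub>\<infinity>k. z powi k * jacobi_coefficient n k)"
proof (induction n)
 case 0
 have "(\<Sum>\<^sub>\<infinity>k. z powi k * jacobi_coefficient 0 k) = z powi 0 * jacobi_coefficient 0 0"
  by (rule infsum_single) (use jacobi_coefficient_support[of 0] in auto)
 thus ?case by (simp add: jacobi_coefficient_def inverse_factor_def)
next
 case (Suc n)
 define S where "S n = (\<Sum>\<^sub>\<infinity>k. z powi k * jacobi_coefficient n k)" for n
 have sh: "(\<Sum>\<^sub>\<infinity>k. z powi k * jacobi_coefficient n (k + d)) = z powi (- d) * S n" for d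
 proof -
  have "(\<Sum>\<^sub>\<infinity>k. z powi k * jacobi_coefficient n (k + d)) = (\<Sum>\<^sub>\<infinity>k. z powi (k - d) * jacobi_coefficient n k)"
   by (rule infsum_reindex_bij_witness[of _ "%k. k - d" "%k. k + d"]) auto
  also have "... = (\<Sum>\<^sub>\<infinity>k. z powi (- d) * (z powi k * jacobi_coefficient n k))"
   by (rule infsum_cong) (use z in \<open>simp add: power_int_diff power_int_minus divide_inverse\<close>)
  finally show ?thesis by (simp add: infsum_cmult_right' S_def)
 qed
 define c d where "c = (1 - (q\<^sup>2) ^ (2 * n + 1)) * (1 - (q\<^sup>2) ^ (2 * n + 2))" and "d = 1 + (q\<^sup>2) ^ (2 * n + 1)"
 define e where "e = q ^ (2 * n + 1)"
 have hs: "((%k. z powi k * jacobi_coefficient n (k + d)) has_sum z powi (- d) * S n) UNIV" for d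
  using has_sum_infsum[OF jacobi_summable[of z n d]] unfolding sh .
 have "((%k. d * (z powi k * jacobi_coefficient n (k + 0)) + e * (z powi k * jacobi_coefficient n (k + -1) + z powi k * jacobi_coefficient n (k + 1)))
   has_sum (d * (z powi (- 0) * S n) + e * (z powi (- (-1)) * S n + z powi (- 1) * S n))) UNIV"
  by (intro has_sum_add has_sum_cmult_right hs)
 also have "(%k. d * (z powi k * jacobi_coefficient n (k + 0)) + e * (z powi k * jacobi_coefficient n (k + -1) + z powi k * jacobi_coefficient n (k + 1)))
   = (%k. c * (z powi k * jacobi_coefficient (Suc n) k))"
 proof
  fix k
  have "c * (z powi k * jacobi_coefficient (Suc n) k) = z powi k * (c * jacobi_coefficient (Suc n) k)" by (simp only: mult_ac)
  also have "c * jacobi_coefficient (Suc n) k = d * jacobi_coefficient n k + e * (jacobi_coefficient n (k - 1) + jacobi_coefficient n (k + 1))"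
   unfolding c_def d_def e_def by (rule jacobi_coefficient_rec)
  finally show "d * (z powi k * jacobi_coefficient n (k + 0)) + e * (z powi k * jacobi_coefficient n (k + -1) + z powi k * jacobi_coefficient n (k + 1))
   = c * (z powi k * jacobi_coefficient (Suc n) k)" by (simp add: algebra_simps)
 qed
 finally have H: "((%k. c * (z powi k * jacobi_coefficient (Suc n) k)) has_sum (d * (z powi (- 0) * S n) + e * (z powi (- (-1)) * S n + z powi (- 1) * S n))) UNIV" .
 have "((%k. z powi k * jacobi_coefficient (Suc n) k) has_sum S (Suc n)) UNIV"
  using has_sum_infsum[OF jacobi_summable[of z "Suc n" 0]] by (simp add: S_def)
 from has_sum_unique[OF has_sum_cmult_right[OF this] H]
 have "c * S (Suc n) = d * S n + e * (z * S n + S n / z)"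
  by (simp add: power_int_minus divide_inverse mult.commute)
 also have "... = (1 + z * e) * (1 + e / z) * S n"
 proof -
  have "d = 1 + e * e" unfolding d_def e_def by (simp add: power_mult[symmetric] power_add[symmetric] mult.commute)
  thus ?thesis using z by (simp add: field_simps)
 qed
 finally have rec: "c * S (Suc n) = (1 + z * e) * (1 + e / z) * S n" .
 have "(\<Prod>i<2 * Suc n. 1 - (q\<^sup>2) ^ Suc i) = (\<Prod>i<2 * n. 1 - (q\<^sup>2) ^ Suc i) * c"
  unfolding c_def by (simp add: mult.assoc)
 hence "(\<Prod>i<2 * Suc n. 1 - (q\<^sup>2) ^ Suc i) * S (Suc n) = (\<Prod>i<2 * n. 1 - (q\<^sup>2) ^ Suc i) * (c * S (Suc n))"
  by (simp only: mult.assoc)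
 also have "... = ((\<Prod>i<2 * n. 1 - (q\<^sup>2) ^ Suc i) * S n) * ((1 + z * e) * (1 + e / z))"
  unfolding rec by (simp only: mult_ac)
 also have "(\<Prod>i<2 * n. 1 - (q\<^sup>2) ^ Suc i) * S n = (\<Prod>i<n. (1 + z * q ^ (2 * i + 1)) * (1 + q ^ (2 * i + 1) / z))"
  unfolding S_def Suc.IH ..
 finally show ?case unfolding S_def e_def by simp
qed

text \<open>The limit of the finite form. The reciprocal Pochhammer symbols converge and are bounded
  by some B, and |q| \<le> |z| bounds the term k by B^2 |q|^(k^2 - |k|).\<close>

lemma jacobi_triple_product:
 assumes z: "norm q <= norm z" "norm z <= 1"
 shows "(%n. \<Prod>i<n. (1 + z * q ^ (2 * i + 1)) * (1 + q ^ (2 * i + 1) / z))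
   \<longlonglongrightarrow> (\<Sum>\<^sub>\<infinity>k. z powi k * q powi (k\<^sup>2)) / euler_product (q\<^sup>2)"
proof -
 have z0: "z ~= 0" using z q by auto
 define E where "E = euler_product (q\<^sup>2)"
 have E: "(%n. \<Prod>i<n. 1 - (q\<^sup>2) ^ Suc i) \<longlonglongrightarrow> E" "E ~= 0"
  using euler_product_limit[OF square_nome] by (simp_all add: E_def)
 have "(%n. 1 / (\<Prod>i<n. 1 - (q\<^sup>2) ^ Suc i)) \<longlonglongrightarrow> 1 / E" using E by (intro tendsto_intros)
 hence "Bseq (%n. 1 / (\<Prod>i<n. 1 - (q\<^sup>2) ^ Suc i))" by (rule convergent_imp_Bseq[OF convergentI])
 then obtain B where B: "B > 0" "!!n. norm (1 / (\<Prod>i<n. 1 - (q\<^sup>2) ^ Suc i)) <= B" by (rule BseqE) blast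
 have bnd: "norm (inverse_factor m) <= B" for m using B by (simp add: inverse_factor_def)
 have lim: "(%n. inverse_factor (int n + m)) \<longlonglongrightarrow> 1 / E" for m
 proof -
  have "(%n. 1 / (\<Prod>i<n. 1 - (q\<^sup>2) ^ Suc i)) \<longlonglongrightarrow> 1 / E" using E by (intro tendsto_intros)
  moreover have "filterlim (%n. nat (int n + m)) at_top sequentially"
   unfolding filterlim_at_top
  proof
   fix Z :: nat
   show "\<forall>\<^sub>F n in sequentially. Z <= nat (int n + m)"
    unfolding eventually_sequentially by (rule exI[of _ "Z + nat \<bar>m\<bar>"]) auto
  qed
  ultimately have "(%n. 1 / (\<Prod>i<nat (int n + m). 1 - (q\<^sup>2) ^ Suc i)) \<longlonglongrightarrow> 1 / E" by (rule filterlim_compose)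
  moreover have "\<forall>\<^sub>F n in sequentially. 1 / (\<Prod>i<nat (int n + m). 1 - (q\<^sup>2) ^ Suc i) = inverse_factor (int n + m)"
   unfolding eventually_sequentially by (rule exI[of _ "nat \<bar>m\<bar>"]) (auto simp: inverse_factor_def)
  ultimately show ?thesis using tendsto_cong by fastforce
 qed
 have "(%n. \<Sum>\<^sub>\<infinity>k. z powi k * jacobi_coefficient n k) \<longlonglongrightarrow> (\<Sum>\<^sub>\<infinity>k. z powi k * (q powi (k\<^sup>2) * (1 / E) * (1 / E)))"
 proof (rule tendsto_infsum_int)
  fix k
  show "(%n. z powi k * jacobi_coefficient n k) \<longlonglongrightarrow> z powi k * (q powi (k\<^sup>2) * (1 / E) * (1 / E))"
   unfolding jacobi_coefficient_def using lim[of "- k"] lim[of k] by (intro tendsto_intros) simp_all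
 next
  \<comment> \<open>Since k^2 - |k| \<ge> |k| - 1, a geometric bound holds after division by
    \<open>norm q\<close>.\<close>
  define M where "M n = B * B / norm q * norm q ^ n" for n :: nat
  show "summable M" unfolding M_def using q by (intro summable_mult summable_geometric) simp
  have "norm (z powi k * jacobi_coefficient n k) <= M (nat \<bar>k\<bar>)" for n k
  proof -
   define a where "a = nat \<bar>k\<bar>"
   have k2: "q powi (k\<^sup>2) = q ^ (a * a)"
    by (simp add: power_int_def a_def power2_eq_square nat_mult_distrib[symmetric] flip: abs_mult)
   have "norm (z powi k) <= (1 / norm z) ^ a" unfolding a_def by (rule norm_powi_le) (use z q in auto)
   also have "... <= (1 / norm q) ^ a" using z q z0 by (intro power_mono divide_left_mono mult_pos_pos) auto
   finally have 1: "norm (z powi k) * norm q ^ (a * a) <= (1 / norm q) ^ a * norm q ^ (a * a)" by (intro mult_right_mono) auto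
   also have "(1 / norm q) ^ a * norm q ^ (a * a) <= norm q ^ a / norm q"
   proof (cases a)
    case (Suc b)
    have "(1 / norm q) ^ a * norm q ^ (a * a) = norm q ^ (a * b)"
     using q by (simp add: Suc power_divide power_add[symmetric] field_simps flip: power_Suc)
    also have "... <= norm q ^ b" using q by (intro power_decreasing) (auto simp: Suc)
    also have "norm q ^ b = norm q ^ a / norm q" using q by (simp add: Suc)
    finally show ?thesis .
   qed (use q in \<open>simp add: field_simps\<close>)
   finally have 2: "norm (z powi k) * norm q ^ (a * a) <= norm q ^ a / norm q" .
   have "norm (z powi k * jacobi_coefficient n k)
     = (norm (z powi k) * norm q ^ (a * a)) * (norm (inverse_factor (int n - k)) * norm (inverse_factor (int n + k)))"
    by (simp add: jacobi_coefficient_def norm_mult k2 norm_power mult_ac)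
   also have "... <= (norm q ^ a / norm q) * (B * B)"
    using bnd B(1) q by (intro mult_mono 2) auto
   finally show ?thesis by (simp add: M_def a_def mult_ac)
  qed
  thus "\<forall>\<^sub>F n in sequentially. \<forall>k. norm (z powi k * jacobi_coefficient n k) <= M (nat \<bar>k\<bar>)" by simp
 qed simp
 moreover have "(%n. \<Prod>i<2 * n. 1 - (q\<^sup>2) ^ Suc i) \<longlonglongrightarrow> E"
  using LIMSEQ_subseq_LIMSEQ[OF E(1), of "%n. 2 * n"] by (simp add: strict_mono_def o_def)
 ultimately have "(%n. (\<Prod>i<2 * n. 1 - (q\<^sup>2) ^ Suc i) * (\<Sum>\<^sub>\<infinity>k. z powi k * jacobi_coefficient n k))
   \<longlonglongrightarrow> E * (\<Sum>\<^sub>\<infinity>k. z powi k * (q powi (k\<^sup>2) * (1 / E) * (1 / E)))"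
  by (intro tendsto_mult)
 moreover have "E * (\<Sum>\<^sub>\<infinity>k. z powi k * (q powi (k\<^sup>2) * (1 / E) * (1 / E))) = (\<Sum>\<^sub>\<infinity>k. z powi k * q powi (k\<^sup>2)) / E"
 proof -
  have "(%k. z powi k * (q powi (k\<^sup>2) * (1 / E) * (1 / E))) = (%k. (z powi k * q powi (k\<^sup>2)) * (1 / E * (1 / E)))"
   by (simp only: mult_ac)
  thus ?thesis using E(2) by (simp only: infsum_cmult_left') simp
 qed
 ultimately show ?thesis unfolding finite_jacobi_triple_product[OF z0] E_def by simp
qed

end

text \<open>The triple product at z = 1, where the two factors coincide and form a square.\<close>

lemma theta_as_product:
 assumes q: "0 < norm q" "norm q < 1"
 shows "theta q = odd_product (- q) ^ 2 * euler_product (q\<^sup>2)"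
proof -
 have q': "norm (- q) < 1" and q2: "norm (q\<^sup>2) < 1" using q norm_power_less_1[OF q(2), of 2] by auto
 have l1: "(%n. \<Prod>i<n. (1 + 1 * q ^ (2 * i + 1)) * (1 + q ^ (2 * i + 1) / 1))
   \<longlonglongrightarrow> (\<Sum>\<^sub>\<infinity>k. 1 powi k * q powi (k\<^sup>2)) / euler_product (q\<^sup>2)"
  by (rule jacobi_triple_product[OF q]) (use q in auto)
 have l2: "(%n. \<Prod>i<n. (1 + 1 * q ^ (2 * i + 1)) * (1 + q ^ (2 * i + 1) / 1)) = (%n. (\<Prod>i<n. 1 - (- q) ^ (2 * i + 1)) ^ 2)"
 proof -
  have "(1 + 1 * q ^ (2 * i + 1)) * (1 + q ^ (2 * i + 1) / 1) = (1 - (- q) ^ (2 * i + 1)) ^ 2" for i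
   by (simp add: power2_eq_square)
  thus ?thesis by (simp only: prod_power_distrib)
 qed
 have l3: "(%n. (\<Prod>i<n. 1 - (- q) ^ (2 * i + 1)) ^ 2) \<longlonglongrightarrow> odd_product (- q) ^ 2"
  by (intro tendsto_power odd_product_limit q')
 have "(\<Sum>\<^sub>\<infinity>k. 1 powi k * q powi (k\<^sup>2)) / euler_product (q\<^sup>2) = odd_product (- q) ^ 2"
  by (rule LIMSEQ_unique[OF l1[unfolded l2] l3])
 moreover have "(\<Sum>\<^sub>\<infinity>k. 1 powi k * q powi (k\<^sup>2)) = theta q"
  unfolding theta_def by (rule infsum_cong) (simp add: power_int_def)
 ultimately show ?thesis using euler_product_limit(2)[OF q2] by (simp add: field_simps)
qed

text \<open>The product over odd exponents is a quotient of two Euler products, and its value at -q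
  follows from (1 + x)(1 - x) = 1 - x^2.\<close>

lemma theta_euler:
 assumes q: "0 < norm q" "norm q < 1"
 shows "theta q = euler_product (q\<^sup>2) ^ 5 / (euler_product q ^ 2 * euler_product (q ^ 4) ^ 2)"
  and "theta (- q) = euler_product q ^ 2 / euler_product (q\<^sup>2)"
proof -
 have q2: "norm (q\<^sup>2) < 1" and q4: "norm (q ^ 4) < 1" using norm_power_less_1[OF q(2)] by auto
 define E1 E2 E4 where "E1 = euler_product q" and "E2 = euler_product (q\<^sup>2)" and "E4 = euler_product (q ^ 4)"
 have nz: "E1 ~= 0" "E2 ~= 0" "E4 ~= 0" using euler_product_limit(2) q q2 q4 by (auto simp: E1_def E2_def E4_def)
 have o1: "odd_product q = E1 / E2" using euler_product_split[OF q(2)] nz by (simp add: E1_def E2_def field_simps)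
 have o2: "odd_product (q\<^sup>2) = E2 / E4" using euler_product_split[OF q2] nz by (simp add: E4_def E2_def field_simps flip: power_mult)
 have o3: "odd_product (- q) = E2 ^ 2 / (E1 * E4)"
  using odd_product_reflect[OF q(2)] nz unfolding o1 o2 by (simp add: field_simps power2_eq_square)
 show "theta q = euler_product (q\<^sup>2) ^ 5 / (euler_product q ^ 2 * euler_product (q ^ 4) ^ 2)"
  unfolding theta_as_product[OF q] o3 E1_def[symmetric] E2_def[symmetric] E4_def[symmetric]
  by (simp add: power_divide power_mult_distrib eval_nat_numeral mult_ac)
 have "theta (- q) = odd_product (- (- q)) ^ 2 * euler_product ((- q)\<^sup>2)" by (rule theta_as_product) (use q in auto)
 also have "... = (E1 / E2)\<^sup>2 * E2" by (simp add: o1 E2_def)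
 also have "... = E1\<^sup>2 / E2" using nz by (simp add: power2_eq_square)
 finally show "theta (- q) = euler_product q ^ 2 / euler_product (q\<^sup>2)" by (simp add: E1_def E2_def)
qed

lemma plus_product_limit:
 assumes q: "norm q < 1"
 shows "(%n. \<Prod>i<n. 1 + q ^ Suc i) \<longlonglongrightarrow> euler_product (q\<^sup>2) / euler_product q"
proof -
 have q2: "norm (q\<^sup>2) < 1" using norm_power_less_1[OF q, of 2] by simp
 have "(%n. (\<Prod>i<n. 1 - (q\<^sup>2) ^ Suc i) / (\<Prod>i<n. 1 - q ^ Suc i)) \<longlonglongrightarrow> euler_product (q\<^sup>2) / euler_product q"
  by (intro tendsto_divide euler_product_limit q q2)
 moreover have "(1 - (q\<^sup>2) ^ Suc i) / (1 - q ^ Suc i) = 1 + q ^ Suc i" for i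
 proof -
  have "1 - (q\<^sup>2) ^ Suc i = (1 + q ^ Suc i) * (1 - q ^ Suc i)"
   unfolding power_power_commute[of q 2 "Suc i"] by (simp add: power2_eq_square algebra_simps)
  thus ?thesis using power_product_nonzero(2)[OF q, of "Suc i"] by simp
 qed
 ultimately show ?thesis by (simp only: prod_dividef[symmetric])
qed

text \<open>The left side is the part of theta over odd x = 2k + 1, where q^(x^2) = q p^(k^2 + k)
  with p = q^4. This is the triple product for base p at z = p, and the factor 2 is the value 1 + 1
  of the second factor at i = 0.\<close>

lemma theta_difference:
 assumes q: "0 < norm q" "norm q < 1"
 shows "theta q - theta (q ^ 4) = 2 * q * (euler_product (q ^ 16) ^ 2 / euler_product (q ^ 8))"
proof -
 define p where "p = q ^ 4"
 have p: "0 < norm p" "norm p < 1" "norm (p\<^sup>2) < 1" using norm_power_less_1[OF q(2), of 4] norm_power_less_1[of p 2] q by (auto simp: p_def)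
 have "(%n. \<Prod>i<n. (1 + p * p ^ (2 * i + 1)) * (1 + p ^ (2 * i + 1) / p)) \<longlonglongrightarrow> (\<Sum>\<^sub>\<infinity>k. p powi k * p powi (k\<^sup>2)) / euler_product (p\<^sup>2)"
  by (rule jacobi_triple_product[OF p(1,2)]) (use p in auto)
 hence l1: "(%n. \<Prod>i<Suc n. (1 + p * p ^ (2 * i + 1)) * (1 + p ^ (2 * i + 1) / p)) \<longlonglongrightarrow> (\<Sum>\<^sub>\<infinity>k. p powi k * p powi (k\<^sup>2)) / euler_product (p\<^sup>2)"
  by (rule LIMSEQ_Suc)
 have e: "(\<Prod>i<Suc n. (1 + p * p ^ (2 * i + 1)) * (1 + p ^ (2 * i + 1) / p)) = 2 * (\<Prod>i<Suc n. 1 + (p\<^sup>2) ^ Suc i) * (\<Prod>i<n. 1 + (p\<^sup>2) ^ Suc i)" for n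
 proof -
  have "1 + p * p ^ (2 * i + 1) = 1 + (p\<^sup>2) ^ Suc i" "1 + p ^ (2 * i + 1) / p = 1 + (p\<^sup>2) ^ i" for i
   using p by (simp_all add: power_mult power_add power2_eq_square)
  hence "(\<Prod>i<Suc n. (1 + p * p ^ (2 * i + 1)) * (1 + p ^ (2 * i + 1) / p)) = (\<Prod>i<Suc n. 1 + (p\<^sup>2) ^ Suc i) * (\<Prod>i<Suc n. 1 + (p\<^sup>2) ^ i)"
   by (simp only: prod.distrib)
  also have "(\<Prod>i<Suc n. 1 + (p\<^sup>2) ^ i) = 2 * (\<Prod>i<n. 1 + (p\<^sup>2) ^ Suc i)"
   by (subst prod.lessThan_Suc_shift) simp
  finally show ?thesis by (simp only: mult_ac)
 qed
 note pl = plus_product_limit[OF p(3)]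
 have l2: "(%n. 2 * (\<Prod>i<Suc n. 1 + (p\<^sup>2) ^ Suc i) * (\<Prod>i<n. 1 + (p\<^sup>2) ^ Suc i))
   \<longlonglongrightarrow> 2 * (euler_product ((p\<^sup>2)\<^sup>2) / euler_product (p\<^sup>2)) * (euler_product ((p\<^sup>2)\<^sup>2) / euler_product (p\<^sup>2))"
  by (intro tendsto_mult tendsto_const LIMSEQ_Suc[OF pl] pl)
 have "(\<Sum>\<^sub>\<infinity>k. p powi k * p powi (k\<^sup>2)) / euler_product (p\<^sup>2) = 2 * (euler_product ((p\<^sup>2)\<^sup>2) / euler_product (p\<^sup>2)) * (euler_product ((p\<^sup>2)\<^sup>2) / euler_product (p\<^sup>2))"
  using LIMSEQ_unique[OF l1[unfolded e] l2] .
 hence S: "(\<Sum>\<^sub>\<infinity>k. p powi k * p powi (k\<^sup>2)) = 2 * (euler_product (q ^ 16) ^ 2 / euler_product (q ^ 8))"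
  using euler_product_limit(2)[OF p(3)] by (simp add: p_def field_simps power2_eq_square[of "euler_product _"] flip: power_mult)
 have s: "(%x::int. q ^ nat (x\<^sup>2)) summable_on UNIV" "(%x::int. (q ^ 4) ^ nat (x\<^sup>2)) summable_on UNIV"
  using theta_abs_summable[of q] theta_abs_summable[of p] q p abs_summable_summable by (auto simp: p_def)
 have "(\<Sum>\<^sub>\<infinity>x::int. if x mod 2 = 0 then (q ^ 4) ^ nat ((x div 2)\<^sup>2) else 0) = theta (q ^ 4)"
  unfolding infsum_even[of "%y. (q ^ 4) ^ nat (y\<^sup>2)"] theta_def ..
 moreover have E: "(%x::int. if x mod 2 = 0 then (q ^ 4) ^ nat ((x div 2)\<^sup>2) else 0) = (%x. if even x then q ^ nat (x\<^sup>2) else 0)"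
 proof
  fix x :: int
  show "(if x mod 2 = 0 then (q ^ 4) ^ nat ((x div 2)\<^sup>2) else 0) = (if even x then q ^ nat (x\<^sup>2) else 0)"
  proof (cases "even x")
   case True
   then obtain y where y: "x = 2 * y" by (elim evenE)
   have "nat (x\<^sup>2) = 4 * nat (y\<^sup>2)" by (simp add: y power_mult_distrib nat_mult_distrib)
   thus ?thesis by (simp add: y power_mult)
  qed (simp add: even_iff_mod_2_eq_zero)
 qed
 moreover have "(%x::int. if even x then q ^ nat (x\<^sup>2) else 0) summable_on UNIV"
 proof -
  have "(%x::int. q ^ nat (x\<^sup>2)) summable_on {x. even x}" using s(1) by (rule summable_on_subset_banach) simp
  thus ?thesis by (subst (asm) summable_on_cong_neutral) auto
 qed
 ultimately have "((%x::int. if even x then q ^ nat (x\<^sup>2) else 0) has_sum theta (q ^ 4)) UNIV"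
  using has_sum_infsum by metis
 moreover have "((%x::int. q ^ nat (x\<^sup>2)) has_sum theta q) UNIV"
  unfolding theta_def using s(1) by (rule has_sum_infsum)
 ultimately have "((%x::int. q ^ nat (x\<^sup>2) + - (if even x then q ^ nat (x\<^sup>2) else 0)) has_sum (theta q + - theta (q ^ 4))) UNIV"
  by (intro has_sum_add has_sum_uminusI)
 hence "((%x::int. q ^ nat (x\<^sup>2)) has_sum (theta q + - theta (q ^ 4))) {x. odd x}"
  by (subst has_sum_cong_neutral) auto
 hence "((%k::int. q * (p powi k * p powi (k\<^sup>2))) has_sum (theta q + - theta (q ^ 4))) UNIV"
 proof (subst (asm) has_sum_reindex_bij_witness[of _ "%k. 2 * k + 1" "%x. (x - 1) div 2"])
  fix x :: int assume "x \<in> {x. odd x}"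
  then obtain k where k: "x = 2 * k + 1" by (auto elim: oddE)
  have a: "q ^ nat (x\<^sup>2) = q powi (x\<^sup>2)" by (simp add: power_int_def)
  have b: "x\<^sup>2 = 1 + (4 * k + 4 * k\<^sup>2)" by (simp add: k power2_eq_square algebra_simps)
  have c: "q powi (1 + (4 * k + 4 * k\<^sup>2)) = q * (p powi k * p powi (k\<^sup>2))"
   using q by (simp add: power_int_add power_int_mult p_def)
  have F: "q ^ nat (x\<^sup>2) = q * (p powi k * p powi (k\<^sup>2))" unfolding a unfolding b by (rule c)
  have d: "(x - 1) div 2 = k" by (simp add: k)
  show "q * (p powi ((x - 1) div 2) * p powi (((x - 1) div 2)\<^sup>2)) = q ^ nat (x\<^sup>2)" unfolding d F ..
 qed auto
 hence "theta q + - theta (q ^ 4) = (\<Sum>\<^sub>\<infinity>k. q * (p powi k * p powi (k\<^sup>2)))" by (rule infsumI[symmetric])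
 also have "... = q * (\<Sum>\<^sub>\<infinity>k. p powi k * p powi (k\<^sup>2))" by (rule infsum_cmult_right')
 finally have "theta q + - theta (q ^ 4) = q * (\<Sum>\<^sub>\<infinity>k. p powi k * p powi (k\<^sup>2))" .
 thus ?thesis unfolding S by simp
qed

text \<open>Twice the left side is theta(q)^2 - theta(-q)^2, and by \<open>theta_quadruple\<close>
  this factors as 4 (theta(q) - theta(q^4)) theta(q^4).\<close>

lemma theta_square_difference:
 assumes q: "0 < norm q" "norm q < 1"
 shows "(theta q)\<^sup>2 - (theta (q\<^sup>2))\<^sup>2 = 4 * q * (euler_product (q ^ 8) ^ 4 / euler_product (q ^ 4) ^ 2)"
proof -
 have q4: "0 < norm (q ^ 4)" "norm (q ^ 4) < 1" "norm (q ^ 8) < 1" "norm (q ^ 16) < 1" using norm_power_less_1[OF q(2)] q by auto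
 define E4 E8 E16 where "E4 = euler_product (q ^ 4)" and "E8 = euler_product (q ^ 8)" and "E16 = euler_product (q ^ 16)"
 have nz: "E4 ~= 0" "E8 ~= 0" "E16 ~= 0" using euler_product_limit(2) q4 by (auto simp: E4_def E8_def E16_def)
 have t4: "theta (q ^ 4) = E8 ^ 5 / (E4 ^ 2 * E16 ^ 2)"
  using theta_euler(1)[OF q4(1,2)] by (simp add: E4_def E8_def E16_def flip: power_mult)
 have d: "theta q - theta (q ^ 4) = 2 * q * (E16 ^ 2 / E8)" using theta_difference[OF q] by (simp add: E8_def E16_def)
 have m: "theta (- q) = 2 * theta (q ^ 4) - theta q" using theta_quadruple[OF q(2)] by (simp add: algebra_simps)
 have "2 * ((theta q)\<^sup>2 - (theta (q\<^sup>2))\<^sup>2) = (theta q)\<^sup>2 - (theta (- q))\<^sup>2"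
  using theta_square_sum[OF q(2)] by (simp add: algebra_simps)
 also have "... = 4 * (theta q - theta (q ^ 4)) * theta (q ^ 4)" unfolding m by (simp add: power2_eq_square algebra_simps)
 also have "... = 2 * (4 * q * (E16 ^ 2 / E8 * (E8 ^ 5 / (E4 ^ 2 * E16 ^ 2))))" unfolding d unfolding t4 by simp
 also have "E8 ^ 5 = E8 * E8 ^ 4" by (simp add: eval_nat_numeral)
 also have "E16 ^ 2 / E8 * (E8 * E8 ^ 4 / (E4 ^ 2 * E16 ^ 2)) = E8 ^ 4 / E4 ^ 2" using nz by simp
 finally show ?thesis unfolding mult_cancel_left E4_def E8_def by simp
qed

section \<open>The four-square series\<close>

lemma infsum_index_geometric:
 fixes y :: complex
 assumes "norm y < 1"
 shows "(\<Sum>\<^sub>\<infinity>m\<in>{1..}. of_nat m * y ^ m) = y / (1 - y)\<^sup>2"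
proof -
 have "(%n. y * (of_nat (Suc n) * y ^ n)) sums (y * (1 / (1 - y)\<^sup>2))"
  using geometric_deriv_sums[OF assms] by (rule sums_mult)
 hence s: "(%n. of_nat (Suc n) * y ^ Suc n) sums (y / (1 - y)\<^sup>2)" by (simp add: mult_ac)
 have "summable (%n. norm y * (of_nat (Suc n) * norm y ^ n))"
  using geometric_deriv_sums[of "norm y"] assms by (intro summable_mult) (auto simp: summable_def)
 moreover have "norm y * (of_nat (Suc n) * norm y ^ n) = norm (of_nat (Suc n) * y ^ Suc n)" for n
  unfolding norm_mult norm_power norm_of_nat by simp
 ultimately have "summable (%n. norm (of_nat (Suc n) * y ^ Suc n))" by (simp only:)
 hence "((%n. of_nat (Suc n) * y ^ Suc n) has_sum (y / (1 - y)\<^sup>2)) UNIV" using s by (rule norm_summable_imp_has_sum)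
 hence "((%m. of_nat m * y ^ m) has_sum (y / (1 - y)\<^sup>2)) {1..}"
  by (subst has_sum_reindex_bij_witness[of _ Suc "%m. m - 1" UNIV "%n. of_nat (Suc n) * y ^ Suc n"]) auto
 thus ?thesis by (rule infsumI)
qed

text \<open>In the series of the sum of divisors the weight is placed on the complementary divisor,
  which gives the sum of m y^m instead of a plain geometric series.\<close>

lemma lambert_square_has_sum:
 assumes q: "norm q < 1"
 shows "((%n. q ^ n / (1 - q ^ n)\<^sup>2) has_sum eval_fps (sigma_fps 1) q) {1..}"
proof -
 have c: "polynomially_bounded (%_. 1)" "polynomially_bounded (%n. of_nat n ^ 1)"
  by (rule polynomially_bounded_const polynomially_bounded_power)+
 have "((%d. 1 * (\<Sum>\<^sub>\<infinity>m\<in>{1..}. of_nat m ^ 1 * (q ^ d) ^ m)) has_sum eval_fps (sigma_fps 1) q) {1..}"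
  unfolding sigma_fps_def lambert_fps_commute[of "%n. of_nat n ^ 1"] by (rule lambert_fps_eval(2)[OF c q])
 thus ?thesis
 proof (rule has_sum_cong[THEN iffD1, rotated])
  fix n :: nat assume "n \<in> {1..}"
  hence "norm (q ^ n) < 1" using norm_power_less_1[OF q, of n] by simp
  from infsum_index_geometric[OF this]
  show "1 * (\<Sum>\<^sub>\<infinity>m\<in>{1..}. of_nat m ^ 1 * (q ^ n) ^ m) = q ^ n / (1 - q ^ n)\<^sup>2" by simp
 qed
qed

text \<open>Jacobi's four-square theorem, needed for k = 2, which the moments with j > 0 do not
  reach. The kernel of dn at \<zeta>^2 = q sums to the square of theta, so the self-convolution
  \<open>F\<close> sums to the fourth power. At n \<noteq> 0 the convolution formula applies and
  contributes 8 (S(q) - S(q^2)), where S is the divisor series; \<open>F 0\<close> is computed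
  directly and equals 1 + 8 (S(q^2) - 4 S(q^4)).\<close>

lemma theta_fourth_power:
 assumes q: "0 < norm q" "norm q < 1"
 shows "theta q ^ 4 = 1 + 8 * eval_fps (sigma_fps 1) q - 32 * eval_fps (sigma_fps 1) (q ^ 4)"
proof -
 let ?S = "eval_fps (sigma_fps 1)"
 obtain r where r: "r\<^sup>2 = q" "0 < norm r" "norm r < 1" "norm q < norm r" using csqrt_nome[OF q] by blast
 have q0: "q ~= 0" and r0: "r ~= 0" using q r by auto
 have q2: "norm (q\<^sup>2) < 1" and q4: "norm (q ^ 4) < 1" using norm_power_less_1[OF q(2)] by auto
 define c where "c = ell_kernel (-1) 0 q r"
 have g: "geometric_decay c" unfolding c_def by (rule geometric_decay_ell_kernel) (use q r in auto)
 have ab: "c abs_summable_on UNIV" using geometric_decay_abs_summable[OF g, of 0] by simp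
 have th: "infsum c UNIV = (theta q)\<^sup>2"
  using sech_sum_eq_dn(1)[of r] sech_sum_eq_theta_square[OF q] by (simp add: dn_series_def moment_series_nth_0 c_def r)
 define F where "F n = (\<Sum>\<^sub>\<infinity>a. c a * c (n - a))" for n
 have F: "(F has_sum theta q ^ 4) UNIV"
  using infsum_convolution(1)[OF ab ab] unfolding F_def th by (simp flip: power_add)
 have Fn: "F n = of_int n * ell_kernel 1 0 q r n" if "n ~= 0" for n
  using ell_kernel_convolution[OF q r0, of "-1" "-1" 0 0 n] that by (simp add: F_def c_def)
 have rp: "r powi (2 * int n) = q ^ n" "q powi (2 * int n) = (q ^ n)\<^sup>2"
  "r powi (- (2 * int n)) = 1 / q ^ n" "q powi (- (2 * int n)) = 1 / (q ^ n)\<^sup>2" for n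
 proof -
  have e: "2 * int n = int (2 * n)" by simp
  show 1: "r powi (2 * int n) = q ^ n" unfolding e power_int_of_nat by (simp add: power_mult r(1))
  show 2: "q powi (2 * int n) = (q ^ n)\<^sup>2" unfolding e power_int_of_nat by (simp add: power_mult power_power_commute[of q 2])
  show "r powi (- (2 * int n)) = 1 / q ^ n" unfolding power_int_minus 1 by (simp add: divide_inverse)
  show "q powi (- (2 * int n)) = 1 / (q ^ n)\<^sup>2" unfolding power_int_minus 2 by (simp add: divide_inverse)
 qed
 have nz: "q ^ n ~= 0" "1 - (q ^ n)\<^sup>2 ~= 0" "1 + (q ^ n)\<^sup>2 ~= 0" if "n >= 1" for n
 proof -
  have "norm (q ^ n) < 1" using norm_power_less_1[OF q(2), of n] that by simp
  thus "1 - (q ^ n)\<^sup>2 ~= 0" "1 + (q ^ n)\<^sup>2 ~= 0" using one_pm_power_nonzero[of "q ^ n" 2] by auto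
  show "q ^ n ~= 0" using q0 by simp
 qed
 have 1: "infsum F UNIV = F 0 + 8 * (?S q + - ?S (q\<^sup>2))"
 proof (rule infsum_even_positive)
  show "F summable_on UNIV" using F by (auto simp: summable_on_def)
  show "F N = 0" if "odd N" for N
   using that Fn[of N] by (cases "N = 0") (auto simp: ell_kernel_def odd_iff_mod_2_eq_one)
  show "((%n. F (2 * int n) + F (- (2 * int n))) has_sum 8 * (?S q + - ?S (q\<^sup>2))) {1..}"
  proof (subst has_sum_cong)
   show "((%n. 8 * (of_nat n ^ 1 * (q ^ n / (1 - (q ^ n)\<^sup>2)))) has_sum 8 * (?S q + - ?S (q\<^sup>2))) {1..}"
    unfolding sigma_fps_def by (intro has_sum_cmult_right lambert_odd_has_sum polynomially_bounded_power q)
   fix n :: nat assume n: "n \<in> {1..}"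
   define x where "x = q ^ n"
   have x: "x ~= 0" "1 - x\<^sup>2 ~= 0" using nz[of n] n by (auto simp: x_def)
   have e: "(1 / x) / (1 - 1 / x\<^sup>2) = - (x / (1 - x\<^sup>2))"
   proof -
    have "1 - 1 / x\<^sup>2 = - ((1 - x\<^sup>2) / x\<^sup>2)" using x by (simp add: field_simps)
    moreover have "(1 / x) / (- (d / x\<^sup>2)) = - (x / d)" for d using x by (simp add: power2_eq_square)
    ultimately show ?thesis by (simp only:)
   qed
   have "F (2 * int n) = of_int (2 * int n) * (2 * x / (1 - x\<^sup>2))"
    by (subst Fn) (use n in \<open>simp_all add: ell_kernel_def rp x_def[symmetric]\<close>)
   moreover have "F (- (2 * int n)) = of_int (- (2 * int n)) * (2 * (1 / x) / (1 - 1 / x\<^sup>2))"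
    by (subst Fn) (use n in \<open>simp_all add: ell_kernel_def rp x_def[symmetric]\<close>)
   moreover have "of_int (- (2 * int n)) * (2 * (1 / x) / D) = - (of_nat n * 4 * ((1 / x) / D))" for D by simp
   ultimately show "F (2 * int n) + F (- (2 * int n)) = 8 * (of_nat n ^ 1 * (q ^ n / (1 - (q ^ n)\<^sup>2)))"
    by (simp only: e) (simp add: x_def)
  qed
 qed
 have 2: "F 0 = 1 + 8 * (?S (q\<^sup>2) + - (4 * ?S (q ^ 4)))"
 proof -
  have "infsum (%a. c a * c (0 - a)) UNIV = c 0 * c (0 - 0) + 8 * (?S (q\<^sup>2) + - (4 * ?S (q ^ 4)))"
  proof (rule infsum_even_positive)
   show "(%a. c a * c (0 - a)) summable_on UNIV" by (rule infsum_convolution(2)[OF ab ab])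
   show "c N * c (0 - N) = 0" if "odd N" for N
    using that by (simp add: c_def ell_kernel_def odd_iff_mod_2_eq_one)
   show "((%n. c (2 * int n) * c (0 - 2 * int n) + c (- (2 * int n)) * c (0 - - (2 * int n))) has_sum 8 * (?S (q\<^sup>2) + - (4 * ?S (q ^ 4)))) {1..}"
   proof (subst has_sum_cong)
    show "((%n. 8 * ((q\<^sup>2) ^ n / (1 - (q\<^sup>2) ^ n)\<^sup>2 + - (4 * ((q ^ 4) ^ n / (1 - (q ^ 4) ^ n)\<^sup>2)))) has_sum 8 * (?S (q\<^sup>2) + - (4 * ?S (q ^ 4)))) {1..}"
     by (intro has_sum_cmult_right has_sum_add has_sum_uminusI lambert_square_has_sum q2 q4)
    fix n :: nat assume n: "n \<in> {1..}"
    define x where "x = q ^ n"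
    have x: "x ~= 0" "1 - x\<^sup>2 ~= 0" "1 + x\<^sup>2 ~= 0" using nz[of n] n by (auto simp: x_def)
    define y where "y = x\<^sup>2"
    have y: "y ~= 0" "1 - y ~= 0" "1 + y ~= 0" using x by (auto simp: y_def)
    have p: "(q\<^sup>2) ^ n = y" "(q ^ 4) ^ n = y\<^sup>2" by (simp_all add: x_def y_def mult.commute flip: power_mult)
    have "x / (1 + y) * ((1 / x) / (1 + 1 / y)) = y / (1 + y)\<^sup>2"
    proof -
     have "1 + 1 / y = (1 + y) / y" using y by (simp add: field_simps)
     thus ?thesis using x y by (simp add: power2_eq_square)
    qed
    moreover have "c (2 * int n) * c (0 - 2 * int n) + c (- (2 * int n)) * c (0 - - (2 * int n)) = 8 * (x / (1 + y) * ((1 / x) / (1 + 1 / y)))"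
     by (simp add: c_def ell_kernel_def rp x_def[symmetric] y_def[symmetric])
    \<comment> \<open>Exchanges the alternating summand y / (1 + y)^2 for the summands of the
      divisor series at q^2 and at q^4.\<close>
    moreover have "y / (1 + y)\<^sup>2 = y / (1 - y)\<^sup>2 + - (4 * (y\<^sup>2 / (1 - y\<^sup>2)\<^sup>2))"
    proof -
     have f: "1 - y\<^sup>2 = (1 - y) * (1 + y)" by (simp add: power2_eq_square algebra_simps)
     have "y / (1 - y)\<^sup>2 - y / (1 + y)\<^sup>2 = (y * (1 + y)\<^sup>2 - y * (1 - y)\<^sup>2) / ((1 - y)\<^sup>2 * (1 + y)\<^sup>2)"
      using y by (subst diff_frac_eq) auto
     also have "y * (1 + y)\<^sup>2 - y * (1 - y)\<^sup>2 = 4 * y\<^sup>2" by (simp add: power2_eq_square algebra_simps)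
     finally show ?thesis unfolding f power_mult_distrib by (simp add: algebra_simps)
    qed
    ultimately show "c (2 * int n) * c (0 - 2 * int n) + c (- (2 * int n)) * c (0 - - (2 * int n))
      = 8 * ((q\<^sup>2) ^ n / (1 - (q\<^sup>2) ^ n)\<^sup>2 + - (4 * ((q ^ 4) ^ n / (1 - (q ^ 4) ^ n)\<^sup>2)))"
     unfolding p by (simp only:)
   qed
  qed
  thus ?thesis by (simp add: F_def c_def ell_kernel_def)
 qed
 show ?thesis using infsumI[OF F] unfolding 1 2 by (simp add: algebra_simps)
qed

section \<open>Kronecker symbols and divisor functions\<close>

text \<open>The Kronecker symbol at d > 0 is a product over the prime factorisation, so a completely
  multiplicative function that agrees with it at primes agrees everywhere.\<close>

lemma kronecker_of_nat_eq:
 fixes \<chi> :: "nat => int"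
 assumes mult: "!!a b. \<chi> (a * b) = \<chi> a * \<chi> b" and one: "\<chi> 1 = 1"
  and pr: "!!p. prime p ==> kronecker_prime D p = \<chi> p" and d: "d > 0"
 shows "kronecker D (int d) = \<chi> d"
proof -
 have pw: "\<chi> (a ^ n) = \<chi> a ^ n" for a n by (induction n) (simp_all add: mult one[simplified])
 have pp: "\<chi> (\<Prod>p\<in>A. f p) = (\<Prod>p\<in>A. \<chi> (f p))" for A :: "nat set" and f
  by (induction A rule: infinite_finite_induct) (simp_all add: mult one[simplified])
 have "kronecker D (int d) = (\<Prod>p\<in>prime_factors d. kronecker_prime D p ^ multiplicity p d)"
  using d by (simp add: kronecker_def)
 also have "... = (\<Prod>p\<in>prime_factors d. \<chi> (p ^ multiplicity p d))"
  by (rule prod.cong) (auto simp: pw pr in_prime_factors_imp_prime)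
 also have "... = \<chi> d" using prod_prime_factors[of d] d by (simp flip: pp)
 finally show ?thesis .
qed

definition chi4_int :: "nat => int" where
 "chi4_int n = (if n mod 4 = 1 then 1 else if n mod 4 = 3 then -1 else 0)"

definition chi8_int :: "nat => int" where
 "chi8_int n = (if n mod 8 = 1 \<or> n mod 8 = 3 then 1 else if n mod 8 = 5 \<or> n mod 8 = 7 then -1 else 0)"

lemma of_int_chi: "of_int (chi4_int n) = chi4 n" "of_int (chi8_int n) = chi8 n"
 by (auto simp: chi4_int_def chi8_int_def chi4_def chi8_def)

lemma chi4_int_mult: "chi4_int (a * b) = chi4_int a * chi4_int b"
proof -
 have e: "(a * b) mod 4 = ((a mod 4) * (b mod 4)) mod 4" by (simp add: mod_mult_eq)
 have "x mod 4 = 0 \<or> x mod 4 = 1 \<or> x mod 4 = 2 \<or> x mod 4 = 3" for x :: nat by presburger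
 from this[of a] this[of b] show ?thesis unfolding chi4_int_def e by (elim disjE) simp_all
qed

lemma chi8_int_mult: "chi8_int (a * b) = chi8_int a * chi8_int b"
proof -
 have e: "(a * b) mod 8 = ((a mod 8) * (b mod 8)) mod 8" by (simp add: mod_mult_eq)
 have "x mod 8 = 0 \<or> x mod 8 = 1 \<or> x mod 8 = 2 \<or> x mod 8 = 3 \<or> x mod 8 = 4 \<or> x mod 8 = 5 \<or> x mod 8 = 6 \<or> x mod 8 = 7"
  for x :: nat by presburger
 from this[of a] this[of b] show ?thesis unfolding chi8_int_def e by (elim disjE) simp_all
qed

text \<open>Euler's criterion makes both values congruent modulo p, and they differ by at most 2,
  which is less than p.\<close>

lemma Legendre_eqI:
 assumes p: "prime p" "p > 2" and e: "e \<in> {1, -1}" and c: "[D ^ ((p - 1) div 2) = e] (mod int p)"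
 shows "Legendre D (int p) = e"
proof -
 have "[Legendre D (int p) = e] (mod int p)"
  using euler_criterion[OF p, of D] c by (rule cong_trans)
 hence d: "int p dvd (Legendre D (int p) - e)" by (simp add: cong_iff_dvd_diff)
 have "Legendre D (int p) \<in> {-1, 0, 1}" by (auto simp: Legendre_def)
 hence "\<bar>Legendre D (int p) - e\<bar> < int p" using e p by auto
 thus ?thesis using dvd_imp_le_int[OF _ d] by fastforce
qed

text \<open>With h = (p - 1)/2 one has (-4)^h = (-1)^h 2^(p-1), and Fermat's theorem removes the
  power of 2.\<close>

lemma Legendre_minus_4:
 assumes p: "prime p" "p > 2"
 shows "Legendre (-4) (int p) = chi4_int p"
proof -
 define h where "h = (p - 1) div 2"
 have ph: "p = 2 * h + 1" using prime_odd_nat[OF p] by (auto simp: h_def elim: oddE)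
 have "~ p dvd 2" using p by (auto dest: dvd_imp_le)
 hence "[2 ^ (p - 1) = 1] (mod p)" using fermat_theorem[OF p(1)] by blast
 hence "[int (2 ^ (p - 1)) = int 1] (mod int p)" by (simp only: cong_int_iff)
 hence "[(-1) ^ h * 2 ^ (p - 1) = (-1) ^ h * 1] (mod int p)" by (intro cong_mult cong_refl) simp
 moreover have "(-1) ^ h * 2 ^ (p - 1) = (-4 :: int) ^ h"
  by (simp add: ph power_mult flip: power_mult_distrib)
 moreover have "(-1) ^ h = chi4_int p"
 proof (cases "even h")
  case True thus ?thesis by (auto simp: ph chi4_int_def elim!: evenE)
 next
  case False
  then obtain m where "h = 2 * m + 1" by (elim oddE)
  hence "p = 3 + m * 4" by (simp add: ph)
  hence "p mod 4 = 3" by simp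
  thus ?thesis using False by (simp add: chi4_int_def)
 qed
 moreover have "(-1 :: int) ^ h \<in> {1, -1}" by (cases "even h") auto
 ultimately show ?thesis using Legendre_eqI[OF p, of "(-1) ^ h" "-4"] by (simp add: h_def)
qed

text \<open>Gauss's lemma for 2: among 2, 4, ..., 2h those exceeding h are the 2x with x > h div 2,
  so 2^h is congruent to (-1)^(h - h div 2). Together with (-1)^h this depends only on h mod 4, that
  is, on p mod 8.\<close>

lemma Legendre_minus_2:
 assumes p: "prime p" "p > 2"
 shows "Legendre (-2) (int p) = chi8_int p"
proof -
 define h where "h = (p - 1) div 2"
 have ph: "p = 2 * h + 1" using prime_odd_nat[OF p] by (auto simp: h_def elim: oddE)
 interpret GAUSS p 2
 proof
  have "~ int p dvd 2" using p by (auto dest: zdvd_imp_le)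
  thus "[2 \<noteq> 0] (mod int p)" by (simp add: cong_0_iff)
 qed (use p in auto)
 have hh: "(int p - 1) div 2 = int h" by (simp add: ph)
 have E: "E = (%x. x * 2) ` {int h div 2<..int h}"
 proof -
  have "C = (%x. x * 2) ` {0<..int h}"
   unfolding C_def B_def A_def hh image_image by (rule image_cong) (auto simp: ph)
  thus ?thesis unfolding E_def hh by auto
 qed
 have "card E = card {int h div 2<..int h}" unfolding E by (rule card_image) (auto simp: inj_on_def)
 also have "... = h - h div 2" by (simp add: nat_diff_distrib flip: zdiv_int of_nat_diff) 
 finally have cE: "card E = h - h div 2" .
 have "[2 ^ h = (-1) ^ (h - h div 2)] (mod int p)" using pre_gauss_lemma unfolding hh cE by simp
 hence "[(-1) ^ h * 2 ^ h = (-1) ^ h * (-1) ^ (h - h div 2)] (mod int p)" by (intro cong_mult cong_refl)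
 moreover have "(-1) ^ h * 2 ^ h = (-2 :: int) ^ h" by (simp flip: power_mult_distrib)
 moreover have "(-1) ^ h * (-1) ^ (h - h div 2) = chi8_int p"
 proof -
  obtain m r where h: "h = 4 * m + r" "r < 4" by (metis mod_less_divisor mult_div_mod_eq zero_less_numeral)
  have d: "h div 2 = 2 * m + r div 2" using h by simp
  have ev: "(-1 :: int) ^ (4 * m) = 1" "(-1 :: int) ^ (2 * m) = 1" by (simp_all add: power_mult)
  have 1: "(-1 :: int) ^ h = (-1) ^ r" by (simp add: h(1) power_add ev)
  have "h - h div 2 = 2 * m + (r - r div 2)" using d h by linarith
  hence 2: "(-1 :: int) ^ (h - h div 2) = (-1) ^ (r - r div 2)" by (simp only: power_add ev mult_1)
  have 3: "p mod 8 = (2 * r + 1) mod 8" unfolding ph h(1) by presburger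
  have "r = 0 \<or> r = 1 \<or> r = 2 \<or> r = 3" using h(2) by auto
  thus ?thesis unfolding 1 2 chi8_int_def 3 by auto
 qed
 moreover have "(-1 :: int) ^ h * (-1) ^ (h - h div 2) \<in> {1, -1}"
  by (cases "even h"; cases "even (h - h div 2)") simp_all
 ultimately show ?thesis using Legendre_eqI[OF p, of "(-1) ^ h * (-1) ^ (h - h div 2)" "-2"] by (simp add: h_def)
qed

lemma kronecker_eq_chi:
 assumes "d > 0"
 shows "of_int (kronecker (-4) (int d)) = chi4 d" "of_int (kronecker (-2) (int d)) = chi8 d"
proof -
 have g: "p > 2" if "prime p" "p ~= 2" for p :: nat using prime_ge_2_nat[OF that(1)] that(2) by simp
 have "kronecker (-4) (int d) = chi4_int d"
  by (rule kronecker_of_nat_eq[OF chi4_int_mult])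
    (use assms in \<open>auto simp: kronecker_prime_def Legendre_minus_4 g chi4_int_def\<close>)
 moreover have "kronecker (-2) (int d) = chi8_int d"
  by (rule kronecker_of_nat_eq[OF chi8_int_mult])
    (use assms in \<open>auto simp: kronecker_prime_def Legendre_minus_2 g chi8_int_def\<close>)
 ultimately show "of_int (kronecker (-4) (int d)) = chi4 d" "of_int (kronecker (-2) (int d)) = chi8 d"
  by (simp_all add: of_int_chi)
qed

lemma of_nat_divide_in_Nats:
 assumes "m > 0"
 shows "(of_nat n / of_nat m :: rat) \<in> \<nat> \<longleftrightarrow> m dvd n"
proof
 assume "(of_nat n / of_nat m :: rat) \<in> \<nat>"
 then obtain l where "(of_nat n / of_nat m :: rat) = of_nat l" by (elim Nats_cases)
 hence "(of_nat n :: rat) = of_nat (l * m)" using assms by (simp add: field_simps)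
 hence "n = l * m" by (simp only: of_nat_eq_iff)
 thus "m dvd n" by simp
qed (use assms in auto)

lemma of_rat_divisor_sum:
 assumes f: "!!d e. d > 0 ==> e > 0 ==> of_rat (f d e) = u d * v e" and m: "m > 0" and n: "n > 0"
 shows "of_rat (divisor_sum f (of_nat n / of_nat m)) = fps_dilate m (lambert_fps u v) $ n"
proof (cases "m dvd n")
 case True
 then obtain l where l: "n = m * l" by (elim dvdE)
 have l0: "l > 0" using l n by auto
 have e: "of_nat n / of_nat m = (of_nat l :: rat)" using m by (simp add: l)
 have "divisor_sum f (of_nat n / of_nat m) = (\<Sum>d | d dvd l. f d (l div d))"
  unfolding e divisor_sum_def using l0 by (simp add: Let_def)
 moreover have "of_rat (\<Sum>d | d dvd l. f d (l div d)) = (\<Sum>d | d dvd l. u d * v (l div d))"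
  unfolding of_rat_sum
 proof (rule sum.cong)
  fix d assume "d \<in> {d. d dvd l}"
  hence "d > 0" "l div d > 0" using l0 by (auto elim!: dvdE)
  thus "of_rat (f d (l div d)) = u d * v (l div d)" by (rule f)
 qed simp
 ultimately show ?thesis using m l0 by (simp add: fps_dilate_def l lambert_fps_nth)
next
 case False
 thus ?thesis using m by (simp add: divisor_sum_def of_nat_divide_in_Nats fps_dilate_def)
qed

lemma of_rat_divisor_functions:
 assumes "m > 0" "n > 0"
 shows "of_rat (divisor_sigma k (of_nat n / of_nat m)) = fps_dilate m (sigma_fps k) $ n"
  and "of_rat (sigma_inf k (-4) (of_nat n / of_nat m)) = fps_dilate m (chi_inf_fps chi4 k) $ n"
  and "of_rat (sigma_inf k (-2) (of_nat n / of_nat m)) = fps_dilate m (chi_inf_fps chi8 k) $ n"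
  and "of_rat (sigma_zero k (-4) (of_nat n / of_nat m)) = fps_dilate m (chi_zero_fps chi4 k) $ n"
  and "of_rat (sigma_zero k (-2) (of_nat n / of_nat m)) = fps_dilate m (chi_zero_fps chi8 k) $ n"
 unfolding divisor_sigma_def sigma_inf_def sigma_zero_def sigma_fps_def chi_inf_fps_def chi_zero_fps_def
 by (rule of_rat_divisor_sum; use assms in \<open>simp add: of_rat_mult of_rat_power kronecker_eq_chi\<close>)+

section \<open>Positivity of Taylor coefficients\<close>

definition nonneg_real :: "complex => bool" where
 "nonneg_real z \<longleftrightarrow> Im z = 0 & 0 <= Re z"

lemma fps_mult_nth_nonneg:
 assumes "!!i. i <= n ==> nonneg_real (f $ i)" "!!i. i <= n ==> nonneg_real (g $ i)"
 shows "nonneg_real ((f * g) $ n)" "i <= n ==> Re (f $ i) * Re (g $ (n - i)) <= Re ((f * g) $ n)"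
proof -
 have R: "Re ((f * g) $ n) = (\<Sum>i=0..n. Re (f $ i) * Re (g $ (n - i)))"
  unfolding fps_mult_nth Re_sum by (rule sum.cong) (use assms in \<open>auto simp: nonneg_real_def\<close>)
 have I: "Im ((f * g) $ n) = 0"
  unfolding fps_mult_nth Im_sum by (rule sum.neutral) (use assms in \<open>auto simp: nonneg_real_def\<close>)
 show "nonneg_real ((f * g) $ n)"
  unfolding nonneg_real_def R I using assms by (auto intro!: sum_nonneg simp: nonneg_real_def)
 show "Re (f $ i) * Re (g $ (n - i)) <= Re ((f * g) $ n)" if "i <= n"
  unfolding R using assms that by (intro member_le_sum) (auto simp: nonneg_real_def)
qed

text \<open>n + 1 times the coefficient of index n + 1 of f is a sum of non-negative terms, and
  keeping a single one of them gives the lower bound. \<open>w\<close> may be built from f itself: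
  the choice w = f covers the Riccati equation of the tangent.\<close>

lemma riccati_nonneg:
 fixes f g w :: "complex fps"
 assumes d: "fps_deriv f = g + f * w" and g: "!!n. nonneg_real (g $ n)" and f0: "nonneg_real (f $ 0)"
  and w: "!!n. (!!i. i <= n ==> nonneg_real (f $ i)) ==> nonneg_real (w $ n)"
 shows "nonneg_real (f $ n)" and "i <= n ==> Re (f $ i) * Re (w $ (n - i)) <= real (n + 1) * Re (f $ (n + 1))"
proof -
 have rec: "of_nat (n + 1) * f $ (n + 1) = g $ n + (f * w) $ n" for n
  using arg_cong[OF d, of "%h. h $ n"] by (simp add: fps_deriv_nth)
 have R: "real (n + 1) * Re (f $ (n + 1)) = Re (g $ n) + Re ((f * w) $ n)"
  and I: "real (n + 1) * Im (f $ (n + 1)) = Im (g $ n) + Im ((f * w) $ n)" for n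
  using arg_cong[OF rec[of n], of Re] arg_cong[OF rec[of n], of Im] by (simp_all add: algebra_simps)
 show A: "nonneg_real (f $ n)" for n
 proof (induction n rule: less_induct)
  case (less n)
  show ?case
  proof (cases n)
   case (Suc m)
   have f: "nonneg_real (f $ i)" if "i <= m" for i using less that Suc by simp
   have "nonneg_real (w $ i)" if "i <= m" for i by (rule w) (use f that in auto)
   from fps_mult_nth_nonneg(1)[OF f this, of m] have "nonneg_real ((f * w) $ m)" by simp
   hence "real (m + 1) * Re (f $ (m + 1)) >= 0" "real (m + 1) * Im (f $ (m + 1)) = 0"
    using R[of m] I[of m] g[of m] by (simp_all add: nonneg_real_def algebra_simps)
   thus ?thesis by (auto simp: Suc nonneg_real_def zero_le_mult_iff)
  qed (use f0 in simp)
 qed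
 have W: "nonneg_real (w $ n)" for n by (rule w) (rule A)
 show "Re (f $ i) * Re (w $ (n - i)) <= real (n + 1) * Re (f $ (n + 1))" if "i <= n"
  using fps_mult_nth_nonneg(2)[OF A W that] g[of n] unfolding R by (simp add: nonneg_real_def)
qed

text \<open>With A = exp(i t), \<kappa> = 1 gives w = tan t and f = (\<mu>/2) / cos t, while
  \<kappa> = -i gives w = tan(t + pi/4). Both equations for f and w are derived from their products
  with the denominator, which is not the zero series.\<close>

lemma cayley_riccati:
 fixes w f :: "complex fps"
 defines "A \<equiv> fps_exp \<i>"
 assumes k: "\<kappa> ~= -1" and w: "(A\<^sup>2 + fps_const \<kappa>) * w = - (fps_const \<i> * (A\<^sup>2 - fps_const \<kappa>))"
  and f: "(A\<^sup>2 + fps_const \<kappa>) * f = fps_const \<mu> * A"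
 shows "fps_deriv w = 1 + w * w" "fps_deriv f = 0 + f * w"
proof -
 have nz: "A\<^sup>2 + fps_const \<kappa> ~= 0"
 proof
  assume "A\<^sup>2 + fps_const \<kappa> = 0"
  hence "(A\<^sup>2 + fps_const \<kappa>) $ 0 = 0" by simp
  hence "1 + \<kappa> = 0" by (simp add: A_def fps_power_zeroth)
  thus False using k by (simp add: add_eq_0_iff)
 qed
 have dA: "fps_deriv (A\<^sup>2) = 2 * (fps_const \<i> * A\<^sup>2)" "fps_deriv A = fps_const \<i> * A"
  by (simp_all add: A_def power2_eq_square algebra_simps)
 have ii: "fps_const \<i> * (fps_const \<i> * x) = - x" for x :: "complex fps"
  by (simp add: mult.assoc[symmetric] flip: fps_const_neg)
 have "fps_deriv ((A\<^sup>2 + fps_const \<kappa>) * w) = fps_deriv (- (fps_const \<i> * (A\<^sup>2 - fps_const \<kappa>)))" unfolding w ..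
 hence 1: "2 * (fps_const \<i> * A\<^sup>2) * w + (A\<^sup>2 + fps_const \<kappa>) * fps_deriv w = 2 * A\<^sup>2"
  by (simp add: dA algebra_simps ii)
 have wi: "fps_const \<i> * ((A\<^sup>2 + fps_const \<kappa>) * w) = A\<^sup>2 - fps_const \<kappa>" unfolding w by (simp add: ii)
 have "(A\<^sup>2 + fps_const \<kappa>) * (1 + w * w) = A\<^sup>2 + fps_const \<kappa> + ((A\<^sup>2 + fps_const \<kappa>) * w) * w" by (simp add: algebra_simps)
 also have "... = A\<^sup>2 + fps_const \<kappa> - fps_const \<i> * (A\<^sup>2 - fps_const \<kappa>) * w" unfolding w by simp
 also have "... = 2 * A\<^sup>2 - 2 * (fps_const \<i> * A\<^sup>2) * w + (fps_const \<i> * ((A\<^sup>2 + fps_const \<kappa>) * w) - (A\<^sup>2 - fps_const \<kappa>))"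
  by (simp add: algebra_simps)
 also have "... = (A\<^sup>2 + fps_const \<kappa>) * fps_deriv w" unfolding wi using 1 by (simp add: algebra_simps)
 finally show "fps_deriv w = 1 + w * w" using nz by simp
 have "fps_deriv ((A\<^sup>2 + fps_const \<kappa>) * f) = fps_const \<i> * ((A\<^sup>2 + fps_const \<kappa>) * f)"
  unfolding f by (simp add: dA mult_ac)
 hence 2: "2 * (fps_const \<i> * A\<^sup>2) * f + (A\<^sup>2 + fps_const \<kappa>) * fps_deriv f = fps_const \<i> * ((A\<^sup>2 + fps_const \<kappa>) * f)"
  by (simp add: dA algebra_simps)
 have "(A\<^sup>2 + fps_const \<kappa>) * (0 + f * w) = f * ((A\<^sup>2 + fps_const \<kappa>) * w)" by (simp only: mult_ac add_0)
 also have "... = (A\<^sup>2 + fps_const \<kappa>) * fps_deriv f" unfolding w using 2 by (simp add: algebra_simps)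
 finally show "fps_deriv f = 0 + f * w" using nz by simp
qed

lemma fps_exp_compose_i: "fps_exp (of_nat n) oo (fps_const \<i> * fps_X) = fps_exp \<i> ^ n"
 by (simp add: fps_exp_power_mult)

lemma fps_compose_i:
 fixes f g :: "complex fps"
 shows "(f * g) oo (fps_const \<i> * fps_X) = (f oo (fps_const \<i> * fps_X)) * (g oo (fps_const \<i> * fps_X))"
 by (rule fps_compose_mult_distrib) simp

lemma fps_const_compose: "fps_const c oo a = fps_const c"
 by (simp add: fps_eq_iff fps_compose_nth mult_delta_left)

text \<open>C = -tanh t and S = 1 / cosh t. After the substitution of i t for t they become, up to a
  factor i for C, tan and sec, which satisfy t' = 1 + t^2 and s' = s t. The products with the linear
  coefficient 1 of tan propagate positivity in steps of two, starting from index 1 for tan and index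
  0 for sec.\<close>

lemma tan_sec_nonzero:
 fixes C S :: "complex fps"
 assumes C: "(1 + fps_exp 2) * C = 1 - fps_exp 2" and S: "(1 + fps_exp 2) * S = 2 * fps_exp 1"
 shows "C $ (2 * j + 1) ~= 0" "S $ (2 * j) ~= 0"
proof -
 let ?I = "fps_const \<i> * fps_X"
 define A where "A = fps_exp \<i>"
 define t s where "t = fps_const \<i> * (C oo ?I)" and "s = S oo ?I"
 have e: "fps_exp 2 oo ?I = A\<^sup>2" "fps_exp 1 oo ?I = A"
  using fps_exp_compose_i[of 2] fps_exp_compose_i[of 1] by (simp_all add: A_def)
 have "((1 + fps_exp 2) * C) oo ?I = (1 - fps_exp 2) oo ?I" unfolding C ..
 hence tC: "(1 + A\<^sup>2) * (C oo ?I) = 1 - A\<^sup>2"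
  by (simp add: fps_compose_i fps_compose_add_distrib fps_compose_sub_distrib e del: fps_exp_compose_linear)
 have "(A\<^sup>2 + fps_const 1) * t = fps_const \<i> * ((1 + A\<^sup>2) * (C oo ?I))" by (simp add: t_def algebra_simps)
 hence t: "(A\<^sup>2 + fps_const 1) * t = - (fps_const \<i> * (A\<^sup>2 - fps_const 1))"
  unfolding tC by (simp add: algebra_simps)
 have "((1 + fps_exp 2) * S) oo ?I = (fps_const 2 * fps_exp 1) oo ?I" unfolding S by (simp add: numeral_fps_const)
 hence "(1 + A\<^sup>2) * s = fps_const 2 * A"
  by (simp add: fps_compose_i fps_compose_add_distrib e fps_const_compose s_def del: fps_exp_compose_linear)
 hence s: "(A\<^sup>2 + fps_const 1) * s = fps_const 2 * A" by (simp add: add.commute)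
 have d: "fps_deriv t = 1 + t * t" "fps_deriv s = 0 + s * t"
  using cayley_riccati[of 1 t s 2] t s unfolding A_def by auto
 have "((1 + fps_exp 2) * C) $ 0 = (1 - fps_exp 2 :: complex fps) $ 0" unfolding C ..
 hence t0: "t $ 0 = 0" by (simp add: t_def)
 have "((1 + fps_exp 2) * S) $ 0 = (2 * fps_exp 1 :: complex fps) $ 0" unfolding S ..
 hence s0: "s $ 0 = 1" by (simp add: s_def fps_mult_nth numeral_fps_const)
 have n1: "nonneg_real ((1 :: complex fps) $ n)" "nonneg_real ((0 :: complex fps) $ n)" for n by (auto simp: nonneg_real_def)
 have nt: "nonneg_real (t $ n)" for n
  by (rule riccati_nonneg(1)[OF d(1) n1(1)]) (auto simp: t0 nonneg_real_def)
 have lt: "Re (t $ i) * Re (t $ (n - i)) <= real (n + 1) * Re (t $ (n + 1))" if "i <= n" for i n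
  by (rule riccati_nonneg(2)[OF d(1) n1(1) _ _ that]) (auto simp: t0 nonneg_real_def)
 have ls: "Re (s $ i) * Re (t $ (n - i)) <= real (n + 1) * Re (s $ (n + 1))" if "i <= n" for i n
  by (rule riccati_nonneg(2)[OF d(2) n1(2) _ nt that]) (auto simp: s0 nonneg_real_def)
 have t1: "t $ 1 = 1" using arg_cong[OF d(1), of "%h. h $ 0"] t0 by (simp add: fps_deriv_nth)
 have "Re (t $ (2 * j + 1)) > 0" for j
 proof (induction j)
  case (Suc j)
  have "Re (t $ (2 * j + 1)) * Re (t $ 1) <= real (2 * j + 2 + 1) * Re (t $ (2 * j + 2 + 1))"
   using lt[of "2 * j + 1" "2 * j + 2"] by simp
  with Suc have "real (2 * j + 2 + 1) * Re (t $ (2 * j + 2 + 1)) > 0" by (simp add: t1[simplified])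
  thus ?case by (simp add: zero_less_mult_iff)
 qed (simp add: t1[simplified])
 from this[of j] show "C $ (2 * j + 1) ~= 0" by (auto simp: t_def)
 have "Re (s $ (2 * j)) > 0" for j
 proof (induction j)
  case (Suc j)
  have "Re (s $ (2 * j)) * Re (t $ 1) <= real (2 * j + 1 + 1) * Re (s $ (2 * j + 1 + 1))"
   using ls[of "2 * j" "2 * j + 1"] by simp
  with Suc have "real (2 * j + 1 + 1) * Re (s $ (2 * j + 1 + 1)) > 0" by (simp add: t1[simplified])
  thus ?case by (simp add: zero_less_mult_iff)
 qed (simp add: s0)
 from this[of j] show "S $ (2 * j) ~= 0" by (auto simp: s_def)
qed

lemma fps_exp_numeral: "fps_exp (numeral n :: complex) = fps_exp 1 ^ numeral n"
 by (simp add: fps_exp_power_mult)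

text \<open>Q is sinh t / cosh(2t), an odd function. The reflection is carried out on the defining
  equation.\<close>

lemma odd_series_nth_even:
 fixes Q :: "complex fps"
 assumes Q: "(1 + fps_exp 4) * Q = fps_exp 3 - fps_exp 1"
 shows "Q $ (2 * j) = 0"
proof -
 let ?I = "fps_const (-1) * fps_X :: complex fps"
 define e where "e = (fps_exp 1 :: complex fps)"
 define m where "m = (fps_exp (-1) :: complex fps)"
 define R where "R = Q oo ?I"
 have me: "m * e = 1" by (simp add: m_def e_def flip: fps_exp_add_mult)
 have ex: "fps_exp (numeral n) oo ?I = m ^ numeral n" for n by (simp add: m_def fps_exp_power_mult)
 have "((1 + fps_exp 4) * Q) oo ?I = (fps_exp 3 - fps_exp 1) oo ?I" unfolding Q ..
 moreover have "((1 + fps_exp 4) * Q) oo ?I = ((1 + fps_exp 4) oo ?I) * R"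
  unfolding R_def by (rule fps_compose_mult_distrib) simp
 ultimately have r: "(1 + m ^ 4) * R = m ^ 3 - m"
  by (simp add: fps_compose_add_distrib fps_compose_sub_distrib ex m_def[symmetric] del: fps_exp_compose_linear)
    (simp add: m_def)
 have q: "(1 + e ^ 4) * Q = e ^ 3 - e" using Q by (simp add: fps_exp_numeral e_def)
 have m4: "e ^ 4 * m ^ 4 = 1" "e ^ 4 * m ^ 3 = e" "e ^ 4 * m = e ^ 3"
 proof -
  have "e ^ 4 * m ^ 4 = (m * e) ^ 4" by (simp add: power_mult_distrib mult.commute)
  thus "e ^ 4 * m ^ 4 = 1" by (simp add: me)
  have "e ^ 4 * m ^ 3 = e * (m * e) ^ 3" by (simp add: power_mult_distrib eval_nat_numeral mult_ac)
  thus "e ^ 4 * m ^ 3 = e" by (simp add: me)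
  have "e ^ 4 * m = e ^ 3 * (m * e)" by (simp add: eval_nat_numeral mult_ac)
  thus "e ^ 4 * m = e ^ 3" by (simp add: me)
 qed
 have "(1 + e ^ 4) * R = e ^ 4 * ((1 + m ^ 4) * R)" using m4(1) by (simp add: algebra_simps flip: mult.assoc)
 also have "... = e - e ^ 3" unfolding r using m4 by (simp add: right_diff_distrib)
 also have "... = (1 + e ^ 4) * (- Q)" using q by simp
 finally have "(1 + e ^ 4) * R = (1 + e ^ 4) * (- Q)" .
 moreover have "1 + e ^ 4 ~= 0"
 proof
  assume "1 + e ^ 4 = 0"
  hence "(1 + e ^ 4) $ 0 = 0" by simp
  thus False by (simp add: e_def fps_power_zeroth)
 qed
 ultimately have "R = - Q" using mult_left_cancel by blast
 hence "R $ (2 * j) = - Q $ (2 * j)" by simp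
 thus ?thesis by (simp add: R_def power_mult)
qed

text \<open>R is cosh t / cosh(2t), for which no suitable first-order equation is at hand. Adding
  the odd companion Q = sinh t / cosh(2t) helps: R - i Q at i t is (cos t + sin t) / cos(2t) = 1 /
  (cos t - sin t), with logarithmic derivative tan(t + pi/4). All its coefficients are positive, and
  those of even index are, up to sign, those of R.\<close>

lemma cosh_quotient_nonzero:
 fixes R :: "complex fps"
 assumes R: "(1 + fps_exp 4) * R = fps_exp 1 + fps_exp 3"
 shows "R $ (2 * j) ~= 0"
proof -
 let ?I = "fps_const \<i> * fps_X"
 define A where "A = fps_exp \<i>"
 define Q :: "complex fps" where "Q = (fps_exp 3 - fps_exp 1) / (1 + fps_exp 4)"
 have Q: "(1 + fps_exp 4) * Q = fps_exp 3 - fps_exp 1" unfolding Q_def by (simp add: fps_divide_unit inverse_mult_eq_1' mult.left_commute)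
 define k where "k = fps_const \<i>"
 have kk: "k * k = -1" "k ^ 2 = -1" by (simp_all add: k_def power2_eq_square flip: fps_const_neg)
 have nz: "A\<^sup>2 + c ~= 0" if "c = k \<or> c = - k" for c
 proof
  assume "A\<^sup>2 + c = 0"
  hence "(A\<^sup>2 + c) $ 0 = 0" by simp
  thus False using that by (auto simp: A_def k_def fps_power_zeroth add_eq_0_iff complex_eq_iff)
 qed
 define w where "w = - (k * (A\<^sup>2 + k)) / (A\<^sup>2 - k)"
 define p where "p = (R - k * Q) oo ?I"
 have e: "fps_exp 4 oo ?I = A ^ 4" "fps_exp 3 oo ?I = A ^ 3" "fps_exp 1 oo ?I = A"
  using fps_exp_compose_i[of 4] fps_exp_compose_i[of 3] fps_exp_compose_i[of 1] by (simp_all add: A_def)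
 have "((1 + fps_exp 4) * (R - k * Q)) oo ?I = (fps_exp 1 + fps_exp 3 - k * (fps_exp 3 - fps_exp 1)) oo ?I"
 proof -
  have "(1 + fps_exp 4) * (R - k * Q) = (1 + fps_exp 4) * R - k * ((1 + fps_exp 4) * Q)" by (simp add: algebra_simps)
  thus ?thesis unfolding R Q by (simp only:)
 qed
 hence "(1 + A ^ 4) * p = A + A ^ 3 - k * (A ^ 3 - A)"
  by (simp add: fps_compose_i fps_compose_add_distrib fps_compose_sub_distrib e p_def k_def fps_const_compose del: fps_exp_compose_linear)
 \<comment> \<open>The common factor A^2 + k cancels against 1 + A^4 = (A^2 + k)(A^2 - k), where k^2
   = -1.\<close>
 also have "... = (A\<^sup>2 + k) * ((1 - k) * A)"
  using kk by (simp add: algebra_simps eval_nat_numeral)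
 also have "1 + A ^ 4 = (A\<^sup>2 + k) * (A\<^sup>2 - k)" using kk by (simp add: algebra_simps eval_nat_numeral)
 finally have "(A\<^sup>2 + k) * ((A\<^sup>2 - k) * p) = (A\<^sup>2 + k) * ((1 - k) * A)" by (simp only: mult.assoc)
 hence "(A\<^sup>2 - k) * p = (1 - k) * A" using nz[of k] by simp
 hence p: "(A\<^sup>2 + fps_const (- \<i>)) * p = fps_const (1 - \<i>) * A" by (simp add: k_def flip: fps_const_neg fps_const_sub)
 have u: "(A\<^sup>2 - k) $ 0 ~= 0" by (auto simp: A_def k_def fps_power_zeroth complex_eq_iff)
 have "(A\<^sup>2 - k) * w = - (k * (A\<^sup>2 + k))" 
  unfolding w_def using inverse_mult_eq_1'[OF u] by (simp only: fps_divide_unit[OF u]) (simp add: mult.left_commute)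
 hence w: "(A\<^sup>2 + fps_const (- \<i>)) * w = - (fps_const \<i> * (A\<^sup>2 - fps_const (- \<i>)))"
  by (simp add: k_def flip: fps_const_neg)
 have d: "fps_deriv w = 1 + w * w" "fps_deriv p = 0 + p * w"
  using cayley_riccati[of "- \<i>" w p "1 - \<i>"] w p unfolding A_def by (auto simp: complex_eq_iff)
 have "((A\<^sup>2 + fps_const (- \<i>)) * w) $ 0 = (- (fps_const \<i> * (A\<^sup>2 - fps_const (- \<i>)))) $ 0" unfolding w ..
 hence "(1 - \<i>) * w $ 0 = (1 - \<i>) * 1" by (simp add: A_def fps_power_zeroth algebra_simps)
 hence w0: "w $ 0 = 1" unfolding mult_cancel_left by (auto simp: complex_eq_iff)
 have "((A\<^sup>2 + fps_const (- \<i>)) * p) $ 0 = (fps_const (1 - \<i>) * A) $ 0" unfolding p ..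
 hence "(1 - \<i>) * p $ 0 = (1 - \<i>) * 1" by (simp add: A_def fps_power_zeroth)
 hence p0: "p $ 0 = 1" unfolding mult_cancel_left by (auto simp: complex_eq_iff)
 have n1: "nonneg_real ((1 :: complex fps) $ n)" "nonneg_real ((0 :: complex fps) $ n)" for n by (auto simp: nonneg_real_def)
 have nw: "nonneg_real (w $ n)" for n
  by (rule riccati_nonneg(1)[OF d(1) n1(1)]) (auto simp: w0 nonneg_real_def)
 have lp: "Re (p $ i) * Re (w $ (n - i)) <= real (n + 1) * Re (p $ (n + 1))" if "i <= n" for i n
  by (rule riccati_nonneg(2)[OF d(2) n1(2) _ nw that]) (auto simp: p0 nonneg_real_def)
 have "Re (p $ n) > 0" for n
 proof (induction n)
  case (Suc n)
  have "Re (p $ n) * Re (w $ 0) <= real (n + 1) * Re (p $ (n + 1))" using lp[of n n] by simp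
  with Suc have "real (n + 1) * Re (p $ (n + 1)) > 0" by (simp add: w0)
  thus ?case by (simp add: zero_less_mult_iff)
 qed (simp add: p0)
 from this[of "2 * j"] have "p $ (2 * j) ~= 0" by auto
 thus ?thesis using odd_series_nth_even[OF Q, of j] by (auto simp: p_def k_def)
qed

section \<open>Bernoulli numbers as Taylor coefficients\<close>

definition fps_of_rat :: "rat fps => complex fps" where
 "fps_of_rat f = Abs_fps (%n. of_rat (f $ n))"

lemma of_rat_fact: "(of_rat (fact n) :: complex) = fact n"
 using of_rat_of_nat_eq[of "fact n"] by (simp only: of_nat_fact)

lemma fps_of_rat_simps:
 "fps_of_rat (f * g) = fps_of_rat f * fps_of_rat g" "fps_of_rat (f + g) = fps_of_rat f + fps_of_rat g"
 "fps_of_rat (f - g) = fps_of_rat f - fps_of_rat g" "fps_of_rat 0 = 0" "fps_of_rat 1 = 1" "fps_of_rat fps_X = fps_X"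
 "fps_of_rat (fps_const c) = fps_const (of_rat c)" "fps_of_rat (fps_exp c) = fps_exp (of_rat c)"
proof -
 show "fps_of_rat (f * g) = fps_of_rat f * fps_of_rat g" "fps_of_rat (f + g) = fps_of_rat f + fps_of_rat g"
  "fps_of_rat (f - g) = fps_of_rat f - fps_of_rat g" "fps_of_rat 0 = 0" "fps_of_rat 1 = 1" "fps_of_rat fps_X = fps_X"
  "fps_of_rat (fps_const c) = fps_const (of_rat c)" "fps_of_rat (fps_exp c) = fps_exp (of_rat c)"
  by (simp_all add: fps_eq_iff fps_of_rat_def fps_mult_nth of_rat_sum of_rat_mult of_rat_add of_rat_diff fps_X_def
    of_rat_divide of_rat_power of_rat_fact)
qed

lemma fps_X_over_exp_minus_1:
 assumes "c ~= 0"
 shows "fps_of_rat (fps_X / (fps_exp c - 1)) * (fps_exp (of_rat c) - 1) = fps_X"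
proof -
 have nz: "(fps_exp c - 1) $ 1 ~= 0" using assms by simp
 have "subdegree (fps_exp c - 1) = 1" by (rule subdegreeI) (use assms in auto)
 hence "fps_exp c - 1 dvd (fps_X :: rat fps)" using nz by (subst fps_dvd_iff) auto
 hence "fps_X / (fps_exp c - 1) * (fps_exp c - 1) = (fps_X :: rat fps)" by simp
 hence "fps_of_rat (fps_X / (fps_exp c - 1) * (fps_exp c - 1)) = fps_of_rat fps_X" by (simp only:)
 thus ?thesis by (simp only: fps_of_rat_simps of_rat_1)
qed

lemma one_plus_exp_nonzero: "1 + fps_exp c ~= (0 :: complex fps)"
proof
 assume "1 + fps_exp c = (0 :: complex fps)"
 hence "(1 + fps_exp c) $ 0 = (0 :: complex fps) $ 0" by (simp only:)
 thus False by simp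
qed

lemma exp_minus_one_nonzero: "c ~= 0 ==> fps_exp c - 1 ~= (0 :: complex fps)"
proof
 assume c: "c ~= 0" and "fps_exp c - 1 = (0 :: complex fps)"
 hence "(fps_exp c - 1) $ 1 = (0 :: complex fps) $ 1" by (simp only:)
 thus False using c by simp
qed

text \<open>For b(t) = t / (exp t - 1) and C = -tanh t one has t C = -t + b(2t) - b(4t). The term -t
  affects only index 1, whence k \<ge> 2.\<close>

lemma bernoulli_tanh:
 fixes C :: "complex fps"
 assumes C: "(1 + fps_exp 2) * C = 1 - fps_exp 2" and k: "k >= 2"
 shows "fact k * C $ (k - 1) = - (2 ^ k * (2 ^ k - 1) * of_rat (bernoulli k))"
proof -
 define e where "e = (fps_exp 1 :: complex fps)"
 define b where "b = fps_of_rat (fps_X / (fps_exp 1 - 1))"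
 have b: "b * (e - 1) = fps_X" using fps_X_over_exp_minus_1[of 1] by (simp add: b_def e_def)
 have dil: "(b oo (fps_const c * fps_X)) * (fps_exp c - 1) = fps_const c * fps_X" for c
 proof -
  have "(b * (e - 1)) oo (fps_const c * fps_X) = fps_X oo (fps_const c * fps_X)" unfolding b ..
  moreover have "(b * (e - 1)) oo (fps_const c * fps_X) = (b oo (fps_const c * fps_X)) * ((e - 1) oo (fps_const c * fps_X))"
   by (rule fps_compose_mult_distrib) simp
  ultimately show ?thesis by (simp add: fps_compose_sub_distrib e_def)
 qed
 define B2 B4 where "B2 = b oo (fps_const 2 * fps_X)" and "B4 = b oo (fps_const 4 * fps_X)"
 have B2: "B2 * (e ^ 2 - 1) = 2 * fps_X" and B4: "B4 * (e ^ 4 - 1) = 4 * fps_X"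
  using dil[of 2] dil[of 4] by (simp_all add: B2_def B4_def e_def fps_exp_numeral numeral_fps_const)
 have C': "(1 + e ^ 2) * C = 1 - e ^ 2" using C by (simp add: e_def fps_exp_numeral)
 have f: "e ^ 4 - 1 = (e ^ 2 - 1) * (1 + e ^ 2)" by (simp add: eval_nat_numeral algebra_simps)
 have "(fps_X * C) * (e ^ 4 - 1) = fps_X * (e ^ 2 - 1) * ((1 + e ^ 2) * C)" unfolding f by (simp only: mult_ac)
 also have "... = - (fps_X * (e ^ 4 - 1)) + (2 * fps_X) * (1 + e ^ 2) - 4 * fps_X"
  unfolding C' by (simp add: eval_nat_numeral algebra_simps)
 also have "... = (- fps_X + B2 - B4) * (e ^ 4 - 1)" unfolding B2[symmetric] B4[symmetric] f by (simp add: algebra_simps)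
 finally have "(fps_X * C) * (e ^ 4 - 1) = (- fps_X + B2 - B4) * (e ^ 4 - 1)" .
 moreover have "e ^ 4 - 1 ~= 0" using exp_minus_one_nonzero[of 4] by (simp add: e_def fps_exp_numeral)
 ultimately have xc: "fps_X * C = - fps_X + B2 - B4" using mult_right_cancel by blast
 have "(fps_X * C) $ k = (- fps_X + B2 - B4) $ k" by (simp only: xc)
 moreover have "B2 $ k = 2 ^ k * b $ k" "B4 $ k = 4 ^ k * b $ k"
  unfolding B2_def B4_def by (rule fps_nth_compose_linear)+
 ultimately have c: "C $ (k - 1) = 2 ^ k * b $ k - 4 ^ k * b $ k" using k by simp
 have "(4 :: complex) ^ k = 2 ^ k * 2 ^ k" by (simp flip: power_mult_distrib)
 moreover have "of_rat (bernoulli k) = fact k * b $ k"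
  by (simp add: of_rat_fact bernoulli_def b_def fps_of_rat_def of_rat_mult)
 ultimately show ?thesis unfolding c by (simp add: algebra_simps)
qed

text \<open>By \<open>S\<close> the character sum divided by exp(N t) - 1 is -R / D, and by
  \<open>R\<close> this is -Y; so the generating function is -t Y and the index drops by
  one.\<close>

lemma gen_bernoulli_quotient:
 fixes D Y R :: "complex fps"
 assumes N: "N > 0" and k: "k > 0" and D: "D ~= 0"
  and S: "(\<Sum>j=1..N. fps_const (of_int (kronecker d (int j))) * fps_exp (of_nat j)) * D = - (fps_exp (of_nat N) - 1) * R"
  and R: "D * Y = R"
 shows "of_rat (gen_bernoulli d N k) = - (fact k * Y $ (k - 1))"
proof -
 define b where "b = fps_of_rat (fps_X / (fps_exp (of_nat N) - 1))"
 define T where "T = (\<Sum>j=1..N. fps_const (of_int (kronecker d (int j))) * fps_exp (of_nat j) :: complex fps)"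
 have sum: "fps_of_rat (sum f A) = (\<Sum>j\<in>A. fps_of_rat (f j))" for f and A :: "nat set"
  by (induction A rule: infinite_finite_induct) (simp_all add: fps_of_rat_simps)
 have b: "b * (fps_exp (of_nat N) - 1) = fps_X" using fps_X_over_exp_minus_1[of "of_nat N"] N by (simp add: b_def)
 have "D * (b * T) = b * (T * D)" by (simp only: mult_ac)
 also have "... = - (b * (fps_exp (of_nat N) - 1)) * R" unfolding T_def S by (simp only: mult_ac mult_minus_left mult_minus_right)
 also have "... = D * (- (fps_X * Y))" unfolding b R[symmetric] by (simp only: mult_ac mult_minus_left mult_minus_right)
 finally have "b * T = - (fps_X * Y)" using D mult_left_cancel by blast
 moreover have "fps_of_rat (fps_X / (fps_exp (of_nat N) - 1) * (\<Sum>j=1..N. fps_const (of_int (kronecker d (int j))) * fps_exp (of_nat j))) = b * T"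
  unfolding fps_of_rat_simps(1) sum b_def T_def by (simp add: fps_of_rat_simps)
 ultimately have "of_rat ((fps_X / (fps_exp (of_nat N) - 1) * (\<Sum>j=1..N. fps_const (of_int (kronecker d (int j))) * fps_exp (of_nat j))) $ k)
   = (- (fps_X * Y)) $ k" by (metis fps_nth_Abs_fps fps_of_rat_def)
 thus ?thesis
  using k by (simp add: of_rat_fact gen_bernoulli_def of_rat_mult)
qed

text \<open>Expanding the fraction for C by 1 + i exp(2t) splits it into a multiple of R = cosh t /
  cosh(2t) and a multiple of the odd series sinh t / cosh(2t). The factor of R is \<zeta> + i
  \<zeta>, which equals \<zeta> - 1/\<zeta> because \<zeta>^2 = i.\<close>

lemma eighth_root_quotient:
 fixes C R :: "complex fps"
 assumes z: "\<zeta>\<^sup>2 = \<i>" and C: "(1 - fps_const \<i> * fps_exp 2) * C = fps_const (2 * \<zeta>) * fps_exp 1"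
  and R: "(1 + fps_exp 4) * R = fps_exp 1 + fps_exp 3"
 shows "C $ (2 * j) = (\<zeta> - 1 / \<zeta>) * R $ (2 * j)"
proof -
 define e where "e = (fps_exp 1 :: complex fps)"
 define k z where "k = fps_const \<i>" and "z = fps_const \<zeta>"
 have kk: "k * k = -1" by (simp add: k_def flip: fps_const_neg)
 have zz: "z * z = k" using z by (simp add: z_def k_def power2_eq_square)
 define Q :: "complex fps" where "Q = (fps_exp 3 - fps_exp 1) / (1 + fps_exp 4)"
 have Q: "(1 + fps_exp 4) * Q = fps_exp 3 - fps_exp 1" unfolding Q_def by (simp add: fps_divide_unit inverse_mult_eq_1' mult.left_commute)
 have e4: "1 + e ^ 4 = (1 + k * e ^ 2) * (1 - k * e ^ 2)" using kk by (simp add: eval_nat_numeral algebra_simps)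
 have "(1 + e ^ 4) * C = (1 + k * e ^ 2) * ((1 - fps_const \<i> * fps_exp 2) * C)"
  unfolding e4 by (simp add: k_def e_def fps_exp_numeral mult_ac)
 also have "... = (1 + k * e ^ 2) * (2 * z * e)" unfolding C by (simp add: z_def e_def numeral_fps_const)
 also have "... = (z + z * k) * (e + e ^ 3) - (z - z * k) * (e ^ 3 - e)" by (simp add: eval_nat_numeral algebra_simps)
 also have "e + e ^ 3 = (1 + e ^ 4) * R" using R by (simp add: e_def fps_exp_numeral)
 also have "e ^ 3 - e = (1 + e ^ 4) * Q" using Q by (simp add: e_def fps_exp_numeral)
 also have "(z + z * k) * ((1 + e ^ 4) * R) - (z - z * k) * ((1 + e ^ 4) * Q) = (1 + e ^ 4) * ((z + z * k) * R - (z - z * k) * Q)"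
  by (simp add: algebra_simps)
 finally have "(1 + e ^ 4) * C = (1 + e ^ 4) * ((z + z * k) * R - (z - z * k) * Q)" .
 moreover have "1 + e ^ 4 ~= 0" using one_plus_exp_nonzero[of 4] by (simp add: e_def fps_exp_numeral)
 ultimately have "C = (z + z * k) * R - (z - z * k) * Q" using mult_left_cancel by blast
 hence "C = fps_const (\<zeta> + \<zeta> * \<i>) * R - fps_const (\<zeta> - \<zeta> * \<i>) * Q" by (simp add: z_def k_def)
 hence "C $ (2 * j) = (\<zeta> + \<zeta> * \<i>) * R $ (2 * j)" using odd_series_nth_even[OF Q, of j] by simp
 moreover have "\<zeta> * \<i> = - (1 / \<zeta>)"
 proof -
  have "\<zeta> ~= 0" using z by auto
  moreover have "\<zeta> * (\<zeta> * \<i>) = -1" using z by (simp add: power2_eq_square flip: mult.assoc)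
  ultimately show ?thesis by (simp add: field_simps)
 qed
 ultimately show ?thesis by simp
qed

section \<open>Representation numbers as coefficients of theta products\<close>

lemma finite_weighted_square:
 assumes "m > 0"
 shows "finite {y :: int. int m * y\<^sup>2 = int n}"
proof (rule finite_subset)
 show "{y :: int. int m * y\<^sup>2 = int n} \<subseteq> {- int n..int n}"
 proof
  fix y :: int assume "y \<in> {y. int m * y\<^sup>2 = int n}"
  hence y: "int m * y\<^sup>2 = int n" by simp
  have "\<bar>y\<bar> <= \<bar>y\<bar> * \<bar>y\<bar>"
   using mult_left_mono[of 1 "\<bar>y\<bar>" "\<bar>y\<bar>"] by (cases "y = 0") simp_all
  hence "\<bar>y\<bar> <= y\<^sup>2" by (simp only: abs_mult_self_eq power2_eq_square)
  also have "... <= int m * y\<^sup>2" using mult_right_mono[of 1 "int m" "y\<^sup>2"] assms by simp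
  finally show "y \<in> {- int n..int n}" unfolding y by (simp add: abs_le_iff)
 qed
qed simp

lemma fps_dilate_theta_nth:
 assumes m: "m > 0"
 shows "fps_dilate m theta_fps $ n = of_nat (card {y :: int. int m * y\<^sup>2 = int n})"
proof (cases "m dvd n")
 case True
 then obtain l where l: "n = m * l" by (elim dvdE)
 have "nat (y\<^sup>2) = l \<longleftrightarrow> int m * y\<^sup>2 = int n" for y :: int
 proof -
  have "int m * y\<^sup>2 = int n \<longleftrightarrow> y\<^sup>2 = int l" using m unfolding l of_nat_mult mult_left_cancel by simp
  thus ?thesis by (simp add: nat_eq_iff)
 qed
 thus ?thesis using m by (simp add: fps_dilate_def theta_fps_def l)
next
 case False
 have "~ int m * y\<^sup>2 = int n" for y
 proof
  assume "int m * y\<^sup>2 = int n"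
  hence "int m dvd int n" by (rule subst) simp
  thus "False" using \<open>~ m dvd n\<close> by simp
 qed
 thus ?thesis using False by (simp add: fps_dilate_def)
qed

text \<open>Induction on the index set: the new variable y accounts for w(a) y^2 = i and the others
  for n - i, which is the Cauchy product. Arbitrary positive weights allow both blocks of variables,
  with weights 1 and m, to be treated at once.\<close>

lemma theta_product_nth:
 fixes w :: "'a => nat"
 assumes "finite I" "!!i. i \<in> I ==> w i > 0"
 defines "A \<equiv> %I n. {x \<in> I \<rightarrow>\<^sub>E (UNIV :: int set). (\<Sum>i\<in>I. int (w i) * (x i)\<^sup>2) = int n}"
 shows "finite (A I n) & (\<Prod>i\<in>I. fps_dilate (w i) theta_fps) $ n = of_nat (card (A I n))"
 using assms(1,2)
proof (induction I arbitrary: n rule: finite_induct)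
 case empty
 have "A {} n = (if n = 0 then {%_. undefined} else {})" by (auto simp: A_def)
 thus ?case by simp
next
 case (insert a I)
 define B where "B i = {y :: int. int (w a) * y\<^sup>2 = int i}" for i
 have wa: "w a > 0" using insert by simp
 have fB: "finite (B i)" for i unfolding B_def by (rule finite_weighted_square[OF wa])
 have IH: "finite (A I n)" "(\<Prod>i\<in>I. fps_dilate (w i) theta_fps) $ n = of_nat (card (A I n))" for n
  using insert by auto
 let ?f = "%(y :: int, g). g(a := y)"
 have im: "A (insert a I) n = ?f ` (\<Union>i\<in>{0..n}. B i \<times> A I (n - i))"
 proof
  show "A (insert a I) n \<subseteq> ?f ` (\<Union>i\<in>{0..n}. B i \<times> A I (n - i))"
  proof
   fix x assume "x \<in> A (insert a I) n"
   hence x: "x \<in> insert a I \<rightarrow>\<^sub>E UNIV" "int (w a) * (x a)\<^sup>2 + (\<Sum>i\<in>I. int (w i) * (x i)\<^sup>2) = int n"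
    using insert.hyps by (auto simp: A_def)
   from x(1) obtain y g where g: "x = g(a := y)" "g \<in> I \<rightarrow>\<^sub>E UNIV" unfolding PiE_insert_eq by auto
   have s: "(\<Sum>i\<in>I. int (w i) * (x i)\<^sup>2) = (\<Sum>i\<in>I. int (w i) * (g i)\<^sup>2)"
    by (rule sum.cong) (use insert.hyps in \<open>auto simp: g(1)\<close>)
   have nn: "0 <= (\<Sum>i\<in>I. int (w i) * (g i)\<^sup>2)" "0 <= int (w a) * y\<^sup>2" by (auto intro!: sum_nonneg)
   define i where "i = nat (int (w a) * y\<^sup>2)"
   have i: "int i = int (w a) * y\<^sup>2" using nn by (simp add: i_def)
   have sn: "int i + (\<Sum>i\<in>I. int (w i) * (g i)\<^sup>2) = int n" using x(2) unfolding s i by (simp add: g(1))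
   hence "i <= n" "(\<Sum>i\<in>I. int (w i) * (g i)\<^sup>2) = int (n - i)" using nn by linarith+
   hence "(y, g) \<in> (\<Union>i\<in>{0..n}. B i \<times> A I (n - i))" using i g(2)
    by (intro UN_I[of i]) (auto simp: B_def A_def)
   thus "x \<in> ?f ` (\<Union>i\<in>{0..n}. B i \<times> A I (n - i))" using g(1) by (intro image_eqI[of _ _ "(y, g)"]) auto
  qed
  show "?f ` (\<Union>i\<in>{0..n}. B i \<times> A I (n - i)) \<subseteq> A (insert a I) n"
  proof clarify
   fix i y g assume i: "i \<in> {0..n}" and y: "y \<in> B i" and g: "g \<in> A I (n - i)"
   have "(\<Sum>i\<in>I. int (w i) * ((g(a := y)) i)\<^sup>2) = (\<Sum>i\<in>I. int (w i) * (g i)\<^sup>2)"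
    by (rule sum.cong) (use insert.hyps in auto)
   thus "g(a := y) \<in> A (insert a I) n" using i y g insert.hyps by (auto simp: A_def B_def PiE_insert_eq)
  qed
 qed
 have inj: "inj_on ?f (\<Union>i\<in>{0..n}. B i \<times> A I (n - i))"
  by (rule inj_on_subset[OF inj_combinator[of a I "%_. UNIV"]]) (use insert.hyps in \<open>auto simp: A_def\<close>)
 have "card (A (insert a I) n) = card (\<Union>i\<in>{0..n}. B i \<times> A I (n - i))"
  unfolding im by (rule card_image[OF inj])
 also have "... = (\<Sum>i=0..n. card (B i \<times> A I (n - i)))"
  by (rule card_UN_disjoint) (use fB IH(1) in \<open>auto simp: B_def\<close>)
 also have "... = (\<Sum>i=0..n. card (B i) * card (A I (n - i)))" by (simp add: card_cartesian_product)
 finally have c: "card (A (insert a I) n) = (\<Sum>i=0..n. card (B i) * card (A I (n - i)))" .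
 show ?case
 proof
  show "finite (A (insert a I) n)" unfolding im using fB IH(1) by auto
  show "(\<Prod>i\<in>insert a I. fps_dilate (w i) theta_fps) $ n = of_nat (card (A (insert a I) n))"
   unfolding c using insert.hyps by (simp add: fps_mult_nth fps_dilate_theta_nth[OF wa] IH(2) B_def)
 qed
qed

lemma rep_count_eq:
 assumes m: "m > 0"
 shows "of_nat (rep_count k m n) = (theta_fps * fps_dilate m theta_fps) ^ k $ n"
proof -
 define w where "w i = (if i <= k then 1 else m)" for i
 have d1: "fps_dilate 1 f = f" for f by (simp add: fps_dilate_def fps_eq_iff)
 have s: "(\<Sum>i=1..2*k. int (w i) * (x i)\<^sup>2) = (\<Sum>i=1..k. (x i)\<^sup>2) + int m * (\<Sum>i=k+1..2*k. (x i)\<^sup>2)" for x :: "nat => int"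
  using sum.ub_add_nat[of 1 k "%i. int (w i) * (x i)\<^sup>2" k] by (simp add: w_def mult_2 sum_distrib_left)
 have p: "(\<Prod>i=1..2*k. fps_dilate (w i) theta_fps) = (theta_fps * fps_dilate m theta_fps) ^ k"
  using prod.ub_add_nat[of 1 k "%i. fps_dilate (w i) theta_fps" k] by (simp add: w_def mult_2 d1[simplified] power_mult_distrib)
 have "rep_count k m n = card {x \<in> {1..2*k} \<rightarrow>\<^sub>E (UNIV :: int set). (\<Sum>i=1..2*k. int (w i) * (x i)\<^sup>2) = int n}"
  unfolding rep_count_def s ..
 thus ?thesis
  using theta_product_nth[of "{1..2*k}" w n] m unfolding p by (simp add: w_def)
qed

section \<open>Eta quotients as power series\<close>

lemma nome_norm: "Im \<tau> > 0 ==> 0 < norm (nome \<tau>) & norm (nome \<tau>) < 1"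
 by (simp add: nome_def norm_exp_eq_Re)

lemma nome_surj:
 assumes "0 < norm q" "norm q < 1"
 obtains \<tau> where "Im \<tau> > 0" "nome \<tau> = q"
proof
 have q0: "q ~= 0" using assms by auto
 show "Im (- (\<i> * Ln q) / of_real (2 * pi)) > 0"
  unfolding Im_divide_of_real using assms q0 by (simp add: divide_neg_pos)
 have "2 * of_real pi * \<i> * (- (\<i> * L) / of_real (2 * pi)) = L" for L by simp
 thus "nome (- (\<i> * Ln q) / of_real (2 * pi)) = q" unfolding nome_def by (simp only: exp_Ln[OF q0])
qed

text \<open>Every q of the punctured disc is a nome, so any competing sequence has the same sums
  there and is the same power series. Thus the definite description in \<open>q_coeff\<close>
  denotes the expected coefficients.\<close>

lemma q_coeff_eqI:
 assumes f: "fps_conv_radius f >= 1" and F: "!!\<tau>. Im \<tau> > 0 ==> F \<tau> = eval_fps f (nome \<tau>)"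
 shows "q_coeff F = fps_nth f"
 unfolding q_coeff_def
proof (rule the_equality)
 show "\<forall>\<tau>. Im \<tau> > 0 --> (%n. f $ n * nome \<tau> ^ n) sums F \<tau>"
  using sums_eval_fps_disc[OF f] nome_norm by (auto simp: F)
next
 fix a assume a: "\<forall>\<tau>. Im \<tau> > 0 --> (%n. a n * nome \<tau> ^ n) sums F \<tau>"
 have s: "(%n. Abs_fps a $ n * q ^ n) sums eval_fps f q" if qd: "0 < norm q" "norm q < 1" for q
 proof -
  obtain \<tau> where t: "Im \<tau> > 0" "nome \<tau> = q" by (rule nome_surj[OF qd])
  have "(%n. a n * nome \<tau> ^ n) sums F \<tau>" using a t(1) by blast
  thus ?thesis unfolding F[OF t(1)] t(2) by simp
 qed
 have r: "fps_conv_radius (Abs_fps a) >= 1"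
 proof (rule fps_conv_radius_ge_1I)
  show "summable (%n. Abs_fps a $ n * q ^ n)" if "norm q < 1" for q
  proof (cases "q = 0")
   case False
   hence "(%n. Abs_fps a $ n * q ^ n) sums eval_fps f q" by (intro s that) simp
   thus ?thesis by (rule sums_summable)
  next
   case True
   show ?thesis unfolding True by (rule summable_0_powser)
  qed
 qed
 have af: "Abs_fps a = f"
 proof (rule eval_fps_unique_disc[OF r f])
  fix q :: complex assume q: "0 < norm q" "norm q < 1"
  show "eval_fps (Abs_fps a) q = eval_fps f q"
   by (rule sums_unique2[OF sums_eval_fps_disc[OF r q(2)] s[OF q]])
 qed
 show "a = fps_nth f"
 proof
  show "a n = f $ n" for n using arg_cong[OF af, of "%h. h $ n"] by simp
 qed
qed

text \<open>The fractional power of q is kept as an integral power of exp(2 pi i \<tau> / 24), so no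
  branch of a root is involved.\<close>

lemma eta_mult_eq: "eta_mult m \<tau> = exp (2 * of_real pi * \<i> * \<tau> / 24) ^ m * euler_product (nome \<tau> ^ m)"
proof -
 have "2 * of_real pi * \<i> * (of_nat m * \<tau>) = of_nat m * (2 * of_real pi * \<i> * \<tau>)" by (simp only: mult_ac)
 hence "nome (of_nat m * \<tau>) = nome \<tau> ^ m" unfolding nome_def by (simp only: exp_of_nat_mult)
 moreover have "2 * of_real pi * \<i> * (of_nat m * \<tau>) / 24 = of_nat m * (2 * of_real pi * \<i> * \<tau> / 24)" by simp
 ultimately show ?thesis
  unfolding eta_mult_def dedekind_eta_def euler_product_def by (simp only: exp_of_nat_mult)
qed

definition eta_base :: "nat => complex fps" where
 "eta_base m = theta_fps * fps_dilate m theta_fps"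

text \<open>The square of \<open>eta_base 2\<close> times the eighth power of \<eta>_1 \<eta>_8 /
  (\<eta>_2 \<eta>_4). The second bracket is the square of theta(-q); multiplication by the square
  of the base is what makes the expression a polynomial in theta series.\<close>

definition eta_ratio2 :: "complex fps" where
 "eta_ratio2 = fps_const (1 / 4) * ((theta_fps ^ 2 + - (fps_dilate 2 theta_fps ^ 2))
   * (fps_const 2 * fps_dilate 2 theta_fps ^ 2 + fps_const (-1) * theta_fps ^ 2))"

text \<open>\<open>eta_base 4\<close> times (\<eta>_1 \<eta>_4 \<eta>_16)^4 / (\<eta>_2 \<eta>_8)^6;
  the second bracket is theta(-q).\<close>

definition eta_ratio4 :: "complex fps" where
 "eta_ratio4 = fps_const (1 / 2) * ((theta_fps + fps_const (-1) * fps_dilate 4 theta_fps)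
   * (fps_const 2 * fps_dilate 4 theta_fps + fps_const (-1) * theta_fps))"

lemma fps_const_disc: "fps_conv_radius (fps_const c :: complex fps) >= 1" "eval_fps (fps_const c) q = (c :: complex)"
 by simp_all

lemma fps_sum_disc:
 fixes f :: "'a => complex fps"
 assumes "!!i. fps_conv_radius (f i) >= 1"
 shows "fps_conv_radius (sum f A) >= 1"
  and "norm q < 1 ==> eval_fps (sum f A) q = (\<Sum>i\<in>A. eval_fps (f i) q)"
proof -
 show r: "fps_conv_radius (sum f A) >= 1" for A
  by (induction A rule: infinite_finite_induct) (use assms in \<open>auto intro: fps_add_disc(1)\<close>)
 show "eval_fps (sum f A) q = (\<Sum>i\<in>A. eval_fps (f i) q)" if "norm q < 1"
  by (induction A rule: infinite_finite_induct) (simp_all add: fps_add_disc(2)[OF assms r that])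
qed

lemmas disc_radius = fps_mult_disc(1) fps_add_disc(1) fps_power_eval(1) fps_const_disc(1) theta_fps_eval(1)
 fps_dilate_eval(1)[OF theta_fps_eval(1)]

lemma fps_dilate_theta_eval:
 assumes "m > 0" "norm q < 1"
 shows "eval_fps (fps_dilate m theta_fps) q = theta (q ^ m)"
 using assms norm_power_less_1[of q m] by (simp add: fps_dilate_eval(2)[OF theta_fps_eval(1)] theta_fps_eval(2))

lemma eta_base_eval:
 assumes "m > 0"
 shows "fps_conv_radius (eta_base m) >= 1"
  and "norm q < 1 ==> eval_fps (eta_base m) q = theta q * theta (q ^ m)"
 unfolding eta_base_def using assms
 by (auto intro!: disc_radius simp: fps_mult_disc(2) disc_radius theta_fps_eval(2) fps_dilate_theta_eval)

lemma eta_ratio2_eval: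
 shows "fps_conv_radius eta_ratio2 >= 1"
  and "norm q < 1 ==> eval_fps eta_ratio2 q = ((theta q)\<^sup>2 - (theta (q\<^sup>2))\<^sup>2) * (2 * (theta (q\<^sup>2))\<^sup>2 - (theta q)\<^sup>2) / 4"
proof -
 have e: "eta_ratio2 = fps_const (1 / 4) * ((theta_fps ^ 2 + fps_const (-1) * fps_dilate 2 theta_fps ^ 2)
   * (fps_const 2 * fps_dilate 2 theta_fps ^ 2 + fps_const (-1) * theta_fps ^ 2))"
  unfolding eta_ratio2_def by (simp flip: fps_const_neg)
 show "fps_conv_radius eta_ratio2 >= 1" unfolding e by (intro disc_radius) simp_all
 show "eval_fps eta_ratio2 q = ((theta q)\<^sup>2 - (theta (q\<^sup>2))\<^sup>2) * (2 * (theta (q\<^sup>2))\<^sup>2 - (theta q)\<^sup>2) / 4" if "norm q < 1"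
  unfolding e using that
  by (simp add: fps_mult_disc(2) fps_add_disc(2) fps_power_eval(2) fps_const_disc(2) disc_radius theta_fps_eval(2) fps_dilate_theta_eval del: fps_const_neg)
qed

lemma eta_ratio4_eval:
 shows "fps_conv_radius eta_ratio4 >= 1"
  and "norm q < 1 ==> eval_fps eta_ratio4 q = (theta q - theta (q ^ 4)) * (2 * theta (q ^ 4) - theta q) / 2"
proof -
 show "fps_conv_radius eta_ratio4 >= 1" unfolding eta_ratio4_def by (intro disc_radius) simp_all
 show "eval_fps eta_ratio4 q = (theta q - theta (q ^ 4)) * (2 * theta (q ^ 4) - theta q) / 2" if "norm q < 1"
  unfolding eta_ratio4_def using that
  by (simp add: fps_mult_disc(2) fps_add_disc(2) fps_power_eval(2) fps_const_disc(2) disc_radius theta_fps_eval(2) fps_dilate_theta_eval del: fps_const_neg)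
qed

lemma theta_nonzero:
 assumes "0 < norm q" "norm q < 1"
 shows "theta q ~= 0"
 using theta_euler(1)[OF assms] euler_product_limit(2) assms norm_power_less_1[OF assms(2)] by simp

text \<open>With u = E1 E8 and v = E2 E4 in Euler products, theta(q) theta(q^2) = v^3 / u^2, and
  \<open>eta_ratio2\<close> is its square times q (u/v)^8. For e = exp(2 pi i \<tau> / 24) the
  powers of e cancel in the first factor (6 * 3 = 9 * 2) and give e^24 = q in the second ((9 - 6) *
  8 = 24). The bound 2j \<le> k makes the exponent k - 2j an honest difference.\<close>

lemma a2_eq:
 assumes "2 * j <= k"
 shows "a2 j k n = (eta_base 2 ^ (k - 2 * j) * eta_ratio2 ^ j) $ n"
proof -
 have r: "fps_conv_radius (eta_base 2 ^ (k - 2 * j) * eta_ratio2 ^ j) >= 1"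
  by (intro disc_radius eta_base_eval(1) eta_ratio2_eval(1)) simp
 have "a2 j k = fps_nth (eta_base 2 ^ (k - 2 * j) * eta_ratio2 ^ j)"
  unfolding a2_def
 proof (rule q_coeff_eqI[OF r])
  fix \<tau> :: complex assume "Im \<tau> > 0"
  define q e where "q = nome \<tau>" and "e = exp (2 * of_real pi * \<i> * \<tau> / 24)"
  have q: "0 < norm q" "norm q < 1" using nome_norm \<open>Im \<tau> > 0\<close> by (auto simp: q_def)
  have eq: "e ^ 24 = q" unfolding e_def q_def nome_def exp_of_nat_mult[symmetric] by (simp add: mult_ac)
  have e0: "e ~= 0" by (simp add: e_def)
  have qp: "0 < norm (q ^ m)" "norm (q ^ m) < 1" if "m > 0" for m using norm_power_less_1[OF q(2) that] q by simp_all
  define E1 E2 E4 E8 where "E1 = euler_product q" and "E2 = euler_product (q\<^sup>2)"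
   and "E4 = euler_product (q ^ 4)" and "E8 = euler_product (q ^ 8)"
  have nz: "E1 ~= 0" "E2 ~= 0" "E4 ~= 0" "E8 ~= 0"
   using euler_product_limit(2) q qp by (auto simp: E1_def E2_def E4_def E8_def)
  define u v where "u = E1 * E8" and "v = E2 * E4"
  have uv: "u ~= 0" "v ~= 0" using nz by (auto simp: u_def v_def)
  define z where "z = theta q * theta (q\<^sup>2)"
  have tq: "theta q = E2 ^ 5 / (E1\<^sup>2 * E4\<^sup>2)" using theta_euler(1)[OF q] by (simp add: E1_def E2_def E4_def)
  have tq2: "theta (q\<^sup>2) = E4 ^ 5 / (E2\<^sup>2 * E8\<^sup>2)"
   using theta_euler(1)[OF qp, of 2] by (simp add: E8_def E2_def E4_def flip: power_mult)
  have tm: "theta (- q) = E1\<^sup>2 / E2" using theta_euler(2)[OF q] by (simp add: E1_def E2_def)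
  have p5: "x ^ 5 = x ^ 3 * x\<^sup>2" for x :: complex by (simp flip: power_add)
  have z: "z = v ^ 3 / u\<^sup>2" unfolding z_def tq tq2 u_def v_def p5 power_mult_distrib using nz
   by (simp add: divide_simps) (simp add: mult_ac)
  define W where "W = ((theta q)\<^sup>2 - (theta (q\<^sup>2))\<^sup>2) * (2 * (theta (q\<^sup>2))\<^sup>2 - (theta q)\<^sup>2) / 4"
  have "2 * (theta (q\<^sup>2))\<^sup>2 - (theta q)\<^sup>2 = (theta (- q))\<^sup>2" using theta_square_sum[OF q(2)] by (simp add: algebra_simps)
  hence "W = q * (E8 ^ 4 / E4\<^sup>2) * (E1\<^sup>2 / E2)\<^sup>2" unfolding W_def theta_square_difference[OF q] tm by (simp add: E8_def E4_def)
  also have "... = q * (u ^ 4 / v\<^sup>2)"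
   unfolding u_def v_def power_mult_distrib power_divide by (simp add: mult_ac flip: power_mult)
  also have "... = z\<^sup>2 * (q * (u / v) ^ 8)"
  proof -
   have "u ^ 8 = u ^ 4 * (u\<^sup>2)\<^sup>2" "v ^ 8 = v\<^sup>2 * (v ^ 3)\<^sup>2"
    unfolding power_mult[symmetric] power_add[symmetric] by simp_all
   moreover have "B / A * (q * (c * A / (d * B))) = q * (c / d)" if "A ~= 0" "B ~= 0" for A B c d
    using that by simp
   moreover have "(u\<^sup>2)\<^sup>2 ~= 0" "(v ^ 3)\<^sup>2 ~= 0" using uv by simp_all
   ultimately show ?thesis unfolding z power_divide by metis
  qed
  finally have W: "W = z\<^sup>2 * (q * (u / v) ^ 8)" .
  have e9: "e ^ 9 = e ^ 1 * e ^ 8" "e ^ 6 = e ^ 2 * e ^ 4" unfolding power_add[symmetric] by simp_all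
  have h: "eta_mult 1 \<tau> * eta_mult 8 \<tau> = e ^ 9 * u" "eta_mult 2 \<tau> * eta_mult 4 \<tau> = e ^ 6 * v"
   unfolding eta_mult_eq q_def[symmetric] e_def[symmetric] u_def v_def E1_def E2_def E4_def E8_def e9
   by (simp_all only: power_one_right mult_ac)
  have 1: "(e ^ 6 * v) ^ (3 * k) / (e ^ 9 * u) ^ (2 * k) = z ^ k"
  proof -
   have c: "(e ^ 6 * v) ^ 3 / (e ^ 9 * u) ^ 2 = z"
    unfolding z power_mult_distrib power_mult[symmetric] using e0 by simp
   have "(e ^ 6 * v) ^ (3 * k) / (e ^ 9 * u) ^ (2 * k) = ((e ^ 6 * v) ^ 3 / (e ^ 9 * u) ^ 2) ^ k"
    by (simp only: power_mult power_divide)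
   thus ?thesis unfolding c .
  qed
  have 2: "((e ^ 9 * u) / (e ^ 6 * v)) ^ (8 * j) = (q * (u / v) ^ 8) ^ j"
  proof -
   have d9: "e ^ 9 = e ^ 6 * e ^ 3" unfolding power_add[symmetric] by simp
   have d: "e ^ 9 * u / (e ^ 6 * v) = e ^ 3 * (u / v)" unfolding d9 mult.assoc times_divide_eq_right
    by (rule nonzero_mult_divide_mult_cancel_left) (use e0 in simp)
   have "(e ^ 3) ^ 8 = q" unfolding power_mult[symmetric] using eq by simp
   hence "((e ^ 9 * u) / (e ^ 6 * v)) ^ 8 = q * (u / v) ^ 8" unfolding d power_mult_distrib by (simp only:)
   thus ?thesis by (simp only: power_mult)
  qed
  have "z ^ k = z ^ (k - 2 * j) * (z\<^sup>2) ^ j" using assms by (simp flip: power_mult power_add)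
  hence "z ^ k * (q * (u / v) ^ 8) ^ j = z ^ (k - 2 * j) * W ^ j" by (simp only: W power_mult_distrib mult.assoc)
  thus "(eta_mult 2 \<tau> * eta_mult 4 \<tau>) ^ (3 * k) / (eta_mult 1 \<tau> * eta_mult 8 \<tau>) ^ (2 * k)
    * ((eta_mult 1 \<tau> * eta_mult 8 \<tau>) / (eta_mult 2 \<tau> * eta_mult 4 \<tau>)) ^ (8 * j)
   = eval_fps (eta_base 2 ^ (k - 2 * j) * eta_ratio2 ^ j) (nome \<tau>)"
   unfolding h 1 2 q_def[symmetric]
   using q by (simp add: fps_mult_disc(2) fps_power_eval disc_radius eta_base_eval eta_ratio2_eval z_def W_def)
 qed
 thus ?thesis by simp
qed

text \<open>With u = E1 E4 E16 and v = E2 E8, theta(q) theta(q^4) = v^5 / (u E4)^2, and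
  \<open>eta_ratio4\<close> is this times q u^4 / v^6. The powers of e = exp(2 pi i \<tau> / 24)
  match by 10 * 5 = 25 * 2 and 21 * 4 - 10 * 6 = 24.\<close>

lemma a4_eq:
 assumes "j <= k"
 shows "a4 j k n = (eta_base 4 ^ (k - j) * eta_ratio4 ^ j) $ n"
proof -
 have r: "fps_conv_radius (eta_base 4 ^ (k - j) * eta_ratio4 ^ j) >= 1"
  by (intro disc_radius eta_base_eval(1) eta_ratio4_eval(1)) simp
 have "a4 j k = fps_nth (eta_base 4 ^ (k - j) * eta_ratio4 ^ j)"
  unfolding a4_def
 proof (rule q_coeff_eqI[OF r])
  fix \<tau> :: complex assume "Im \<tau> > 0"
  define q e where "q = nome \<tau>" and "e = exp (2 * of_real pi * \<i> * \<tau> / 24)"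
  have q: "0 < norm q" "norm q < 1" using nome_norm \<open>Im \<tau> > 0\<close> by (auto simp: q_def)
  have eq: "e ^ 24 = q" unfolding e_def q_def nome_def exp_of_nat_mult[symmetric] by (simp add: mult_ac)
  have e0: "e ~= 0" by (simp add: e_def)
  have qp: "0 < norm (q ^ m)" "norm (q ^ m) < 1" if "m > 0" for m using norm_power_less_1[OF q(2) that] q by simp_all
  define E1 E2 E4 E8 E16 where "E1 = euler_product q" and "E2 = euler_product (q\<^sup>2)"
   and "E4 = euler_product (q ^ 4)" and "E8 = euler_product (q ^ 8)" and "E16 = euler_product (q ^ 16)"
  have nz: "E1 ~= 0" "E2 ~= 0" "E4 ~= 0" "E8 ~= 0" "E16 ~= 0"
   using euler_product_limit(2) q qp by (auto simp: E1_def E2_def E4_def E8_def E16_def)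
  define u v where "u = E1 * E4 * E16" and "v = E2 * E8"
  have uv: "u ~= 0" "v ~= 0" using nz by (auto simp: u_def v_def)
  define z where "z = theta q * theta (q ^ 4)"
  have tq: "theta q = E2 ^ 5 / (E1\<^sup>2 * E4\<^sup>2)" using theta_euler(1)[OF q] by (simp add: E1_def E2_def E4_def)
  have tq4: "theta (q ^ 4) = E8 ^ 5 / (E4\<^sup>2 * E16\<^sup>2)"
   using theta_euler(1)[OF qp, of 4] by (simp add: E8_def E4_def E16_def flip: power_mult)
  have tm: "theta (- q) = E1\<^sup>2 / E2" using theta_euler(2)[OF q] by (simp add: E1_def E2_def)
  have z: "z = v ^ 5 / (u * E4)\<^sup>2" unfolding z_def tq tq4 u_def v_def power_mult_distrib by (simp add: mult_ac)
  define W where "W = (theta q - theta (q ^ 4)) * (2 * theta (q ^ 4) - theta q) / 2"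
  have "2 * theta (q ^ 4) - theta q = theta (- q)" using theta_quadruple[OF q(2)] by (simp add: algebra_simps)
  hence "W = q * (E16\<^sup>2 / E8) * (E1\<^sup>2 / E2)" unfolding W_def theta_difference[OF q] tm by (simp add: E8_def E16_def)
  also have "... = q * (u\<^sup>2 / (v * E4\<^sup>2))"
   unfolding u_def v_def power_mult_distrib using nz by (simp add: divide_simps)
  also have "... = z * (q * (u ^ 4 / v ^ 6))"
  proof -
   have "u ^ 4 = u\<^sup>2 * u\<^sup>2" "v ^ 6 = v * v ^ 5"
    unfolding power_Suc[symmetric] power_add[symmetric] by simp_all
   moreover have "B / (A * F) * (q * (A * A / (v * B))) = q * (A / (v * F))" if "A ~= 0" "B ~= 0" for A B F
    using that by simp
   moreover have "u\<^sup>2 ~= 0" "v ^ 5 ~= 0" using uv by simp_all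
   ultimately show ?thesis unfolding z power_mult_distrib by metis
  qed
  finally have W: "W = z * (q * (u ^ 4 / v ^ 6))" .
  have e25: "e ^ 25 = e ^ 1 * (e ^ 4 * e ^ 4) * e ^ 16" "e ^ 10 = e ^ 2 * e ^ 8" "e ^ 21 = e ^ 1 * e ^ 4 * e ^ 16"
   unfolding power_add[symmetric] by simp_all
  have h: "eta_mult 1 \<tau> * (eta_mult 4 \<tau>)\<^sup>2 * eta_mult 16 \<tau> = e ^ 25 * (u * E4)" "eta_mult 2 \<tau> * eta_mult 8 \<tau> = e ^ 10 * v"
   "eta_mult 1 \<tau> * eta_mult 4 \<tau> * eta_mult 16 \<tau> = e ^ 21 * u"
   unfolding eta_mult_eq q_def[symmetric] e_def[symmetric] u_def v_def E1_def E2_def E4_def E8_def E16_def e25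
    power2_eq_square[of "_ * _"]
   by (simp_all only: power_one_right mult_ac)
  have 1: "(e ^ 10 * v) ^ (5 * k) / (e ^ 25 * (u * E4)) ^ (2 * k) = z ^ k"
  proof -
   have c: "(e ^ 10 * v) ^ 5 / (e ^ 25 * (u * E4)) ^ 2 = z"
    unfolding z power_mult_distrib power_mult[symmetric] using e0 by simp
   have "(e ^ 10 * v) ^ (5 * k) / (e ^ 25 * (u * E4)) ^ (2 * k) = ((e ^ 10 * v) ^ 5 / (e ^ 25 * (u * E4)) ^ 2) ^ k"
    by (simp only: power_mult power_divide)
   thus ?thesis unfolding c .
  qed
  have 2: "(e ^ 21 * u) ^ (4 * j) / (e ^ 10 * v) ^ (6 * j) = (q * (u ^ 4 / v ^ 6)) ^ j"
  proof -
   have "e ^ 84 = q * e ^ 60" unfolding eq[symmetric] power_add[symmetric] by simp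
   moreover have "(e ^ 21) ^ 4 = e ^ 84" "(e ^ 10) ^ 6 = e ^ 60" unfolding power_mult[symmetric] by simp_all
   ultimately have c: "(e ^ 21 * u) ^ 4 / (e ^ 10 * v) ^ 6 = q * (u ^ 4 / v ^ 6)"
    unfolding power_mult_distrib using e0 by simp
   have "(e ^ 21 * u) ^ (4 * j) / (e ^ 10 * v) ^ (6 * j) = ((e ^ 21 * u) ^ 4 / (e ^ 10 * v) ^ 6) ^ j"
    by (simp only: power_mult power_divide)
   thus ?thesis unfolding c .
  qed
  have "z ^ k = z ^ (k - j) * z ^ j" using assms by (simp flip: power_add)
  hence "z ^ k * (q * (u ^ 4 / v ^ 6)) ^ j = z ^ (k - j) * W ^ j" by (simp only: W power_mult_distrib mult.assoc)
  thus "(eta_mult 2 \<tau> * eta_mult 8 \<tau>) ^ (5 * k) / (eta_mult 1 \<tau> * (eta_mult 4 \<tau>)\<^sup>2 * eta_mult 16 \<tau>) ^ (2 * k)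
    * ((eta_mult 1 \<tau> * eta_mult 4 \<tau> * eta_mult 16 \<tau>) ^ (4 * j) / (eta_mult 2 \<tau> * eta_mult 8 \<tau>) ^ (6 * j))
   = eval_fps (eta_base 4 ^ (k - j) * eta_ratio4 ^ j) (nome \<tau>)"
   unfolding h 1 2 q_def[symmetric]
   using q by (simp add: fps_mult_disc(2) fps_power_eval disc_radius eta_base_eval eta_ratio4_eval z_def W_def)
 qed
 thus ?thesis by simp
qed

section \<open>Unique rational coefficients\<close>

text \<open>A complex solution is given. As the matrix is unitriangular, the equation n = j
  expresses the coefficient j through the earlier ones; this recursion gives uniqueness, and it
  preserves rationality.\<close>

lemma triangular_rational_solution:
 fixes A :: "nat => nat => complex" and D c' :: "nat => complex"
 assumes D: "!!n. n > 0 ==> D n \<in> \<rat>" and A: "!!j n. A j n \<in> \<rat>" and A0: "!!j n. n < j ==> A j n = 0"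
  and A1: "!!j. A j j = 1" and c': "!!n. n > 0 ==> D n = (\<Sum>j=1..l. c' j * A j n)"
 shows "\<exists>!c. c \<in> {1..l} \<rightarrow>\<^sub>E (UNIV :: rat set) & (\<forall>n>0. D n = (\<Sum>j=1..l. of_rat (c j) * A j n))"
proof -
 have rec: "f j = D j - (\<Sum>i\<in>{1..<j}. f i * A i j)"
  if f: "!!n. n > 0 ==> D n = (\<Sum>i=1..l. f i * A i n)" and j: "j \<in> {1..l}" for f j
 proof -
  have "D j = (\<Sum>i=1..l. f i * A i j)" using f j by simp
  also have "... = (\<Sum>i=1..j. f i * A i j)" by (rule sum.mono_neutral_right) (use j A0 in auto)
  also have "{1..j} = insert j {1..<j}" using j by auto
  finally show ?thesis by (simp add: A1)
 qed
 have rat: "c' j \<in> \<rat>" if "j \<in> {1..l}" for j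
  using that
 proof (induction j rule: less_induct)
  case (less j)
  have "(\<Sum>i\<in>{1..<j}. c' i * A i j) \<in> \<rat>" using less A by (intro Rats_sum Rats_mult) auto
  moreover have "D j \<in> \<rat>" using D less by simp
  ultimately show ?case using rec[OF c' less.prems] by (metis Rats_diff)
 qed
 \<comment> \<open>Outside {1..l} the function is undefined, as the extensional function space
   demands; otherwise it would not be unique.\<close>
 define c where "c = (\<lambda>j\<in>{1..l}. SOME r. of_rat r = c' j)"
 have cc: "of_rat (c j) = c' j" if "j \<in> {1..l}" for j
  using rat[OF that] that by (auto simp: c_def Rats_def intro: someI)
 show ?thesis
 proof (rule ex1I[of _ c])
  have "(\<Sum>j=1..l. of_rat (c j) * A j n) = (\<Sum>j=1..l. c' j * A j n)" for n
   by (rule sum.cong) (simp_all add: cc)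
  thus "c \<in> {1..l} \<rightarrow>\<^sub>E UNIV & (\<forall>n>0. D n = (\<Sum>j=1..l. of_rat (c j) * A j n))"
   using c' by (simp add: c_def)
  fix d assume d: "d \<in> {1..l} \<rightarrow>\<^sub>E UNIV & (\<forall>n>0. D n = (\<Sum>j=1..l. of_rat (d j) * A j n))"
  have eq: "of_rat (d j) = c' j" if "j \<in> {1..l}" for j
   using that
  proof (induction j rule: less_induct)
   case (less j)
   have "(\<Sum>i\<in>{1..<j}. of_rat (d i) * A i j) = (\<Sum>i\<in>{1..<j}. c' i * A i j)"
    by (rule sum.cong) (use less in auto)
   thus ?case using rec[OF c' less.prems] rec[of "%i. of_rat (d i)", OF _ less.prems] d by simp
  qed
  show "d = c"
  proof (rule PiE_ext)
   show "d \<in> {1..l} \<rightarrow>\<^sub>E UNIV" using d by simp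
   show "c \<in> {1..l} \<rightarrow>\<^sub>E UNIV" by (simp add: c_def)
   fix j assume j: "j \<in> {1..l}"
   show "d j = c j" using eq[OF j] cc[OF j] by (metis of_rat_eq_iff)
  qed
 qed
qed

definition rational_coeffs :: "complex fps => bool" where
 "rational_coeffs f \<longleftrightarrow> (\<forall>n. f $ n \<in> \<rat>)"

lemma rational_coeffs_mult: "rational_coeffs f ==> rational_coeffs g ==> rational_coeffs (f * g)"
 unfolding rational_coeffs_def fps_mult_nth by (intro allI Rats_sum Rats_mult) auto

lemma rational_coeffs_intros:
 "rational_coeffs f ==> rational_coeffs g ==> rational_coeffs (f + g)"
 "rational_coeffs f ==> rational_coeffs (- f)"
 "c \<in> \<rat> ==> rational_coeffs (fps_const c)"
 "rational_coeffs f ==> rational_coeffs (fps_dilate m f)"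
 by (simp_all add: rational_coeffs_def fps_dilate_def)

lemma rational_coeffs_theta: "rational_coeffs theta_fps"
 by (simp add: rational_coeffs_def theta_fps_def)

lemma rational_coeffs_power: "rational_coeffs f ==> rational_coeffs (f ^ n)"
proof (induction n)
 case 0 show ?case using rational_coeffs_intros(3)[of 1] by simp
qed (simp add: rational_coeffs_mult)

text \<open>W is X times a series with constant term 1, hence so is its j-th power relative to
  X^j.\<close>

lemma fps_power_times_leading:
 fixes W Z :: "complex fps"
 assumes W: "W $ 0 = 0" "W $ 1 = 1" and Z: "Z $ 0 = 1"
 shows "n < j ==> (Z ^ m * W ^ j) $ n = 0" "(Z ^ m * W ^ j) $ j = 1"
proof -
 define V where "V = Abs_fps (%n. W $ (n + 1))"
 have WV: "W = fps_X * V"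
 proof (rule fps_ext)
  show "W $ n = (fps_X * V) $ n" for n by (cases n) (simp_all add: V_def W(1))
 qed
 have e: "Z ^ m * W ^ j = fps_X ^ j * (Z ^ m * V ^ j)" unfolding WV power_mult_distrib by (simp only: mult_ac)
 show "n < j ==> (Z ^ m * W ^ j) $ n = 0" unfolding e fps_X_power_mult_nth by simp
 show "(Z ^ m * W ^ j) $ j = 1" unfolding e fps_X_power_mult_nth using W(2) Z by (simp add: fps_power_zeroth V_def)
qed

text \<open>Substituting the affine function \<alpha> + \<beta> x into P gives a polynomial R, and a
  l \<le> k lets the denominators be absorbed: E is the sum of R_i Z^(k - a i) W^i as a power
  series. The coefficients of R with i \<ge> 1 are, up to sign, those sought.\<close>

lemma unique_expansion:
 fixes Z W E :: "complex fps" and P :: "complex poly" and e :: "nat => rat"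
 assumes rad: "fps_conv_radius Z >= 1" "fps_conv_radius W >= 1" "fps_conv_radius E >= 1"
  and Z0: "Z $ 0 = 1" and W: "W $ 0 = 0" "W $ 1 = 1" and E0: "E $ 0 = 1"
  and rat: "rational_coeffs Z" "rational_coeffs W" and e: "!!n. n > 0 ==> E $ n = of_rat (e n)"
  and al: "a * l <= k" and P: "degree P <= l"
  and eq: "!!q. 0 < norm q ==> norm q < 1 ==> eval_fps Z q ~= 0 &
   eval_fps E q = poly P (\<alpha> + \<beta> * (eval_fps W q / eval_fps Z q ^ a)) * eval_fps Z q ^ k"
 shows "\<exists>!c. c \<in> {1..l} \<rightarrow>\<^sub>E (UNIV :: rat set) &
  (\<forall>n>0. (Z ^ k) $ n = of_rat (e n) + (\<Sum>j=1..l. of_rat (c j) * (Z ^ (k - a * j) * W ^ j) $ n))"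
proof -
 define R where "R = pcompose P [:\<alpha>, \<beta>:]"
 define T where "T i = Z ^ (k - a * i) * W ^ i" for i
 have "degree R <= degree P * degree [:\<alpha>, \<beta>:]" unfolding R_def by (rule degree_pcompose_le)
 also have "degree [:\<alpha>, \<beta>:] <= 1" by (cases "\<beta> = 0") simp_all
 finally have dR: "degree R <= l" using P by simp
 have rT: "fps_conv_radius (T i) >= 1" for i unfolding T_def by (intro fps_mult_disc(1) fps_power_eval(1) rad)
 have rc: "fps_conv_radius (fps_const (poly.coeff R i) * T i) >= 1" for i by (intro fps_mult_disc(1) rT fps_const_disc(1))
 have "E = (\<Sum>i\<le>l. fps_const (poly.coeff R i) * T i)"
 proof (rule eval_fps_unique_disc[OF rad(3)])
  show "fps_conv_radius (\<Sum>i\<le>l. fps_const (poly.coeff R i) * T i) >= 1" by (rule fps_sum_disc(1)[OF rc])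
  fix q :: complex assume q: "0 < norm q" "norm q < 1"
  define z w where "z = eval_fps Z q" and "w = eval_fps W q"
  have z0: "z ~= 0" using eq[OF q] by (simp add: z_def)
  have "eval_fps (\<Sum>i\<le>l. fps_const (poly.coeff R i) * T i) q = (\<Sum>i\<le>l. eval_fps (fps_const (poly.coeff R i) * T i) q)"
   by (rule fps_sum_disc(2)[OF rc q(2)])
  also have "... = (\<Sum>i\<le>l. poly.coeff R i * (w / z ^ a) ^ i * z ^ k)"
  proof (rule sum.cong)
   fix i assume i: "i \<in> {..l}"
   hence "a * i <= a * l" by simp
   hence "k - a * i + a * i = k" using al by linarith
   hence "z ^ k = z ^ (k - a * i + a * i)" by (simp only:)
   hence "z ^ k = z ^ (k - a * i) * (z ^ a) ^ i" by (simp only: power_add power_mult)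
   hence "(w / z ^ a) ^ i * z ^ k = z ^ (k - a * i) * w ^ i" using z0 by (simp add: power_divide)
   moreover have "eval_fps (fps_const (poly.coeff R i) * T i) q = poly.coeff R i * (z ^ (k - a * i) * w ^ i)"
    unfolding T_def z_def w_def
    by (simp only: fps_mult_disc(2)[OF fps_const_disc(1) fps_mult_disc(1)[OF fps_power_eval(1)[OF rad(1)] fps_power_eval(1)[OF rad(2)]] q(2)]
      fps_mult_disc(2)[OF fps_power_eval(1)[OF rad(1)] fps_power_eval(1)[OF rad(2)] q(2)]
      fps_power_eval(2)[OF rad(1) q(2)] fps_power_eval(2)[OF rad(2) q(2)] fps_const_disc(2))
   ultimately show "eval_fps (fps_const (poly.coeff R i) * T i) q = poly.coeff R i * (w / z ^ a) ^ i * z ^ k" by simp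
  qed simp
  also have "... = poly R (w / z ^ a) * z ^ k"
  proof -
   have "poly R x = (\<Sum>i\<le>l. poly.coeff R i * x ^ i)" for x
    unfolding poly_altdef by (rule sum.mono_neutral_left) (use dR in \<open>auto simp: coeff_eq_0\<close>)
   thus ?thesis by (simp add: sum_distrib_right)
  qed
  also have "... = eval_fps E q" using eq[OF q] by (simp add: R_def poly_pcompose z_def w_def mult.commute)
  finally show "eval_fps E q = eval_fps (\<Sum>i\<le>l. fps_const (poly.coeff R i) * T i) q" ..
 qed
 hence En: "E $ n = (\<Sum>i\<le>l. poly.coeff R i * T i $ n)" for n by (simp add: fps_sum_nth)
 have sp: "(\<Sum>i\<le>l. f i) = f 0 + (\<Sum>i=1..l. f i)" for f :: "nat => complex"
 proof -
  have "{..l} = insert 0 {1..l}" by auto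
  thus ?thesis by simp
 qed
 have T0: "T 0 = Z ^ k" by (simp add: T_def)
 have "(\<Sum>i=1..l. poly.coeff R i * T i $ 0) = 0"
  by (rule sum.neutral) (auto simp: T_def fps_power_zeroth W)
 \<comment> \<open>W vanishes at q = 0, so comparing constant terms normalises the contribution of i
   = 0 to Z^k itself.\<close>
 hence R0: "poly.coeff R 0 = 1" using En[of 0] E0 by (simp add: sp T0 fps_power_zeroth Z0)
 have Zk: "(Z ^ k) $ n = of_rat (e n) + (\<Sum>j=1..l. - poly.coeff R j * T j $ n)" if "n > 0" for n
  using En[of n] e[OF that] by (simp add: sp T0 R0 sum_negf)
 have rat': "rational_coeffs (T j)" for j unfolding T_def by (intro rational_coeffs_mult rational_coeffs_power rat)
 have rZ: "(Z ^ k) $ n \<in> \<rat>" for n using rational_coeffs_power[OF rat(1)] by (simp add: rational_coeffs_def)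
 have "\<exists>!c. c \<in> {1..l} \<rightarrow>\<^sub>E (UNIV :: rat set) & (\<forall>n>0. (Z ^ k) $ n - of_rat (e n) = (\<Sum>j=1..l. of_rat (c j) * T j $ n))"
 proof (rule triangular_rational_solution[where D = "%n. (Z ^ k) $ n - of_rat (e n)" and A = "%j n. T j $ n" and c' = "%j. - poly.coeff R j"])
  show "(Z ^ k) $ n - of_rat (e n) \<in> \<rat>" for n using rZ by (intro Rats_diff) auto
  show "T j $ n \<in> \<rat>" for j n using rat' by (simp add: rational_coeffs_def)
  show "T j $ n = 0" if "n < j" for j n unfolding T_def by (rule fps_power_times_leading(1)[OF W Z0 that])
  show "T j $ j = 1" for j unfolding T_def by (rule fps_power_times_leading(2)[OF W Z0])
  show "(Z ^ k) $ n - of_rat (e n) = (\<Sum>j=1..l. - poly.coeff R j * T j $ n)" if "n > 0" for n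
   using Zk[OF that] by simp
 qed
 moreover have "(Z ^ k) $ n - of_rat (e n) = x \<longleftrightarrow> (Z ^ k) $ n = of_rat (e n) + x" for n x
  unfolding diff_eq_eq by (simp only: add.commute)
 ultimately show ?thesis unfolding T_def by (simp only:)
qed

section \<open>Divisor parts and the shape of the expansion\<close>

text \<open>The divisor part of each case is entered as a list of coefficient, dilation and series,
  so that convergence, evaluation and coefficients are treated once for all cases. The constant term
  is normalised to 1.\<close>

definition eisenstein :: "(complex \<times> nat \<times> complex fps) list => complex fps" where
 "eisenstein xs = 1 + (\<Sum>(c, m, f)\<leftarrow>xs. fps_const c * fps_dilate m f)"

text \<open>Only vanishing at q = 0 is meant; the series concerned are Lambert series and not cusp
  forms.\<close>

definition cuspidal_series :: "complex fps => bool" where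
 "cuspidal_series f \<longleftrightarrow> fps_conv_radius f >= 1 & f $ 0 = 0"

lemma cuspidal_series_lambert:
 "cuspidal_series (sigma_fps k)" "cuspidal_series (chi_inf_fps chi4 k)" "cuspidal_series (chi_inf_fps chi8 k)"
 "cuspidal_series (chi_zero_fps chi4 k)" "cuspidal_series (chi_zero_fps chi8 k)"
 unfolding cuspidal_series_def sigma_fps_def chi_inf_fps_def chi_zero_fps_def
 using polynomially_bounded_power_times[OF norm_chi_le(1), where k = 0] polynomially_bounded_power_times[OF norm_chi_le(2), where k = 0]
 by (auto intro!: lambert_fps_eval(1) polynomially_bounded_const polynomially_bounded_power
   polynomially_bounded_power_times norm_chi_le simp: lambert_fps_nth_0)

lemma eisenstein_series:
 assumes "\<forall>(c, m, f)\<in>set xs. m > 0 & cuspidal_series f"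
 shows "fps_conv_radius (eisenstein xs) >= 1" "eisenstein xs $ 0 = 1"
  and "norm q < 1 ==> eval_fps (eisenstein xs) q = 1 + (\<Sum>(c, m, f)\<leftarrow>xs. c * eval_fps f (q ^ m))"
  and "n > 0 ==> eisenstein xs $ n = (\<Sum>(c, m, f)\<leftarrow>xs. c * fps_dilate m f $ n)"
proof -
 let ?S = "%xs. \<Sum>(c, m, f)\<leftarrow>xs. fps_const c * fps_dilate m f"
 have "fps_conv_radius (?S xs) >= 1 & ?S xs $ 0 = 0 &
   (norm q < 1 --> eval_fps (?S xs) q = (\<Sum>(c, m, f)\<leftarrow>xs. c * eval_fps f (q ^ m))) &
   ?S xs $ n = (\<Sum>(c, m, f)\<leftarrow>xs. c * fps_dilate m f $ n)" for n
  using assms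
 proof (induction xs)
  case (Cons x xs)
  obtain c m f where x: "x = (c, m, f)" by (cases x)
  have m: "m > 0" and f: "fps_conv_radius f >= 1" "f $ 0 = 0" using Cons.prems by (auto simp: x cuspidal_series_def)
  have r: "fps_conv_radius (fps_const c * fps_dilate m f) >= 1"
   by (intro fps_mult_disc(1) fps_const_disc(1) fps_dilate_eval(1)[OF f(1) m])
  have IH: "fps_conv_radius (?S xs) >= 1" "?S xs $ 0 = 0"
   "norm q < 1 ==> eval_fps (?S xs) q = (\<Sum>(c, m, f)\<leftarrow>xs. c * eval_fps f (q ^ m))"
   "?S xs $ n = (\<Sum>(c, m, f)\<leftarrow>xs. c * fps_dilate m f $ n)"
   using Cons by auto
  have S: "?S (x # xs) = fps_const c * fps_dilate m f + ?S xs" by (simp add: x)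
  have "eval_fps (?S (x # xs)) q = (\<Sum>(c, m, f)\<leftarrow>x # xs. c * eval_fps f (q ^ m))" if q: "norm q < 1"
   unfolding S fps_add_disc(2)[OF r IH(1) q] fps_mult_disc(2)[OF fps_const_disc(1) fps_dilate_eval(1)[OF f(1) m] q]
    fps_dilate_eval(2)[OF f(1) m q] IH(3)[OF q] fps_const_disc(2) by (simp add: x)
  moreover have "fps_dilate m f $ 0 = 0" by (simp add: fps_dilate_def f)
  ultimately show ?case unfolding S using fps_add_disc(1)[OF r IH(1)] IH by (simp add: x)
 qed simp
 note A = this
 have B: "?S xs $ 0 = 0" using A by blast
 show "fps_conv_radius (eisenstein xs) >= 1"
  unfolding eisenstein_def using A by (intro fps_add_disc(1)) simp_all
 show "eisenstein xs $ 0 = 1" unfolding eisenstein_def fps_add_nth B by simp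
 show "eval_fps (eisenstein xs) q = 1 + (\<Sum>(c, m, f)\<leftarrow>xs. c * eval_fps f (q ^ m))" if "norm q < 1"
  unfolding eisenstein_def using A fps_add_disc(2)[of 1 "?S xs", OF _ _ that] that by simp
 show "eisenstein xs $ n = (\<Sum>(c, m, f)\<leftarrow>xs. c * fps_dilate m f $ n)" if "n > 0"
  unfolding eisenstein_def using A[of n] that by simp
qed

lemma theta_fps_nth: "theta_fps $ 0 = 1" "theta_fps $ 1 = 2"
proof -
 have "{x :: int. nat (x\<^sup>2) = 0} = {0}" by auto
 thus "theta_fps $ 0 = 1" by (simp add: theta_fps_def)
 have "{x :: int. nat (x\<^sup>2) = 1} = {1, -1}" by (auto simp: nat_eq_iff power2_eq_1_iff)
 thus "theta_fps $ 1 = 2" by (simp add: theta_fps_def)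
qed

lemma eta_series_nth:
 "eta_base m $ 0 = 1" "eta_ratio2 $ 0 = 0" "eta_ratio2 $ 1 = 1" "eta_ratio4 $ 0 = 0" "eta_ratio4 $ 1 = 1"
 using theta_fps_nth
 by (simp_all add: eta_base_def eta_ratio2_def eta_ratio4_def fps_dilate_def power2_eq_square fps_mult_nth_1)

lemma rational_eta_series: "rational_coeffs (eta_base m)" "rational_coeffs eta_ratio2" "rational_coeffs eta_ratio4"
 unfolding eta_base_def eta_ratio2_def eta_ratio4_def
 by (intro rational_coeffs_mult rational_coeffs_intros rational_coeffs_power rational_coeffs_theta; simp)+

text \<open>With a = theta(q)^2, b = theta(q^2)^2 and v = a/b, the quotient x of
  \<open>eta_ratio2\<close> by the squared base is (a - b)(2b - a) / (4 a b), so v + 2/v = 3 - 4x.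
  This is the origin of the constants 3 and -4.\<close>

lemma rep_count_2_expansion:
 assumes xs: "\<forall>(c, m, f)\<in>set xs. m > 0 & cuspidal_series f"
  and e: "!!n. n > 0 ==> (\<Sum>(c, m, f)\<leftarrow>xs. c * fps_dilate m f $ n) = of_rat (e n)"
  and P: "degree P <= l" "2 * l <= k"
  and eq: "!!q. 0 < norm q ==> norm q < 1 ==> theta q ~= 0 ==> theta (q\<^sup>2) ~= 0 ==>
   1 + (\<Sum>(c, m, f)\<leftarrow>xs. c * eval_fps f (q ^ m))
   = poly P ((theta q)\<^sup>2 / (theta (q\<^sup>2))\<^sup>2 + 2 / ((theta q)\<^sup>2 / (theta (q\<^sup>2))\<^sup>2)) * (theta q * theta (q\<^sup>2)) ^ k"
 shows "\<exists>!c. c \<in> {1..l} \<rightarrow>\<^sub>E (UNIV :: rat set) &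
  (\<forall>n>0. (of_nat (rep_count k 2 n) :: complex) = of_rat (e n) + (\<Sum>j=1..l. of_rat (c j) * a2 j k n))"
proof -
 have "(eta_base 2 ^ k) $ n = of_nat (rep_count k 2 n)" for n by (simp add: rep_count_eq eta_base_def)
 moreover have "(\<Sum>j=1..l. of_rat (c j) * a2 j k n) = (\<Sum>j=1..l. of_rat (c j) * (eta_base 2 ^ (k - 2 * j) * eta_ratio2 ^ j) $ n)" for c n
  by (rule sum.cong) (use P in \<open>auto simp: a2_eq\<close>)
 moreover have "\<exists>!c. c \<in> {1..l} \<rightarrow>\<^sub>E (UNIV :: rat set) &
  (\<forall>n>0. (eta_base 2 ^ k) $ n = of_rat (e n) + (\<Sum>j=1..l. of_rat (c j) * (eta_base 2 ^ (k - 2 * j) * eta_ratio2 ^ j) $ n))"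
 proof (rule unique_expansion[where E = "eisenstein xs" and P = P and \<alpha> = 3 and \<beta> = "-4"])
  show "eisenstein xs $ n = of_rat (e n)" if "n > 0" for n using eisenstein_series(4)[OF xs that] e[OF that] by simp
  fix q :: complex assume q: "0 < norm q" "norm q < 1"
  have q2: "0 < norm (q\<^sup>2)" "norm (q\<^sup>2) < 1" using norm_power_less_1[OF q(2), of 2] q by auto
  note nz = theta_nonzero[OF q] theta_nonzero[OF q2]
  have "3 + - 4 * ((a - b) * (2 * b - a) / 4 / (a * b)) = a / b + 2 / (a / b)" if "a ~= 0" "b ~= 0" for a b :: complex
   using that by (simp add: field_simps)
  from this[of "(theta q)\<^sup>2" "(theta (q\<^sup>2))\<^sup>2"] nz
  have x: "3 + - 4 * (eval_fps eta_ratio2 q / eval_fps (eta_base 2) q ^ 2)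
    = (theta q)\<^sup>2 / (theta (q\<^sup>2))\<^sup>2 + 2 / ((theta q)\<^sup>2 / (theta (q\<^sup>2))\<^sup>2)"
   using q by (simp add: eta_ratio2_eval(2) eta_base_eval(2) power_mult_distrib)
  show "eval_fps (eta_base 2) q ~= 0 & eval_fps (eisenstein xs) q
    = poly P (3 + - 4 * (eval_fps eta_ratio2 q / eval_fps (eta_base 2) q ^ 2)) * eval_fps (eta_base 2) q ^ k"
   unfolding x using eisenstein_series(3)[OF xs q(2)] eq[OF q nz] nz q by (simp add: eta_base_eval(2))
 qed (use P eisenstein_series(1,2)[OF xs] in \<open>simp_all add: eta_base_eval eta_ratio2_eval eta_series_nth eta_series_nth[simplified] rational_eta_series\<close>)
 ultimately show ?thesis by (simp only:)
qed

text \<open>Here the quotient of \<open>eta_ratio4\<close> by the base is x = (w - 1)(2 - w) / (2w),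
  so w + 2/w = 3 - 2x.\<close>

lemma rep_count_4_expansion:
 assumes xs: "\<forall>(c, m, f)\<in>set xs. m > 0 & cuspidal_series f"
  and e: "!!n. n > 0 ==> (\<Sum>(c, m, f)\<leftarrow>xs. c * fps_dilate m f $ n) = of_rat (e n)"
  and P: "degree P <= l" "l <= k"
  and eq: "!!q w t. 0 < norm q ==> norm q < 1 ==> w ~= 0 ==> t ~= 0 ==> theta q = w * t ==> theta (q ^ 4) = t ==>
   1 + (\<Sum>(c, m, f)\<leftarrow>xs. c * eval_fps f (q ^ m)) = poly P (w + 2 / w) * (w * t\<^sup>2) ^ k"
 shows "\<exists>!c. c \<in> {1..l} \<rightarrow>\<^sub>E (UNIV :: rat set) &
  (\<forall>n>0. (of_nat (rep_count k 4 n) :: complex) = of_rat (e n) + (\<Sum>j=1..l. of_rat (c j) * a4 j k n))"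
proof -
 have "(eta_base 4 ^ k) $ n = of_nat (rep_count k 4 n)" for n by (simp add: rep_count_eq eta_base_def)
 moreover have "(\<Sum>j=1..l. of_rat (c j) * a4 j k n) = (\<Sum>j=1..l. of_rat (c j) * (eta_base 4 ^ (k - 1 * j) * eta_ratio4 ^ j) $ n)" for c n
  by (rule sum.cong) (use P in \<open>auto simp: a4_eq\<close>)
 moreover have "\<exists>!c. c \<in> {1..l} \<rightarrow>\<^sub>E (UNIV :: rat set) &
  (\<forall>n>0. (eta_base 4 ^ k) $ n = of_rat (e n) + (\<Sum>j=1..l. of_rat (c j) * (eta_base 4 ^ (k - 1 * j) * eta_ratio4 ^ j) $ n))"
 proof (rule unique_expansion[where E = "eisenstein xs" and P = P and \<alpha> = 3 and \<beta> = "-2"])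
  show "eisenstein xs $ n = of_rat (e n)" if "n > 0" for n using eisenstein_series(4)[OF xs that] e[OF that] by simp
  fix q :: complex assume q: "0 < norm q" "norm q < 1"
  have q4: "0 < norm (q ^ 4)" "norm (q ^ 4) < 1" using norm_power_less_1[OF q(2), of 4] q by auto
  note nz = theta_nonzero[OF q] theta_nonzero[OF q4]
  define t w where "t = theta (q ^ 4)" and "w = theta q / theta (q ^ 4)"
  have wt: "w ~= 0" "t ~= 0" "theta q = w * t" "theta (q ^ 4) = t" using nz by (auto simp: w_def t_def)
  have b: "eval_fps (eta_base 4) q = w * t\<^sup>2" using q by (simp add: eta_base_eval(2) wt power2_eq_square)
  have "eval_fps eta_ratio4 q = (w * t - t) * (2 * t - w * t) / 2" using q by (simp add: eta_ratio4_eval(2) wt)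
  also have "... = (w - 1) * (2 - w) / 2 * t\<^sup>2" by (simp add: power2_eq_square algebra_simps)
  finally have r: "eval_fps eta_ratio4 q = (w - 1) * (2 - w) / 2 * t\<^sup>2" .
  have "eval_fps eta_ratio4 q / eval_fps (eta_base 4) q ^ 1 = (w - 1) * (2 - w) / 2 / w"
   unfolding b r using wt by simp
  moreover have "3 + - 2 * ((w - 1) * (2 - w) / 2 / w) = w + 2 / w" using wt by (simp add: field_simps)
  ultimately have x: "3 + - 2 * (eval_fps eta_ratio4 q / eval_fps (eta_base 4) q ^ 1) = w + 2 / w" by simp
  show "eval_fps (eta_base 4) q ~= 0 & eval_fps (eisenstein xs) q
    = poly P (3 + - 2 * (eval_fps eta_ratio4 q / eval_fps (eta_base 4) q ^ 1)) * eval_fps (eta_base 4) q ^ k"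
   unfolding x unfolding b using eisenstein_series(3)[OF xs q(2)] eq[OF q wt] wt by simp
 qed (use P eisenstein_series(1,2)[OF xs] in \<open>simp_all add: eta_base_eval eta_ratio4_eval eta_series_nth eta_series_nth[simplified] rational_eta_series\<close>)
 ultimately show ?thesis by (simp only:)
qed

section \<open>Moments in terms of w, for m = 2 and m = 4\<close>

lemma even_deriv_scaled:
 assumes "H = c * h" "S = c * s" "P = c ^ 2 * p"
 shows "even_deriv H S P j n = c ^ (n div 2 + j) * even_deriv h s p j n"
 unfolding assms by (rule even_deriv_scale)

text \<open>Expresses the theta constants at -q and -q^2 through the squares of those at q and q^2,
  the only two independent quantities for m = 2.\<close>

lemma theta_reflect_squares:
 assumes q: "norm q < 1"
 shows "theta (- q) ^ 4 = (2 * (theta (q\<^sup>2))\<^sup>2 - (theta q)\<^sup>2)\<^sup>2"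
  and "theta (- q\<^sup>2) ^ 4 = (theta q)\<^sup>2 * (2 * (theta (q\<^sup>2))\<^sup>2 - (theta q)\<^sup>2)"
proof -
 have 1: "(theta (- q))\<^sup>2 = 2 * (theta (q\<^sup>2))\<^sup>2 - (theta q)\<^sup>2" using theta_square_sum[OF q] by (simp add: algebra_simps)
 have "theta (- q) ^ 4 = ((theta (- q))\<^sup>2)\<^sup>2" by (simp flip: power_mult)
 thus "theta (- q) ^ 4 = (2 * (theta (q\<^sup>2))\<^sup>2 - (theta q)\<^sup>2)\<^sup>2" unfolding 1 .
 have "theta (- q\<^sup>2) ^ 4 = ((theta (- q\<^sup>2))\<^sup>2)\<^sup>2" by (simp flip: power_mult)
 thus "theta (- q\<^sup>2) ^ 4 = (theta q)\<^sup>2 * (2 * (theta (q\<^sup>2))\<^sup>2 - (theta q)\<^sup>2)"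
  unfolding theta_reflect_product[OF q, symmetric] power_mult_distrib 1 .
qed

lemma theta_power_4: "theta q ^ 4 = ((theta q)\<^sup>2)\<^sup>2"
 by (simp flip: power_mult)

text \<open>With \<open>a = \<theta>(q)\<^sup>2\<close>, \<open>b = \<theta>(q\<^sup>2)\<^sup>2\<close> and \<open>v = a / b\<close>, the arguments of the recursion are
 homogeneous in \<open>(a, b)\<close>, and \<open>v \<mapsto> 2 / v\<close> exchanges the two families of Lambert series.\<close>

lemma level_8_moments:
 assumes q: "0 < norm q" "norm q < 1" and nz: "theta q ~= 0" "theta (q\<^sup>2) ~= 0" and j: "j > 0"
 defines "v \<equiv> (theta q)\<^sup>2 / (theta (q\<^sup>2))\<^sup>2" and "z \<equiv> theta q * theta (q\<^sup>2)"
 shows "2 * 4 ^ j * eval_fps (chi_zero_fps chi8 (2 * j)) q = z ^ (2 * j + 1) * even_deriv 1 (1 / v + 2 - v) ((2 - v) / v) j 1"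
  and "(1 + fps_exp 4) * R = fps_exp 1 + fps_exp 3 ==>
   fact (2 * j) * R $ (2 * j) + 2 * eval_fps (chi_inf_fps chi8 (2 * j)) q
   = (-2) ^ j * (z ^ (2 * j + 1) * even_deriv 1 (v / 2 + 2 - 2 / v) (v - 1) j 1)"
  and "2 ^ (2 * j + 3) * (eval_fps (sigma_fps (2 * j + 1)) q - eval_fps (sigma_fps (2 * j + 1)) (q\<^sup>2))
   = z ^ (2 * j + 2) * even_deriv 0 (4 / v - 4 - v) (4 * v - 4) j 2"
  and "(1 + fps_exp 2) * C = 1 - fps_exp 2 ==>
   (-2) ^ (j + 1) * (fact (2 * j + 1) * C $ (2 * j + 1) + 2 ^ (2 * j + 3) *
    (2 ^ (2 * j + 2) * eval_fps (sigma_fps (2 * j + 1)) (q ^ 8) - eval_fps (sigma_fps (2 * j + 1)) (q ^ 4)))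
   = z ^ (2 * j + 2) * even_deriv 0 (4 / (2 / v) - 4 - 2 / v) (4 * (2 / v) - 4) j 2"
proof -
 define a b where "a = (theta q)\<^sup>2" and "b = (theta (q\<^sup>2))\<^sup>2"
 have ab: "a ~= 0" "b ~= 0" using nz by (auto simp: a_def b_def)
 have v: "v = a / b" by (simp add: v_def a_def b_def)
 have zz: "z\<^sup>2 = a * b" by (simp add: z_def a_def b_def power_mult_distrib)
 have zp: "z ^ (2 * j + 1) = z * (a * b) ^ j" "z ^ (2 * j + 2) = (a * b) ^ (1 + j)"
  unfolding zz[symmetric] by (simp_all flip: power_mult power_add)
 note t = theta_power_4[of q] theta_power_4[of "q\<^sup>2"] theta_reflect_squares[OF q(2)]
 note t = t[folded a_def b_def]
 have 1: "2 * 4 ^ j * eval_fps (chi_zero_fps chi8 (2 * j)) q = z * even_deriv (z\<^sup>2) (b\<^sup>2 + a * (2 * b - a)) (b\<^sup>2 * (a * (2 * b - a))) j 1"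
  using zero8_moment[OF q j] unfolding t z_def .
 have "even_deriv (z\<^sup>2) (b\<^sup>2 + a * (2 * b - a)) (b\<^sup>2 * (a * (2 * b - a))) j 1
   = (a * b) ^ (1 div 2 + j) * even_deriv 1 (1 / v + 2 - v) ((2 - v) / v) j 1"
 proof (rule even_deriv_scaled)
  show "z\<^sup>2 = a * b * 1" by (simp add: zz)
 qed (use ab in \<open>simp_all add: v field_simps power2_eq_square\<close>)
 thus "2 * 4 ^ j * eval_fps (chi_zero_fps chi8 (2 * j)) q = z ^ (2 * j + 1) * even_deriv 1 (1 / v + 2 - v) ((2 - v) / v) j 1"
  unfolding 1 zp by simp
 have 3: "2 ^ (2 * j + 3) * (eval_fps (sigma_fps (2 * j + 1)) q - eval_fps (sigma_fps (2 * j + 1)) (q\<^sup>2))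
   = even_deriv 0 ((2 * b - a)\<^sup>2 - 2 * a\<^sup>2) (a\<^sup>2 * (a\<^sup>2 - (2 * b - a)\<^sup>2)) j 2"
  using sigma_moment[OF q j] unfolding t .
 have "even_deriv 0 ((2 * b - a)\<^sup>2 - 2 * a\<^sup>2) (a\<^sup>2 * (a\<^sup>2 - (2 * b - a)\<^sup>2)) j 2
   = (a * b) ^ (2 div 2 + j) * even_deriv 0 (4 / v - 4 - v) (4 * v - 4) j 2"
  by (rule even_deriv_scaled) (use ab in \<open>simp_all add: v field_simps power2_eq_square\<close>)
 thus "2 ^ (2 * j + 3) * (eval_fps (sigma_fps (2 * j + 1)) q - eval_fps (sigma_fps (2 * j + 1)) (q\<^sup>2))
   = z ^ (2 * j + 2) * even_deriv 0 (4 / v - 4 - v) (4 * v - 4) j 2"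
  unfolding 3 zp by simp
 show "fact (2 * j) * R $ (2 * j) + 2 * eval_fps (chi_inf_fps chi8 (2 * j)) q
   = (-2) ^ j * (z ^ (2 * j + 1) * even_deriv 1 (v / 2 + 2 - 2 / v) (v - 1) j 1)"
  if R: "(1 + fps_exp 4) * R = fps_exp 1 + fps_exp 3"
 proof -
  \<comment> \<open>Any square root of i would do. The difference d of \<zeta> and its inverse
    satisfies d^2 = -2, which produces the factor (-2)^j.\<close>
  define \<zeta> where "\<zeta> = csqrt \<i>"
  have z2: "\<zeta>\<^sup>2 = \<i>" unfolding \<zeta>_def by (rule power2_csqrt)
  have "(norm \<zeta>)\<^sup>2 = 1\<^sup>2" using arg_cong[OF z2, of norm] by (simp add: norm_power)
  hence z1: "norm \<zeta> = 1" by (simp only: power2_eq_iff_nonneg norm_ge_zero zero_le_one)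
  have z0: "\<zeta> ~= 0" using z1 by auto
  define d where "d = \<zeta> - 1 / \<zeta>"
  have d2: "d\<^sup>2 = -2"
  proof -
   have "d\<^sup>2 = \<zeta>\<^sup>2 - 2 + 1 / \<zeta>\<^sup>2" using z0 by (simp add: d_def power2_eq_square field_simps)
   thus ?thesis unfolding z2 by simp
  qed
  hence d0: "d ~= 0" by auto
  define C where "C = fps_const (2 * \<zeta>) * fps_exp 1 / (1 - fps_const \<i> * fps_exp 2)"
  have u: "(1 - fps_const \<i> * fps_exp 2) $ 0 ~= 0" by (simp add: complex_eq_iff)
  have C: "(1 - fps_const \<i> * fps_exp 2) * C = fps_const (2 * \<zeta>) * fps_exp 1"
   unfolding C_def fps_divide_unit[OF u] mult.left_commute[of "1 - fps_const \<i> * fps_exp 2"] inverse_mult_eq_1'[OF u]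
   by simp
  have "even_deriv ((d * z)\<^sup>2) ((2 * b - a)\<^sup>2 - 2 * a\<^sup>2) (a\<^sup>2 * (a\<^sup>2 - (2 * b - a)\<^sup>2)) j 1
    = (-2 * (a * b)) ^ (1 div 2 + j) * even_deriv 1 (v / 2 + 2 - 2 / v) (v - 1) j 1"
  proof (rule even_deriv_scaled)
   show "(d * z)\<^sup>2 = -2 * (a * b) * 1" by (simp add: power_mult_distrib d2 zz)
  qed (use ab in \<open>simp_all add: v field_simps power2_eq_square\<close>)
  hence "fact (2 * j) * C $ (2 * j) + 2 * d * eval_fps (chi_inf_fps chi8 (2 * j)) q
    = d * z * ((-2 * (a * b)) ^ j * even_deriv 1 (v / 2 + 2 - 2 / v) (v - 1) j 1)"
   using inf8_boundary_moment[OF q z2 z1 C, of j] unfolding t d_def z_def by simp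
  moreover have "C $ (2 * j) = d * R $ (2 * j)" unfolding d_def by (rule eighth_root_quotient[OF z2 C R])
  ultimately have "d * (fact (2 * j) * R $ (2 * j) + 2 * eval_fps (chi_inf_fps chi8 (2 * j)) q)
    = d * (z * ((-2 * (a * b)) ^ j * even_deriv 1 (v / 2 + 2 - 2 / v) (v - 1) j 1))"
   by (simp add: algebra_simps)
  hence "fact (2 * j) * R $ (2 * j) + 2 * eval_fps (chi_inf_fps chi8 (2 * j)) q
    = z * ((-2 * (a * b)) ^ j * even_deriv 1 (v / 2 + 2 - 2 / v) (v - 1) j 1)"
   using d0 mult_left_cancel by blast
  thus ?thesis unfolding zp power_mult_distrib[of "-2"] by (simp only: mult_ac)
 qed
 show "(-2) ^ (j + 1) * (fact (2 * j + 1) * C $ (2 * j + 1) + 2 ^ (2 * j + 3) *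
    (2 ^ (2 * j + 2) * eval_fps (sigma_fps (2 * j + 1)) (q ^ 8) - eval_fps (sigma_fps (2 * j + 1)) (q ^ 4)))
   = z ^ (2 * j + 2) * even_deriv 0 (4 / (2 / v) - 4 - 2 / v) (4 * (2 / v) - 4) j 2"
  if C: "(1 + fps_exp 2) * C = 1 - fps_exp 2"
 proof -
  have q2: "0 < norm (q\<^sup>2)" "norm (q\<^sup>2) < 1" using norm_power_less_1[OF q(2), of 2] q by auto
  have qq: "(q\<^sup>2) ^ 4 = q ^ 8" "(q\<^sup>2)\<^sup>2 = q ^ 4" by (simp_all flip: power_mult)
  \<comment> \<open>The boundary moment is taken at nome q^2, so its arguments P^2 and P^4 become
    q^4 and q^8.\<close>
  have 4: "fact (2 * j + 1) * C $ (2 * j + 1) + 2 ^ (2 * j + 3) *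
    (2 ^ (2 * j + 2) * eval_fps (sigma_fps (2 * j + 1)) (q ^ 8) - eval_fps (sigma_fps (2 * j + 1)) (q ^ 4))
   = even_deriv 0 (b\<^sup>2 + a * (2 * b - a)) (b\<^sup>2 * (a * (2 * b - a))) j 2"
   using sigma_boundary_moment[OF q2 j C] unfolding t qq .
  \<comment> \<open>At 2/v the two arguments are -2 and (-2)^2 times those that the boundary moment
    yields after division by powers of a b; homogeneity turns this into the factor
    (-2)^(j+1).\<close>
  have 5: "even_deriv 0 (4 / (2 / v) - 4 - 2 / v) (4 * (2 / v) - 4) j 2
    = (-2) ^ (2 div 2 + j) * even_deriv 0 (1 / v + 2 - v) ((2 - v) / v) j 2"
   by (rule even_deriv_scaled) (use ab in \<open>simp_all add: v field_simps power2_eq_square\<close>)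
  have 6: "even_deriv 0 (b\<^sup>2 + a * (2 * b - a)) (b\<^sup>2 * (a * (2 * b - a))) j 2
    = (a * b) ^ (2 div 2 + j) * even_deriv 0 (1 / v + 2 - v) ((2 - v) / v) j 2"
   by (rule even_deriv_scaled) (use ab in \<open>simp_all add: v field_simps power2_eq_square\<close>)
  show ?thesis unfolding 4 5 6 zp by (simp add: mult_ac)
 qed
qed

lemma i_mult_cancel: "\<i> * x = \<i> * y ==> x = y"
 by simp

text \<open>With theta(q) = w t and theta(q^4) = t one gets theta(-q) = (2 - w) t, theta(q^2)^2 = w
  t^2 M and theta(-q^2)^2 = w (2 - w) t^2, where M = w - 2 + 2/w. M is invariant under w to 2/w, and
  r = 2 - w is sent to r' = 2 - 2/w. The six identities thus form three pairs whose right-hand sides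
  correspond under this substitution, up to the factor (-1/4)^j in the second pair.\<close>

lemma level_16_moments:
 fixes w t :: complex
 assumes q: "0 < norm q" "norm q < 1" and wt: "w ~= 0" "t ~= 0" "theta q = w * t" "theta (q ^ 4) = t" and j: "j > 0"
 defines "z \<equiv> w * t\<^sup>2"
 shows "2 ^ (2 * j + 3) * (eval_fps (sigma_fps (2 * j + 1)) q - eval_fps (sigma_fps (2 * j + 1)) (q\<^sup>2))
   = z ^ (2 * j + 2) * even_deriv 0 ((2 - w) ^ 4 / w\<^sup>2 - 2 * w\<^sup>2) (w ^ 4 - (2 - w) ^ 4) j 2"
  and "(1 + fps_exp 2) * C = 1 - fps_exp 2 ==>
   (-4) ^ (j + 1) * (fact (2 * j + 1) * C $ (2 * j + 1) + 2 ^ (2 * j + 3) *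
    (2 ^ (2 * j + 2) * eval_fps (sigma_fps (2 * j + 1)) (q ^ 16) - eval_fps (sigma_fps (2 * j + 1)) (q ^ 8)))
   = z ^ (2 * j + 2) * even_deriv 0 ((2 - 2 / w) ^ 4 / (2 / w)\<^sup>2 - 2 * (2 / w)\<^sup>2) ((2 / w) ^ 4 - (2 - 2 / w) ^ 4) j 2"
  and "4 ^ (j + 1) * eval_fps (chi_zero_fps chi4 (2 * j)) q
   = z ^ (2 * j + 1) * (w * even_deriv (w\<^sup>2) (w\<^sup>2 + (2 - w) ^ 4 / w\<^sup>2) ((2 - w) ^ 4) j 1)"
  and "(1 + fps_exp 2) * S = 2 * fps_exp 1 ==>
   2 * (fact (2 * j) * S $ (2 * j) + 4 * eval_fps (chi_inf_fps chi4 (2 * j)) (q ^ 4))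
   = z ^ (2 * j + 1) * ((-1/4) ^ j * ((2 / w) * even_deriv ((2 / w)\<^sup>2) ((2 / w)\<^sup>2 + (2 - 2 / w) ^ 4 / (2 / w)\<^sup>2) ((2 - 2 / w) ^ 4) j 1))"
  and "4 ^ (j + 1) * (2 * 4 ^ j * eval_fps (chi_zero_fps chi4 (2 * j)) (q ^ 4) - eval_fps (chi_zero_fps chi4 (2 * j)) (q\<^sup>2))
   = z ^ (2 * j + 1) * ((2 - w) * even_deriv ((2 - w)\<^sup>2) ((w - 2 + 2 / w)\<^sup>2 + (2 - w)\<^sup>2) (((w - 2 + 2 / w) * (2 - w))\<^sup>2) j 1)"
  and "4 * (-1) ^ j * (eval_fps (chi_inf_fps chi4 (2 * j)) q - eval_fps (chi_inf_fps chi4 (2 * j)) (q\<^sup>2))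
   = z ^ (2 * j + 1) * ((2 - 2 / w) * even_deriv ((2 - 2 / w)\<^sup>2) ((2 / w - 2 + 2 / (2 / w))\<^sup>2 + (2 - 2 / w)\<^sup>2)
     (((2 / w - 2 + 2 / (2 / w)) * (2 - 2 / w))\<^sup>2) j 1)"
proof -
 have q2: "0 < norm (q\<^sup>2)" "norm (q\<^sup>2) < 1" and q4: "0 < norm (q ^ 4)" "norm (q ^ 4) < 1"
  using norm_power_less_1[OF q(2)] q by auto
 define r M r' where "r = 2 - w" and "M = w - 2 + 2 / w" and "r' = 2 - 2 / w"
 have M': "2 / w - 2 + 2 / (2 / w) = M" using wt by (simp add: M_def)
 \<comment> \<open>The equation for sn brings in M^2 - r^2, which this relation replaces by the
   square of r'.\<close>
 have Mr: "M\<^sup>2 = r\<^sup>2 + r'\<^sup>2" using wt by (simp add: M_def r_def r'_def field_simps power2_eq_square)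
 \<comment> \<open>In y = w - 1 the ratio of theta(-q^4)^4 to theta(q^4)^4 is simply 1 - y^4, which
   suits the two boundary moments at nome q^4.\<close>
 define y where "y = w - 1"
 have r'y: "r' = 2 * y / w" using wt by (simp add: r'_def y_def field_simps)
 have My: "w\<^sup>2 * r * M = 1 - y ^ 4"
 proof -
  have "w * M = 1 + y\<^sup>2" using wt by (simp add: M_def y_def field_simps power2_eq_square)
  moreover have "w * r = 1 - y\<^sup>2" by (simp add: r_def y_def field_simps power2_eq_square)
  moreover have "w\<^sup>2 * r * M = (w * M) * (w * r)" by (simp add: power2_eq_square)
  moreover have "(1 + y\<^sup>2) * (1 - y\<^sup>2) = 1 - y ^ 4" by (simp add: eval_nat_numeral algebra_simps)
  ultimately show ?thesis by simp
 qed
 have zz: "z\<^sup>2 = w\<^sup>2 * t ^ 4" by (simp add: z_def power_mult_distrib flip: power_mult)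
 have zp: "z ^ (2 * j + 1) = z * (z\<^sup>2) ^ j" "z ^ (2 * j + 2) = (z\<^sup>2) ^ (1 + j)"
  by (simp_all flip: power_mult power_add)
 have m: "theta (- q) = r * t" using theta_quadruple[OF q(2)] by (simp add: wt r_def algebra_simps)
 have s2: "(theta (q\<^sup>2))\<^sup>2 = w * t\<^sup>2 * M"
 proof -
  have "2 * (theta (q\<^sup>2))\<^sup>2 = (w * t)\<^sup>2 + (r * t)\<^sup>2" using theta_square_sum[OF q(2)] by (simp add: wt m)
  also have "... = 2 * (w * t\<^sup>2 * M)" using wt by (simp add: r_def M_def field_simps power2_eq_square)
  finally show ?thesis unfolding mult_cancel_left by simp
 qed
 have m2: "(theta (- q\<^sup>2))\<^sup>2 = w * r * t\<^sup>2"
 proof -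
  have e: "(theta (- q\<^sup>2))\<^sup>2 = w * t * (r * t)" using theta_reflect_product[OF q(2)] by (simp add: wt m)
  show ?thesis unfolding e by (simp add: power2_eq_square)
 qed
 have m4: "theta (- (q ^ 4)) ^ 4 = w\<^sup>2 * r * M * t ^ 4"
 proof -
  have "(q\<^sup>2)\<^sup>2 = q ^ 4" by (simp flip: power_mult)
  hence "theta (q\<^sup>2) * theta (- q\<^sup>2) = (theta (- (q ^ 4)))\<^sup>2" using theta_reflect_product[OF q2(2)] by simp
  hence "theta (- (q ^ 4)) ^ 4 = (theta (q\<^sup>2))\<^sup>2 * (theta (- q\<^sup>2))\<^sup>2" unfolding theta_power_4[of "- (q ^ 4)"] by (simp flip: power_mult_distrib)
  thus ?thesis unfolding s2 m2 by (simp add: eval_nat_numeral)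
 qed
 have t4: "theta q ^ 4 = w ^ 4 * t ^ 4" "theta (- q) ^ 4 = r ^ 4 * t ^ 4" "theta (q\<^sup>2) ^ 4 = w\<^sup>2 * t ^ 4 * M\<^sup>2"
  "theta (- q\<^sup>2) ^ 4 = w\<^sup>2 * r\<^sup>2 * t ^ 4" "theta (q ^ 4) ^ 4 = t ^ 4"
  unfolding theta_power_4[of "q\<^sup>2"] theta_power_4[of "- q\<^sup>2"] s2 m2 wt m
  by (simp_all add: power_mult_distrib flip: power_mult)
 have w4: "w ^ 4 = w\<^sup>2 * w\<^sup>2" "t ^ 8 = t ^ 4 * t ^ 4" by (simp_all flip: power_add)
 have nz: "w\<^sup>2 ~= 0" "t ^ 4 ~= 0" using wt by auto
 have w2: "w * (w * x) = w\<^sup>2 * x" for x by (simp add: power2_eq_square)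
 have 1: "2 ^ (2 * j + 3) * (eval_fps (sigma_fps (2 * j + 1)) q - eval_fps (sigma_fps (2 * j + 1)) (q\<^sup>2))
   = even_deriv 0 (r ^ 4 * t ^ 4 - 2 * (w ^ 4 * t ^ 4)) (w ^ 4 * t ^ 4 * (w ^ 4 * t ^ 4 - r ^ 4 * t ^ 4)) j 2"
  using sigma_moment[OF q j] unfolding t4 .
 have "even_deriv 0 (r ^ 4 * t ^ 4 - 2 * (w ^ 4 * t ^ 4)) (w ^ 4 * t ^ 4 * (w ^ 4 * t ^ 4 - r ^ 4 * t ^ 4)) j 2
   = (z\<^sup>2) ^ (2 div 2 + j) * even_deriv 0 (r ^ 4 / w\<^sup>2 - 2 * w\<^sup>2) (w ^ 4 - r ^ 4) j 2"
 proof (rule even_deriv_scaled)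
  show "r ^ 4 * t ^ 4 - 2 * (w ^ 4 * t ^ 4) = z\<^sup>2 * (r ^ 4 / w\<^sup>2 - 2 * w\<^sup>2)"
   unfolding zz w4 using nz by (simp add: right_diff_distrib)
  show "w ^ 4 * t ^ 4 * (w ^ 4 * t ^ 4 - r ^ 4 * t ^ 4) = (z\<^sup>2)\<^sup>2 * (w ^ 4 - r ^ 4)"
   unfolding zz w4 power2_eq_square[of "w\<^sup>2 * t ^ 4"] by (simp add: algebra_simps)
 qed simp
 thus "2 ^ (2 * j + 3) * (eval_fps (sigma_fps (2 * j + 1)) q - eval_fps (sigma_fps (2 * j + 1)) (q\<^sup>2))
   = z ^ (2 * j + 2) * even_deriv 0 ((2 - w) ^ 4 / w\<^sup>2 - 2 * w\<^sup>2) (w ^ 4 - (2 - w) ^ 4) j 2"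
  unfolding 1 zp by (simp add: r_def)
 show "(-4) ^ (j + 1) * (fact (2 * j + 1) * C $ (2 * j + 1) + 2 ^ (2 * j + 3) *
    (2 ^ (2 * j + 2) * eval_fps (sigma_fps (2 * j + 1)) (q ^ 16) - eval_fps (sigma_fps (2 * j + 1)) (q ^ 8)))
   = z ^ (2 * j + 2) * even_deriv 0 ((2 - 2 / w) ^ 4 / (2 / w)\<^sup>2 - 2 * (2 / w)\<^sup>2) ((2 / w) ^ 4 - (2 - 2 / w) ^ 4) j 2"
  if C: "(1 + fps_exp 2) * C = 1 - fps_exp 2"
 proof -
  have qq: "(q ^ 4) ^ 4 = q ^ 16" "(q ^ 4)\<^sup>2 = q ^ 8" by (simp_all flip: power_mult)
  have 4: "fact (2 * j + 1) * C $ (2 * j + 1) + 2 ^ (2 * j + 3) *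
    (2 ^ (2 * j + 2) * eval_fps (sigma_fps (2 * j + 1)) (q ^ 16) - eval_fps (sigma_fps (2 * j + 1)) (q ^ 8))
   = even_deriv 0 (t ^ 4 + (1 - y ^ 4) * t ^ 4) (t ^ 4 * ((1 - y ^ 4) * t ^ 4)) j 2"
   using sigma_boundary_moment[OF q4 j C] unfolding t4 m4 My qq .
  have "(2 / w) ^ 4 = 16 / (w\<^sup>2 * w\<^sup>2)" "r' ^ 4 = 16 * y ^ 4 / (w\<^sup>2 * w\<^sup>2)" "(2 / w)\<^sup>2 = 4 / w\<^sup>2"
   unfolding r'y power_divide power_mult_distrib w4 by simp_all
  note e = this
  have 5: "even_deriv 0 (r' ^ 4 / (2 / w)\<^sup>2 - 2 * (2 / w)\<^sup>2) ((2 / w) ^ 4 - r' ^ 4) j 2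
    = (-4) ^ (2 div 2 + j) * even_deriv 0 ((2 - y ^ 4) / w\<^sup>2) ((1 - y ^ 4) / (w\<^sup>2 * w\<^sup>2)) j 2"
  proof (rule even_deriv_scaled)
   show "r' ^ 4 / (2 / w)\<^sup>2 - 2 * (2 / w)\<^sup>2 = -4 * ((2 - y ^ 4) / w\<^sup>2)"
    unfolding e using nz by (simp add: field_simps)
   show "(2 / w) ^ 4 - r' ^ 4 = (-4)\<^sup>2 * ((1 - y ^ 4) / (w\<^sup>2 * w\<^sup>2))"
    unfolding e by (simp add: diff_divide_distrib right_diff_distrib)
  qed simp
  have 6: "even_deriv 0 (t ^ 4 + (1 - y ^ 4) * t ^ 4) (t ^ 4 * ((1 - y ^ 4) * t ^ 4)) j 2
    = (z\<^sup>2) ^ (2 div 2 + j) * even_deriv 0 ((2 - y ^ 4) / w\<^sup>2) ((1 - y ^ 4) / (w\<^sup>2 * w\<^sup>2)) j 2"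
  proof (rule even_deriv_scaled)
   show "t ^ 4 + (1 - y ^ 4) * t ^ 4 = z\<^sup>2 * ((2 - y ^ 4) / w\<^sup>2)"
   proof -
    have e': "w\<^sup>2 * t ^ 4 * (c / w\<^sup>2) = t ^ 4 * c" for c using nz by simp
    show ?thesis unfolding zz e' by (simp add: algebra_simps)
   qed
   show "t ^ 4 * ((1 - y ^ 4) * t ^ 4) = (z\<^sup>2)\<^sup>2 * ((1 - y ^ 4) / (w\<^sup>2 * w\<^sup>2))"
   proof -
    have g: "T * (c * T) = W * T * (W * T) * (c / (W * W))" if "W ~= 0" for W T c :: complex
    proof -
     have "W * W * (c / (W * W)) = c" using that by simp
     hence "T * T * (W * W * (c / (W * W))) = T * T * c" by (simp only:)
     thus ?thesis by (simp only: mult_ac)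
    qed
    show ?thesis unfolding zz power2_eq_square[of "w\<^sup>2 * t ^ 4"] by (rule g[OF nz(1)])
   qed
  qed simp
  show ?thesis unfolding 4 6 r'_def[symmetric] 5 zp by (simp only: mult_ac div_self) simp
 qed
 have 3: "4 ^ (j + 1) * eval_fps (chi_zero_fps chi4 (2 * j)) q
   = (w * t)\<^sup>2 * even_deriv (((w * t)\<^sup>2)\<^sup>2) (w ^ 4 * t ^ 4 + r ^ 4 * t ^ 4) (w ^ 4 * t ^ 4 * (r ^ 4 * t ^ 4)) j 1"
  using zero4_moment[OF q j] unfolding t4 unfolding wt .
 have T3: "even_deriv (((w * t)\<^sup>2)\<^sup>2) (w ^ 4 * t ^ 4 + r ^ 4 * t ^ 4) (w ^ 4 * t ^ 4 * (r ^ 4 * t ^ 4)) j 1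
   = (z\<^sup>2) ^ (1 div 2 + j) * even_deriv (w\<^sup>2) (w\<^sup>2 + r ^ 4 / w\<^sup>2) (r ^ 4) j 1"
 proof (rule even_deriv_scaled)
  have "((w * t)\<^sup>2)\<^sup>2 = w ^ 4 * t ^ 4" by (simp add: power_mult_distrib flip: power_mult)
  also have "... = z\<^sup>2 * w\<^sup>2" unfolding zz w4(1) by (simp only: mult_ac)
  finally show "((w * t)\<^sup>2)\<^sup>2 = z\<^sup>2 * w\<^sup>2" .
  show "w ^ 4 * t ^ 4 + r ^ 4 * t ^ 4 = z\<^sup>2 * (w\<^sup>2 + r ^ 4 / w\<^sup>2)"
   unfolding zz w4 using nz by (simp add: distrib_left)
  show "w ^ 4 * t ^ 4 * (r ^ 4 * t ^ 4) = (z\<^sup>2)\<^sup>2 * r ^ 4"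
   unfolding zz w4 power2_eq_square[of "w\<^sup>2 * t ^ 4"] by (simp only: mult_ac)
 qed
 have wz: "(w * t)\<^sup>2 = z * w" by (simp add: z_def power2_eq_square)
 show "4 ^ (j + 1) * eval_fps (chi_zero_fps chi4 (2 * j)) q
   = z ^ (2 * j + 1) * (w * even_deriv (w\<^sup>2) (w\<^sup>2 + (2 - w) ^ 4 / w\<^sup>2) ((2 - w) ^ 4) j 1)"
  unfolding 3 T3 unfolding zp r_def[symmetric] wz by (simp add: mult_ac)
 have 7: "4 ^ (j + 1) * (2 * 4 ^ j * eval_fps (chi_zero_fps chi4 (2 * j)) (q ^ 4) - eval_fps (chi_zero_fps chi4 (2 * j)) (q\<^sup>2))
   = (w * r * t\<^sup>2) * even_deriv ((w * r * t\<^sup>2)\<^sup>2) (w\<^sup>2 * t ^ 4 * M\<^sup>2 + w\<^sup>2 * r\<^sup>2 * t ^ 4) (w\<^sup>2 * t ^ 4 * M\<^sup>2 * (w\<^sup>2 * r\<^sup>2 * t ^ 4)) j 1"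
  using zero4_alternating_moment[OF q j] unfolding t4 m2 .
 have "even_deriv ((w * r * t\<^sup>2)\<^sup>2) (w\<^sup>2 * t ^ 4 * M\<^sup>2 + w\<^sup>2 * r\<^sup>2 * t ^ 4) (w\<^sup>2 * t ^ 4 * M\<^sup>2 * (w\<^sup>2 * r\<^sup>2 * t ^ 4)) j 1
   = (z\<^sup>2) ^ (1 div 2 + j) * even_deriv (r\<^sup>2) (M\<^sup>2 + r\<^sup>2) ((M * r)\<^sup>2) j 1"
 proof (rule even_deriv_scaled)
  show "(w * r * t\<^sup>2)\<^sup>2 = z\<^sup>2 * r\<^sup>2" unfolding zz by (simp add: power_mult_distrib mult_ac flip: power_mult)
  show "w\<^sup>2 * t ^ 4 * M\<^sup>2 + w\<^sup>2 * r\<^sup>2 * t ^ 4 = z\<^sup>2 * (M\<^sup>2 + r\<^sup>2)" unfolding zz by (simp add: algebra_simps)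
  show "w\<^sup>2 * t ^ 4 * M\<^sup>2 * (w\<^sup>2 * r\<^sup>2 * t ^ 4) = (z\<^sup>2)\<^sup>2 * (M * r)\<^sup>2"
   unfolding zz power2_eq_square[of "w\<^sup>2 * t ^ 4"] power_mult_distrib[of M r] by (simp only: mult_ac)
 qed
 thus "4 ^ (j + 1) * (2 * 4 ^ j * eval_fps (chi_zero_fps chi4 (2 * j)) (q ^ 4) - eval_fps (chi_zero_fps chi4 (2 * j)) (q\<^sup>2))
   = z ^ (2 * j + 1) * ((2 - w) * even_deriv ((2 - w)\<^sup>2) ((w - 2 + 2 / w)\<^sup>2 + (2 - w)\<^sup>2) (((w - 2 + 2 / w) * (2 - w))\<^sup>2) j 1)"
  unfolding 7 zp r_def[symmetric] M_def[symmetric] by (simp add: z_def mult_ac)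
 have wM: "(w * t)\<^sup>2 - w * t\<^sup>2 * M = z * r'"
  using wt by (simp add: z_def M_def r'_def field_simps power2_eq_square)
 have 8: "4 * \<i> * (eval_fps (chi_inf_fps chi4 (2 * j)) q - eval_fps (chi_inf_fps chi4 (2 * j)) (q\<^sup>2))
   = \<i> * (z * r') * even_deriv ((\<i> * (z * r'))\<^sup>2) (w\<^sup>2 * r\<^sup>2 * t ^ 4 - 2 * (w\<^sup>2 * t ^ 4 * M\<^sup>2))
     (w\<^sup>2 * t ^ 4 * M\<^sup>2 * (w\<^sup>2 * t ^ 4 * M\<^sup>2 - w\<^sup>2 * r\<^sup>2 * t ^ 4)) j 1"
  using inf4_moment[OF q, of j] unfolding t4 s2 wt(3) wM .
 have 9: "even_deriv ((\<i> * (z * r'))\<^sup>2) (w\<^sup>2 * r\<^sup>2 * t ^ 4 - 2 * (w\<^sup>2 * t ^ 4 * M\<^sup>2))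
     (w\<^sup>2 * t ^ 4 * M\<^sup>2 * (w\<^sup>2 * t ^ 4 * M\<^sup>2 - w\<^sup>2 * r\<^sup>2 * t ^ 4)) j 1
   = (- (z\<^sup>2)) ^ (1 div 2 + j) * even_deriv (r'\<^sup>2) (M\<^sup>2 + r'\<^sup>2) ((M * r')\<^sup>2) j 1"
 proof (rule even_deriv_scaled)
  show "(\<i> * (z * r'))\<^sup>2 = - (z\<^sup>2) * r'\<^sup>2" by (simp add: power_mult_distrib)
  have rM: "r'\<^sup>2 = M\<^sup>2 - r\<^sup>2" using Mr by simp
  show "w\<^sup>2 * r\<^sup>2 * t ^ 4 - 2 * (w\<^sup>2 * t ^ 4 * M\<^sup>2) = - (z\<^sup>2) * (M\<^sup>2 + r'\<^sup>2)" unfolding zz rM by (simp add: algebra_simps)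
  show "w\<^sup>2 * t ^ 4 * M\<^sup>2 * (w\<^sup>2 * t ^ 4 * M\<^sup>2 - w\<^sup>2 * r\<^sup>2 * t ^ 4) = (- (z\<^sup>2))\<^sup>2 * (M * r')\<^sup>2"
   unfolding zz power2_minus power2_eq_square[of "w\<^sup>2 * t ^ 4"] power_mult_distrib[of M r'] rM by (simp add: algebra_simps)
 qed
 have ii: "\<i> * (4 * (-1) ^ j * (eval_fps (chi_inf_fps chi4 (2 * j)) q - eval_fps (chi_inf_fps chi4 (2 * j)) (q\<^sup>2)))
   = \<i> * (z ^ (2 * j + 1) * (r' * even_deriv (r'\<^sup>2) (M\<^sup>2 + r'\<^sup>2) ((M * r')\<^sup>2) j 1))"
 proof -
  have s: "(- (z\<^sup>2)) ^ j = (-1) ^ j * (z\<^sup>2) ^ j" by (simp flip: power_mult_distrib)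
  have o: "(-1) ^ j * ((-1) ^ j * x) = (x :: complex)" for x by (simp flip: mult.assoc power_mult_distrib)
  have "\<i> * (4 * (-1) ^ j * (eval_fps (chi_inf_fps chi4 (2 * j)) q - eval_fps (chi_inf_fps chi4 (2 * j)) (q\<^sup>2)))
    = (-1) ^ j * (4 * \<i> * (eval_fps (chi_inf_fps chi4 (2 * j)) q - eval_fps (chi_inf_fps chi4 (2 * j)) (q\<^sup>2)))"
   by (simp only: mult_ac)
  also have "... = (-1) ^ j * ((-1) ^ j * (\<i> * (z ^ (2 * j + 1) * (r' * even_deriv (r'\<^sup>2) (M\<^sup>2 + r'\<^sup>2) ((M * r')\<^sup>2) j 1))))"
   unfolding 8 9 zp by (simp add: s mult_ac)
  finally show ?thesis unfolding o .
 qed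
 thus "4 * (-1) ^ j * (eval_fps (chi_inf_fps chi4 (2 * j)) q - eval_fps (chi_inf_fps chi4 (2 * j)) (q\<^sup>2))
   = z ^ (2 * j + 1) * ((2 - 2 / w) * even_deriv ((2 - 2 / w)\<^sup>2) ((2 / w - 2 + 2 / (2 / w))\<^sup>2 + (2 - 2 / w)\<^sup>2)
     (((2 / w - 2 + 2 / (2 / w)) * (2 - 2 / w))\<^sup>2) j 1)"
  unfolding M' r'_def[symmetric] by (rule i_mult_cancel)
 show "2 * (fact (2 * j) * S $ (2 * j) + 4 * eval_fps (chi_inf_fps chi4 (2 * j)) (q ^ 4))
   = z ^ (2 * j + 1) * ((-1/4) ^ j * ((2 / w) * even_deriv ((2 / w)\<^sup>2) ((2 / w)\<^sup>2 + (2 - 2 / w) ^ 4 / (2 / w)\<^sup>2) ((2 - 2 / w) ^ 4) j 1))"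
  if S: "(1 + fps_exp 2) * S = 2 * fps_exp 1"
 proof -
  have C: "(1 + fps_exp 2) * (fps_const \<i> * S) = fps_const (2 * \<i>) * fps_exp 1"
  proof -
   have "(1 + fps_exp 2) * (fps_const \<i> * S) = fps_const \<i> * ((1 + fps_exp 2) * S)" by (simp only: mult_ac)
   also have "... = fps_const \<i> * (fps_const 2 * fps_exp 1)" unfolding S by (simp only: numeral_fps_const)
   finally show ?thesis by (simp add: mult_ac flip: fps_const_mult)
  qed
  have e: "(2 / w)\<^sup>2 = 4 / w\<^sup>2" "r' ^ 4 = 16 * y ^ 4 / (w\<^sup>2 * w\<^sup>2)"
   unfolding r'y power_divide power_mult_distrib w4 by simp_all
  have 10: "fact (2 * j) * (fps_const \<i> * S) $ (2 * j) + 4 * \<i> * eval_fps (chi_inf_fps chi4 (2 * j)) (q ^ 4)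
    = \<i> * t\<^sup>2 * even_deriv ((\<i> * t\<^sup>2)\<^sup>2) ((1 - y ^ 4) * t ^ 4 - 2 * t ^ 4) (t ^ 4 * (t ^ 4 - (1 - y ^ 4) * t ^ 4)) j 1"
   using inf4_boundary_moment[OF q4 C, of j] unfolding t4 m4 My unfolding wt .
  have 11: "even_deriv ((\<i> * t\<^sup>2)\<^sup>2) ((1 - y ^ 4) * t ^ 4 - 2 * t ^ 4) (t ^ 4 * (t ^ 4 - (1 - y ^ 4) * t ^ 4)) j 1
    = ((-1/4) * z\<^sup>2) ^ (1 div 2 + j) * even_deriv ((2 / w)\<^sup>2) ((2 / w)\<^sup>2 + r' ^ 4 / (2 / w)\<^sup>2) (r' ^ 4) j 1"
  proof (rule even_deriv_scaled)
   show "(\<i> * t\<^sup>2)\<^sup>2 = (-1/4) * z\<^sup>2 * (2 / w)\<^sup>2" unfolding zz e using nz by (simp add: power_mult_distrib flip: power_mult)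
   show "(1 - y ^ 4) * t ^ 4 - 2 * t ^ 4 = (-1/4) * z\<^sup>2 * ((2 / w)\<^sup>2 + r' ^ 4 / (2 / w)\<^sup>2)"
   proof -
    have g: "(1 - Y) * T - 2 * T = (-1/4) * (W * T) * (4 / W + 16 * Y / (W * W) / (4 / W))" if W: "W ~= 0" for W T Y :: complex
    proof -
     have 1: "16 * Y / (W * W) / (4 / W) = 4 * Y / W" using W by simp
     have 2: "4 / W + 4 * Y / W = 4 * (1 + Y) / W" by (simp add: add_divide_distrib distrib_left)
     have "(-1/4) * (W * T) * (4 * (1 + Y) / W) = - (T * (1 + Y))" using W by simp
     thus ?thesis unfolding 1 2 by (simp add: algebra_simps)
    qed
    show ?thesis unfolding zz e by (rule g[OF nz(1)])
   qed
   show "t ^ 4 * (t ^ 4 - (1 - y ^ 4) * t ^ 4) = ((-1/4) * z\<^sup>2)\<^sup>2 * r' ^ 4"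
    unfolding zz e power_mult_distrib power2_eq_square[of "w\<^sup>2"] power2_eq_square[of "t ^ 4"] using nz by (simp add: power_divide algebra_simps)
  qed
  define D where "D = even_deriv ((2 / w)\<^sup>2) ((2 / w)\<^sup>2 + r' ^ 4 / (2 / w)\<^sup>2) (r' ^ 4) j 1"
  have j0: "1 div 2 + j = j" by simp
  have "\<i> * (fact (2 * j) * S $ (2 * j) + 4 * eval_fps (chi_inf_fps chi4 (2 * j)) (q ^ 4))
    = fact (2 * j) * (fps_const \<i> * S) $ (2 * j) + 4 * \<i> * eval_fps (chi_inf_fps chi4 (2 * j)) (q ^ 4)"
   by (simp add: algebra_simps)
  also have "... = \<i> * t\<^sup>2 * (((-1/4) * z\<^sup>2) ^ j * D)" unfolding 10 11 D_def j0 ..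
  also have "... = \<i> * (t\<^sup>2 * (((-1/4) ^ j * (z\<^sup>2) ^ j) * D))" unfolding power_mult_distrib by (simp only: mult.assoc)
  finally have "\<i> * (fact (2 * j) * S $ (2 * j) + 4 * eval_fps (chi_inf_fps chi4 (2 * j)) (q ^ 4))
    = \<i> * (t\<^sup>2 * (((-1/4) ^ j * (z\<^sup>2) ^ j) * even_deriv ((2 / w)\<^sup>2) ((2 / w)\<^sup>2 + r' ^ 4 / (2 / w)\<^sup>2) (r' ^ 4) j 1))"
   unfolding D_def .
  hence 12: "fact (2 * j) * S $ (2 * j) + 4 * eval_fps (chi_inf_fps chi4 (2 * j)) (q ^ 4)
    = t\<^sup>2 * (((-1/4) ^ j * (z\<^sup>2) ^ j) * even_deriv ((2 / w)\<^sup>2) ((2 / w)\<^sup>2 + r' ^ 4 / (2 / w)\<^sup>2) (r' ^ 4) j 1)"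
   by (rule i_mult_cancel)
  have tz: "2 * t\<^sup>2 = z * (2 / w)" using wt by (simp add: z_def)
  show ?thesis unfolding 12 zp r'_def[symmetric] mult.assoc[symmetric] tz by (simp only: mult_ac)
 qed
qed

section \<open>Bernoulli constants and auxiliary values\<close>

lemma one_plus_exp_quotient: "\<exists>Y. (1 + fps_exp c) * Y = (N :: complex fps)"
proof
 have u: "(1 + fps_exp c :: complex fps) $ 0 ~= 0" by simp
 show "(1 + fps_exp c) * (inverse (1 + fps_exp c) * N) = N"
  using inverse_mult_eq_1'[OF u] by (simp add: mult.assoc[symmetric])
qed

text \<open>The character changes sign under j to j + 4. Therefore its sum over a period, multiplied
  by 1 + exp(4t), telescopes to -(exp(8t) - 1)(exp t + exp(3t)).\<close>

lemma bernoulli8_eq: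
 assumes R: "(1 + fps_exp 4) * R = fps_exp 1 + fps_exp 3" and k: "k > 0"
 shows "of_rat (bernoulli8 k) = - (fact k * R $ (k - 1) :: complex)"
proof (rule gen_bernoulli_quotient[OF _ k one_plus_exp_nonzero _ R])
 define e where "e = (fps_exp 1 :: complex fps)"
 have s: "{1..8} = {1, 2, 3, 4, 5, 6, 7, 8 :: nat}"
 proof
  have "x = 1 \<or> x = 2 \<or> x = 3 \<or> x = 4 \<or> x = 5 \<or> x = 6 \<or> x = 7 \<or> x = 8" if "1 <= x" "x <= 8" for x :: nat using that by presburger
  thus "{1..8} \<subseteq> {1, 2, 3, 4, 5, 6, 7, 8 :: nat}" by auto
 qed auto
 have "(\<Sum>j=1..8. fps_const (of_int (kronecker (-2) (int j))) * fps_exp (of_nat j))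
   = (\<Sum>j=1..8. fps_const (chi8 j) * fps_exp (of_nat j))"
  by (rule sum.cong) (simp_all add: kronecker_eq_chi)
 also have "... = e + e ^ 3 - e ^ 5 - e ^ 7"
  unfolding s by (simp add: chi8_def e_def fps_exp_numeral flip: fps_const_neg)
 finally have T: "(\<Sum>j=1..8. fps_const (of_int (kronecker (-2) (int j))) * fps_exp (of_nat j)) = e + e ^ 3 - e ^ 5 - e ^ 7" .
 have x: "fps_exp 4 = e ^ 4" "fps_exp 3 = e ^ 3" "fps_exp (of_nat 8) = e ^ 8" by (simp_all add: e_def fps_exp_numeral)
 have "(e + e ^ 3 - e ^ 5 - e ^ 7) * (1 + e ^ 4) = - (e ^ 8 - 1) * (e + e ^ 3)" by (simp add: eval_nat_numeral algebra_simps)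
 thus "(\<Sum>j=1..8. fps_const (of_int (kronecker (-2) (int j))) * fps_exp (of_nat j)) * (1 + fps_exp 4 :: complex fps)
   = - (fps_exp (of_nat 8) - 1) * (fps_exp 1 + fps_exp 3)"
  unfolding T x e_def[symmetric] .
qed simp

text \<open>The same telescoping, with a change of sign under j to j + 2. The factor 1/2 appears
  because S is normalised as 1 / cosh t.\<close>

lemma bernoulli4_eq:
 assumes S: "(1 + fps_exp 2) * S = 2 * fps_exp 1" and k: "k > 0"
 shows "of_rat (bernoulli4 k) = - (fact k * S $ (k - 1) / 2 :: complex)"
proof -
 define e where "e = (fps_exp 1 :: complex fps)"
 have S': "(1 + fps_exp 2) * (fps_const (1 / 2) * S) = e"
 proof -
  have "(1 + fps_exp 2) * (fps_const (1 / 2) * S) = fps_const (1 / 2) * ((1 + fps_exp 2) * S)" by (simp only: mult_ac)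
  also have "... = (fps_const (1 / 2) * fps_const 2) * e" unfolding S numeral_fps_const e_def by (simp only: mult.assoc)
  finally show ?thesis by simp
 qed
 have "of_rat (bernoulli4 k) = - (fact k * (fps_const (1 / 2) * S) $ (k - 1))"
 proof (rule gen_bernoulli_quotient[OF _ k one_plus_exp_nonzero _ S'])
  have s: "{1..4} = {1, 2, 3, 4 :: nat}"
  proof
   have "x = 1 \<or> x = 2 \<or> x = 3 \<or> x = 4" if "1 <= x" "x <= 4" for x :: nat using that by presburger
   thus "{1..4} \<subseteq> {1, 2, 3, 4 :: nat}" by auto
  qed auto
  have "(\<Sum>j=1..4. fps_const (of_int (kronecker (-4) (int j))) * fps_exp (of_nat j))
    = (\<Sum>j=1..4. fps_const (chi4 j) * fps_exp (of_nat j))"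
   by (rule sum.cong) (simp_all add: kronecker_eq_chi)
  also have "... = e - e ^ 3"
   unfolding s by (simp add: chi4_def e_def fps_exp_numeral flip: fps_const_neg)
  finally have T: "(\<Sum>j=1..4. fps_const (of_int (kronecker (-4) (int j))) * fps_exp (of_nat j)) = e - e ^ 3" .
  have "(e - e ^ 3) * (1 + e ^ 2) = - (e ^ 4 - 1) * e" by (simp add: eval_nat_numeral algebra_simps)
  thus "(\<Sum>j=1..4. fps_const (of_int (kronecker (-4) (int j))) * fps_exp (of_nat j)) * (1 + fps_exp 2)
    = - (fps_exp (of_nat 4) - 1) * e"
   unfolding T by (simp add: e_def fps_exp_numeral)
 qed simp
 thus ?thesis by simp
qed

text \<open>Rewrites the constant term of the boundary moment of dn^2 through the Bernoulli number;
  positivity of the tangent coefficients makes it non-zero, so the division in the theorem is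
  genuine.\<close>

lemma bernoulli_even_constant:
 assumes C: "(1 + fps_exp 2) * C = 1 - fps_exp 2" and k: "k = 2 * j + 2"
 shows "of_nat k * (fact (2 * j + 1) * C $ (2 * j + 1)) = - (2 ^ k * (2 ^ k - 1) * of_rat (bernoulli k) :: complex)"
  and "bernoulli k ~= 0"
proof -
 show 1: "of_nat k * (fact (2 * j + 1) * C $ (2 * j + 1)) = - (2 ^ k * (2 ^ k - 1) * of_rat (bernoulli k) :: complex)"
  using bernoulli_tanh[OF C, of k] by (simp add: k mult.assoc)
 obtain S :: "complex fps" where "(1 + fps_exp 2) * S = 2 * fps_exp 1" using one_plus_exp_quotient by blast
 from tan_sec_nonzero(1)[OF C this, of j] have "C $ (2 * j + 1) ~= 0" .
 hence "of_nat k * (fact (2 * j + 1) * C $ (2 * j + 1)) ~= 0" unfolding k by (simp del: of_nat_Suc of_nat_add)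
 thus "bernoulli k ~= 0" unfolding 1 by auto
qed

lemma bernoulli_2: "bernoulli 2 = 1 / 6"
proof -
 obtain C :: "complex fps" where C: "(1 + fps_exp 2) * C = 1 - fps_exp 2" using one_plus_exp_quotient by blast
 have "((1 + fps_exp 2) * C) $ 0 = (1 - fps_exp 2 :: complex fps) $ 0" "((1 + fps_exp 2) * C) $ 1 = (1 - fps_exp 2 :: complex fps) $ 1"
  unfolding C by (rule refl)+
 hence "C $ 0 = 0" "C $ 1 = -1" by (simp_all add: fps_mult_nth_1)
 hence "of_rat (bernoulli 2) = (of_rat (1 / 6) :: complex)"
  using bernoulli_tanh[OF C, of 2] by (simp add: of_rat_divide field_simps)
 thus ?thesis by (simp only: of_rat_eq_iff)
qed

text \<open>For odd n the summands combine by x/(1 - x) - x/(1 + x) = 2 x^2 / (1 - x^2), and for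
  even n they coincide. It is used to evaluate the four-square series at -q^2.\<close>

lemma sigma_series_reflect:
 assumes q: "norm q < 1"
 shows "eval_fps (sigma_fps 1) q + eval_fps (sigma_fps 1) (- q)
  = 6 * eval_fps (sigma_fps 1) (q\<^sup>2) - 4 * eval_fps (sigma_fps 1) (q ^ 4)"
proof -
 let ?S = "eval_fps (sigma_fps 1)"
 define g where "g q n = of_nat n ^ 1 * (q ^ n / (1 - q ^ n))" for q :: complex and n
 have hs: "((%n. g q n) has_sum ?S q) {1..}" if "norm q < 1" for q
  unfolding g_def sigma_fps_def by (intro lambert_has_sum(1) polynomially_bounded_power that)
 have q2: "norm (q\<^sup>2) < 1" and q4: "norm (q ^ 4) < 1" and q': "norm (- q) < 1" using norm_power_less_1[OF q] q by auto
 have ev: "((%n. if even n then g p n else 0) has_sum 2 * ?S (p\<^sup>2)) {1..}" if p: "norm p < 1" for p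
 proof (rule has_sum_even_nat)
  have "norm (p\<^sup>2) < 1" using norm_power_less_1[OF p, of 2] by simp
  from has_sum_cmult_right[OF hs[OF this], of 2]
  show "((%m. g p (2 * m)) has_sum 2 * ?S (p\<^sup>2)) {1..}" by (simp add: g_def power_mult mult.assoc)
 qed
 have qq: "(q\<^sup>2)\<^sup>2 = q ^ 4" by (simp flip: power_mult)
 have A: "((%n. 2 * g (q\<^sup>2) n + - (2 * (if even n then g (q\<^sup>2) n else 0)) + 2 * (if even n then g q n else 0))
   has_sum (2 * ?S (q\<^sup>2) + - (2 * (2 * ?S (q ^ 4))) + 2 * (2 * ?S (q\<^sup>2)))) {1..}"
  using ev[OF q2] unfolding qq by (intro has_sum_add has_sum_uminusI has_sum_cmult_right hs ev q q2)
 have eqn: "g q n + g (- q) n = 2 * g (q\<^sup>2) n + - (2 * (if even n then g (q\<^sup>2) n else 0)) + 2 * (if even n then g q n else 0)"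
  if n: "n \<in> {1..}" for n
 proof (cases "even n")
  case False
  define x where "x = q ^ n"
  have m: "(- q) ^ n = - x" using False by (simp add: x_def)
  have s: "(q\<^sup>2) ^ n = x\<^sup>2" unfolding x_def by (rule power_power_commute)
  have "norm x < 1" using norm_power_less_1[OF q, of n] n by (simp add: x_def)
  hence nz: "1 - x ~= 0" "1 + x ~= 0" using one_pm_power_nonzero[of x 1] by auto
  have f: "1 - x\<^sup>2 = (1 - x) * (1 + x)" by (simp add: power2_eq_square algebra_simps)
  have H: "x / (1 - x) + - x / (1 + x) = 2 * (x\<^sup>2 / (1 - x\<^sup>2))"
   unfolding f using nz by (simp add: divide_simps) (simp add: power2_eq_square algebra_simps)
  have "of_nat n * (x / (1 - x)) + of_nat n * (- x / (1 + x)) = of_nat n * (x / (1 - x) + - x / (1 + x))"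
   by (rule distrib_left[symmetric])
  also have "... = 2 * (of_nat n * (x\<^sup>2 / (1 - x\<^sup>2)))" unfolding H by (rule mult.left_commute)
  finally have "of_nat n * (x / (1 - x)) + of_nat n * (- x / (1 + x)) = 2 * (of_nat n * (x\<^sup>2 / (1 - x\<^sup>2)))" .
  moreover have "g q n = of_nat n * (x / (1 - x))" by (simp add: g_def x_def)
  moreover have "g (- q) n = of_nat n * (- x / (1 + x))" unfolding g_def m by simp
  moreover have "g (q\<^sup>2) n = of_nat n * (x\<^sup>2 / (1 - x\<^sup>2))" unfolding g_def s by simp
  ultimately show ?thesis using False by (simp only: if_False mult_zero_right minus_zero add_0_right)
 qed (simp add: g_def)
 have "((%n. g q n + g (- q) n) has_sum (2 * ?S (q\<^sup>2) + - (2 * (2 * ?S (q ^ 4))) + 2 * (2 * ?S (q\<^sup>2)))) {1..}"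
  by (rule has_sum_cong[THEN iffD2, OF eqn A])
 moreover have "((%n. g q n + g (- q) n) has_sum (?S q + ?S (- q))) {1..}"
  by (intro has_sum_add hs q q')
 ultimately have "?S q + ?S (- q) = 2 * ?S (q\<^sup>2) + - (2 * (2 * ?S (q ^ 4))) + 2 * (2 * ?S (q\<^sup>2))"
  using has_sum_unique by blast
 thus ?thesis by simp
qed

lemma of_rat_divisor_functions_numeral:
 fixes n :: nat
 assumes n: "n > 0"
 shows "of_rat (divisor_sigma k (of_nat n)) = fps_dilate 1 (sigma_fps k) $ n"
  and "of_rat (divisor_sigma k (of_nat n / numeral m)) = fps_dilate (numeral m) (sigma_fps k) $ n"
  and "of_rat (sigma_inf k (-4) (of_nat n)) = fps_dilate 1 (chi_inf_fps chi4 k) $ n"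
  and "of_rat (sigma_inf k (-4) (of_nat n / numeral m)) = fps_dilate (numeral m) (chi_inf_fps chi4 k) $ n"
  and "of_rat (sigma_zero k (-4) (of_nat n)) = fps_dilate 1 (chi_zero_fps chi4 k) $ n"
  and "of_rat (sigma_zero k (-4) (of_nat n / numeral m)) = fps_dilate (numeral m) (chi_zero_fps chi4 k) $ n"
  and "of_rat (sigma_inf k (-2) (of_nat n)) = fps_dilate 1 (chi_inf_fps chi8 k) $ n"
  and "of_rat (sigma_zero k (-2) (of_nat n)) = fps_dilate 1 (chi_zero_fps chi8 k) $ n"
 using of_rat_divisor_functions[of 1 n k] of_rat_divisor_functions[of "numeral m" n k] n by simp_all

lemmas of_rat_simps = of_rat_mult of_rat_add of_rat_diff of_rat_minus of_rat_divide of_rat_power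

section \<open>The expansions for m = 2\<close>

text \<open>The factor b = -k / B_{k,8} is the reciprocal of the constant term L of the boundary
  moment. With weight b (-2)^j the two symmetric moments add up to 1 plus the divisor sums, and
  (-2)^j 4^j = (-8)^j explains the power in the statement.\<close>

lemma expansion_2_odd:
 assumes j: "j > 0" and k: "k = 2 * j + 1"
 shows "\<exists>!c. c \<in> {1..j} \<rightarrow>\<^sub>E (UNIV :: rat set) &
  (\<forall>n>0. (of_nat (rep_count k 2 n) :: complex) = of_rat (- (of_nat k / bernoulli8 k) *
    ((2 * sigma_inf (2 * j) (-2) (of_nat n) + 2 * (-8) ^ j * sigma_zero (2 * j) (-2) (of_nat n)) / (1 + 0)))
   + (\<Sum>i=1..j. of_rat (c i) * a2 i k n))"
proof -
 obtain R :: "complex fps" where R: "(1 + fps_exp 4) * R = fps_exp 1 + fps_exp 3" using one_plus_exp_quotient by blast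
 define L where "L = fact (2 * j) * R $ (2 * j)"
 have L: "L ~= 0" using cosh_quotient_nonzero[OF R, of j] by (simp add: L_def)
 define b where "b = - (of_nat k / of_rat (bernoulli8 k) :: complex)"
 have "of_rat (bernoulli8 k) = - (of_nat k * L)" using bernoulli8_eq[OF R, of k] by (simp add: k L_def mult.assoc)
 hence bL: "b * L = 1" using L by (simp add: b_def k del: of_nat_Suc of_nat_add)
 obtain P :: "complex poly" where P: "degree P <= j" "!!v. v ~= 0 ==>
   even_deriv 1 (1 / v + 2 - v) ((2 - v) / v) j 1 + even_deriv 1 (v / 2 + 2 - 2 / v) (v - 1) j 1 = poly P (v + 2 / v)"
  using laurent_case_2_odd by blast
 show ?thesis
 proof (rule rep_count_2_expansion[where P = "Polynomial.smult (b * (-2) ^ j) P" and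
   xs = "[(b * 2, 1 :: nat, chi_inf_fps chi8 (2 * j)), (b * (2 * (-8) ^ j), 1 :: nat, chi_zero_fps chi8 (2 * j))]"])
  show "\<forall>(c, m, f)\<in>set [(b * 2, 1 :: nat, chi_inf_fps chi8 (2 * j)), (b * (2 * (-8) ^ j), 1 :: nat, chi_zero_fps chi8 (2 * j))]. m > 0 & cuspidal_series f"
   by (simp add: cuspidal_series_lambert)
  show "degree (Polynomial.smult (b * (-2) ^ j) P) <= j" using P(1) degree_smult_le[of "b * (-2) ^ j" P] by linarith
  show "2 * j <= k" by (simp add: k)
  fix n :: nat assume n: "n > 0"
  show "(\<Sum>(c, m, f)\<leftarrow>[(b * 2, 1 :: nat, chi_inf_fps chi8 (2 * j)), (b * (2 * (-8) ^ j), 1 :: nat, chi_zero_fps chi8 (2 * j))]. c * fps_dilate m f $ n)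
   = of_rat (- (of_nat k / bernoulli8 k) *
    ((2 * sigma_inf (2 * j) (-2) (of_nat n) + 2 * (-8) ^ j * sigma_zero (2 * j) (-2) (of_nat n)) / (1 + 0)))"
   by (simp add: of_rat_simps of_rat_divisor_functions_numeral[OF n] b_def[symmetric] flip: mult_minus_left)
     (simp add: b_def algebra_simps add_divide_distrib)
 next
  fix q :: complex assume q: "0 < norm q" "norm q < 1" "theta q ~= 0" "theta (q\<^sup>2) ~= 0"
  define v z where "v = (theta q)\<^sup>2 / (theta (q\<^sup>2))\<^sup>2" and "z = theta q * theta (q\<^sup>2)"
  have v: "v ~= 0" using q by (simp add: v_def)
  define S0 SI where "S0 = eval_fps (chi_zero_fps chi8 (2 * j)) q" and "SI = eval_fps (chi_inf_fps chi8 (2 * j)) q"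
  define A B where "A = even_deriv 1 (1 / v + 2 - v) ((2 - v) / v) j 1" and "B = even_deriv 1 (v / 2 + 2 - 2 / v) (v - 1) j 1"
  have 1: "2 * 4 ^ j * S0 = z ^ k * A"
   using level_8_moments(1)[OF q j] by (simp only: S0_def A_def z_def v_def k)
  have 2: "L + 2 * SI = (-2) ^ j * (z ^ k * B)"
   using level_8_moments(2)[OF q j R] by (simp only: SI_def B_def z_def v_def k L_def)
  have "b * (-2) ^ j * poly P (v + 2 / v) * z ^ k = b * ((-2) ^ j * (z ^ k * A) + (-2) ^ j * (z ^ k * B))"
   unfolding P(2)[OF v, symmetric] A_def B_def by (simp add: algebra_simps)
  also have "... = b * ((-2) ^ j * (2 * 4 ^ j * S0)) + b * L + b * 2 * SI" unfolding 1[symmetric] 2[symmetric] by (simp add: algebra_simps)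
  also have "(-2) ^ j * (2 * 4 ^ j * S0) = 2 * (-8) ^ j * S0"
  proof -
   have "(-8 :: complex) ^ j = (-2) ^ j * 4 ^ j" by (simp flip: power_mult_distrib)
   thus ?thesis by (simp only: mult_ac)
  qed
  finally have "b * (-2) ^ j * poly P (v + 2 / v) * z ^ k = 1 + (b * 2 * SI + b * (2 * (-8) ^ j) * S0)" unfolding bL by simp
  thus "1 + (\<Sum>(c, m, f)\<leftarrow>[(b * 2, 1 :: nat, chi_inf_fps chi8 (2 * j)), (b * (2 * (-8) ^ j), 1 :: nat, chi_zero_fps chi8 (2 * j))]. c * eval_fps f (q ^ m))
   = poly (Polynomial.smult (b * (-2) ^ j) P) ((theta q)\<^sup>2 / (theta (q\<^sup>2))\<^sup>2 + 2 / ((theta q)\<^sup>2 / (theta (q\<^sup>2))\<^sup>2)) * (theta q * theta (q\<^sup>2)) ^ k"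
   unfolding v_def[symmetric] z_def[symmetric] by (simp add: S0_def SI_def)
 qed
qed

text \<open>For k = 1 the two divisor sums coincide, B_{1,8} = -1, and the denominator is 2, so the
  claim is the theorem on x^2 + 2 y^2.\<close>

lemma expansion_2_one:
 "\<exists>!c. c \<in> {1..0} \<rightarrow>\<^sub>E (UNIV :: rat set) &
  (\<forall>n>0. (of_nat (rep_count 1 2 n) :: complex) = of_rat (- (of_nat 1 / bernoulli8 1) *
    ((2 * sigma_inf 0 (-2) (of_nat n) + 2 * (-8) ^ 0 * sigma_zero 0 (-2) (of_nat n)) / (1 + 1)))
   + (\<Sum>i=1..0. of_rat (c i) * a2 i 1 n))"
proof -
 obtain R :: "complex fps" where R: "(1 + fps_exp 4) * R = fps_exp 1 + fps_exp 3" using one_plus_exp_quotient by blast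
 have "((1 + fps_exp 4) * R) $ 0 = (fps_exp 1 + fps_exp 3) $ 0" unfolding R ..
 hence "R $ 0 = 1" by simp
 hence "of_rat (bernoulli8 1) = (of_rat (-1) :: complex)" using bernoulli8_eq[OF R, of 1] by (simp add: of_rat_minus)
 hence b: "bernoulli8 1 = -1" by (simp only: of_rat_eq_iff)
 show ?thesis
 proof (rule rep_count_2_expansion[where P = "[:1:]" and xs = "[(2, 1 :: nat, chi_inf_fps chi8 0)]"])
  show "\<forall>(c, m, f)\<in>set [(2, 1 :: nat, chi_inf_fps chi8 0)]. m > 0 & cuspidal_series f" by (simp add: cuspidal_series_lambert)
  fix n :: nat assume n: "n > 0"
  have "chi_zero_fps chi8 0 = chi_inf_fps chi8 0"
   by (simp add: chi_zero_fps_def chi_inf_fps_def) (rule lambert_fps_commute)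
  thus "(\<Sum>(c, m, f)\<leftarrow>[(2, 1 :: nat, chi_inf_fps chi8 0)]. c * fps_dilate m f $ n) = of_rat (- (of_nat 1 / bernoulli8 1) *
    ((2 * sigma_inf 0 (-2) (of_nat n) + 2 * (-8) ^ 0 * sigma_zero 0 (-2) (of_nat n)) / (1 + 1)))"
   unfolding b by (simp add: of_rat_simps of_rat_divisor_functions_numeral[OF n])
 next
  fix q :: complex assume q: "0 < norm q" "norm q < 1"
  show "1 + (\<Sum>(c, m, f)\<leftarrow>[(2, 1 :: nat, chi_inf_fps chi8 0)]. c * eval_fps f (q ^ m))
   = poly [:1:] ((theta q)\<^sup>2 / (theta (q\<^sup>2))\<^sup>2 + 2 / ((theta q)\<^sup>2 / (theta (q\<^sup>2))\<^sup>2)) * (theta q * theta (q\<^sup>2)) ^ 1"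
   using theta_product_lambert[OF q] by simp
 qed simp_all
qed

text \<open>Here b is the common factor of the divisor sums and K the constant of the boundary
  moment, so that b K = 2^k / 2^j. The weight \<epsilon> b / (2 X) with \<epsilon> = (-1)^(j+1) and
  X = 2^k turns this constant into 1.\<close>

lemma expansion_2_even:
 assumes j: "j > 0" and k: "k = 2 * j + 2"
 shows "\<exists>!c. c \<in> {1..j} \<rightarrow>\<^sub>E (UNIV :: rat set) &
  (\<forall>n>0. (of_nat (rep_count k 2 n) :: complex) = of_rat (- (of_nat k / bernoulli k) *
    (((-1) ^ (j + 1) * divisor_sigma (2 * j + 1) (of_nat n) - (-1) ^ (j + 1) * divisor_sigma (2 * j + 1) (of_nat n / 2)
     - 2 ^ (j + 1) * divisor_sigma (2 * j + 1) (of_nat n / 4) + 8 ^ (j + 1) * divisor_sigma (2 * j + 1) (of_nat n / 8))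
    / (2 ^ j * (2 ^ k - 1))))
   + (\<Sum>i=1..j. of_rat (c i) * a2 i k n))"
proof -
 obtain C :: "complex fps" where C: "(1 + fps_exp 2) * C = 1 - fps_exp 2" using one_plus_exp_quotient by blast
 define K where "K = fact (2 * j + 1) * C $ (2 * j + 1)"
 define \<beta> :: complex where "\<beta> = of_rat (bernoulli k)"
 define X x y :: complex where "X = 2 ^ k" and "x = 2 ^ (j + 1)" and "y = 2 ^ j"
 have X: "X = x * x" "2 ^ (2 * j + 3) = 2 * X" "2 ^ (2 * j + 2) = X" "x = 2 * y" "8 ^ (j + 1) = x * X"
 proof -
  show 1: "X = x * x"
   unfolding X_def x_def k power_add[symmetric] by (rule arg_cong[of _ _ "power 2"]) simp
  show "2 ^ (2 * j + 3) = 2 * X" "2 ^ (2 * j + 2) = X" "x = 2 * y" by (simp_all add: X_def x_def y_def k power_add)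
  show "8 ^ (j + 1) = x * X" unfolding 1 x_def power_mult_distrib[symmetric] by simp
 qed
 have nz: "X ~= 0" "y ~= 0" "X - 1 ~= 0" "\<beta> ~= 0" "of_nat k ~= (0 :: complex)"
 proof -
  have "(2 :: nat) ^ k ~= 1" by (simp add: k)
  hence "of_nat (2 ^ k) ~= (of_nat 1 :: complex)" unfolding of_nat_eq_iff .
  thus "X - 1 ~= 0" by (simp add: X_def)
  show "\<beta> ~= 0" using bernoulli_even_constant(2)[OF C k] by (simp add: \<beta>_def)
 qed (simp_all add: X_def y_def k del: of_nat_Suc of_nat_add)
 define b where "b = - (of_nat k / \<beta>) / (y * (X - 1))"
 have bK: "b * K = X / y"
 proof -
  have "of_nat k * K = - (X * (X - 1) * \<beta>)"
   using bernoulli_even_constant(1)[OF C k] by (simp only: K_def X_def \<beta>_def)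
  hence h: "of_nat k * K / \<beta> = - (X * (X - 1))" using nz by simp
  have "b * K = - (of_nat k * K / \<beta>) / (y * (X - 1))" by (simp add: b_def)
  also have "... = X / y" unfolding h using nz by simp
  finally show ?thesis .
 qed
 define \<epsilon> :: complex where "\<epsilon> = (-1) ^ (j + 1)"
 have ee: "\<epsilon> * \<epsilon> = 1" unfolding \<epsilon>_def power_mult_distrib[symmetric] by simp
 obtain P :: "complex poly" where P: "degree P <= j" "!!v. v ~= 0 ==>
   even_deriv 0 (4 / v - 4 - v) (4 * v - 4) j 2 + even_deriv 0 (4 / (2 / v) - 4 - 2 / v) (4 * (2 / v) - 4) j 2 = poly P (v + 2 / v)"
  using laurent_case_2_even[of j] j by auto
 let ?S = "sigma_fps (2 * j + 1)"
 let ?xs = "[(b * \<epsilon>, 1 :: nat, ?S), (- (b * \<epsilon>), 2, ?S), (- (b * x), 4, ?S), (b * (x * X), 8, ?S)]"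
 show ?thesis
 proof (rule rep_count_2_expansion[where P = "Polynomial.smult (\<epsilon> * b / (2 * X)) P" and xs = ?xs])
  show "\<forall>(c, m, f)\<in>set ?xs. m > 0 & cuspidal_series f" by (simp add: cuspidal_series_lambert del: One_nat_def)
  show "degree (Polynomial.smult (\<epsilon> * b / (2 * X)) P) <= j" using P(1) degree_smult_le[of "\<epsilon> * b / (2 * X)" P] by linarith
  show "2 * j <= k" by (simp add: k)
  fix n :: nat assume n: "n > 0"
  have E: "of_rat (- (of_nat k / bernoulli k) *
    (((-1) ^ (j + 1) * divisor_sigma (2 * j + 1) (of_nat n) - (-1) ^ (j + 1) * divisor_sigma (2 * j + 1) (of_nat n / 2)
     - 2 ^ (j + 1) * divisor_sigma (2 * j + 1) (of_nat n / 4) + 8 ^ (j + 1) * divisor_sigma (2 * j + 1) (of_nat n / 8))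
    / (2 ^ j * (2 ^ k - 1))))
   = - (of_nat k / \<beta>) * ((\<epsilon> * fps_dilate 1 ?S $ n - \<epsilon> * fps_dilate 2 ?S $ n - x * fps_dilate 4 ?S $ n + 8 ^ (j + 1) * fps_dilate 8 ?S $ n)
    / (y * (X - 1)))"
   unfolding of_rat_simps of_rat_divisor_functions_numeral[OF n] \<beta>_def \<epsilon>_def x_def y_def X_def by simp
  have F: "- (of_nat k / \<beta>) * (N / (y * (X - 1))) = b * N" for N by (simp add: b_def)
  show "(\<Sum>(c, m, f)\<leftarrow>?xs. c * fps_dilate m f $ n) = of_rat (- (of_nat k / bernoulli k) *
    (((-1) ^ (j + 1) * divisor_sigma (2 * j + 1) (of_nat n) - (-1) ^ (j + 1) * divisor_sigma (2 * j + 1) (of_nat n / 2)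
     - 2 ^ (j + 1) * divisor_sigma (2 * j + 1) (of_nat n / 4) + 8 ^ (j + 1) * divisor_sigma (2 * j + 1) (of_nat n / 8))
    / (2 ^ j * (2 ^ k - 1))))"
   unfolding E F X(5) by (simp add: algebra_simps)
 next
  fix q :: complex assume q: "0 < norm q" "norm q < 1" "theta q ~= 0" "theta (q\<^sup>2) ~= 0"
  define v z where "v = (theta q)\<^sup>2 / (theta (q\<^sup>2))\<^sup>2" and "z = theta q * theta (q\<^sup>2)"
  have v: "v ~= 0" using q by (simp add: v_def)
  define S1 S2 S4 S8 where "S1 = eval_fps ?S q" and "S2 = eval_fps ?S (q\<^sup>2)" and "S4 = eval_fps ?S (q ^ 4)" and "S8 = eval_fps ?S (q ^ 8)"
  define A B where "A = even_deriv 0 (4 / v - 4 - v) (4 * v - 4) j 2"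
   and "B = even_deriv 0 (4 / (2 / v) - 4 - 2 / v) (4 * (2 / v) - 4) j 2"
  have 1: "2 * X * (S1 - S2) = z ^ k * A"
   using level_8_moments(3)[OF q j] unfolding X by (simp only: S1_def S2_def A_def z_def v_def k)
  have "(-2 :: complex) ^ (j + 1) = \<epsilon> * x" unfolding \<epsilon>_def x_def power_mult_distrib[symmetric] by simp
  hence 2: "\<epsilon> * x * (K + 2 * X * (X * S8 - S4)) = z ^ k * B"
   using level_8_moments(4)[OF q j C] unfolding X(2,3) by (simp only: S4_def S8_def B_def z_def v_def k K_def)
  have "\<epsilon> * b / (2 * X) * poly P (v + 2 / v) * z ^ k = \<epsilon> * b / (2 * X) * (z ^ k * A + z ^ k * B)"
   unfolding P(2)[OF v, symmetric] A_def B_def by (simp only: distrib_left mult_ac)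
  also have "... = \<epsilon> * b * (S1 - S2) + (\<epsilon> * \<epsilon>) * (x * (b * K) / (2 * X)) + (\<epsilon> * \<epsilon>) * (b * x * (X * S8 - S4))"
   unfolding 1[symmetric] 2[symmetric] using nz(1) by (simp add: distrib_left add_divide_distrib)
  also have "x * (b * K) / (2 * X) = 1" unfolding bK X(4) using nz(1,2) by simp
  finally have "\<epsilon> * b / (2 * X) * poly P (v + 2 / v) * z ^ k = 1 + (b * \<epsilon> * S1 - b * \<epsilon> * S2 - b * x * S4 + b * (x * X) * S8)"
   unfolding ee by (simp add: algebra_simps)
  thus "1 + (\<Sum>(c, m, f)\<leftarrow>?xs. c * eval_fps f (q ^ m))
   = poly (Polynomial.smult (\<epsilon> * b / (2 * X)) P) ((theta q)\<^sup>2 / (theta (q\<^sup>2))\<^sup>2 + 2 / ((theta q)\<^sup>2 / (theta (q\<^sup>2))\<^sup>2)) * (theta q * theta (q\<^sup>2)) ^ k"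
   unfolding v_def[symmetric] z_def[symmetric] by (simp add: S1_def S2_def S4_def S8_def)
 qed
qed

text \<open>For k = 2 the identity 2 (theta(q) theta(q^2))^2 = theta(q)^4 + theta(-q^2)^4 reduces
  the claim to the four-square series at q and at -q^2.\<close>

lemma expansion_2_two:
 "\<exists>!c. c \<in> {1..0} \<rightarrow>\<^sub>E (UNIV :: rat set) &
  (\<forall>n>0. (of_nat (rep_count 2 2 n) :: complex) = of_rat (- (of_nat 2 / bernoulli 2) *
    (((-1) ^ 1 * divisor_sigma 1 (of_nat n) - (-1) ^ 1 * divisor_sigma 1 (of_nat n / 2)
     - 2 ^ 1 * divisor_sigma 1 (of_nat n / 4) + 8 ^ 1 * divisor_sigma 1 (of_nat n / 8)) / (2 ^ 0 * (2 ^ 2 - 1))))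
   + (\<Sum>i=1..0. of_rat (c i) * a2 i 2 n))"
proof -
 let ?S = "sigma_fps 1"
 let ?xs = "[(4, 1 :: nat, ?S), (- 4, 2, ?S), (8, 4, ?S), (- 32, 8, ?S)]"
 show ?thesis
 proof (rule rep_count_2_expansion[where P = "[:1:]" and xs = ?xs])
  show "\<forall>(c, m, f)\<in>set ?xs. m > 0 & cuspidal_series f" by (simp add: cuspidal_series_lambert del: One_nat_def)
  fix n :: nat assume n: "n > 0"
  show "(\<Sum>(c, m, f)\<leftarrow>?xs. c * fps_dilate m f $ n) = of_rat (- (of_nat 2 / bernoulli 2) *
    (((-1) ^ 1 * divisor_sigma 1 (of_nat n) - (-1) ^ 1 * divisor_sigma 1 (of_nat n / 2)
     - 2 ^ 1 * divisor_sigma 1 (of_nat n / 4) + 8 ^ 1 * divisor_sigma 1 (of_nat n / 8)) / (2 ^ 0 * (2 ^ 2 - 1))))"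
   unfolding bernoulli_2 by (simp add: of_rat_simps of_rat_divisor_functions_numeral[OF n] algebra_simps del: One_nat_def)
 next
  fix q :: complex assume q: "0 < norm q" "norm q < 1"
  have q2: "norm (q\<^sup>2) < 1" and q2': "0 < norm (- (q\<^sup>2))" "norm (- (q\<^sup>2)) < 1" using norm_power_less_1[OF q(2), of 2] q by auto
  have p: "(q\<^sup>2) ^ 4 = q ^ 8" "(q\<^sup>2)\<^sup>2 = q ^ 4" "(- (q\<^sup>2)) ^ 4 = q ^ 8" by (simp_all flip: power_mult)
  have "2 * (theta q * theta (q\<^sup>2))\<^sup>2 = theta q ^ 4 + theta (- q\<^sup>2) ^ 4"
   unfolding theta_reflect_squares(2)[OF q(2)] theta_power_4[of q] by (simp add: power2_eq_square algebra_simps)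
  also have "... = 2 * (1 + (4 * eval_fps ?S q - 4 * eval_fps ?S (q\<^sup>2) + 8 * eval_fps ?S (q ^ 4) - 32 * eval_fps ?S (q ^ 8)))"
  proof -
   have r: "eval_fps ?S (- (q\<^sup>2)) = 6 * eval_fps ?S (q ^ 4) - 4 * eval_fps ?S (q ^ 8) - eval_fps ?S (q\<^sup>2)"
    using sigma_series_reflect[OF q2] unfolding p by (metis add_diff_cancel_left')
   show ?thesis
    unfolding theta_fourth_power[OF q] theta_fourth_power[OF q2'] unfolding p r by (simp add: algebra_simps)
  qed
  finally have "(theta q * theta (q\<^sup>2))\<^sup>2 = 1 + (4 * eval_fps ?S q - 4 * eval_fps ?S (q\<^sup>2) + 8 * eval_fps ?S (q ^ 4) - 32 * eval_fps ?S (q ^ 8))"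
   unfolding mult_cancel_left by simp
  thus "1 + (\<Sum>(c, m, f)\<leftarrow>?xs. c * eval_fps f (q ^ m))
   = poly [:1:] ((theta q)\<^sup>2 / (theta (q\<^sup>2))\<^sup>2 + 2 / ((theta q)\<^sup>2 / (theta (q\<^sup>2))\<^sup>2)) * (theta q * theta (q\<^sup>2)) ^ 2"
   by simp
 qed simp_all
qed

section \<open>The expansions for m = 4\<close>

text \<open>The divisor sums at 8 and 16 come from the boundary moment at nome q^4. With X = 2^k and
  y = X/2 the constant satisfies b K = X / y = 2, and the weight \<epsilon> b / (2 X) again
  normalises the constant term to 1.\<close>

lemma expansion_4_even:
 assumes j: "j > 0" and k: "k = 2 * j + 2"
 shows "\<exists>!c. c \<in> {1..2 * j + 1} \<rightarrow>\<^sub>E (UNIV :: rat set) &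
  (\<forall>n>0. (of_nat (rep_count k 4 n) :: complex) = of_rat (- (of_nat k / bernoulli k) *
    (((-1) ^ (j + 1) * divisor_sigma (2 * j + 1) (of_nat n) - (-1) ^ (j + 1) * divisor_sigma (2 * j + 1) (of_nat n / 2)
     - 2 ^ k * divisor_sigma (2 * j + 1) (of_nat n / 8) + 4 ^ k * divisor_sigma (2 * j + 1) (of_nat n / 16))
    / (2 ^ (2 * j + 1) * (2 ^ k - 1))))
   + (\<Sum>i=1..2 * j + 1. of_rat (c i) * a4 i k n))"
proof -
 obtain C :: "complex fps" where C: "(1 + fps_exp 2) * C = 1 - fps_exp 2" using one_plus_exp_quotient by blast
 define K where "K = fact (2 * j + 1) * C $ (2 * j + 1)"
 define \<beta> :: complex where "\<beta> = of_rat (bernoulli k)"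
 define X y :: complex where "X = 2 ^ k" and "y = 2 ^ (2 * j + 1)"
 have X: "X = 2 * y" "2 ^ (2 * j + 3) = 2 * X" "2 ^ (2 * j + 2) = X" "4 ^ k = X * X" "4 ^ (j + 1) = X"
 proof -
  show "X = 2 * y" "2 ^ (2 * j + 3) = 2 * X" "2 ^ (2 * j + 2) = X" by (simp_all add: X_def y_def k power_add)
  show "4 ^ k = X * X" unfolding X_def power_mult_distrib[symmetric] by simp
  have "(4 :: complex) ^ (j + 1) = (2\<^sup>2) ^ (j + 1)" by simp
  also have "... = 2 ^ (2 * (j + 1))" by (simp only: power_mult)
  finally show "4 ^ (j + 1) = X" by (simp add: X_def k)
 qed
 have nz: "X ~= 0" "y ~= 0" "X - 1 ~= 0" "\<beta> ~= 0" "of_nat k ~= (0 :: complex)"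
 proof -
  have "(2 :: nat) ^ k ~= 1" by (simp add: k)
  hence "of_nat (2 ^ k) ~= (of_nat 1 :: complex)" unfolding of_nat_eq_iff .
  thus "X - 1 ~= 0" by (simp add: X_def)
  show "\<beta> ~= 0" using bernoulli_even_constant(2)[OF C k] by (simp add: \<beta>_def)
 qed (simp_all add: X_def y_def k del: of_nat_Suc of_nat_add)
 define b where "b = - (of_nat k / \<beta>) / (y * (X - 1))"
 have bK: "b * K = X / y"
 proof -
  have "of_nat k * K = - (X * (X - 1) * \<beta>)"
   using bernoulli_even_constant(1)[OF C k] by (simp only: K_def X_def \<beta>_def)
  hence h: "of_nat k * K / \<beta> = - (X * (X - 1))" using nz by simp
  have "b * K = - (of_nat k * K / \<beta>) / (y * (X - 1))" by (simp add: b_def)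
  also have "... = X / y" unfolding h using nz by simp
  finally show ?thesis .
 qed
 define \<epsilon> :: complex where "\<epsilon> = (-1) ^ (j + 1)"
 have ee: "\<epsilon> * \<epsilon> = 1" unfolding \<epsilon>_def power_mult_distrib[symmetric] by simp
 obtain P :: "complex poly" where P: "degree P <= 2 * (j + 1) - 1" "!!w. w ~= 0 ==>
   even_deriv 0 ((2 - w) ^ 4 / w\<^sup>2 - 2 * w\<^sup>2) (w ^ 4 - (2 - w) ^ 4) j 2
   + even_deriv 0 ((2 - 2 / w) ^ 4 / (2 / w)\<^sup>2 - 2 * (2 / w)\<^sup>2) ((2 / w) ^ 4 - (2 - 2 / w) ^ 4) j 2 = poly P (w + 2 / w)"
  using laurent_case_4_even[of j] j by auto
 let ?S = "sigma_fps (2 * j + 1)"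
 let ?xs = "[(b * \<epsilon>, 1 :: nat, ?S), (- (b * \<epsilon>), 2, ?S), (- (b * X), 8, ?S), (b * (X * X), 16, ?S)]"
 show ?thesis
 proof (rule rep_count_4_expansion[where P = "Polynomial.smult (\<epsilon> * b / (2 * X)) P" and xs = ?xs])
  show "\<forall>(c, m, f)\<in>set ?xs. m > 0 & cuspidal_series f" by (simp add: cuspidal_series_lambert del: One_nat_def)
  show "degree (Polynomial.smult (\<epsilon> * b / (2 * X)) P) <= 2 * j + 1" using P(1) degree_smult_le[of "\<epsilon> * b / (2 * X)" P] by simp
  show "2 * j + 1 <= k" by (simp add: k)
  fix n :: nat assume n: "n > 0"
  have E: "of_rat (- (of_nat k / bernoulli k) *
    (((-1) ^ (j + 1) * divisor_sigma (2 * j + 1) (of_nat n) - (-1) ^ (j + 1) * divisor_sigma (2 * j + 1) (of_nat n / 2)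
     - 2 ^ k * divisor_sigma (2 * j + 1) (of_nat n / 8) + 4 ^ k * divisor_sigma (2 * j + 1) (of_nat n / 16))
    / (2 ^ (2 * j + 1) * (2 ^ k - 1))))
   = - (of_nat k / \<beta>) * ((\<epsilon> * fps_dilate 1 ?S $ n - \<epsilon> * fps_dilate 2 ?S $ n - X * fps_dilate 8 ?S $ n + 4 ^ k * fps_dilate 16 ?S $ n)
    / (y * (X - 1)))"
   unfolding of_rat_simps of_rat_divisor_functions_numeral[OF n] \<beta>_def \<epsilon>_def y_def X_def by simp
  have F: "- (of_nat k / \<beta>) * (N / (y * (X - 1))) = b * N" for N by (simp add: b_def)
  show "(\<Sum>(c, m, f)\<leftarrow>?xs. c * fps_dilate m f $ n) = of_rat (- (of_nat k / bernoulli k) *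
    (((-1) ^ (j + 1) * divisor_sigma (2 * j + 1) (of_nat n) - (-1) ^ (j + 1) * divisor_sigma (2 * j + 1) (of_nat n / 2)
     - 2 ^ k * divisor_sigma (2 * j + 1) (of_nat n / 8) + 4 ^ k * divisor_sigma (2 * j + 1) (of_nat n / 16))
    / (2 ^ (2 * j + 1) * (2 ^ k - 1))))"
   unfolding E F X(4) by (simp add: algebra_simps)
 next
  fix q w t :: complex assume q: "0 < norm q" "norm q < 1" and wt: "w ~= 0" "t ~= 0" "theta q = w * t" "theta (q ^ 4) = t"
  define z where "z = w * t\<^sup>2"
  define S1 S2 S8 S16 where "S1 = eval_fps ?S q" and "S2 = eval_fps ?S (q\<^sup>2)" and "S8 = eval_fps ?S (q ^ 8)" and "S16 = eval_fps ?S (q ^ 16)"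
  define A B where "A = even_deriv 0 ((2 - w) ^ 4 / w\<^sup>2 - 2 * w\<^sup>2) (w ^ 4 - (2 - w) ^ 4) j 2"
   and "B = even_deriv 0 ((2 - 2 / w) ^ 4 / (2 / w)\<^sup>2 - 2 * (2 / w)\<^sup>2) ((2 / w) ^ 4 - (2 - 2 / w) ^ 4) j 2"
  have 1: "2 * X * (S1 - S2) = z ^ k * A"
   using level_16_moments(1)[OF q wt j] unfolding X(2) by (simp only: S1_def S2_def A_def z_def k)
  have "(-4 :: complex) ^ (j + 1) = \<epsilon> * X" unfolding \<epsilon>_def X(5)[symmetric] power_mult_distrib[symmetric] by simp
  hence 2: "\<epsilon> * X * (K + 2 * X * (X * S16 - S8)) = z ^ k * B"
   using level_16_moments(2)[OF q wt j C] unfolding X(2,3) by (simp only: S16_def S8_def B_def z_def k K_def)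
  have "\<epsilon> * b / (2 * X) * poly P (w + 2 / w) * z ^ k = \<epsilon> * b / (2 * X) * (z ^ k * A + z ^ k * B)"
   unfolding P(2)[OF wt(1), symmetric] A_def B_def by (simp only: distrib_left mult_ac)
  also have "... = \<epsilon> * b * (S1 - S2) + (\<epsilon> * \<epsilon>) * (b * K / 2) + (\<epsilon> * \<epsilon>) * (b * X * (X * S16 - S8))"
   unfolding 1[symmetric] 2[symmetric] using nz(1) by (simp add: distrib_left add_divide_distrib)
  also have "b * K / 2 = 1" unfolding bK X(1) using nz(2) by simp
  finally have "\<epsilon> * b / (2 * X) * poly P (w + 2 / w) * z ^ k = 1 + (b * \<epsilon> * S1 - b * \<epsilon> * S2 - b * X * S8 + b * (X * X) * S16)"
   unfolding ee by (simp add: algebra_simps)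
  thus "1 + (\<Sum>(c, m, f)\<leftarrow>?xs. c * eval_fps f (q ^ m)) = poly (Polynomial.smult (\<epsilon> * b / (2 * X)) P) (w + 2 / w) * (w * t\<^sup>2) ^ k"
   unfolding z_def[symmetric] by (simp add: S1_def S2_def S16_def S8_def)
 qed
qed

lemma theta_square_middle:
 assumes q: "norm q < 1" and wt: "theta q = w * t" "theta (q ^ 4) = t"
 shows "(theta (q\<^sup>2))\<^sup>2 = (w\<^sup>2 - 2 * w + 2) * t\<^sup>2"
proof -
 have m: "theta (- q) = (2 - w) * t" using theta_quadruple[OF q] by (simp add: wt algebra_simps)
 have "2 * (theta (q\<^sup>2))\<^sup>2 = 2 * ((w\<^sup>2 - 2 * w + 2) * t\<^sup>2)"
  using theta_square_sum[OF q] unfolding m wt by (simp add: power2_eq_square algebra_simps)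
 thus ?thesis unfolding mult_cancel_left by simp
qed

text \<open>Four times the divisor part is theta(q)^4 + 4 theta(q^4)^4 - theta(q^2)^4, which equals
  4 (w + 2/w - 2) times the square of theta(q) theta(q^4). Hence the polynomial x - 2 and one eta
  quotient.\<close>

lemma expansion_4_two:
 "\<exists>!c. c \<in> {1..1} \<rightarrow>\<^sub>E (UNIV :: rat set) &
  (\<forall>n>0. (of_nat (rep_count 2 4 n) :: complex) = of_rat (- (of_nat 2 / bernoulli 2) *
    (((-1) ^ 1 * divisor_sigma 1 (of_nat n) - (-1) ^ 1 * divisor_sigma 1 (of_nat n / 2)
     - 2 ^ 2 * divisor_sigma 1 (of_nat n / 8) + 4 ^ 2 * divisor_sigma 1 (of_nat n / 16)) / (2 ^ 1 * (2 ^ 2 - 1))))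
   + (\<Sum>i=1..1. of_rat (c i) * a4 i 2 n))"
proof -
 let ?S = "sigma_fps 1"
 let ?xs = "[(2, 1 :: nat, ?S), (- 2, 2, ?S), (8, 8, ?S), (- 32, 16, ?S)]"
 show ?thesis
 proof (rule rep_count_4_expansion[where P = "[:-2, 1:]" and xs = ?xs])
  show "\<forall>(c, m, f)\<in>set ?xs. m > 0 & cuspidal_series f" by (simp add: cuspidal_series_lambert del: One_nat_def)
  fix n :: nat assume n: "n > 0"
  show "(\<Sum>(c, m, f)\<leftarrow>?xs. c * fps_dilate m f $ n) = of_rat (- (of_nat 2 / bernoulli 2) *
    (((-1) ^ 1 * divisor_sigma 1 (of_nat n) - (-1) ^ 1 * divisor_sigma 1 (of_nat n / 2)
     - 2 ^ 2 * divisor_sigma 1 (of_nat n / 8) + 4 ^ 2 * divisor_sigma 1 (of_nat n / 16)) / (2 ^ 1 * (2 ^ 2 - 1))))"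
   unfolding bernoulli_2 by (simp add: of_rat_simps of_rat_divisor_functions_numeral[OF n] algebra_simps del: One_nat_def)
 next
  fix q w t :: complex assume q: "0 < norm q" "norm q < 1" and wt: "w ~= 0" "t ~= 0" "theta q = w * t" "theta (q ^ 4) = t"
  have q2: "0 < norm (q\<^sup>2)" "norm (q\<^sup>2) < 1" and q4: "0 < norm (q ^ 4)" "norm (q ^ 4) < 1"
   using norm_power_less_1[OF q(2)] q by auto
  have p: "(q\<^sup>2) ^ 4 = q ^ 8" "(q ^ 4) ^ 4 = q ^ 16" by (simp_all flip: power_mult)
  note t = theta_fourth_power[OF q] theta_fourth_power[OF q2, unfolded p] theta_fourth_power[OF q4, unfolded p]
  have "4 * (1 + (2 * eval_fps ?S q - 2 * eval_fps ?S (q\<^sup>2) + 8 * eval_fps ?S (q ^ 8) - 32 * eval_fps ?S (q ^ 16)))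
    = theta q ^ 4 + 4 * theta (q ^ 4) ^ 4 - theta (q\<^sup>2) ^ 4"
   unfolding t by simp
  also have "... = (w * t) ^ 4 + 4 * t ^ 4 - ((w\<^sup>2 - 2 * w + 2) * t\<^sup>2)\<^sup>2"
   unfolding theta_power_4[of "q\<^sup>2"] theta_square_middle[OF q(2) wt(3,4)] wt ..
  also have "... = 4 * ((w + 2 / w - 2) * (w * t\<^sup>2)\<^sup>2)"
  proof -
   have e: "(w + 2 / w - 2) * (w * t\<^sup>2)\<^sup>2 = (w\<^sup>2 + 2 - 2 * w) * (w * (t\<^sup>2)\<^sup>2)"
    using wt(1) by (simp add: power_mult_distrib) (simp add: field_simps power2_eq_square)
   show ?thesis unfolding e by (simp add: eval_nat_numeral algebra_simps)
  qed
  finally have "1 + (2 * eval_fps ?S q - 2 * eval_fps ?S (q\<^sup>2) + 8 * eval_fps ?S (q ^ 8) - 32 * eval_fps ?S (q ^ 16))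
   = (w + 2 / w - 2) * (w * t\<^sup>2)\<^sup>2"
   unfolding mult_cancel_left by simp
  moreover have "poly [:-2, 1:] (w + 2 / w) = w + 2 / w - 2" by simp
  ultimately show "1 + (\<Sum>(c, m, f)\<leftarrow>?xs. c * eval_fps f (q ^ m)) = poly [:-2, 1:] (w + 2 / w) * (w * t\<^sup>2) ^ 2"
   by (simp only:) (simp add: algebra_simps)
 qed simp_all
qed

text \<open>The combination theta(q)^2 - theta(q^2)^2 + 2 theta(q^4)^2 equals 2 theta(q) theta(q^4),
  and each square is a two-square series.\<close>

lemma expansion_4_one:
 "\<exists>!c. c \<in> {1..0} \<rightarrow>\<^sub>E (UNIV :: rat set) &
  (\<forall>n>0. (of_nat (rep_count 1 4 n) :: complex) = of_rat (2 * sigma_inf 0 (-4) (of_nat n)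
    - 2 * sigma_inf 0 (-4) (of_nat n / 2) + 4 * sigma_inf 0 (-4) (of_nat n / 4))
   + (\<Sum>i=1..0. of_rat (c i) * a4 i 1 n))"
proof -
 let ?S = "chi_inf_fps chi4 0"
 let ?xs = "[(2, 1 :: nat, ?S), (- 2, 2, ?S), (4, 4, ?S)]"
 show ?thesis
 proof (rule rep_count_4_expansion[where P = "[:1:]" and xs = ?xs])
  show "\<forall>(c, m, f)\<in>set ?xs. m > 0 & cuspidal_series f" by (simp add: cuspidal_series_lambert del: One_nat_def)
  fix n :: nat assume n: "n > 0"
  show "(\<Sum>(c, m, f)\<leftarrow>?xs. c * fps_dilate m f $ n) = of_rat (2 * sigma_inf 0 (-4) (of_nat n)
    - 2 * sigma_inf 0 (-4) (of_nat n / 2) + 4 * sigma_inf 0 (-4) (of_nat n / 4))"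
   by (simp add: of_rat_simps of_rat_divisor_functions_numeral[OF n] algebra_simps del: One_nat_def)
 next
  fix q w t :: complex assume q: "0 < norm q" "norm q < 1" and wt: "w ~= 0" "t ~= 0" "theta q = w * t" "theta (q ^ 4) = t"
  have q2: "0 < norm (q\<^sup>2)" "norm (q\<^sup>2) < 1" and q4: "0 < norm (q ^ 4)" "norm (q ^ 4) < 1"
   using norm_power_less_1[OF q(2)] q by auto
  have "2 * (1 + (2 * eval_fps ?S q - 2 * eval_fps ?S (q\<^sup>2) + 4 * eval_fps ?S (q ^ 4)))
    = (theta q)\<^sup>2 - (theta (q\<^sup>2))\<^sup>2 + 2 * (theta (q ^ 4))\<^sup>2"
   unfolding theta_square_lambert[OF q] theta_square_lambert[OF q2] theta_square_lambert[OF q4] by simp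
  also have "... = 2 * (w * t\<^sup>2)"
   unfolding theta_square_middle[OF q(2) wt(3,4)] wt by (simp add: power2_eq_square algebra_simps)
  finally have "1 + (2 * eval_fps ?S q - 2 * eval_fps ?S (q\<^sup>2) + 4 * eval_fps ?S (q ^ 4)) = w * t\<^sup>2"
   unfolding mult_cancel_left by simp
  thus "1 + (\<Sum>(c, m, f)\<leftarrow>?xs. c * eval_fps f (q ^ m)) = poly [:1:] (w + 2 / w) * (w * t\<^sup>2) ^ 1"
   by (simp add: algebra_simps)
 qed simp_all
qed

text \<open>Four moments are combined: a central and a boundary moment weighted so that both carry
  (-1/4)^j, minus the two moments at \<zeta> = i q. Only the boundary moment has a constant term,
  entering as 2L, and b L = 2 because B_{k,4} is -k L / 2; so the weight b/4 normalises the constant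
  to 1.\<close>

lemma expansion_4_odd:
 assumes j: "j > 0" and k: "k = 2 * j + 1"
 shows "\<exists>!c. c \<in> {1..2 * j - 1} \<rightarrow>\<^sub>E (UNIV :: rat set) &
  (\<forall>n>0. (of_nat (rep_count k 4 n) :: complex) = of_rat (- (of_nat k / bernoulli4 k) *
    ((-1) ^ (j + 1) * sigma_inf (2 * j) (-4) (of_nat n) - (-1) ^ (j + 1) * sigma_inf (2 * j) (-4) (of_nat n / 2)
    + 2 * sigma_inf (2 * j) (-4) (of_nat n / 4) - (-1) ^ (j + 1) * sigma_zero (2 * j) (-4) (of_nat n)
    + 2 ^ (2 * j) * sigma_zero (2 * j) (-4) (of_nat n / 2) - 2 ^ (2 * k - 1) * sigma_zero (2 * j) (-4) (of_nat n / 4)))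
   + (\<Sum>i=1..2 * j - 1. of_rat (c i) * a4 i k n))"
proof -
 obtain S :: "complex fps" where S: "(1 + fps_exp 2) * S = 2 * fps_exp 1" using one_plus_exp_quotient by blast
 obtain C :: "complex fps" where C: "(1 + fps_exp 2) * C = 1 - fps_exp 2" using one_plus_exp_quotient by blast
 define L where "L = fact (2 * j) * S $ (2 * j)"
 have L: "L ~= 0" using tan_sec_nonzero(2)[OF C S, of j] by (simp add: L_def)
 define b where "b = - (of_nat k / of_rat (bernoulli4 k) :: complex)"
 have "of_rat (bernoulli4 k) = - (of_nat k * L / 2)" using bernoulli4_eq[OF S, of k] by (simp add: k L_def mult.assoc)
 hence bL: "b * L = 2" using L by (simp add: b_def k del: of_nat_Suc of_nat_add)
 define F \<epsilon> :: complex where "F = 4 ^ j" and "\<epsilon> = (-1) ^ j"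
 have F0: "F ~= 0" by (simp add: F_def)
 have ee: "\<epsilon> * \<epsilon> = 1" unfolding \<epsilon>_def power_mult_distrib[symmetric] by simp
 have pw: "(-1) ^ (j + 1) = - \<epsilon>" "4 ^ (j + 1) = 4 * F" "(-1/4) ^ j = \<epsilon> / F" "2 ^ (2 * j) = F" "2 ^ (2 * k - 1) = 2 * F * F"
 proof -
  show "(-1) ^ (j + 1) = - \<epsilon>" "4 ^ (j + 1) = 4 * F" by (simp_all add: F_def \<epsilon>_def)
  show "(-1/4) ^ j = \<epsilon> / F" unfolding power_divide F_def \<epsilon>_def ..
  show 4: "2 ^ (2 * j) = F" by (simp add: F_def power_mult)
  have "2 * k - 1 = 1 + 2 * j + 2 * j" by (simp add: k)
  thus "2 ^ (2 * k - 1) = 2 * F * F" unfolding 4[symmetric] by (simp only: power_add power_one_right)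
 qed
 obtain P :: "complex poly" where P: "degree P <= 2 * j - 1" "!!w. w ~= 0 ==>
   (-1/4) ^ j * (w * even_deriv (w\<^sup>2) (w\<^sup>2 + (2 - w) ^ 4 / w\<^sup>2) ((2 - w) ^ 4) j 1
    + (2 / w) * even_deriv ((2 / w)\<^sup>2) ((2 / w)\<^sup>2 + (2 - 2 / w) ^ 4 / (2 / w)\<^sup>2) ((2 - 2 / w) ^ 4) j 1)
   - ((2 - w) * even_deriv ((2 - w)\<^sup>2) ((w - 2 + 2 / w)\<^sup>2 + (2 - w)\<^sup>2) (((w - 2 + 2 / w) * (2 - w))\<^sup>2) j 1
    + (2 - 2 / w) * even_deriv ((2 - 2 / w)\<^sup>2) ((2 / w - 2 + 2 / (2 / w))\<^sup>2 + (2 - 2 / w)\<^sup>2) (((2 / w - 2 + 2 / (2 / w)) * (2 - 2 / w))\<^sup>2) j 1)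
   = poly P (w + 2 / w)"
  using laurent_case_4_odd[of j] j by auto
 let ?I = "chi_inf_fps chi4 (2 * j)" and ?Z = "chi_zero_fps chi4 (2 * j)"
 let ?xs = "[(- (b * \<epsilon>), 1 :: nat, ?I), (b * \<epsilon>, 2, ?I), (2 * b, 4, ?I), (b * \<epsilon>, 1 :: nat, ?Z), (b * F, 2, ?Z), (- (2 * b * F * F), 4, ?Z)]"
 show ?thesis
 proof (rule rep_count_4_expansion[where P = "Polynomial.smult (b / 4) P" and xs = ?xs])
  show "\<forall>(c, m, f)\<in>set ?xs. m > 0 & cuspidal_series f" by (simp add: cuspidal_series_lambert del: One_nat_def)
  show "degree (Polynomial.smult (b / 4) P) <= 2 * j - 1" using P(1) degree_smult_le[of "b / 4" P] by linarith
  show "2 * j - 1 <= k" by (simp add: k)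
  fix n :: nat assume n: "n > 0"
  have E: "of_rat (- (of_nat k / bernoulli4 k) *
    ((-1) ^ (j + 1) * sigma_inf (2 * j) (-4) (of_nat n) - (-1) ^ (j + 1) * sigma_inf (2 * j) (-4) (of_nat n / 2)
    + 2 * sigma_inf (2 * j) (-4) (of_nat n / 4) - (-1) ^ (j + 1) * sigma_zero (2 * j) (-4) (of_nat n)
    + 2 ^ (2 * j) * sigma_zero (2 * j) (-4) (of_nat n / 2) - 2 ^ (2 * k - 1) * sigma_zero (2 * j) (-4) (of_nat n / 4)))
   = b * ((-1) ^ (j + 1) * fps_dilate 1 ?I $ n - (-1) ^ (j + 1) * fps_dilate 2 ?I $ n
    + 2 * fps_dilate 4 ?I $ n - (-1) ^ (j + 1) * fps_dilate 1 ?Z $ n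
    + 2 ^ (2 * j) * fps_dilate 2 ?Z $ n - 2 ^ (2 * k - 1) * fps_dilate 4 ?Z $ n)"
   unfolding of_rat_simps of_rat_divisor_functions_numeral[OF n] b_def by simp
  show "(\<Sum>(c, m, f)\<leftarrow>?xs. c * fps_dilate m f $ n) = of_rat (- (of_nat k / bernoulli4 k) *
    ((-1) ^ (j + 1) * sigma_inf (2 * j) (-4) (of_nat n) - (-1) ^ (j + 1) * sigma_inf (2 * j) (-4) (of_nat n / 2)
    + 2 * sigma_inf (2 * j) (-4) (of_nat n / 4) - (-1) ^ (j + 1) * sigma_zero (2 * j) (-4) (of_nat n)
    + 2 ^ (2 * j) * sigma_zero (2 * j) (-4) (of_nat n / 2) - 2 ^ (2 * k - 1) * sigma_zero (2 * j) (-4) (of_nat n / 4)))"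
   unfolding E pw by (simp add: algebra_simps)
 next
  fix q w t :: complex assume q: "0 < norm q" "norm q < 1" and wt: "w ~= 0" "t ~= 0" "theta q = w * t" "theta (q ^ 4) = t"
  define z where "z = w * t\<^sup>2"
  define I1 I2 I4 where "I1 = eval_fps ?I q" and "I2 = eval_fps ?I (q\<^sup>2)" and "I4 = eval_fps ?I (q ^ 4)"
  define Z1 Z2 Z4 where "Z1 = eval_fps ?Z q" and "Z2 = eval_fps ?Z (q\<^sup>2)" and "Z4 = eval_fps ?Z (q ^ 4)"
  define A1 A2 B1 B2 where "A1 = w * even_deriv (w\<^sup>2) (w\<^sup>2 + (2 - w) ^ 4 / w\<^sup>2) ((2 - w) ^ 4) j 1"
   and "A2 = (2 / w) * even_deriv ((2 / w)\<^sup>2) ((2 / w)\<^sup>2 + (2 - 2 / w) ^ 4 / (2 / w)\<^sup>2) ((2 - 2 / w) ^ 4) j 1"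
   and "B1 = (2 - w) * even_deriv ((2 - w)\<^sup>2) ((w - 2 + 2 / w)\<^sup>2 + (2 - w)\<^sup>2) (((w - 2 + 2 / w) * (2 - w))\<^sup>2) j 1"
   and "B2 = (2 - 2 / w) * even_deriv ((2 - 2 / w)\<^sup>2) ((2 / w - 2 + 2 / (2 / w))\<^sup>2 + (2 - 2 / w)\<^sup>2) (((2 / w - 2 + 2 / (2 / w)) * (2 - 2 / w))\<^sup>2) j 1"
  note m = level_16_moments(3)[OF q wt j] level_16_moments(4)[OF q wt j S] level_16_moments(5,6)[OF q wt j]
  note m = m[folded A1_def A2_def B1_def B2_def z_def I1_def I2_def I4_def Z1_def Z2_def Z4_def L_def F_def \<epsilon>_def, unfolded pw, folded k]
  have PP: "poly P (w + 2 / w) = \<epsilon> / F * (A1 + A2) - (B1 + B2)"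
   using P(2)[OF wt(1)] unfolding A1_def[symmetric] A2_def[symmetric] B1_def[symmetric] B2_def[symmetric] pw by (rule sym)
  have g: "c * (h * (A1 + A2) - (B1 + B2)) * x = c * (h * (x * A1) + x * (h * A2) - x * B1 - x * B2)" for c h x
   by (simp add: algebra_simps)
  have "b / 4 * poly P (w + 2 / w) * z ^ k = b / 4 * (\<epsilon> / F * (z ^ k * A1) + z ^ k * (\<epsilon> / F * A2) - z ^ k * B1 - z ^ k * B2)"
   unfolding PP by (rule g)
  also have "... = b / 4 * (\<epsilon> / F * (4 * F * Z1) + 2 * (L + 4 * I4) - 4 * F * (2 * F * Z4 - Z2) - 4 * \<epsilon> * (I1 - I2))"
   by (simp only: m)
  also have "\<epsilon> / F * (4 * F * Z1) = 4 * \<epsilon> * Z1" using F0 by simp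
  also have "b / 4 * (4 * \<epsilon> * Z1 + 2 * (L + 4 * I4) - 4 * F * (2 * F * Z4 - Z2) - 4 * \<epsilon> * (I1 - I2))
    = b * L / 2 + (b * \<epsilon> * I2 - b * \<epsilon> * I1 + 2 * b * I4 + b * \<epsilon> * Z1 + b * F * Z2 - 2 * b * F * F * Z4)"
   by (simp add: field_simps)
  finally have "b / 4 * poly P (w + 2 / w) * z ^ k
    = 1 + (b * \<epsilon> * I2 - b * \<epsilon> * I1 + 2 * b * I4 + b * \<epsilon> * Z1 + b * F * Z2 - 2 * b * F * F * Z4)"
   unfolding bL by simp
  thus "1 + (\<Sum>(c, m, f)\<leftarrow>?xs. c * eval_fps f (q ^ m)) = poly (Polynomial.smult (b / 4) P) (w + 2 / w) * (w * t\<^sup>2) ^ k"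
   unfolding z_def[symmetric] by (simp add: I1_def I2_def I4_def Z1_def Z2_def Z4_def)
 qed
qed

section \<open>Both expansions for every k\<close>

theorem theorem2p1:
  fixes k :: nat
  assumes "k > 0"
  shows
    "(\<exists>!c :: nat \<Rightarrow> rat. c \<in> {1..ell2 k} \<rightarrow>\<^sub>E UNIV \<and>
       (\<forall>n::nat. n > 0 \<longrightarrow>
          (of_nat (rep_count k 2 n) :: complex) =
          of_rat
            (if odd k then
               - (of_nat k / bernoulli8 k) *
               ((2 * sigma_inf (k - 1) (-2) (of_nat n)
                 + 2 * (-8) ^ ((k - 1) div 2) * sigma_zero (k - 1) (-2) (of_nat n))
                / (1 + (if k = 1 then 1 else 0)))
             else
               - (of_nat k / bernoulli k) *
               (((-1) ^ (k div 2) * divisor_sigma (k - 1) (of_nat n)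
                 - (-1) ^ (k div 2) * divisor_sigma (k - 1) (of_nat n / 2)
                 - 2 ^ (k div 2) * divisor_sigma (k - 1) (of_nat n / 4)
                 + 8 ^ (k div 2) * divisor_sigma (k - 1) (of_nat n / 8))
                / (2 ^ (k div 2 - 1) * (2 ^ k - 1))))
          + (\<Sum>j = 1..ell2 k. of_rat (c j) * a2 j k n)))
     \<and>
     (\<exists>!c :: nat \<Rightarrow> rat. c \<in> {1..ell4 k} \<rightarrow>\<^sub>E UNIV \<and>
       (\<forall>n::nat. n > 0 \<longrightarrow>
          (of_nat (rep_count k 4 n) :: complex) =
          of_rat
            (if k = 1 then
               2 * sigma_inf 0 (-4) (of_nat n)
               - 2 * sigma_inf 0 (-4) (of_nat n / 2)
               + 4 * sigma_inf 0 (-4) (of_nat n / 4)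
             else if odd k then
               - (of_nat k / bernoulli4 k) *
               ((-1) ^ ((k + 1) div 2) * sigma_inf (k - 1) (-4) (of_nat n)
                - (-1) ^ ((k + 1) div 2) * sigma_inf (k - 1) (-4) (of_nat n / 2)
                + 2 * sigma_inf (k - 1) (-4) (of_nat n / 4)
                - (-1) ^ ((k + 1) div 2) * sigma_zero (k - 1) (-4) (of_nat n)
                + 2 ^ (k - 1) * sigma_zero (k - 1) (-4) (of_nat n / 2)
                - 2 ^ (2 * k - 1) * sigma_zero (k - 1) (-4) (of_nat n / 4))
             else
               - (of_nat k / bernoulli k) *
               (((-1) ^ (k div 2) * divisor_sigma (k - 1) (of_nat n)
                 - (-1) ^ (k div 2) * divisor_sigma (k - 1) (of_nat n / 2)
                 - 2 ^ k * divisor_sigma (k - 1) (of_nat n / 8)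
                 + 4 ^ k * divisor_sigma (k - 1) (of_nat n / 16))
                / (2 ^ (k - 1) * (2 ^ k - 1))))
          + (\<Sum>j = 1..ell4 k. of_rat (c j) * a4 j k n)))"
proof -
  \<comment> \<open>The weights k = 1 and k = 2 correspond to j = 0 and rest on the theorems on two
    squares, on x^2 + 2 y^2 and on four squares. All larger k have j > 0, where the moment
    identities apply.\<close>
  have "k = 1 \<or> k = 2 \<or> (\<exists>j>0. k = 2 * j + 1) \<or> (\<exists>j>0. k = 2 * j + 2)" using assms by presburger
  then consider (one) "k = 1" | (two) "k = 2" | (odd) j where "j > 0" "k = 2 * j + 1" | (even) j where "j > 0" "k = 2 * j + 2"
    by blast
  thus ?thesis
  proof cases
    case one
    have e: "(1 :: nat) - 1 = 0" "(0 :: nat) div 2 = 0" "ell2 1 = 0" "ell4 1 = 0" "odd (1 :: nat)"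
      by (simp_all add: ell2_def ell4_def)
    show ?thesis using expansion_2_one expansion_4_one by (simp only: one e simp_thms if_True if_False)
  next
    case two
    have e: "(2 :: nat) - 1 = 1" "(1 :: nat) - 1 = 0" "(2 :: nat) div 2 = 1" "ell2 2 = 0" "ell4 2 = 1" "even (2 :: nat)" "(2 :: nat) \<noteq> 1"
      by (simp_all add: ell2_def ell4_def)
    show ?thesis using expansion_2_two expansion_4_two by (simp only: two e simp_thms if_True if_False)
  next
    case (odd j)
    have e: "k - 1 = 2 * j" "2 * j div 2 = j" "(k + 1) div 2 = j + 1" "ell2 k = j" "ell4 k = 2 * j - 1" "odd k" "k \<noteq> 1"
      using odd by (simp_all add: ell2_def ell4_def)
    show ?thesis using expansion_2_odd[OF odd] expansion_4_odd[OF odd] by (simp only: e simp_thms if_True if_False)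
  next
    case (even j)
    have e: "k - 1 = 2 * j + 1" "k div 2 = j + 1" "j + 1 - 1 = j" "ell2 k = j" "ell4 k = 2 * j + 1" "even k" "k \<noteq> 1"
      using even by (simp_all add: ell2_def ell4_def)
    show ?thesis using expansion_2_even[OF even] expansion_4_even[OF even] by (simp only: e simp_thms if_True if_False)
  qed
qed

end
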